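(* The inclusion $\widetilde{\mathrm{vTr}}(2\mathbf{Foam})\hookrightarrow\mathrm{hTr}(2\mathbf{Foam})$ is an equivalence of categories.
   Context: Work over $\mathbb{C}$; powers of $q$ denote formal grading shifts. **Categorified $\mathfrak{gl}_m$.** $\mathcal{U}_Q(\mathfrak{gl}_m)$ is the Khovanov–Lauda 2-category with scalars $t_{i,i+1}=-1$, $t_{i+1,i}=1$, $t_{ij}=1$ for $|i-j|>1$. Objects: $\mathbf a\in\mathbb{Z}^m$ (put $\lambda_i=a_i-a_{i+1}$). 1-morphisms: formal direct sums of shifts $q^k$ of composites of $\mathcal{E}_i\mathbf 1_{\mathbf a}:\mathbf a\to\mathbf a+\epsilon_i$ and $\mathcal{F}_i\mathbf 1_{\mathbf a}:\mathbf a\to\mathbf a-\epsilon_i$, where $1\le i\le m-1$ and $\epsilon_i=[0,\dots,1,-1,\dots,0]$ with $1$ in position $i$. 2-morphisms: matrices of degree-zero combinations of composites of $x_i:\mathcal{E}_i\to\mathcal{E}_i$ (dot, degree $2$), $\tau_{ij}:\mathcal{E}_i\mathcal{E}_j\to\mathcal{E}_j\mathcal{E}_i$ (degree $-2$ if $i=j$, $1$ if $|i-j|=1$, $0$ otherwise), $\eta_i:\mathbf 1_{\mathbf a}\to\mathcal{F}_i\mathcal{E}_i\mathbf 1_{\mathbf a}$ (degree $1+\lambda_i$), $\kappa_i:\mathcal{E}_i\mathcal{F}_i\mathbf 1_{\mathbf a}\to\mathbf 1_{\mathbf a}$ (degree $1-\lambda_i$); a map $q^{d_1}G\to q^{d_2}H$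 given by a diagram $D$ has degree $\deg D+d_1-d_2$. Relations (Rouquier's equivalent presentation): $\tau_{ij}(x_i\mathcal{E}_j)-(\mathcal{E}_jx_i)\tau_{ij}=\delta_{ij}\,\mathrm{id}=(x_j\mathcal{E}_i)\tau_{ij}-\tau_{ij}(\mathcal{E}_ix_j)$; $\tau_{ji}\tau_{ij}=0$ if $i=j$, $\mathrm{id}$ if $|i-j|>1$, $t_{ij}x_i\mathcal{E}_j+t_{ji}\mathcal{E}_ix_j$ if $|i-j|=1$; $(\tau_{jk}\mathcal{E}_i)(\mathcal{E}_j\tau_{ik})(\tau_{ij}\mathcal{E}_k)-(\mathcal{E}_k\tau_{ij})(\tau_{ik}\mathcal{E}_j)(\mathcal{E}_i\tau_{jk})$ is $t_{ij}\,\mathrm{id}$ if $i=k$, $|i-j|=1$ and $0$ otherwise; $\eta_i,\kappa_i$ satisfy the zigzag identities; and with $\sigma_{ij}=(\mathcal{F}_j\mathcal{E}_i\kappa_j)(\mathcal{F}_j\tau_{ji}\mathcal{F}_j)(\eta_j\mathcal{E}_i\mathcal{F}_j):\mathcal{E}_i\mathcal{F}_j\to\mathcal{F}_j\mathcal{E}_i$ the following are (up to shifts) isomorphisms: $\sigma_{ij}$ for $i\ne j$; $(\sigma_{ii},\kappa_i,\kappa_i(x_i\mathcal{F}_i),\dots,\kappa_i(x_i^{\lambda_i-1}\mathcal{F}_i)):\mathcal{E}_i\mathcal{F}_i\mathbf 1_{\mathbf a}\to\mathcal{F}_i\mathcal{E}_i\mathbf 1_{\mathbf a}\oplus\mathbf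 1_{\mathbf a}^{\oplus\lambda_i}$ if $\lambda_i\ge0$; $(\sigma_{ii},\eta_i,(\mathcal{F}_ix_i)\eta_i,\dots,(\mathcal{F}_ix_i^{-\lambda_i-1})\eta_i):\mathcal{E}_i\mathcal{F}_i\mathbf 1_{\mathbf a}\oplus\mathbf 1_{\mathbf a}^{\oplus-\lambda_i}\to\mathcal{F}_i\mathcal{E}_i\mathbf 1_{\mathbf a}$ if $\lambda_i\le0$. $\check{\mathcal{U}}_Q(\mathfrak{gl}_m)$ is the full sub-2-category of the Karoubi completion (idempotent completion of all Hom-categories) generated by divided powers $\mathcal{E}_i^{(k)}\mathbf 1_{\mathbf a},\mathcal{F}_i^{(k)}\mathbf 1_{\mathbf a}$. A superscript $0\le2$ means the quotient killing all weights with an entry not in $\{0,1,2\}$. **Foams.** $2\mathbf{Foam}$ is the enhanced (Blanchet) $\mathfrak{sl}_2$ foam 2-category: objects are sequences with entries in $\{1,2\}$ (and a zero object), 1-morphisms are direct sums of shifts of left-directed $\mathfrak{sl}_2$ webs, 2-morphisms are matrices of degree-zero combinations of foams. Up to equivalence it is $\varinjlim_m\check{\mathcal{U}}_Q(\mathfrak{gl}_m)^{0\le2}$ along $\mathbf a\mapsto[\mathbf a,0]$ ($\mathcal{E}_i^{(k)}$, resp. $\mathcal{F}_i^{(k)}$, being a $k$-labeled rung between adjacent strands, $0$-labeled edges deleted); we take this as its definition. **Traces.** For such a graded linear 2-category $\mathcal{D}$, $\mathcal{D}^*$ is the version without shifts and with 2-morphisms of all degrees. $\widetilde{\mathrm{vTr}}(\mathcal{D})$: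 objects are finite formal direct sums of $q^kc$, $c$ an object of $\mathcal{D}$; morphisms $q^{k_1}c\to q^{k_2}d$ are elements of degree zero (degree of the 2-morphism plus $k_1-k_2$) in $\bigoplus_{p:c\to d}\mathrm{End}_{\mathcal{D}^*}(p)/\mathrm{span}\{fg-gf\}$. $\mathrm{hTr}(\mathcal{D})$ (graded horizontal trace): objects are finite direct sums of $q^kf$, $f:c\to c$ a 1-morphism; morphisms $q^{k_1}f\to q^{k_2}g$ ($f:c\to c$, $g:d\to d$) are degree-zero classes of pairs $(p,\sigma)$, $p:c\to d$, $\sigma:pf\to gp$ in $\mathcal{D}^*$, modulo linearity and $(p,\sigma\circ(\tau f))\sim(p',(g\tau)\circ\sigma)$ for $\tau:p\to p'$, $\sigma:p'f\to gp$; composition $(r,\rho)(p,\sigma)=(rp,(\rho p)(r\sigma))$. The inclusion is $q^kc\mapsto q^k\mathbf 1_c$, $[\sigma:p\to p]\mapsto(p,\sigma)$. *)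

theory Defs
  imports Complex_Main "HOL-Library.FuncSet" "HOL-Library.Poly_Mapping"
begin

section \<open>Categories, functors, equivalences\<close>

text \<open>Hom-sets need not be disjoint; composition therefore takes the three objects as
  arguments: \<open>cmp C X Y Z g f\<close> is the composite of \<open>f : X \<rightarrow> Y\<close> and \<open>g : Y \<rightarrow> Z\<close>.\<close>

record ('o, 'h) cat =
  obj :: "'o set"
  hom :: "'o \<Rightarrow> 'o \<Rightarrow> 'h set"
  idt :: "'o \<Rightarrow> 'h"
  cmp :: "'o \<Rightarrow> 'o \<Rightarrow> 'o \<Rightarrow> 'h \<Rightarrow> 'h \<Rightarrow> 'h"

definition is_category :: "('o, 'h) cat \<Rightarrow> bool" where
  "is_category C \<longleftrightarrow>
     (\<forall>X\<in>obj C. idt C X \<in> hom C X X) \<and>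
     (\<forall>X\<in>obj C. \<forall>Y\<in>obj C. \<forall>Z\<in>obj C. \<forall>f\<in>hom C X Y. \<forall>g\<in>hom C Y Z.
        cmp C X Y Z g f \<in> hom C X Z) \<and>
     (\<forall>X\<in>obj C. \<forall>Y\<in>obj C. \<forall>f\<in>hom C X Y.
        cmp C X X Y f (idt C X) = f \<and> cmp C X Y Y (idt C Y) f = f) \<and>
     (\<forall>W\<in>obj C. \<forall>X\<in>obj C. \<forall>Y\<in>obj C. \<forall>Z\<in>obj C.
        \<forall>f\<in>hom C W X. \<forall>g\<in>hom C X Y. \<forall>h\<in>hom C Y Z.
        cmp C W Y Z h (cmp C W X Y g f) = cmp C W X Z (cmp C X Y Z h g) f)"

record ('o1, 'h1, 'o2, 'h2) fctr =
  omap :: "'o1 \<Rightarrow> 'o2"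
  hmap :: "'o1 \<Rightarrow> 'o1 \<Rightarrow> 'h1 \<Rightarrow> 'h2"

definition is_functor ::
    "('o1, 'h1) cat \<Rightarrow> ('o2, 'h2) cat \<Rightarrow> ('o1, 'h1, 'o2, 'h2) fctr \<Rightarrow> bool" where
  "is_functor C D F \<longleftrightarrow>
     (\<forall>X\<in>obj C. omap F X \<in> obj D) \<and>
     (\<forall>X\<in>obj C. \<forall>Y\<in>obj C. \<forall>f\<in>hom C X Y. hmap F X Y f \<in> hom D (omap F X) (omap F Y)) \<and>
     (\<forall>X\<in>obj C. hmap F X X (idt C X) = idt D (omap F X)) \<and>
     (\<forall>X\<in>obj C. \<forall>Y\<in>obj C. \<forall>Z\<in>obj C. \<forall>f\<in>hom C X Y. \<forall>g\<in>hom C Y Z.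
        hmap F X Z (cmp C X Y Z g f) =
        cmp D (omap F X) (omap F Y) (omap F Z) (hmap F Y Z g) (hmap F X Y f))"

definition id_functor :: "('o, 'h, 'o, 'h) fctr" where
  "id_functor = \<lparr>omap = (\<lambda>X. X), hmap = (\<lambda>X Y f. f)\<rparr>"

definition comp_functor ::
    "('o2, 'h2, 'o3, 'h3) fctr \<Rightarrow> ('o1, 'h1, 'o2, 'h2) fctr \<Rightarrow> ('o1, 'h1, 'o3, 'h3) fctr" where
  "comp_functor G F =
     \<lparr>omap = (\<lambda>X. omap G (omap F X)),
      hmap = (\<lambda>X Y f. hmap G (omap F X) (omap F Y) (hmap F X Y f))\<rparr>"

definition is_iso :: "('o, 'h) cat \<Rightarrow> 'o \<Rightarrow> 'o \<Rightarrow> 'h \<Rightarrow> bool" where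
  "is_iso C X Y f \<longleftrightarrow> f \<in> hom C X Y \<and>
     (\<exists>g\<in>hom C Y X. cmp C X Y X g f = idt C X \<and> cmp C Y X Y f g = idt C Y)"

definition naturally_isomorphic ::
    "('o1, 'h1) cat \<Rightarrow> ('o2, 'h2) cat \<Rightarrow> ('o1, 'h1, 'o2, 'h2) fctr \<Rightarrow>
     ('o1, 'h1, 'o2, 'h2) fctr \<Rightarrow> bool" where
  "naturally_isomorphic C D F G \<longleftrightarrow>
     (\<exists>\<eta>. (\<forall>X\<in>obj C. is_iso D (omap F X) (omap G X) (\<eta> X)) \<and>
        (\<forall>X\<in>obj C. \<forall>Y\<in>obj C. \<forall>f\<in>hom C X Y.
           cmp D (omap F X) (omap F Y) (omap G Y) (\<eta> Y) (hmap F X Y f) =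
           cmp D (omap F X) (omap G X) (omap G Y) (hmap G X Y f) (\<eta> X)))"

definition is_equivalence ::
    "('o1, 'h1) cat \<Rightarrow> ('o2, 'h2) cat \<Rightarrow> ('o1, 'h1, 'o2, 'h2) fctr \<Rightarrow> bool" where
  "is_equivalence C D F \<longleftrightarrow> is_category C \<and> is_category D \<and> is_functor C D F \<and>
     (\<exists>G. is_functor D C G \<and>
        naturally_isomorphic C C id_functor (comp_functor G F) \<and>
        naturally_isomorphic D D (comp_functor F G) id_functor)"


section \<open>Finite formal direct sums\<close>

record ('x, 'h) lincat = "('x, 'h) cat" +
  hadd :: "'x \<Rightarrow> 'x \<Rightarrow> 'h \<Rightarrow> 'h \<Rightarrow> 'h"
  hzero :: "'x \<Rightarrow> 'x \<Rightarrow> 'h"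

definition hsum :: "('x, 'h) lincat \<Rightarrow> 'x \<Rightarrow> 'x \<Rightarrow> 'h list \<Rightarrow> 'h" where
  "hsum A x y hs = foldr (hadd A x y) hs (hzero A x y)"

text \<open>A finite formal direct sum is the list of its summands. The matrix of a morphism
  \<open>X \<rightarrow> Y\<close> has its rows indexed by \<open>Y\<close> and its columns by \<open>X\<close>; it is \<open>undefined\<close> outside the
  index range.\<close>

definition mhom :: "('x, 'h) lincat \<Rightarrow> 'x list \<Rightarrow> 'x list \<Rightarrow> (nat \<times> nat \<Rightarrow> 'h) set" where
  "mhom A X Y = (\<Pi>\<^sub>E (i, j) \<in> {..<length Y} \<times> {..<length X}. hom A (X ! j) (Y ! i))"

definition mid :: "('x, 'h) lincat \<Rightarrow> 'x list \<Rightarrow> nat \<times> nat \<Rightarrow> 'h" where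
  "mid A X = (\<lambda>(i, j) \<in> {..<length X} \<times> {..<length X}.
     if i = j then idt A (X ! i) else hzero A (X ! j) (X ! i))"

definition mcmp :: "('x, 'h) lincat \<Rightarrow> 'x list \<Rightarrow> 'x list \<Rightarrow> 'x list \<Rightarrow>
    (nat \<times> nat \<Rightarrow> 'h) \<Rightarrow> (nat \<times> nat \<Rightarrow> 'h) \<Rightarrow> nat \<times> nat \<Rightarrow> 'h" where
  "mcmp A X Y Z N M = (\<lambda>(i, k) \<in> {..<length Z} \<times> {..<length X}.
     hsum A (X ! k) (Z ! i)
       (map (\<lambda>j. cmp A (X ! k) (Y ! j) (Z ! i) (N (i, j)) (M (j, k))) [0..<length Y]))"

definition mat_cat :: "('x, 'h) lincat \<Rightarrow> ('x list, nat \<times> nat \<Rightarrow> 'h) cat" where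
  "mat_cat A = \<lparr>obj = lists (obj A), hom = mhom A, idt = mid A, cmp = mcmp A\<rparr>"


section \<open>Traces of graded linear 2-categories\<close>

text \<open>A record of this type describes the version \<open>\<D>\<^sup>*\<close> of a graded linear 2-category \<open>\<D>\<close>: no
  shifts, and 2-morphisms of all degrees, \<open>two_deg D p q d\<close> being the degree \<open>d\<close> part of
  \<open>two D p q\<close>. \<open>comp1 D g f\<close> is the composite of \<open>f : c \<rightarrow> d\<close> and \<open>g : d \<rightarrow> e\<close>. For
  \<open>\<sigma> : p \<rightarrow> q\<close> and \<open>\<rho> : q \<rightarrow> r\<close> the vertical composite is \<open>vcomp D p q r \<rho> \<sigma>\<close>; for
  \<open>\<sigma> : p \<rightarrow> p'\<close> and \<open>\<rho> : r \<rightarrow> r'\<close> the horizontal composite \<open>\<rho>\<sigma> : rp \<rightarrow> r'p'\<close> is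
  \<open>hcomp D r r' p p' \<rho> \<sigma>\<close>. Composition of 1-morphisms is meant to be strict.\<close>

record ('o, 'p, 'm) gl2cat =
  obj2 :: "'o set"
  one :: "'o \<Rightarrow> 'o \<Rightarrow> 'p set"
  unit1 :: "'o \<Rightarrow> 'p"
  comp1 :: "'p \<Rightarrow> 'p \<Rightarrow> 'p"
  two :: "'p \<Rightarrow> 'p \<Rightarrow> 'm set"
  two_deg :: "'p \<Rightarrow> 'p \<Rightarrow> int \<Rightarrow> 'm set"
  id2 :: "'p \<Rightarrow> 'm"
  vcomp :: "'p \<Rightarrow> 'p \<Rightarrow> 'p \<Rightarrow> 'm \<Rightarrow> 'm \<Rightarrow> 'm"
  hcomp :: "'p \<Rightarrow> 'p \<Rightarrow> 'p \<Rightarrow> 'p \<Rightarrow> 'm \<Rightarrow> 'm \<Rightarrow> 'm"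
  add2 :: "'p \<Rightarrow> 'p \<Rightarrow> 'm \<Rightarrow> 'm \<Rightarrow> 'm"
  scale2 :: "'p \<Rightarrow> 'p \<Rightarrow> complex \<Rightarrow> 'm \<Rightarrow> 'm"

definition lwhisker :: "('o, 'p, 'm) gl2cat \<Rightarrow> 'p \<Rightarrow> 'p \<Rightarrow> 'p \<Rightarrow> 'm \<Rightarrow> 'm" where
  "lwhisker D g p p' \<tau> = hcomp D g g p p' (id2 D g) \<tau>"

definition rwhisker :: "('o, 'p, 'm) gl2cat \<Rightarrow> 'p \<Rightarrow> 'p \<Rightarrow> 'p \<Rightarrow> 'm \<Rightarrow> 'm" where
  "rwhisker D p p' f \<tau> = hcomp D p p' f f \<tau> (id2 D f)"

text \<open>Trace classes are cosets in the free complex vector space on pairs \<open>(p, \<sigma>)\<close>. Dividing out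
  linearity in \<open>\<sigma>\<close> turns the free space into the direct sum over \<open>p\<close> of the spaces of 2-morphisms.\<close>

type_synonym ('p, 'm) formal = "('p \<times> 'm) \<Rightarrow>\<^sub>0 complex"

abbreviation pair :: "'p \<Rightarrow> 'm \<Rightarrow> ('p, 'm) formal" where
  "pair p \<sigma> \<equiv> Poly_Mapping.single (p, \<sigma>) 1"

definition fscale :: "complex \<Rightarrow> ('p, 'm) formal \<Rightarrow> ('p, 'm) formal" where
  "fscale z v = Poly_Mapping.map (\<lambda>w. z * w) v"

definition fspan :: "('p, 'm) formal set \<Rightarrow> ('p, 'm) formal set" where
  "fspan S = module.span fscale S"

definition coset :: "('p, 'm) formal set \<Rightarrow> ('p, 'm) formal \<Rightarrow> ('p, 'm) formal set" where
  "coset N v = {w. w - v \<in> N}"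

definition coset_add ::
    "('p, 'm) formal set \<Rightarrow> ('p, 'm) formal set \<Rightarrow> ('p, 'm) formal set \<Rightarrow> ('p, 'm) formal set" where
  "coset_add N V U = (\<Union>v\<in>V. \<Union>u\<in>U. coset N (v + u))"

definition bilin :: "('p \<Rightarrow> 'm \<Rightarrow> 'p \<Rightarrow> 'm \<Rightarrow> 'p \<times> 'm) \<Rightarrow>
    ('p, 'm) formal \<Rightarrow> ('p, 'm) formal \<Rightarrow> ('p, 'm) formal" where
  "bilin b v u =
     (\<Sum>(r, \<rho>)\<in>Poly_Mapping.keys v. \<Sum>(p, \<sigma>)\<in>Poly_Mapping.keys u.
        Poly_Mapping.single (b r \<rho> p \<sigma>)
          (Poly_Mapping.lookup v (r, \<rho>) * Poly_Mapping.lookup u (p, \<sigma>)))"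

definition coset_comp :: "('p, 'm) formal set \<Rightarrow> ('p \<Rightarrow> 'm \<Rightarrow> 'p \<Rightarrow> 'm \<Rightarrow> 'p \<times> 'm) \<Rightarrow>
    ('p, 'm) formal set \<Rightarrow> ('p, 'm) formal set \<Rightarrow> ('p, 'm) formal set" where
  "coset_comp N b V U = (\<Union>v\<in>V. \<Union>u\<in>U. coset N (bilin b v u))"


subsection \<open>The vertical trace\<close>

definition v_null :: "('o, 'p, 'm) gl2cat \<Rightarrow> 'o \<Rightarrow> 'o \<Rightarrow> ('p, 'm) formal set" where
  "v_null D c d = fspan
     ({pair p (add2 D p p \<sigma> \<sigma>') - pair p \<sigma> - pair p \<sigma>' | p \<sigma> \<sigma>'.
         p \<in> one D c d \<and> \<sigma> \<in> two D p p \<and> \<sigma>' \<in> two D p p} \<union>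
      {pair p (scale2 D p p z \<sigma>) - fscale z (pair p \<sigma>) | p z \<sigma>.
         p \<in> one D c d \<and> \<sigma> \<in> two D p p} \<union>
      {pair p' (vcomp D p' p p' f g) - pair p (vcomp D p p' p g f) | p p' f g.
         p \<in> one D c d \<and> p' \<in> one D c d \<and> f \<in> two D p p' \<and> g \<in> two D p' p})"

text \<open>The object \<open>(k, c)\<close> stands for \<open>q\<^sup>k c\<close>.\<close>

definition v_hom ::
    "('o, 'p, 'm) gl2cat \<Rightarrow> int \<times> 'o \<Rightarrow> int \<times> 'o \<Rightarrow> ('p, 'm) formal set set" where
  "v_hom D = (\<lambda>(k1, c) (k2, d). coset (v_null D c d) `
     fspan {pair p \<sigma> | p \<sigma>. p \<in> one D c d \<and> \<sigma> \<in> two_deg D p p (k2 - k1)})"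

definition v_pairs :: "('o, 'p, 'm) gl2cat \<Rightarrow> (int \<times> 'o, ('p, 'm) formal set) lincat" where
  "v_pairs D =
     \<lparr>obj = UNIV \<times> obj2 D,
      hom = v_hom D,
      idt = (\<lambda>(k, c). coset (v_null D c c) (pair (unit1 D c) (id2 D (unit1 D c)))),
      cmp = (\<lambda>(k1, c) (k2, d) (k3, e).
        coset_comp (v_null D c e) (\<lambda>r \<rho> p \<sigma>. (comp1 D r p, hcomp D r r p p \<rho> \<sigma>))),
      hadd = (\<lambda>(k1, c) (k2, d). coset_add (v_null D c d)),
      hzero = (\<lambda>(k1, c) (k2, d). coset (v_null D c d) 0)\<rparr>"

definition vTr ::
    "('o, 'p, 'm) gl2cat \<Rightarrow> ((int \<times> 'o) list, nat \<times> nat \<Rightarrow> ('p, 'm) formal set) cat" where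
  "vTr D = mat_cat (v_pairs D)"


subsection \<open>The horizontal trace\<close>

definition h_null :: "('o, 'p, 'm) gl2cat \<Rightarrow> 'o \<times> 'p \<Rightarrow> 'o \<times> 'p \<Rightarrow> ('p, 'm) formal set" where
  "h_null D = (\<lambda>(c, f) (d, g). fspan
     ({pair p (add2 D (comp1 D p f) (comp1 D g p) \<sigma> \<sigma>') - pair p \<sigma> - pair p \<sigma>' | p \<sigma> \<sigma>'.
         p \<in> one D c d \<and> \<sigma> \<in> two D (comp1 D p f) (comp1 D g p) \<and>
         \<sigma>' \<in> two D (comp1 D p f) (comp1 D g p)} \<union>
      {pair p (scale2 D (comp1 D p f) (comp1 D g p) z \<sigma>) - fscale z (pair p \<sigma>) | p z \<sigma>.
         p \<in> one D c d \<and> \<sigma> \<in> two D (comp1 D p f) (comp1 D g p)} \<union>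
      {pair p (vcomp D (comp1 D p f) (comp1 D p' f) (comp1 D g p) \<sigma> (rwhisker D p p' f \<tau>)) -
       pair p' (vcomp D (comp1 D p' f) (comp1 D g p) (comp1 D g p') (lwhisker D g p p' \<tau>) \<sigma>)
       | p p' \<tau> \<sigma>. p \<in> one D c d \<and> p' \<in> one D c d \<and> \<tau> \<in> two D p p' \<and>
         \<sigma> \<in> two D (comp1 D p' f) (comp1 D g p)}))"

text \<open>The object \<open>(k, c, f)\<close> stands for \<open>q\<^sup>k f\<close> with \<open>f : c \<rightarrow> c\<close>.\<close>

definition h_hom :: "('o, 'p, 'm) gl2cat \<Rightarrow> int \<times> 'o \<times> 'p \<Rightarrow> int \<times> 'o \<times> 'p \<Rightarrow>
    ('p, 'm) formal set set" where
  "h_hom D = (\<lambda>(k1, c, f) (k2, d, g). coset (h_null D (c, f) (d, g)) `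
     fspan {pair p \<sigma> | p \<sigma>. p \<in> one D c d \<and>
       \<sigma> \<in> two_deg D (comp1 D p f) (comp1 D g p) (k2 - k1)})"

text \<open>The composite of \<open>(p, \<sigma>) : f \<rightarrow> g\<close> and \<open>(r, \<rho>) : g \<rightarrow> h\<close> is \<open>(rp, (\<rho>p)(r\<sigma>))\<close>.\<close>

definition h_comp :: "('o, 'p, 'm) gl2cat \<Rightarrow> 'p \<Rightarrow> 'p \<Rightarrow> 'p \<Rightarrow>
    'p \<Rightarrow> 'm \<Rightarrow> 'p \<Rightarrow> 'm \<Rightarrow> 'p \<times> 'm" where
  "h_comp D f g h r \<rho> p \<sigma> =
     (comp1 D r p,
      vcomp D (comp1 D r (comp1 D p f)) (comp1 D r (comp1 D g p)) (comp1 D h (comp1 D r p))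
        (rwhisker D (comp1 D r g) (comp1 D h r) p \<rho>)
        (lwhisker D r (comp1 D p f) (comp1 D g p) \<sigma>))"

definition h_pairs :: "('o, 'p, 'm) gl2cat \<Rightarrow> (int \<times> 'o \<times> 'p, ('p, 'm) formal set) lincat" where
  "h_pairs D =
     \<lparr>obj = {(k, c, f). c \<in> obj2 D \<and> f \<in> one D c c},
      hom = h_hom D,
      idt = (\<lambda>(k, c, f). coset (h_null D (c, f) (c, f)) (pair (unit1 D c) (id2 D f))),
      cmp = (\<lambda>(k1, c, f) (k2, d, g) (k3, e, h).
        coset_comp (h_null D (c, f) (e, h)) (h_comp D f g h)),
      hadd = (\<lambda>(k1, x) (k2, y). coset_add (h_null D x y)),
      hzero = (\<lambda>(k1, x) (k2, y). coset (h_null D x y) 0)\<rparr>"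

definition hTr ::
    "('o, 'p, 'm) gl2cat \<Rightarrow> ((int \<times> 'o \<times> 'p) list, nat \<times> nat \<Rightarrow> ('p, 'm) formal set) cat" where
  "hTr D = mat_cat (h_pairs D)"

text \<open>The inclusion is induced by \<open>(p, \<sigma>) \<mapsto> (p, \<sigma>)\<close>, which makes sense because
  \<open>p1 = p = 1p\<close> strictly.\<close>

definition trace_inclusion :: "('o, 'p, 'm) gl2cat \<Rightarrow>
    ((int \<times> 'o) list, nat \<times> nat \<Rightarrow> ('p, 'm) formal set,
     (int \<times> 'o \<times> 'p) list, nat \<times> nat \<Rightarrow> ('p, 'm) formal set) fctr" where
  "trace_inclusion D =
     \<lparr>omap = map (\<lambda>(k, c). (k, c, unit1 D c)),
      hmap = (\<lambda>X Y M. \<lambda>(i, j) \<in> {..<length Y} \<times> {..<length X}.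
        \<Union>v\<in>M (i, j). coset (h_null D (snd (X ! j), unit1 D (snd (X ! j)))
                                      (snd (Y ! i), unit1 D (snd (Y ! i)))) v)\<rparr>"


section \<open>The categorified quantum group of gl(m)\<close>

text \<open>A gl(m)-weight is a function \<open>nat \<Rightarrow> int\<close> supported on \<open>{1..m}\<close>, so that the map
  \<open>a \<mapsto> [a, 0]\<close> from gl(m)-weights to gl(m+1)-weights is an inclusion of sets. Only the letters with
  \<open>1 \<le> i < m\<close> are used in gl(m).\<close>

type_synonym weight = "nat \<Rightarrow> int"

definition weights :: "nat \<Rightarrow> weight set" where
  "weights m = {a. \<forall>n. n \<notin> {1..m} \<longrightarrow> a n = 0}"

definition lam :: "weight \<Rightarrow> nat \<Rightarrow> int" where
  "lam a i = a i - a (Suc i)"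

definition eps :: "nat \<Rightarrow> weight" where
  "eps i = (\<lambda>n. if n = i then 1 else if n = Suc i then -1 else 0)"

datatype letter = Ee nat | Ff nat

text \<open>The leftmost letter of a word acts last.\<close>

type_synonym word = "letter list"

fun act_letter :: "letter \<Rightarrow> weight \<Rightarrow> weight" where
  "act_letter (Ee i) a = (\<lambda>n. a n + eps i n)"
| "act_letter (Ff i) a = (\<lambda>n. a n - eps i n)"

definition act :: "word \<Rightarrow> weight \<Rightarrow> weight" where
  "act w a = foldr act_letter w a"

fun letter_ok :: "nat \<Rightarrow> letter \<Rightarrow> bool" where
  "letter_ok m (Ee i) \<longleftrightarrow> 1 \<le> i \<and> i < m"
| "letter_ok m (Ff i) \<longleftrightarrow> 1 \<le> i \<and> i < m"

abbreviation word_ok :: "nat \<Rightarrow> word \<Rightarrow> bool" where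
  "word_ok m w \<equiv> list_all (letter_ok m) w"

definition adj :: "nat \<Rightarrow> nat \<Rightarrow> bool" where
  "adj i j \<longleftrightarrow> i = Suc j \<or> j = Suc i"

definition tcoef :: "nat \<Rightarrow> nat \<Rightarrow> complex" where
  "tcoef i j = (if j = Suc i then -1 else 1)"

text \<open>Formal expressions for 2-morphisms. \<open>Cup i\<close> is the unit \<open>\<eta>\<^sub>i\<close> and \<open>Cap i\<close> the counit
  \<open>\<kappa>\<^sub>i\<close>. The last three generators are the entries of the inverses of the maps that are required to be
  isomorphisms: \<open>SInv i j : F\<^sub>j E\<^sub>i \<rightarrow> E\<^sub>i F\<^sub>j\<close>,
  \<open>CupInv i r : 1 \<rightarrow> E\<^sub>i F\<^sub>i\<close> (inverse to \<open>\<kappa>\<^sub>i (x\<^sub>i\<^sup>r F\<^sub>i)\<close>, for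
  \<open>r < \<lambda>\<^sub>i\<close>) and \<open>CapInv i r : F\<^sub>i E\<^sub>i \<rightarrow> 1\<close> (inverse to
  \<open>(F\<^sub>i x\<^sub>i\<^sup>r) \<eta>\<^sub>i\<close>, for \<open>r < - \<lambda>\<^sub>i\<close>).\<close>

datatype dgm =
    Idn word
  | Dot nat
  | Crs nat nat
  | Cup nat
  | Cap nat
  | SInv nat nat
  | CupInv nat nat
  | CapInv nat nat
  | Ver dgm dgm (infixr "\<odot>" 70)
  | Hor dgm dgm (infixr "\<otimes>" 75)
  | Nul word word
  | Add dgm dgm (infixl "\<oplus>" 65)
  | Scl complex dgm (infixr "\<cdot>" 72)

abbreviation Sub :: "dgm \<Rightarrow> dgm \<Rightarrow> dgm" (infixl "\<ominus>" 65) where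
  "s \<ominus> t \<equiv> s \<oplus> (-1) \<cdot> t"

primrec dom :: "dgm \<Rightarrow> word" where
  "dom (Idn w) = w"
| "dom (Dot i) = [Ee i]"
| "dom (Crs i j) = [Ee i, Ee j]"
| "dom (Cup i) = []"
| "dom (Cap i) = [Ee i, Ff i]"
| "dom (SInv i j) = [Ff j, Ee i]"
| "dom (CupInv i r) = []"
| "dom (CapInv i r) = [Ff i, Ee i]"
| "dom (s \<odot> t) = dom t"
| "dom (s \<otimes> t) = dom s @ dom t"
| "dom (Nul p q) = p"
| "dom (s \<oplus> t) = dom s"
| "dom (z \<cdot> t) = dom t"

primrec cod :: "dgm \<Rightarrow> word" where
  "cod (Idn w) = w"
| "cod (Dot i) = [Ee i]"
| "cod (Crs i j) = [Ee j, Ee i]"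
| "cod (Cup i) = [Ff i, Ee i]"
| "cod (Cap i) = []"
| "cod (SInv i j) = [Ee i, Ff j]"
| "cod (CupInv i r) = [Ee i, Ff i]"
| "cod (CapInv i r) = []"
| "cod (s \<odot> t) = cod s"
| "cod (s \<otimes> t) = cod s @ cod t"
| "cod (Nul p q) = q"
| "cod (s \<oplus> t) = cod s"
| "cod (z \<cdot> t) = cod t"

text \<open>\<open>wf_dgm m a t\<close>: \<open>t\<close> is a 2-morphism of gl(m) whose source and target 1-morphisms start at the
  weight \<open>a\<close>. A zero morphism exists only between 1-morphisms with the same target weight.\<close>

primrec wf_dgm :: "nat \<Rightarrow> weight \<Rightarrow> dgm \<Rightarrow> bool" where
  "wf_dgm m a (Idn w) \<longleftrightarrow> word_ok m w"
| "wf_dgm m a (Dot i) \<longleftrightarrow> 1 \<le> i \<and> i < m"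
| "wf_dgm m a (Crs i j) \<longleftrightarrow> 1 \<le> i \<and> i < m \<and> 1 \<le> j \<and> j < m"
| "wf_dgm m a (Cup i) \<longleftrightarrow> 1 \<le> i \<and> i < m"
| "wf_dgm m a (Cap i) \<longleftrightarrow> 1 \<le> i \<and> i < m"
| "wf_dgm m a (SInv i j) \<longleftrightarrow> 1 \<le> i \<and> i < m \<and> 1 \<le> j \<and> j < m"
| "wf_dgm m a (CupInv i r) \<longleftrightarrow> 1 \<le> i \<and> i < m \<and> int r < lam a i"
| "wf_dgm m a (CapInv i r) \<longleftrightarrow> 1 \<le> i \<and> i < m \<and> int r < - lam a i"
| "wf_dgm m a (s \<odot> t) \<longleftrightarrow> wf_dgm m a s \<and> wf_dgm m a t \<and> dom s = cod t"
| "wf_dgm m a (s \<otimes> t) \<longleftrightarrow> wf_dgm m (act (dom t) a) s \<and> wf_dgm m a t"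
| "wf_dgm m a (Nul p q) \<longleftrightarrow> word_ok m p \<and> word_ok m q \<and> act p a = act q a"
| "wf_dgm m a (s \<oplus> t) \<longleftrightarrow> wf_dgm m a s \<and> wf_dgm m a t \<and> dom s = dom t \<and> cod s = cod t"
| "wf_dgm m a (z \<cdot> t) \<longleftrightarrow> wf_dgm m a t"

text \<open>\<open>has_deg a t d\<close>: the expression \<open>t\<close> is homogeneous of degree \<open>d\<close>. The maps \<open>\<sigma>\<^sub>i\<^sub>j\<close> have
  degree 0, and the entries of an inverse matrix have the negatives of the degrees of the entries
  they are paired with.\<close>

primrec has_deg :: "weight \<Rightarrow> dgm \<Rightarrow> int \<Rightarrow> bool" where
  "has_deg a (Idn w) d \<longleftrightarrow> d = 0"
| "has_deg a (Dot i) d \<longleftrightarrow> d = 2"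
| "has_deg a (Crs i j) d \<longleftrightarrow> d = (if i = j then -2 else if adj i j then 1 else 0)"
| "has_deg a (Cup i) d \<longleftrightarrow> d = 1 + lam a i"
| "has_deg a (Cap i) d \<longleftrightarrow> d = 1 - lam a i"
| "has_deg a (SInv i j) d \<longleftrightarrow> d = 0"
| "has_deg a (CupInv i r) d \<longleftrightarrow> d = - (1 - lam a i + 2 * int r)"
| "has_deg a (CapInv i r) d \<longleftrightarrow> d = - (1 + lam a i + 2 * int r)"
| "has_deg a (s \<odot> t) d \<longleftrightarrow> (\<exists>d1 d2. has_deg a s d1 \<and> has_deg a t d2 \<and> d = d1 + d2)"
| "has_deg a (s \<otimes> t) d \<longleftrightarrow>
     (\<exists>d1 d2. has_deg (act (dom t) a) s d1 \<and> has_deg a t d2 \<and> d = d1 + d2)"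
| "has_deg a (Nul p q) d \<longleftrightarrow> True"
| "has_deg a (s \<oplus> t) d \<longleftrightarrow> has_deg a s d \<and> has_deg a t d"
| "has_deg a (z \<cdot> t) d \<longleftrightarrow> has_deg a t d"

text \<open>The axioms of a strict linear 2-category. Side conditions on sources, targets and weights are
  imposed in \<open>dgm_eq\<close> below.\<close>

inductive ax :: "dgm \<Rightarrow> dgm \<Rightarrow> bool" where
  ver_assoc: "ax ((r \<odot> s) \<odot> t) (r \<odot> (s \<odot> t))"
| ver_id_left: "ax (Idn (cod t) \<odot> t) t"
| ver_id_right: "ax (t \<odot> Idn (dom t)) t"
| hor_assoc: "ax ((r \<otimes> s) \<otimes> t) (r \<otimes> (s \<otimes> t))"
| hor_id_left: "ax (Idn [] \<otimes> t) t"
| hor_id_right: "ax (t \<otimes> Idn []) t"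
| hor_Idn: "ax (Idn u \<otimes> Idn v) (Idn (u @ v))"
| interchange: "ax ((s \<otimes> s') \<odot> (t \<otimes> t')) ((s \<odot> t) \<otimes> (s' \<odot> t'))"
| add_assoc: "ax ((r \<oplus> s) \<oplus> t) (r \<oplus> (s \<oplus> t))"
| add_comm: "ax (s \<oplus> t) (t \<oplus> s)"
| add_zero: "ax (t \<oplus> Nul (dom t) (cod t)) t"
| add_minus: "ax (t \<ominus> t) (Nul (dom t) (cod t))"
| scl_one: "ax (1 \<cdot> t) t"
| scl_scl: "ax (y \<cdot> z \<cdot> t) ((y * z) \<cdot> t)"
| scl_add: "ax (z \<cdot> (s \<oplus> t)) (z \<cdot> s \<oplus> z \<cdot> t)"
| add_scl: "ax ((y + z) \<cdot> t) (y \<cdot> t \<oplus> z \<cdot> t)"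
| ver_add_left: "ax ((s \<oplus> s') \<odot> t) (s \<odot> t \<oplus> s' \<odot> t)"
| ver_add_right: "ax (s \<odot> (t \<oplus> t')) (s \<odot> t \<oplus> s \<odot> t')"
| ver_scl_left: "ax ((z \<cdot> s) \<odot> t) (z \<cdot> (s \<odot> t))"
| ver_scl_right: "ax (s \<odot> (z \<cdot> t)) (z \<cdot> (s \<odot> t))"
| hor_add_left: "ax ((s \<oplus> s') \<otimes> t) (s \<otimes> t \<oplus> s' \<otimes> t)"
| hor_add_right: "ax (s \<otimes> (t \<oplus> t')) (s \<otimes> t \<oplus> s \<otimes> t')"
| hor_scl_left: "ax ((z \<cdot> s) \<otimes> t) (z \<cdot> (s \<otimes> t))"
| hor_scl_right: "ax (s \<otimes> (z \<cdot> t)) (z \<cdot> (s \<otimes> t))"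

abbreviation E\<^sub>1 :: "nat \<Rightarrow> dgm" where "E\<^sub>1 i \<equiv> Idn [Ee i]"
abbreviation F\<^sub>1 :: "nat \<Rightarrow> dgm" where "F\<^sub>1 i \<equiv> Idn [Ff i]"

primrec dots :: "nat \<Rightarrow> nat \<Rightarrow> dgm" where
  "dots i 0 = E\<^sub>1 i"
| "dots i (Suc r) = Dot i \<odot> dots i r"

definition sigma :: "nat \<Rightarrow> nat \<Rightarrow> dgm" where
  "sigma i j = (Idn [Ff j, Ee i] \<otimes> Cap j) \<odot> (F\<^sub>1 j \<otimes> Crs j i \<otimes> F\<^sub>1 j) \<odot> (Cup j \<otimes> Idn [Ee i, Ff j])"

definition cap_dots :: "nat \<Rightarrow> nat \<Rightarrow> dgm" where
  "cap_dots i r = Cap i \<odot> (dots i r \<otimes> F\<^sub>1 i)"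

definition cup_dots :: "nat \<Rightarrow> nat \<Rightarrow> dgm" where
  "cup_dots i r = (F\<^sub>1 i \<otimes> dots i r) \<odot> Cup i"

definition dgm_sum :: "word \<Rightarrow> word \<Rightarrow> (nat \<Rightarrow> dgm) \<Rightarrow> nat \<Rightarrow> dgm" where
  "dgm_sum p q t n = foldr (\<oplus>) (map t [0..<n]) (Nul p q)"

text \<open>The defining relations at the weight \<open>a\<close>. The rules \<open>iso_pos_\<close> say that the column
  \<open>(\<sigma>\<^sub>i\<^sub>i, \<kappa>\<^sub>i, \<kappa>\<^sub>i(x\<^sub>i F\<^sub>i), \<dots>)\<close> is inverse to the row
  \<open>(SInv i i, CupInv i 0, CupInv i 1, \<dots>)\<close>, and the rules \<open>iso_neg_\<close> say that the row
  \<open>(\<sigma>\<^sub>i\<^sub>i, \<eta>\<^sub>i, (F\<^sub>i x\<^sub>i)\<eta>\<^sub>i, \<dots>)\<close> is inverse to the column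
  \<open>(SInv i i, CapInv i 0, CapInv i 1, \<dots>)\<close>.\<close>

inductive rel :: "weight \<Rightarrow> dgm \<Rightarrow> dgm \<Rightarrow> bool" for a where
  dot_slide_left:
    "rel a (Crs i j \<odot> (Dot i \<otimes> E\<^sub>1 j) \<ominus> (E\<^sub>1 j \<otimes> Dot i) \<odot> Crs i j)
           (if i = j then Idn [Ee i, Ee j] else Nul [Ee i, Ee j] [Ee j, Ee i])"
| dot_slide_right:
    "rel a ((Dot j \<otimes> E\<^sub>1 i) \<odot> Crs i j \<ominus> Crs i j \<odot> (E\<^sub>1 i \<otimes> Dot j))
           (if i = j then Idn [Ee i, Ee j] else Nul [Ee i, Ee j] [Ee j, Ee i])"
| quadratic:
    "rel a (Crs j i \<odot> Crs i j)
           (if i = j then Nul [Ee i, Ee j] [Ee i, Ee j]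
            else if adj i j then tcoef i j \<cdot> (Dot i \<otimes> E\<^sub>1 j) \<oplus> tcoef j i \<cdot> (E\<^sub>1 i \<otimes> Dot j)
            else Idn [Ee i, Ee j])"
| cubic:
    "rel a ((Crs j k \<otimes> E\<^sub>1 i) \<odot> (E\<^sub>1 j \<otimes> Crs i k) \<odot> (Crs i j \<otimes> E\<^sub>1 k) \<ominus>
            (E\<^sub>1 k \<otimes> Crs i j) \<odot> (Crs i k \<otimes> E\<^sub>1 j) \<odot> (E\<^sub>1 i \<otimes> Crs j k))
           (if i = k \<and> adj i j then tcoef i j \<cdot> Idn [Ee i, Ee j, Ee k]
            else Nul [Ee i, Ee j, Ee k] [Ee k, Ee j, Ee i])"
| zigzag_E: "rel a ((Cap i \<otimes> E\<^sub>1 i) \<odot> (E\<^sub>1 i \<otimes> Cup i)) (E\<^sub>1 i)"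
| zigzag_F: "rel a ((F\<^sub>1 i \<otimes> Cap i) \<odot> (Cup i \<otimes> F\<^sub>1 i)) (F\<^sub>1 i)"
| iso_mixed_left: "i \<noteq> j \<Longrightarrow> rel a (SInv i j \<odot> sigma i j) (Idn [Ee i, Ff j])"
| iso_mixed_right: "i \<noteq> j \<Longrightarrow> rel a (sigma i j \<odot> SInv i j) (Idn [Ff j, Ee i])"
| iso_pos_EF: "0 \<le> lam a i \<Longrightarrow>
    rel a (SInv i i \<odot> sigma i i \<oplus>
           dgm_sum [Ee i, Ff i] [Ee i, Ff i] (\<lambda>r. CupInv i r \<odot> cap_dots i r) (nat (lam a i)))
          (Idn [Ee i, Ff i])"
| iso_pos_FE: "0 \<le> lam a i \<Longrightarrow> rel a (sigma i i \<odot> SInv i i) (Idn [Ff i, Ee i])"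
| iso_pos_sigma: "int r < lam a i \<Longrightarrow> rel a (sigma i i \<odot> CupInv i r) (Nul [] [Ff i, Ee i])"
| iso_pos_cap: "int r < lam a i \<Longrightarrow> rel a (cap_dots i r \<odot> SInv i i) (Nul [Ff i, Ee i] [])"
| iso_pos_one: "int r < lam a i \<Longrightarrow> int s < lam a i \<Longrightarrow>
    rel a (cap_dots i r \<odot> CupInv i s) (if r = s then Idn [] else Nul [] [])"
| iso_neg_FE: "lam a i \<le> 0 \<Longrightarrow>
    rel a (sigma i i \<odot> SInv i i \<oplus>
           dgm_sum [Ff i, Ee i] [Ff i, Ee i] (\<lambda>r. cup_dots i r \<odot> CapInv i r) (nat (- lam a i)))
          (Idn [Ff i, Ee i])"
| iso_neg_EF: "lam a i \<le> 0 \<Longrightarrow> rel a (SInv i i \<odot> sigma i i) (Idn [Ee i, Ff i])"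
| iso_neg_cup: "int r < - lam a i \<Longrightarrow> rel a (SInv i i \<odot> cup_dots i r) (Nul [] [Ee i, Ff i])"
| iso_neg_sigma: "int r < - lam a i \<Longrightarrow> rel a (CapInv i r \<odot> sigma i i) (Nul [Ee i, Ff i] [])"
| iso_neg_one: "int r < - lam a i \<Longrightarrow> int s < - lam a i \<Longrightarrow>
    rel a (CapInv i r \<odot> cup_dots i s) (if r = s then Idn [] else Nul [] [])"

text \<open>Equality of 2-morphisms starting at the weight \<open>a\<close> in the quotient of the 2-category of gl(m)
  by the weights in \<open>K\<close>; \<open>K = {}\<close> gives the 2-category of gl(m) itself.\<close>

inductive dgm_eq :: "nat \<Rightarrow> weight set \<Rightarrow> weight \<Rightarrow> dgm \<Rightarrow> dgm \<Rightarrow> bool" for m K where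
  refl: "wf_dgm m a t \<Longrightarrow> dgm_eq m K a t t"
| sym: "dgm_eq m K a s t \<Longrightarrow> dgm_eq m K a t s"
| trans: "dgm_eq m K a r s \<Longrightarrow> dgm_eq m K a s t \<Longrightarrow> dgm_eq m K a r t"
| ver: "dgm_eq m K a s s' \<Longrightarrow> dgm_eq m K a t t' \<Longrightarrow> dom s = cod t \<Longrightarrow>
    dgm_eq m K a (s \<odot> t) (s' \<odot> t')"
| hor: "dgm_eq m K (act (dom t) a) s s' \<Longrightarrow> dgm_eq m K a t t' \<Longrightarrow>
    dgm_eq m K a (s \<otimes> t) (s' \<otimes> t')"
| add: "dgm_eq m K a s s' \<Longrightarrow> dgm_eq m K a t t' \<Longrightarrow> dom s = dom t \<Longrightarrow> cod s = cod t \<Longrightarrow>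
    dgm_eq m K a (s \<oplus> t) (s' \<oplus> t')"
| scl: "dgm_eq m K a t t' \<Longrightarrow> dgm_eq m K a (z \<cdot> t) (z \<cdot> t')"
| ax: "ax s t \<Longrightarrow> wf_dgm m a s \<Longrightarrow> wf_dgm m a t \<Longrightarrow> dgm_eq m K a s t"
| rel: "rel a s t \<Longrightarrow> wf_dgm m a s \<Longrightarrow> wf_dgm m a t \<Longrightarrow> dgm_eq m K a s t"
| kill: "a \<in> K \<Longrightarrow> dgm_eq m K a (Idn []) (Nul [] [])"


subsection \<open>Divided powers\<close>

text \<open>The divided power of \<open>E\<^sub>i\<close> is the image of the nilHecke idempotent
  \<open>x\<^sub>1\<^sup>k\<^sup>-\<^sup>1 x\<^sub>2\<^sup>k\<^sup>-\<^sup>2 \<cdots> x\<^sub>k\<^sub>-\<^sub>1 \<tau>\<^sub>w\<close> on the \<open>k\<close>th power of \<open>E\<^sub>i\<close>, where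
  \<open>w\<close> is the longest permutation and strands are numbered from the left. The idempotent of the divided
  power of \<open>F\<^sub>i\<close> is its mate under the adjunction given by \<open>\<eta>\<^sub>i\<close> and \<open>\<kappa>\<^sub>i\<close>.
  The usual overall shift of divided powers plays no role, since shifts are adjoined separately.\<close>

text \<open>The leftmost of \<open>k + 1\<close> strands crosses all the others.\<close>

primrec sweep :: "nat \<Rightarrow> nat \<Rightarrow> dgm" where
  "sweep i 0 = E\<^sub>1 i"
| "sweep i (Suc k) = (E\<^sub>1 i \<otimes> sweep i k) \<odot> (Crs i i \<otimes> Idn (replicate k (Ee i)))"

primrec half_twist :: "nat \<Rightarrow> nat \<Rightarrow> dgm" where
  "half_twist i 0 = Idn []"
| "half_twist i (Suc k) = sweep i k \<odot> (E\<^sub>1 i \<otimes> half_twist i k)"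

primrec staircase :: "nat \<Rightarrow> nat \<Rightarrow> dgm" where
  "staircase i 0 = Idn []"
| "staircase i (Suc k) = dots i k \<otimes> staircase i k"

definition E_idem :: "nat \<Rightarrow> nat \<Rightarrow> dgm" where
  "E_idem i k = staircase i k \<odot> half_twist i k"

primrec cups :: "nat \<Rightarrow> nat \<Rightarrow> dgm" where
  "cups i 0 = Idn []"
| "cups i (Suc k) = (Idn (replicate k (Ff i)) \<otimes> Cup i \<otimes> Idn (replicate k (Ee i))) \<odot> cups i k"

primrec caps :: "nat \<Rightarrow> nat \<Rightarrow> dgm" where
  "caps i 0 = Idn []"
| "caps i (Suc k) = caps i k \<odot> (Idn (replicate k (Ee i)) \<otimes> Cap i \<otimes> Idn (replicate k (Ff i)))"

definition F_idem :: "nat \<Rightarrow> nat \<Rightarrow> dgm" where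
  "F_idem i k = (Idn (replicate k (Ff i)) \<otimes> caps i k) \<odot>
     (Idn (replicate k (Ff i)) \<otimes> E_idem i k \<otimes> Idn (replicate k (Ff i))) \<odot>
     (cups i k \<otimes> Idn (replicate k (Ff i)))"

text \<open>\<open>Ed i k\<close> and \<open>Fd i k\<close> stand for the \<open>k\<close>th divided powers of \<open>E\<^sub>i\<close> and \<open>F\<^sub>i\<close>. A word \<open>P\<close> in
  them is, in the idempotent completion, the pair of the ordinary word \<open>expand P\<close> and its
  idempotent \<open>idem P\<close>.\<close>

datatype dletter = Ed nat nat | Fd nat nat

type_synonym dword = "dletter list"

fun dletter_ok :: "nat \<Rightarrow> dletter \<Rightarrow> bool" where
  "dletter_ok m (Ed i k) \<longleftrightarrow> 1 \<le> i \<and> i < m \<and> 1 \<le> k"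
| "dletter_ok m (Fd i k) \<longleftrightarrow> 1 \<le> i \<and> i < m \<and> 1 \<le> k"

fun expand_letter :: "dletter \<Rightarrow> word" where
  "expand_letter (Ed i k) = replicate k (Ee i)"
| "expand_letter (Fd i k) = replicate k (Ff i)"

definition expand :: "dword \<Rightarrow> word" where
  "expand P = concat (map expand_letter P)"

fun idem_letter :: "dletter \<Rightarrow> dgm" where
  "idem_letter (Ed i k) = E_idem i k"
| "idem_letter (Fd i k) = F_idem i k"

definition idem :: "dword \<Rightarrow> dgm" where
  "idem P = foldr (\<otimes>) (map idem_letter P) (Idn [])"


section \<open>Foams\<close>

definition killed :: "weight set" where
  "killed = {a. \<exists>n. a n \<notin> {0, 1, 2}}"

text \<open>The ideal of the category with divided powers generated by the killed weights consists of
  the 2-morphisms between idempotents that lie in the ideal of the category without divided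
  powers, because \<open>E\<^sub>i\<close> and \<open>F\<^sub>i\<close> are themselves divided powers. So idempotents can be
  split after killing weights.

  The transition functors of the colimit over \<open>m\<close> do not change weights, words or diagrams;
  two diagrams agree in the colimit iff they agree for some \<open>m\<close>.\<close>

definition foam_eq :: "weight \<Rightarrow> dgm \<Rightarrow> dgm \<Rightarrow> bool" where
  "foam_eq a s t \<longleftrightarrow> (\<exists>m. a \<in> weights m \<and> dgm_eq m killed a s t)"

type_synonym foam = "dgm set"

definition foam_of :: "weight \<Rightarrow> dgm \<Rightarrow> foam" where
  "foam_of a t = {s. foam_eq a t s}"

definition foam_dgms :: "weight \<Rightarrow> dword \<Rightarrow> dword \<Rightarrow> dgm set" where
  "foam_dgms a P Q = {t. (\<exists>m. a \<in> weights m \<and> wf_dgm m a t) \<and>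
     dom t = expand P \<and> cod t = expand Q \<and> foam_eq a (idem Q \<odot> t \<odot> idem P) t}"

definition foam_hcomp :: "weight \<Rightarrow> foam \<Rightarrow> foam \<Rightarrow> foam" where
  "foam_hcomp a S T = (\<Union>s\<in>S. \<Union>t\<in>T. foam_of a (s \<otimes> t))"

definition foam_scale :: "weight \<Rightarrow> complex \<Rightarrow> foam \<Rightarrow> foam" where
  "foam_scale a z T = (\<Union>t\<in>T. foam_of a (z \<cdot> t))"

definition web_words :: "weight \<Rightarrow> weight \<Rightarrow> dword set" where
  "web_words a b = {P. \<exists>m. a \<in> weights m \<and> list_all (dletter_ok m) P \<and> act (expand P) a = b}"

definition foam_cat :: "weight \<Rightarrow> weight \<Rightarrow> (dword, foam) lincat" where
  "foam_cat a b =
     \<lparr>obj = web_words a b,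
      hom = (\<lambda>P Q. foam_of a ` foam_dgms a P Q),
      idt = (\<lambda>P. foam_of a (idem P)),
      cmp = (\<lambda>P Q R S T. \<Union>s\<in>S. \<Union>t\<in>T. foam_of a (s \<odot> t)),
      hadd = (\<lambda>P Q S T. \<Union>s\<in>S. \<Union>t\<in>T. foam_of a (s \<oplus> t)),
      hzero = (\<lambda>P Q. foam_of a (Nul (expand P) (expand Q)))\<rparr>"

text \<open>The 1-morphism \<open>(a, Ps, b)\<close> is the direct sum of the composites \<open>Ps\<close> from \<open>a\<close> to \<open>b\<close>, and
  2-morphisms are matrices of foams. Direct sums are composed by distributing, the
  right factor varying fastest; \<open>div\<close> and \<open>mod\<close> below recover the two indices.\<close>

type_synonym web = "weight \<times> dword list \<times> weight"
type_synonym foam_matrix = "nat \<times> nat \<Rightarrow> foam"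

fun web_comp :: "web \<Rightarrow> web \<Rightarrow> web" where
  "web_comp (b, Rs, c) (a, Ps, b') = (a, [R @ P. R \<leftarrow> Rs, P \<leftarrow> Ps], c)"

fun fm_hom :: "web \<Rightarrow> web \<Rightarrow> foam_matrix set" where
  "fm_hom (a, Ps, b) (a', Qs, b') =
     (if a = a' \<and> b = b' then mhom (foam_cat a b) Ps Qs else {})"

fun fm_deg :: "web \<Rightarrow> web \<Rightarrow> int \<Rightarrow> foam_matrix set" where
  "fm_deg (a, Ps, b) (a', Qs, b') d =
     (if a = a' \<and> b = b' then
        (\<Pi>\<^sub>E (i, j) \<in> {..<length Qs} \<times> {..<length Ps}.
           foam_of a ` {t \<in> foam_dgms a (Ps ! j) (Qs ! i). has_deg a t d})
      else {})"

fun fm_id :: "web \<Rightarrow> foam_matrix" where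
  "fm_id (a, Ps, b) = mid (foam_cat a b) Ps"

fun fm_vcomp :: "web \<Rightarrow> web \<Rightarrow> web \<Rightarrow> foam_matrix \<Rightarrow> foam_matrix \<Rightarrow> foam_matrix" where
  "fm_vcomp (a, Ps, b) (a', Qs, b') (a'', Rs, b'') N M = mcmp (foam_cat a b) Ps Qs Rs N M"

fun fm_hcomp :: "web \<Rightarrow> web \<Rightarrow> web \<Rightarrow> web \<Rightarrow> foam_matrix \<Rightarrow> foam_matrix \<Rightarrow> foam_matrix" where
  "fm_hcomp (b, Rs, c) (b', Rs', c') (a, Ps, b'') (a', Ps', b''') N M =
     (\<lambda>(i, j) \<in> {..<length Rs' * length Ps'} \<times> {..<length Rs * length Ps}.
        foam_hcomp a (N (i div length Ps', j div length Ps)) (M (i mod length Ps', j mod length Ps)))"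

fun fm_add :: "web \<Rightarrow> web \<Rightarrow> foam_matrix \<Rightarrow> foam_matrix \<Rightarrow> foam_matrix" where
  "fm_add (a, Ps, b) (a', Qs, b') M N =
     (\<lambda>(i, j) \<in> {..<length Qs} \<times> {..<length Ps}.
        hadd (foam_cat a b) (Ps ! j) (Qs ! i) (M (i, j)) (N (i, j)))"

fun fm_scale :: "web \<Rightarrow> web \<Rightarrow> complex \<Rightarrow> foam_matrix \<Rightarrow> foam_matrix" where
  "fm_scale (a, Ps, b) (a', Qs, b') z M =
     (\<lambda>(i, j) \<in> {..<length Qs} \<times> {..<length Ps}. foam_scale a z (M (i, j)))"

text \<open>Killed weights stay objects of the foam 2-category; the identity 2-morphisms of their identity
  1-morphisms vanish, so they are zero objects.\<close>

definition TwoFoam :: "(weight, web, foam_matrix) gl2cat" where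
  "TwoFoam =
     \<lparr>obj2 = (\<Union>m. weights m),
      one = (\<lambda>a b. {(a, Ps, b) | Ps. a \<in> (\<Union>m. weights m) \<and> set Ps \<subseteq> web_words a b}),
      unit1 = (\<lambda>a. (a, [[]], a)),
      comp1 = web_comp,
      two = fm_hom,
      two_deg = fm_deg,
      id2 = fm_id,
      vcomp = fm_vcomp,
      hcomp = fm_hcomp,
      add2 = fm_add,
      scale2 = fm_scale\<rparr>"

end

theory Submission
  imports Defs
begin

text \<open>Because \<open>p1 = p = 1p\<close> strictly, the morphisms between identity 1-morphisms in the horizontal trace
  are those of the vertical trace. So the inclusion is fully faithful, and one has to show
  that every \<open>f : c \<rightarrow> c\<close> becomes isomorphic in the horizontal trace to a sum of shifted identities.
  Two facts about the horizontal trace are used: direct sum decompositions of 1-morphisms persist, and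
  \<open>gf \<cong> fg\<close> whenever \<open>f\<close> has a left adjoint. The latter applies to the divided powers of \<open>F\<close>.

  Given a closed word in divided powers, move its last \<open>F\<^sub>j\<close> to the right past the \<open>E\<^sub>i\<close>. For
  \<open>i \<noteq> j\<close> they commute, because \<open>\<sigma>\<^sub>i\<^sub>j\<close> intertwines the nilHecke idempotents. For \<open>i = j\<close> the weights
  with entries in \<open>{0, 1, 2}\<close> leave, up to shifts, only the cases \<open>FE \<cong> EF \<oplus> 1 \<oplus> \<dots> \<oplus> 1\<close>,
  \<open>F E\<^sup>(\<^sup>2\<^sup>) \<cong> E\<close>, \<open>F\<^sup>(\<^sup>2\<^sup>) E \<cong> F\<close> and \<open>F\<^sup>(\<^sup>2\<^sup>) E\<^sup>(\<^sup>2\<^sup>) \<cong> 1\<close>; divided cubes vanish. An \<open>F\<close> at the right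
  end of the word is rotated to the left end, which changes the weight \<open>c\<close> in a fixed direction. As
  only finitely many weights are not killed, the process stops, and a closed word without \<open>F\<close> is empty.\<close>

section \<open>Additive completion and equivalences\<close>

text \<open>The cases with divided squares come from one mechanism. At entries 0, 2 in positions i,
  i + 1 the word EF passes through a weight with a negative entry, so the required isomorphism
  shrinks to FE = 1 + 1 up to shifts, with the cup and the dotted cup as inclusions. Hence FEE and
  FFE, at the weights where they occur, are two copies of E and of F; their inclusions are B0 and X
  B0, where B0 ends in a crossing \<tau> and X is a dot. From \<tau>\<tau> = 0 and the dot slides it
  follows that the divided square is just one of the two copies. As divided cubes vanish, nilHecke
  idempotents are needed on two strands only, and those of F are obtained from those of E as mates
  under the adjunction. Moving letters and rotating them need a common measure. It is lexicographic:
  the number of undivided letters, then the distance of a linear function of c from its maximum,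
  then the number of letters behind the last F. The bound m is removed early: words, weights and
  diagrams of all gl(m) are treated at once, and classes of ill-formed diagrams are empty sets, so
  that most laws hold without side conditions.\<close>

lemma equivalence_criterion:
  fixes F :: "('o1, 'h1, 'o2, 'h2) fctr"
  assumes C: "is_category C" and D: "is_category D" and F: "is_functor C D F"
    and ff: "\<And>X Y. X \<in> obj C \<Longrightarrow> Y \<in> obj C \<Longrightarrow>
      bij_betw (hmap F X Y) (hom C X Y) (hom D (omap F X) (omap F Y))"
    and ess: "\<And>Y. Y \<in> obj D \<Longrightarrow> \<exists>X\<in>obj C. \<exists>f. is_iso D (omap F X) Y f"
  shows "is_equivalence C D F"
proof -
  obtain G0 e where G0: "\<And>Y. Y \<in> obj D \<Longrightarrow> G0 Y \<in> obj C"
    and e: "\<And>Y. Y \<in> obj D \<Longrightarrow> is_iso D (omap F (G0 Y)) Y (e Y)"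
    using ess by metis
  have FO: "\<And>X. X \<in> obj C \<Longrightarrow> omap F X \<in> obj D" using F by (auto simp: is_functor_def)
  have Fid: "\<And>X. X \<in> obj C \<Longrightarrow> hmap F X X (idt C X) = idt D (omap F X)"
    and Fcmp: "\<And>X Y Z f g. \<lbrakk>X \<in> obj C; Y \<in> obj C; Z \<in> obj C; f \<in> hom C X Y; g \<in> hom C Y Z\<rbrakk> \<Longrightarrow>
      hmap F X Z (cmp C X Y Z g f) =
      cmp D (omap F X) (omap F Y) (omap F Z) (hmap F Y Z g) (hmap F X Y f)"
    and Fin: "\<And>X Y f. \<lbrakk>X \<in> obj C; Y \<in> obj C; f \<in> hom C X Y\<rbrakk> \<Longrightarrow> hmap F X Y f \<in> hom D (omap F X) (omap F Y)"
    using F by (auto simp: is_functor_def)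
  have ein: "\<And>Y. Y \<in> obj D \<Longrightarrow> e Y \<in> hom D (omap F (G0 Y)) Y" using e by (auto simp: is_iso_def)
  have "\<forall>Y. \<exists>g. Y \<in> obj D \<longrightarrow> g \<in> hom D Y (omap F (G0 Y)) \<and>
      cmp D (omap F (G0 Y)) Y (omap F (G0 Y)) g (e Y) = idt D (omap F (G0 Y)) \<and>
      cmp D Y (omap F (G0 Y)) Y (e Y) g = idt D Y"
    using e unfolding is_iso_def by metis
  then obtain e' where e'in: "\<And>Y. Y \<in> obj D \<Longrightarrow> e' Y \<in> hom D Y (omap F (G0 Y))"
    and e'e: "\<And>Y. Y \<in> obj D \<Longrightarrow>
      cmp D (omap F (G0 Y)) Y (omap F (G0 Y)) (e' Y) (e Y) = idt D (omap F (G0 Y))"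
    and ee': "\<And>Y. Y \<in> obj D \<Longrightarrow> cmp D Y (omap F (G0 Y)) Y (e Y) (e' Y) = idt D Y"
    by metis
  \<comment> \<open>The inverse of F on hom-sets. Equations in C are checked below by applying F to
    both sides and using injectivity.\<close>
  define I where "I X Y h = inv_into (hom C X Y) (hmap F X Y) h" for X Y h
  have I1: "I X Y h \<in> hom C X Y" and I2: "hmap F X Y (I X Y h) = h"
    if "X \<in> obj C" "Y \<in> obj C" "h \<in> hom D (omap F X) (omap F Y)" for X Y h
    using ff[OF that(1,2)] that(3) unfolding I_def bij_betw_def
    by (auto intro: inv_into_into f_inv_into_f)
  have inj: "f = g" if "X \<in> obj C" "Y \<in> obj C" "f \<in> hom C X Y" "g \<in> hom C X Y"
      "hmap F X Y f = hmap F X Y g" for X Y f g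
    using ff[OF that(1,2)] that(3-) unfolding bij_betw_def by (auto dest: inj_onD)
  have Cid: "\<And>X. X \<in> obj C \<Longrightarrow> idt C X \<in> hom C X X"
    and Ccmp: "\<And>X Y Z f g. \<lbrakk>X \<in> obj C; Y \<in> obj C; Z \<in> obj C; f \<in> hom C X Y; g \<in> hom C Y Z\<rbrakk> \<Longrightarrow>
      cmp C X Y Z g f \<in> hom C X Z"
    using C unfolding is_category_def by blast+
  have Did: "\<And>X. X \<in> obj D \<Longrightarrow> idt D X \<in> hom D X X"
    and Dcmp: "\<And>X Y Z f g. \<lbrakk>X \<in> obj D; Y \<in> obj D; Z \<in> obj D; f \<in> hom D X Y; g \<in> hom D Y Z\<rbrakk> \<Longrightarrow>
      cmp D X Y Z g f \<in> hom D X Z"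
    and Dr: "\<And>X Y f. \<lbrakk>X \<in> obj D; Y \<in> obj D; f \<in> hom D X Y\<rbrakk> \<Longrightarrow> cmp D X X Y f (idt D X) = f"
    and Dl: "\<And>X Y f. \<lbrakk>X \<in> obj D; Y \<in> obj D; f \<in> hom D X Y\<rbrakk> \<Longrightarrow> cmp D X Y Y (idt D Y) f = f"
    and Da: "\<And>W X Y Z f g h. \<lbrakk>W \<in> obj D; X \<in> obj D; Y \<in> obj D; Z \<in> obj D;
        f \<in> hom D W X; g \<in> hom D X Y; h \<in> hom D Y Z\<rbrakk> \<Longrightarrow>
        cmp D W X Z (cmp D X Y Z h g) f = cmp D W Y Z h (cmp D W X Y g f)"
    using D unfolding is_category_def by metis+
  \<comment> \<open>Conjugation by \<open>e\<close> moves h to a morphism between objects in the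
    image of F, where full faithfulness can lift it to C.\<close>
  define T where "T Y Z h = cmp D (omap F (G0 Y)) Y (omap F (G0 Z)) (cmp D Y Z (omap F (G0 Z)) (e' Z) h) (e Y)"
    for Y Z h
  have Tin: "T Y Z h \<in> hom D (omap F (G0 Y)) (omap F (G0 Z))"
    if "Y \<in> obj D" "Z \<in> obj D" "h \<in> hom D Y Z" for Y Z h
    unfolding T_def using that by (intro Dcmp FO G0 ein e'in)
  have Tid: "T Y Y (idt D Y) = idt D (omap F (G0 Y))" if "Y \<in> obj D" for Y
    unfolding T_def using that by (simp add: Dr FO G0 e'in e'e)
  have eT: "cmp D (omap F (G0 Y)) (omap F (G0 Z)) Z (e Z) (T Y Z h) = cmp D (omap F (G0 Y)) Y Z h (e Y)"
    if "Y \<in> obj D" "Z \<in> obj D" "h \<in> hom D Y Z" for Y Z h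
    unfolding T_def using that
    by (simp add: Da[symmetric] FO G0 e'in ein Dcmp ee' Dl)
  have e'T: "cmp D Y (omap F (G0 Y)) (omap F (G0 Z)) (T Y Z h) (e' Y) = cmp D Y Z (omap F (G0 Z)) (e' Z) h"
    if "Y \<in> obj D" "Z \<in> obj D" "h \<in> hom D Y Z" for Y Z h
    unfolding T_def using that
    by (simp add: Da FO G0 e'in ein Dcmp ee' Dr)
  have Tcmp: "T X Z (cmp D X Y Z g f) =
      cmp D (omap F (G0 X)) (omap F (G0 Y)) (omap F (G0 Z)) (T Y Z g) (T X Y f)"
    if o: "X \<in> obj D" "Y \<in> obj D" "Z \<in> obj D" and m: "f \<in> hom D X Y" "g \<in> hom D Y Z" for X Y Z f g
  proof -
    have "cmp D (omap F (G0 X)) (omap F (G0 Y)) (omap F (G0 Z)) (T Y Z g) (T X Y f) =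
      cmp D (omap F (G0 X)) X (omap F (G0 Z))
        (cmp D X (omap F (G0 Y)) (omap F (G0 Z)) (T Y Z g) (cmp D X Y (omap F (G0 Y)) (e' Y) f)) (e X)"
      unfolding T_def[of X Y f] using o m by (simp add: Da FO G0 e'in ein Dcmp Tin)
    also have "cmp D X (omap F (G0 Y)) (omap F (G0 Z)) (T Y Z g) (cmp D X Y (omap F (G0 Y)) (e' Y) f) =
      cmp D X Y (omap F (G0 Z)) (cmp D Y (omap F (G0 Y)) (omap F (G0 Z)) (T Y Z g) (e' Y)) f"
      using o m by (simp add: Da FO G0 e'in Tin)
    also have "\<dots> = cmp D X Z (omap F (G0 Z)) (e' Z) (cmp D X Y Z g f)"
      using o m by (simp add: e'T Da FO G0 e'in)
    finally show ?thesis by (simp add: T_def)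
  qed
  define G where "G = \<lparr>omap = G0, hmap = (\<lambda>Y Z h. I (G0 Y) (G0 Z) (T Y Z h))\<rparr>"
  have Gf: "is_functor D C G"
    unfolding is_functor_def G_def fctr.simps
  proof (intro conjI ballI)
    fix X Y f assume "X \<in> obj D" "Y \<in> obj D" "f \<in> hom D X Y"
    then show "I (G0 X) (G0 Y) (T X Y f) \<in> hom C (G0 X) (G0 Y)" by (intro I1 G0 Tin)
  next
    fix X assume X: "X \<in> obj D"
    show "I (G0 X) (G0 X) (T X X (idt D X)) = idt C (G0 X)"
      by (rule inj[of "G0 X" "G0 X"]) (use X in \<open>simp_all add: G0 I1 I2 Tin Did Cid Tid FO Fid\<close>)
  next
    fix X Y Z f g assume o: "X \<in> obj D" "Y \<in> obj D" "Z \<in> obj D" and m: "f \<in> hom D X Y" "g \<in> hom D Y Z"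
    have T: "T X Y f \<in> hom D (omap F (G0 X)) (omap F (G0 Y))" "T Y Z g \<in> hom D (omap F (G0 Y)) (omap F (G0 Z))"
      "T X Z (cmp D X Y Z g f) \<in> hom D (omap F (G0 X)) (omap F (G0 Z))"
      using o m Tin Dcmp by auto
    show "I (G0 X) (G0 Z) (T X Z (cmp D X Y Z g f)) =
      cmp C (G0 X) (G0 Y) (G0 Z) (I (G0 Y) (G0 Z) (T Y Z g)) (I (G0 X) (G0 Y) (T X Y f))"
      by (rule inj[of "G0 X" "G0 Z"]) (use o m T in \<open>simp_all add: G0 I1 I2 Fcmp Ccmp Tcmp\<close>)
  qed (use G0 in auto)
  have n2: "naturally_isomorphic D D (comp_functor F G) id_functor"
    unfolding naturally_isomorphic_def comp_functor_def id_functor_def G_def fctr.simps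
    by (intro exI[of _ e] conjI ballI) (simp_all add: e I2 G0 Tin eT)
  have e'F: "e' (omap F X) \<in> hom D (omap F X) (omap F (G0 (omap F X)))"
    and eF: "e (omap F X) \<in> hom D (omap F (G0 (omap F X))) (omap F X)" if "X \<in> obj C" for X
    using that e'in ein FO by auto
  have n1: "naturally_isomorphic C C id_functor (comp_functor G F)"
    unfolding naturally_isomorphic_def comp_functor_def id_functor_def G_def fctr.simps
  \<comment> \<open>The unit of the equivalence is the lift of the inverse of \<open>e\<close> at
    \<open>omap F X\<close>.\<close>
  proof (intro exI[of _ "\<lambda>X. I X (G0 (omap F X)) (e' (omap F X))"] conjI ballI)
    fix X assume X: "X \<in> obj C"
    note m = X FO[OF X] G0[OF FO[OF X]] e'F[OF X] eF[OF X]
    show "is_iso C X (G0 (omap F X)) (I X (G0 (omap F X)) (e' (omap F X)))"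
      unfolding is_iso_def
    proof (intro conjI bexI[of _ "I (G0 (omap F X)) X (e (omap F X))"])
      show "cmp C X (G0 (omap F X)) X (I (G0 (omap F X)) X (e (omap F X))) (I X (G0 (omap F X)) (e' (omap F X))) = idt C X"
        by (rule inj[of X X]) (use m in \<open>simp_all add: I1 I2 Fcmp Ccmp Cid Fid ee'\<close>)
      show "cmp C (G0 (omap F X)) X (G0 (omap F X)) (I X (G0 (omap F X)) (e' (omap F X))) (I (G0 (omap F X)) X (e (omap F X))) = idt C (G0 (omap F X))"
        by (rule inj[of "G0 (omap F X)" "G0 (omap F X)"]) (use m in \<open>simp_all add: I1 I2 Fcmp Ccmp Cid Fid e'e\<close>)
    qed (use m I1 in auto)
  next
    fix X Y f assume X: "X \<in> obj C" and Y: "Y \<in> obj C" and f: "f \<in> hom C X Y"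
    note m = X FO[OF X] G0[OF FO[OF X]] e'F[OF X] eF[OF X] Y FO[OF Y] G0[OF FO[OF Y]] e'F[OF Y] eF[OF Y] f
      Fin[OF X Y f] Tin[OF FO[OF X] FO[OF Y] Fin[OF X Y f]]
    show "cmp C X Y (G0 (omap F Y)) (I Y (G0 (omap F Y)) (e' (omap F Y))) f =
      cmp C X (G0 (omap F X)) (G0 (omap F Y)) (I (G0 (omap F X)) (G0 (omap F Y)) (T (omap F X) (omap F Y) (hmap F X Y f)))
        (I X (G0 (omap F X)) (e' (omap F X)))"
      by (rule inj[of X "G0 (omap F Y)"]) (use m in \<open>simp_all add: I1 I2 Fcmp Ccmp e'T\<close>)
  qed
  show ?thesis
    unfolding is_equivalence_def using C D F Gf n1 n2 by blast
qed

section \<open>Isomorphic objects\<close>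

definition isomorphic :: "('o, 'h) cat \<Rightarrow> 'o \<Rightarrow> 'o \<Rightarrow> bool" where
  "isomorphic C X Y \<longleftrightarrow> (\<exists>f. is_iso C X Y f)"

lemma isomorphicI:
  assumes "f \<in> hom C X Y" "g \<in> hom C Y X" "cmp C X Y X g f = idt C X" "cmp C Y X Y f g = idt C Y"
  shows "isomorphic C X Y"
  using assms unfolding isomorphic_def is_iso_def by blast

lemma isomorphicE:
  assumes "isomorphic C X Y"
  obtains f g where "f \<in> hom C X Y" "g \<in> hom C Y X"
    "cmp C X Y X g f = idt C X" "cmp C Y X Y f g = idt C Y"
  using assms unfolding isomorphic_def is_iso_def by blast

lemma isomorphic_refl: "is_category C \<Longrightarrow> X \<in> obj C \<Longrightarrow> isomorphic C X X"
  by (rule isomorphicI[of "idt C X" _ _ _ "idt C X"]) (auto simp: is_category_def)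

lemma isomorphic_sym: "isomorphic C X Y \<Longrightarrow> isomorphic C Y X"
  by (erule isomorphicE, rule isomorphicI)

lemma isomorphic_trans:
  assumes C: "is_category C" and o: "X \<in> obj C" "Y \<in> obj C" "Z \<in> obj C"
    and XY: "isomorphic C X Y" and YZ: "isomorphic C Y Z"
  shows "isomorphic C X Z"
proof -
  from XY obtain f g where f: "f \<in> hom C X Y" and g: "g \<in> hom C Y X"
    and gf: "cmp C X Y X g f = idt C X" and fg: "cmp C Y X Y f g = idt C Y" by (rule isomorphicE)
  from YZ obtain f' g' where f': "f' \<in> hom C Y Z" and g': "g' \<in> hom C Z Y"
    and gf': "cmp C Y Z Y g' f' = idt C Y" and fg': "cmp C Z Y Z f' g' = idt C Z" by (rule isomorphicE)
  have c: "\<And>X Y Z f g. \<lbrakk>X \<in> obj C; Y \<in> obj C; Z \<in> obj C; f \<in> hom C X Y; g \<in> hom C Y Z\<rbrakk> \<Longrightarrow>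
      cmp C X Y Z g f \<in> hom C X Z"
    and r: "\<And>X Y f. \<lbrakk>X \<in> obj C; Y \<in> obj C; f \<in> hom C X Y\<rbrakk> \<Longrightarrow> cmp C X X Y f (idt C X) = f"
    and a: "\<And>W X Y Z f g h. \<lbrakk>W \<in> obj C; X \<in> obj C; Y \<in> obj C; Z \<in> obj C;
        f \<in> hom C W X; g \<in> hom C X Y; h \<in> hom C Y Z\<rbrakk> \<Longrightarrow>
        cmp C W Y Z h (cmp C W X Y g f) = cmp C W X Z (cmp C X Y Z h g) f"
    using C unfolding is_category_def by metis+
  show ?thesis
  proof (rule isomorphicI)
    show "cmp C X Y Z f' f \<in> hom C X Z" "cmp C Z Y X g g' \<in> hom C Z X"
      using c f f' g g' o by auto
    have "cmp C X Z X (cmp C Z Y X g g') (cmp C X Y Z f' f) = cmp C X Y X (cmp C Y Z X (cmp C Z Y X g g') f') f"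
      using c f f' g g' o by (simp add: a)
    also have "cmp C Y Z X (cmp C Z Y X g g') f' = cmp C Y Y X g (cmp C Y Z Y g' f')"
      using f f' g g' o by (simp add: a)
    finally show "cmp C X Z X (cmp C Z Y X g g') (cmp C X Y Z f' f) = idt C X"
      using gf gf' r o g by simp
    have "cmp C Z X Z (cmp C X Y Z f' f) (cmp C Z Y X g g') = cmp C Z Y Z (cmp C Y X Z (cmp C X Y Z f' f) g) g'"
      using c f f' g g' o by (simp add: a)
    also have "cmp C Y X Z (cmp C X Y Z f' f) g = cmp C Y Y Z f' (cmp C Y X Y f g)"
      using f f' g g' o by (simp add: a)
    finally show "cmp C Z X Z (cmp C X Y Z f' f) (cmp C Z Y X g g') = idt C Z"
      using fg fg' r o f' by simp
  qed
qed

text \<open>Facts on matrices that use no law of composition. They are shared by the horizontal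
  trace, whose laws are proved directly, and the vertical trace, which inherits its laws.\<close>

locale hom_matrices =
  fixes A :: "('x, 'h) lincat"
begin

lemma mhom_iff: "M \<in> mhom A X Y \<longleftrightarrow>
    (\<forall>i<length Y. \<forall>j<length X. M (i, j) \<in> hom A (X ! j) (Y ! i)) \<and>
    M \<in> extensional ({..<length Y} \<times> {..<length X})"
  unfolding mhom_def PiE_def by (auto simp: Pi_iff)

lemma mhom_entry: "\<lbrakk>M \<in> mhom A X Y; i < length Y; j < length X\<rbrakk> \<Longrightarrow> M (i, j) \<in> hom A (X ! j) (Y ! i)"
  by (simp add: mhom_iff)

lemma mhom_eqI: "\<lbrakk>M \<in> mhom A X Y; N \<in> mhom A X Y;
    \<And>i j. i < length Y \<Longrightarrow> j < length X \<Longrightarrow> M (i, j) = N (i, j)\<rbrakk> \<Longrightarrow> M = N"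
  unfolding mhom_def by (rule PiE_ext) auto

lemma obj_nth: "X \<in> lists (obj A) \<Longrightarrow> i < length X \<Longrightarrow> X ! i \<in> obj A"
  by (simp add: in_lists_conv_set)

end

text \<open>Enrichment in commutative monoids; as there are no negatives, absorption of zero is
  listed as a law. All laws are relative to objects and hom-sets because the underlying types
  contain much more.\<close>

locale preadditive = hom_matrices A for A :: "('x, 'h) lincat" +
  assumes idt_in: "x \<in> obj A \<Longrightarrow> idt A x \<in> hom A x x"
    and cmp_in: "\<lbrakk>x \<in> obj A; y \<in> obj A; z \<in> obj A; f \<in> hom A x y; g \<in> hom A y z\<rbrakk> \<Longrightarrow>
      cmp A x y z g f \<in> hom A x z"
    and idt_left: "\<lbrakk>x \<in> obj A; y \<in> obj A; f \<in> hom A x y\<rbrakk> \<Longrightarrow> cmp A x y y (idt A y) f = f"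
    and idt_right: "\<lbrakk>x \<in> obj A; y \<in> obj A; f \<in> hom A x y\<rbrakk> \<Longrightarrow> cmp A x x y f (idt A x) = f"
    and cmp_assoc: "\<lbrakk>w \<in> obj A; x \<in> obj A; y \<in> obj A; z \<in> obj A;
      f \<in> hom A w x; g \<in> hom A x y; h \<in> hom A y z\<rbrakk> \<Longrightarrow>
      cmp A w y z h (cmp A w x y g f) = cmp A w x z (cmp A x y z h g) f"
    and zero_in: "\<lbrakk>x \<in> obj A; y \<in> obj A\<rbrakk> \<Longrightarrow> hzero A x y \<in> hom A x y"
    and add_in: "\<lbrakk>x \<in> obj A; y \<in> obj A; f \<in> hom A x y; g \<in> hom A x y\<rbrakk> \<Longrightarrow> hadd A x y f g \<in> hom A x y"
    and add_assoc: "\<lbrakk>x \<in> obj A; y \<in> obj A; f \<in> hom A x y; g \<in> hom A x y; h \<in> hom A x y\<rbrakk> \<Longrightarrow>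
      hadd A x y (hadd A x y f g) h = hadd A x y f (hadd A x y g h)"
    and add_comm: "\<lbrakk>x \<in> obj A; y \<in> obj A; f \<in> hom A x y; g \<in> hom A x y\<rbrakk> \<Longrightarrow>
      hadd A x y f g = hadd A x y g f"
    and add_zero: "\<lbrakk>x \<in> obj A; y \<in> obj A; f \<in> hom A x y\<rbrakk> \<Longrightarrow> hadd A x y f (hzero A x y) = f"
    and cmp_add_left: "\<lbrakk>x \<in> obj A; y \<in> obj A; z \<in> obj A; f \<in> hom A x y; g \<in> hom A y z; h \<in> hom A y z\<rbrakk> \<Longrightarrow>
      cmp A x y z (hadd A y z g h) f = hadd A x z (cmp A x y z g f) (cmp A x y z h f)"
    and cmp_add_right: "\<lbrakk>x \<in> obj A; y \<in> obj A; z \<in> obj A; f \<in> hom A x y; g \<in> hom A x y; h \<in> hom A y z\<rbrakk> \<Longrightarrow>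
      cmp A x y z h (hadd A x y f g) = hadd A x z (cmp A x y z h f) (cmp A x y z h g)"
    and cmp_zero_left: "\<lbrakk>x \<in> obj A; y \<in> obj A; z \<in> obj A; f \<in> hom A x y\<rbrakk> \<Longrightarrow>
      cmp A x y z (hzero A y z) f = hzero A x z"
    and cmp_zero_right: "\<lbrakk>x \<in> obj A; y \<in> obj A; z \<in> obj A; g \<in> hom A y z\<rbrakk> \<Longrightarrow>
      cmp A x y z g (hzero A x y) = hzero A x z"
begin

text \<open>\<open>hsum\<close> is a right fold over a list, while inductions on the number of terms
  want the last term split off. Entries of matrix products are stated in this indexed form.\<close>

definition isum :: "'x \<Rightarrow> 'x \<Rightarrow> nat \<Rightarrow> (nat \<Rightarrow> 'h) \<Rightarrow> 'h" where
  "isum x y n f = hsum A x y (map f [0..<n])"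

lemma hsum_in: "\<lbrakk>x \<in> obj A; y \<in> obj A; set hs \<subseteq> hom A x y\<rbrakk> \<Longrightarrow> hsum A x y hs \<in> hom A x y"
  by (induction hs) (auto simp: hsum_def zero_in add_in)

lemma add_zero_left: "\<lbrakk>x \<in> obj A; y \<in> obj A; f \<in> hom A x y\<rbrakk> \<Longrightarrow> hadd A x y (hzero A x y) f = f"
  using add_comm add_zero zero_in by metis

lemma hsum_append: "\<lbrakk>x \<in> obj A; y \<in> obj A; set hs \<subseteq> hom A x y; set hs' \<subseteq> hom A x y\<rbrakk> \<Longrightarrow>
    hsum A x y (hs @ hs') = hadd A x y (hsum A x y hs) (hsum A x y hs')"
proof (induction hs)
  case Nil
  then show ?case using hsum_in[of x y hs'] add_zero_left by (simp add: hsum_def)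
next
  case (Cons h hs)
  then show ?case using hsum_in[of x y hs'] hsum_in[of x y hs] by (simp add: hsum_def add_assoc)
qed

lemma isum_0 [simp]: "isum x y 0 f = hzero A x y"
  by (simp add: isum_def hsum_def)

lemma isum_Suc: "\<lbrakk>x \<in> obj A; y \<in> obj A; \<And>i. i \<le> n \<Longrightarrow> f i \<in> hom A x y\<rbrakk> \<Longrightarrow>
    isum x y (Suc n) f = hadd A x y (isum x y n f) (f n)"
  unfolding isum_def by (simp, subst hsum_append) (auto simp: hsum_def add_zero)

lemma isum_in: "\<lbrakk>x \<in> obj A; y \<in> obj A; \<And>i. i < n \<Longrightarrow> f i \<in> hom A x y\<rbrakk> \<Longrightarrow> isum x y n f \<in> hom A x y"
  unfolding isum_def by (rule hsum_in) auto

lemma isum_cong: "(\<And>i. i < n \<Longrightarrow> f i = g i) \<Longrightarrow> isum x y n f = isum x y n g"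
  unfolding isum_def by (rule arg_cong[of _ _ "hsum A x y"]) simp

lemma isum_zero: "\<lbrakk>x \<in> obj A; y \<in> obj A\<rbrakk> \<Longrightarrow> isum x y n (\<lambda>i. hzero A x y) = hzero A x y"
  by (induction n) (simp_all add: isum_Suc zero_in add_zero)

lemma isum_1: "\<lbrakk>x \<in> obj A; y \<in> obj A; f 0 \<in> hom A x y\<rbrakk> \<Longrightarrow> isum x y (Suc 0) f = f 0"
  by (simp add: isum_def hsum_def add_zero)

lemma isum_plus: "\<lbrakk>x \<in> obj A; y \<in> obj A; \<And>i. i < n + m \<Longrightarrow> f i \<in> hom A x y\<rbrakk> \<Longrightarrow>
    isum x y (n + m) f = hadd A x y (isum x y n f) (isum x y m (\<lambda>i. f (n + i)))"
proof (induction m)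
  case 0
  then show ?case by (simp add: add_zero isum_in)
next
  case (Suc m)
  then have "isum x y (n + m) f = hadd A x y (isum x y n f) (isum x y m (\<lambda>i. f (n + i)))" by simp
  then show ?case using Suc.prems by (simp add: isum_Suc isum_in add_assoc)
qed

lemma cmp_isum_right:
  assumes o: "x \<in> obj A" "y \<in> obj A" "z \<in> obj A" and g: "g \<in> hom A y z"
    and f: "\<And>i. i < n \<Longrightarrow> f i \<in> hom A x y"
  shows "cmp A x y z g (isum x y n f) = isum x z n (\<lambda>i. cmp A x y z g (f i))"
  using f
proof (induction n)
  case 0
  then show ?case using o g by (simp add: cmp_zero_right)
next
  case (Suc n)
  then show ?case using o g by (simp add: isum_Suc cmp_add_right isum_in cmp_in)
qed

lemma cmp_isum_left:
  assumes o: "x \<in> obj A" "y \<in> obj A" "z \<in> obj A" and g: "g \<in> hom A x y"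
    and f: "\<And>i. i < n \<Longrightarrow> f i \<in> hom A y z"
  shows "cmp A x y z (isum y z n f) g = isum x z n (\<lambda>i. cmp A x y z (f i) g)"
  using f
proof (induction n)
  case 0
  then show ?case using o g by (simp add: cmp_zero_left)
next
  case (Suc n)
  then show ?case using o g by (simp add: isum_Suc cmp_add_left isum_in cmp_in)
qed

lemma add_swap:
  assumes "x \<in> obj A" "y \<in> obj A" "f \<in> hom A x y" "g \<in> hom A x y" "h \<in> hom A x y" "k \<in> hom A x y"
  shows "hadd A x y (hadd A x y f g) (hadd A x y h k) = hadd A x y (hadd A x y f h) (hadd A x y g k)"
proof -
  have "hadd A x y g (hadd A x y h k) = hadd A x y h (hadd A x y g k)"
    using assms by (simp add: add_assoc[symmetric] add_comm[of x y g h])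
  then show ?thesis using assms by (simp add: add_assoc add_in)
qed

lemma isum_add:
  assumes o: "x \<in> obj A" "y \<in> obj A"
    and f: "\<And>i. i < n \<Longrightarrow> f i \<in> hom A x y" and g: "\<And>i. i < n \<Longrightarrow> g i \<in> hom A x y"
  shows "isum x y n (\<lambda>i. hadd A x y (f i) (g i)) = hadd A x y (isum x y n f) (isum x y n g)"
  using f g
proof (induction n)
  case 0
  then show ?case using o by (simp add: add_zero zero_in)
next
  case (Suc n)
  then show ?case using o by (simp add: isum_Suc add_in isum_in add_swap)
qed

lemma isum_swap:
  assumes o: "x \<in> obj A" "y \<in> obj A"
    and f: "\<And>i j. i < n \<Longrightarrow> j < m \<Longrightarrow> f i j \<in> hom A x y"
  shows "isum x y n (\<lambda>i. isum x y m (f i)) = isum x y m (\<lambda>j. isum x y n (\<lambda>i. f i j))"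
  using f
proof (induction n)
  case 0
  then show ?case using o by (simp add: isum_zero)
next
  case (Suc n)
  have "isum x y (Suc n) (\<lambda>i. isum x y m (f i)) =
      hadd A x y (isum x y m (\<lambda>j. isum x y n (\<lambda>i. f i j))) (isum x y m (f n))"
    using Suc o by (simp add: isum_Suc isum_in)
  also have "\<dots> = isum x y m (\<lambda>j. hadd A x y (isum x y n (\<lambda>i. f i j)) (f n j))"
    by (subst isum_add) (use Suc.prems o in \<open>auto intro: isum_in\<close>)
  also have "\<dots> = isum x y m (\<lambda>j. isum x y (Suc n) (\<lambda>i. f i j))"
    by (rule isum_cong) (use Suc.prems o in \<open>simp add: isum_Suc\<close>)
  finally show ?case .
qed

lemma isum_delta:
  assumes o: "x \<in> obj A" "y \<in> obj A" and i: "i < n" and f: "f i \<in> hom A x y"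
  shows "isum x y n (\<lambda>j. if j = i then f j else hzero A x y) = f i"
proof -
  have *: "isum x y m (\<lambda>j. if j = i then f j else hzero A x y) = (if i < m then f i else hzero A x y)" for m
  proof (induction m)
    case (Suc m)
    show ?case
      by (subst isum_Suc) (use Suc o f in \<open>auto simp: zero_in add_zero add_zero_left less_Suc_eq\<close>)
  qed simp
  show ?thesis using *[of n] i by simp
qed

text \<open>A double sum with a single running index, the inner index running fastest. This is the
  order of the summands in a composite of direct sums of words, where the lemma is applied.\<close>

lemma isum_mult:
  assumes o: "x \<in> obj A" "y \<in> obj A"
    and f: "\<And>i j. i < n \<Longrightarrow> j < m \<Longrightarrow> f i j \<in> hom A x y"
  shows "isum x y (n * m) (\<lambda>k. f (k div m) (k mod m)) = isum x y n (\<lambda>i. isum x y m (f i))"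
  using f
proof (induction n)
  case 0
  then show ?case using o by simp
next
  case (Suc n)
  show ?case
  proof (cases "m = 0")
    case True
    then show ?thesis using o by (simp add: isum_zero)
  next
    case False
    have "isum x y (Suc n * m) (\<lambda>k. f (k div m) (k mod m)) =
      hadd A x y (isum x y (n * m) (\<lambda>k. f (k div m) (k mod m)))
        (isum x y m (\<lambda>i. f ((n * m + i) div m) ((n * m + i) mod m)))"
    proof -
      have "Suc n * m = n * m + m" by simp
      moreover have "f (i div m) (i mod m) \<in> hom A x y" if "i < n * m + m" for i
        using that Suc.prems False
        by (metis \<open>Suc n * m = n * m + m\<close> less_mult_imp_div_less mod_less_divisor not_gr_zero)
      ultimately show ?thesis using o isum_plus[of x y "n * m" m "\<lambda>k. f (k div m) (k mod m)"] by presburger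
    qed
    also have "isum x y m (\<lambda>i. f ((n * m + i) div m) ((n * m + i) mod m)) = isum x y m (f n)"
      by (rule isum_cong) (use False in simp)
    also have "isum x y (n * m) (\<lambda>k. f (k div m) (k mod m)) = isum x y n (\<lambda>i. isum x y m (f i))"
      using Suc by simp
    finally show ?thesis using Suc.prems o by (simp add: isum_Suc isum_in)
  qed
qed

section \<open>Matrices over a preadditive category\<close>

lemma mcmp_entry: "i < length Z \<Longrightarrow> k < length X \<Longrightarrow> mcmp A X Y Z N M (i, k) =
    isum (X ! k) (Z ! i) (length Y) (\<lambda>j. cmp A (X ! k) (Y ! j) (Z ! i) (N (i, j)) (M (j, k)))"
  by (simp add: mcmp_def isum_def)

lemma mid_entry: "i < length X \<Longrightarrow> j < length X \<Longrightarrow>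
    mid A X (i, j) = (if i = j then idt A (X ! i) else hzero A (X ! j) (X ! i))"
  by (simp add: mid_def)

lemma mid_in: "X \<in> lists (obj A) \<Longrightarrow> mid A X \<in> mhom A X X"
  unfolding mhom_iff by (auto simp: mid_def idt_in zero_in obj_nth)

lemma mcmp_in: "\<lbrakk>X \<in> lists (obj A); Y \<in> lists (obj A); Z \<in> lists (obj A);
    M \<in> mhom A X Y; N \<in> mhom A Y Z\<rbrakk> \<Longrightarrow> mcmp A X Y Z N M \<in> mhom A X Z"
  unfolding mhom_iff[of _ X Z]
proof (intro conjI allI impI)
  fix i j assume *: "X \<in> lists (obj A)" "Y \<in> lists (obj A)" "Z \<in> lists (obj A)"
    "M \<in> mhom A X Y" "N \<in> mhom A Y Z" "i < length Z" "j < length X"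
  then show "mcmp A X Y Z N M (i, j) \<in> hom A (X ! j) (Z ! i)"
    by (auto simp: mcmp_entry intro!: isum_in cmp_in obj_nth dest: mhom_entry)
qed (simp add: mcmp_def)

lemma mid_left: 
  assumes o: "X \<in> lists (obj A)" "Y \<in> lists (obj A)" and M: "M \<in> mhom A X Y"
  shows "mcmp A X Y Y (mid A Y) M = M"
proof (rule mhom_eqI)
  fix i j assume ij: "i < length Y" "j < length X"
  then have "mcmp A X Y Y (mid A Y) M (i, j) =
    isum (X ! j) (Y ! i) (length Y) (\<lambda>k. if k = i then M (k, j) else hzero A (X ! j) (Y ! i))"
    unfolding mcmp_entry[OF ij]
    by (intro isum_cong) (use M o in \<open>auto simp: mid_entry obj_nth idt_left cmp_zero_left dest: mhom_entry\<close>)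
  also have "\<dots> = M (i, j)"
    by (rule isum_delta) (use ij o M in \<open>auto simp: obj_nth dest: mhom_entry\<close>)
  finally show "mcmp A X Y Y (mid A Y) M (i, j) = M (i, j)" .
qed (use assms mcmp_in mid_in in auto)

lemma mid_right:
  assumes o: "X \<in> lists (obj A)" "Y \<in> lists (obj A)" and M: "M \<in> mhom A X Y"
  shows "mcmp A X X Y M (mid A X) = M"
proof (rule mhom_eqI)
  fix i j assume ij: "i < length Y" "j < length X"
  then have "mcmp A X X Y M (mid A X) (i, j) =
    isum (X ! j) (Y ! i) (length X) (\<lambda>k. if k = j then M (i, k) else hzero A (X ! j) (Y ! i))"
    unfolding mcmp_entry[OF ij]
    by (intro isum_cong) (use M o in \<open>auto simp: mid_entry obj_nth idt_right cmp_zero_right dest: mhom_entry\<close>)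
  also have "\<dots> = M (i, j)"
    by (rule isum_delta) (use ij o M in \<open>auto simp: obj_nth dest: mhom_entry\<close>)
  finally show "mcmp A X X Y M (mid A X) (i, j) = M (i, j)" .
qed (use assms mcmp_in mid_in in auto)

lemma mcmp_assoc:
  assumes o: "W \<in> lists (obj A)" "X \<in> lists (obj A)" "Y \<in> lists (obj A)" "Z \<in> lists (obj A)"
    and L: "L \<in> mhom A W X" and M: "M \<in> mhom A X Y" and N: "N \<in> mhom A Y Z"
  shows "mcmp A W Y Z N (mcmp A W X Y M L) = mcmp A W X Z (mcmp A X Y Z N M) L"
proof (rule mhom_eqI)
  fix i l assume il: "i < length Z" "l < length W"
  note m = mhom_entry[OF L] mhom_entry[OF M] mhom_entry[OF N]
  let ?c = "cmp A"
  have "mcmp A W Y Z N (mcmp A W X Y M L) (i, l) =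
    isum (W ! l) (Z ! i) (length Y) (\<lambda>j. isum (W ! l) (Z ! i) (length X) (\<lambda>k.
      ?c (W ! l) (Y ! j) (Z ! i) (N (i, j)) (?c (W ! l) (X ! k) (Y ! j) (M (j, k)) (L (k, l)))))"
    unfolding mcmp_entry[OF il]
    by (rule isum_cong, subst mcmp_entry) (use il m o in \<open>auto simp: obj_nth intro!: cmp_isum_right cmp_in\<close>)
  also have "\<dots> = isum (W ! l) (Z ! i) (length X) (\<lambda>k. isum (W ! l) (Z ! i) (length Y) (\<lambda>j.
      ?c (W ! l) (Y ! j) (Z ! i) (N (i, j)) (?c (W ! l) (X ! k) (Y ! j) (M (j, k)) (L (k, l)))))"
    by (rule isum_swap) (use il m o in \<open>auto simp: obj_nth intro!: cmp_in\<close>)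
  also have "\<dots> = isum (W ! l) (Z ! i) (length X) (\<lambda>k. isum (W ! l) (Z ! i) (length Y) (\<lambda>j.
      ?c (W ! l) (X ! k) (Z ! i) (?c (X ! k) (Y ! j) (Z ! i) (N (i, j)) (M (j, k))) (L (k, l))))"
    by (intro isum_cong cmp_assoc) (use il m o in \<open>auto simp: obj_nth\<close>)
  also have "\<dots> = mcmp A W X Z (mcmp A X Y Z N M) L (i, l)"
    unfolding mcmp_entry[OF il]
    by (rule isum_cong, subst mcmp_entry)
      (use il m o in \<open>auto simp: obj_nth intro!: cmp_isum_left[symmetric] cmp_in\<close>)
  finally show "mcmp A W Y Z N (mcmp A W X Y M L) (i, l) = mcmp A W X Z (mcmp A X Y Z N M) L (i, l)" .
qed (use assms mcmp_in in auto)

lemma is_category_mat_cat: "is_category (mat_cat A)"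
  unfolding is_category_def mat_cat_def cat.simps
  by (intro conjI ballI mid_in mcmp_in mid_left mid_right mcmp_assoc) assumption+

text \<open>The block diagonal matrix of M and N, that is, the direct sum of two morphisms.\<close>

definition block :: "'x list \<Rightarrow> 'x list \<Rightarrow> 'x list \<Rightarrow> 'x list \<Rightarrow>
    (nat \<times> nat \<Rightarrow> 'h) \<Rightarrow> (nat \<times> nat \<Rightarrow> 'h) \<Rightarrow> nat \<times> nat \<Rightarrow> 'h" where
  "block X X' Y Y' M N = (\<lambda>(i, j) \<in> {..<length (Y @ Y')} \<times> {..<length (X @ X')}.
     if i < length Y \<and> j < length X then M (i, j)
     else if \<not> i < length Y \<and> \<not> j < length X then N (i - length Y, j - length X)
     else hzero A ((X @ X') ! j) ((Y @ Y') ! i))"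

lemma block_in:
  assumes "X \<in> lists (obj A)" "X' \<in> lists (obj A)" "Y \<in> lists (obj A)" "Y' \<in> lists (obj A)"
    "M \<in> mhom A X Y" "N \<in> mhom A X' Y'"
  shows "block X X' Y Y' M N \<in> mhom A (X @ X') (Y @ Y')"
  unfolding mhom_iff[of _ "X @ X'"] using assms
  by (auto simp: block_def nth_append obj_nth mhom_entry intro!: zero_in)

lemma block_id: "block X X' X X' (mid A X) (mid A X') = mid A (X @ X')"
  unfolding block_def mid_def by (rule restrict_ext) (auto simp: nth_append)

lemma block_cmp:
  assumes o: "X \<in> lists (obj A)" "X' \<in> lists (obj A)" "Y \<in> lists (obj A)" "Y' \<in> lists (obj A)"
      "Z \<in> lists (obj A)" "Z' \<in> lists (obj A)"
    and m: "M \<in> mhom A X Y" "M' \<in> mhom A X' Y'" "N \<in> mhom A Y Z" "N' \<in> mhom A Y' Z'"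
  shows "mcmp A (X @ X') (Y @ Y') (Z @ Z') (block Y Y' Z Z' N N') (block X X' Y Y' M M') =
    block X X' Z Z' (mcmp A X Y Z N M) (mcmp A X' Y' Z' N' M')"
proof -
  have oo: "X @ X' \<in> lists (obj A)" "Y @ Y' \<in> lists (obj A)" "Z @ Z' \<in> lists (obj A)" using o by auto
  note b = block_in[OF o(1,2,3,4) m(1,2)] block_in[OF o(3,4,5,6) m(3,4)]
  show ?thesis
  proof (rule mhom_eqI[OF mcmp_in[OF oo b]])
    fix i k assume ik: "i < length (Z @ Z')" "k < length (X @ X')"
    define x z where "x = (X @ X') ! k" and "z = (Z @ Z') ! i"
    have xz: "x \<in> obj A" "z \<in> obj A" using obj_nth[OF oo(1) ik(2)] obj_nth[OF oo(3) ik(1)] by (simp_all add: x_def z_def)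
    define t where "t j = cmp A x ((Y @ Y') ! j) z (block Y Y' Z Z' N N' (i, j)) (block X X' Y Y' M M' (j, k))" for j
    have tin: "t j \<in> hom A x z" if "j < length (Y @ Y')" for j
      unfolding t_def x_def z_def by (intro cmp_in obj_nth oo that ik mhom_entry[OF b(1)] mhom_entry[OF b(2)])
    \<comment> \<open>The sum over the middle index is split at \<open>length Y\<close>. For given i
      and k at most one of the two halves can be nonzero.\<close>
    have L: "mcmp A (X @ X') (Y @ Y') (Z @ Z') (block Y Y' Z Z' N N') (block X X' Y Y' M M') (i, k) =
       hadd A x z (isum x z (length Y) t) (isum x z (length Y') (\<lambda>j. t (length Y + j)))"
    proof -
      have "mcmp A (X @ X') (Y @ Y') (Z @ Z') (block Y Y' Z Z' N N') (block X X' Y Y' M M') (i, k) =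
          isum x z (length Y + length Y') t"
        unfolding mcmp_entry[OF ik] x_def z_def t_def by simp
      also have "\<dots> = hadd A x z (isum x z (length Y) t) (isum x z (length Y') (\<lambda>j. t (length Y + j)))"
        by (rule isum_plus[OF xz]) (use tin in simp)
      finally show ?thesis .
    qed
    have 1: "t j = (if i < length Z \<and> k < length X then cmp A (X ! k) (Y ! j) (Z ! i) (N (i, j)) (M (j, k)) else hzero A x z)"
      if "j < length Y" for j
      using that ik o m xz unfolding t_def block_def
      by (auto simp: nth_append x_def z_def cmp_zero_left cmp_zero_right obj_nth mhom_entry zero_in)
    have 2: "t (length Y + j) = (if \<not> i < length Z \<and> \<not> k < length X then
        cmp A (X' ! (k - length X)) (Y' ! j) (Z' ! (i - length Z)) (N' (i - length Z, j)) (M' (j, k - length X)) else hzero A x z)"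
      if "j < length Y'" for j
      using that ik o m xz unfolding t_def block_def
      by (auto simp: nth_append x_def z_def cmp_zero_left cmp_zero_right obj_nth mhom_entry zero_in)
    have L1: "isum x z (length Y) t = (if i < length Z \<and> k < length X then mcmp A X Y Z N M (i, k) else hzero A x z)"
    proof (cases "i < length Z \<and> k < length X")
      case True
      then have "isum x z (length Y) t = isum x z (length Y) (\<lambda>j. cmp A (X ! k) (Y ! j) (Z ! i) (N (i, j)) (M (j, k)))"
        using 1 by (intro isum_cong) auto
      then show ?thesis using True by (simp add: mcmp_entry x_def z_def nth_append)
    next
      case False
      then have "isum x z (length Y) t = isum x z (length Y) (\<lambda>j. hzero A x z)"
        using 1 by (intro isum_cong) auto
      then show ?thesis using False xz by (auto simp: isum_zero)
    qed
    have L2: "isum x z (length Y') (\<lambda>j. t (length Y + j)) = (if \<not> i < length Z \<and> \<not> k < length X then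
        mcmp A X' Y' Z' N' M' (i - length Z, k - length X) else hzero A x z)"
    proof (cases "\<not> i < length Z \<and> \<not> k < length X")
      case True
      then have "isum x z (length Y') (\<lambda>j. t (length Y + j)) = isum x z (length Y') (\<lambda>j.
          cmp A (X' ! (k - length X)) (Y' ! j) (Z' ! (i - length Z)) (N' (i - length Z, j)) (M' (j, k - length X)))"
        using 2 by (intro isum_cong) auto
      moreover have "i - length Z < length Z'" "k - length X < length X'" using True ik by auto
      ultimately show ?thesis using True by (simp add: mcmp_entry x_def z_def nth_append)
    next
      case False
      then have "isum x z (length Y') (\<lambda>j. t (length Y + j)) = isum x z (length Y') (\<lambda>j. hzero A x z)"
        using 2 by (intro isum_cong) auto
      then show ?thesis using False xz by (auto simp: isum_zero)
    qed
    have m1: "mcmp A X Y Z N M (i, k) \<in> hom A x z" if "i < length Z" "k < length X"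
      using mhom_entry[OF mcmp_in[OF o(1,3,5) m(1,3)] that] that by (simp add: x_def z_def nth_append)
    have m2: "mcmp A X' Y' Z' N' M' (i - length Z, k - length X) \<in> hom A x z" if "\<not> i < length Z" "\<not> k < length X"
      using mhom_entry[OF mcmp_in[OF o(2,4,6) m(2,4)], of "i - length Z" "k - length X"] that ik
      by (simp add: x_def z_def nth_append)
    show "mcmp A (X @ X') (Y @ Y') (Z @ Z') (block Y Y' Z Z' N N') (block X X' Y Y' M M') (i, k) =
      block X X' Z Z' (mcmp A X Y Z N M) (mcmp A X' Y' Z' N' M') (i, k)"
      unfolding L L1 L2 using ik m1 m2 xz
      by (auto simp: block_def add_zero add_zero_left zero_in x_def[symmetric] z_def[symmetric])
  next
    show "block X X' Z Z' (mcmp A X Y Z N M) (mcmp A X' Y' Z' N' M') \<in> mhom A (X @ X') (Z @ Z')"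
      by (intro block_in mcmp_in o) (use m o in auto)
  qed
qed

lemma isomorphic_append:
  assumes o: "X \<in> lists (obj A)" "X' \<in> lists (obj A)" "Y \<in> lists (obj A)" "Y' \<in> lists (obj A)"
    and i: "isomorphic (mat_cat A) X Y" "isomorphic (mat_cat A) X' Y'"
  shows "isomorphic (mat_cat A) (X @ X') (Y @ Y')"
proof -
  from i(1) obtain f g where fg: "f \<in> mhom A X Y" "g \<in> mhom A Y X"
    "mcmp A X Y X g f = mid A X" "mcmp A Y X Y f g = mid A Y"
    by (rule isomorphicE) (simp add: mat_cat_def)
  from i(2) obtain f' g' where fg': "f' \<in> mhom A X' Y'" "g' \<in> mhom A Y' X'"
    "mcmp A X' Y' X' g' f' = mid A X'" "mcmp A Y' X' Y' f' g' = mid A Y'"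
    by (rule isomorphicE) (simp add: mat_cat_def)
  show ?thesis
    by (rule isomorphicI[of "block X X' Y Y' f f'" _ _ _ "block Y Y' X X' g g'"])
      (use o fg fg' in \<open>simp_all add: mat_cat_def block_in block_cmp block_id\<close>)
qed

text \<open>Isomorphisms may be applied summand by summand, so essential surjectivity has to be
  shown for single summands only.\<close>

lemma isomorphic_concat:
  assumes "\<And>x. x \<in> set X \<Longrightarrow> x \<in> obj A \<and> f x \<in> lists (obj A) \<and> isomorphic (mat_cat A) [x] (f x)"
  shows "isomorphic (mat_cat A) X (concat (map f X))"
  using assms
proof (induction X)
  case Nil
  then show ?case using isomorphic_refl[OF is_category_mat_cat, of "[]"] by (simp add: mat_cat_def)
next
  case (Cons x X)
  have "isomorphic (mat_cat A) ([x] @ X) (f x @ concat (map f X))"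
  proof (rule isomorphic_append)
    show "concat (map f X) \<in> lists (obj A)" "X \<in> lists (obj A)" "[x] \<in> lists (obj A)" "f x \<in> lists (obj A)"
      using Cons.prems by (fastforce simp: in_lists_conv_set)+
  qed (use Cons in auto)
  then show ?case by simp
qed

text \<open>The characterisation of a biproduct by maps: the projections \<open>f i\<close> form a
  column, the inclusions \<open>g i\<close> a row, and the hypotheses say that the two are inverse
  matrices.\<close>

lemma isomorphic_splitI:
  assumes o: "x \<in> obj A" "Y \<in> lists (obj A)"
    and f: "\<And>i. i < length Y \<Longrightarrow> f i \<in> hom A x (Y ! i)"
    and g: "\<And>i. i < length Y \<Longrightarrow> g i \<in> hom A (Y ! i) x"
    and fg: "\<And>i j. i < length Y \<Longrightarrow> j < length Y \<Longrightarrow>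
      cmp A (Y ! j) x (Y ! i) (f i) (g j) = (if i = j then idt A (Y ! i) else hzero A (Y ! j) (Y ! i))"
    and gf: "hsum A x x (map (\<lambda>i. cmp A x (Y ! i) x (g i) (f i)) [0..<length Y]) = idt A x"
  shows "isomorphic (mat_cat A) [x] Y"
proof -
  let ?f = "\<lambda>(i, j) \<in> {..<length Y} \<times> {..<length [x]}. f i"
  let ?g = "\<lambda>(i, j) \<in> {..<length [x]} \<times> {..<length Y}. g j"
  have x: "[x] \<in> lists (obj A)" using o by simp
  have fi: "?f \<in> mhom A [x] Y" and gi: "?g \<in> mhom A Y [x]" using f g by (auto simp: mhom_iff)
  have "mcmp A [x] Y [x] ?g ?f = mid A [x]"
  proof (rule mhom_eqI)
    fix i j assume "i < length [x]" "j < length [x]"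
    then have "mcmp A [x] Y [x] ?g ?f (i, j) = isum x x (length Y) (\<lambda>i. cmp A x (Y ! i) x (g i) (f i))"
      by (subst mcmp_entry) (auto intro!: isum_cong)
    then show "mcmp A [x] Y [x] ?g ?f (i, j) = mid A [x] (i, j)"
      using \<open>i < length [x]\<close> \<open>j < length [x]\<close> by (simp add: mid_entry isum_def gf)
  qed (use x o fi gi mcmp_in mid_in in auto)
  moreover have "mcmp A Y [x] Y ?f ?g = mid A Y"
  proof (rule mhom_eqI)
    fix i j assume "i < length Y" "j < length Y"
    then show "mcmp A Y [x] Y ?f ?g (i, j) = mid A Y (i, j)"
      using fg[of i j] o by (cases "i = j") (simp_all add: mcmp_entry mid_entry isum_1 obj_nth idt_in zero_in)
  qed (use x o fi gi mcmp_in mid_in in auto)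
  ultimately show ?thesis
    using fi gi by (intro isomorphicI[of ?f _ _ _ ?g]) (simp_all add: mat_cat_def)
qed

end

section \<open>Trace classes\<close>

lemma lookup_fscale: "Poly_Mapping.lookup (fscale z v) k = z * Poly_Mapping.lookup v k"
  by (simp add: fscale_def map.rep_eq when_def)

interpretation formal: module fscale
  by unfold_locales
    (auto intro!: poly_mapping_eqI simp: lookup_fscale lookup_add algebra_simps)

lemma fspan_eq: "fspan S = formal.span S"
  by (simp add: fspan_def)

lemma fscale_single: "fscale z (Poly_Mapping.single k w) = Poly_Mapping.single k (z * w)"
  by (auto intro!: poly_mapping_eqI simp: lookup_fscale lookup_single when_def)

text \<open>\<open>bilin\<close> sums over the supports of its arguments, which change under
  addition. Enlarging the index sets adds only terms with coefficient zero, and over a common index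
  set linearity is visible.\<close>

lemma bilin_superset:
  assumes S: "finite S" "Poly_Mapping.keys v \<subseteq> S" and T: "finite T" "Poly_Mapping.keys u \<subseteq> T"
  shows "bilin b v u = (\<Sum>x\<in>S. \<Sum>y\<in>T. Poly_Mapping.single (b (fst x) (snd x) (fst y) (snd y))
    (Poly_Mapping.lookup v x * Poly_Mapping.lookup u y))"
proof -
  let ?h = "\<lambda>x y. Poly_Mapping.single (b (fst x) (snd x) (fst y) (snd y))
    (Poly_Mapping.lookup v x * Poly_Mapping.lookup u y)"
  have "bilin b v u = (\<Sum>x\<in>Poly_Mapping.keys v. \<Sum>y\<in>Poly_Mapping.keys u. ?h x y)"
    by (simp add: bilin_def case_prod_beta)
  also have "\<dots> = (\<Sum>x\<in>Poly_Mapping.keys v. \<Sum>y\<in>T. ?h x y)"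
    by (intro sum.cong refl sum.mono_neutral_left T) (auto simp: in_keys_iff)
  also have "\<dots> = (\<Sum>x\<in>S. \<Sum>y\<in>T. ?h x y)"
    by (intro sum.mono_neutral_left S) (auto simp: in_keys_iff)
  finally show ?thesis .
qed

lemma bilin_add_left: "bilin b (v + v') u = bilin b v u + bilin b v' u"
proof -
  let ?S = "Poly_Mapping.keys v \<union> Poly_Mapping.keys v' \<union> Poly_Mapping.keys (v + v')"
  have e: "bilin b w u = (\<Sum>x\<in>?S. \<Sum>y\<in>Poly_Mapping.keys u. Poly_Mapping.single (b (fst x) (snd x) (fst y) (snd y))
    (Poly_Mapping.lookup w x * Poly_Mapping.lookup u y))"
    if "Poly_Mapping.keys w \<subseteq> ?S" for w
    by (rule bilin_superset) (use that in auto)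
  have *: "Poly_Mapping.keys v \<subseteq> ?S" "Poly_Mapping.keys v' \<subseteq> ?S" "Poly_Mapping.keys (v + v') \<subseteq> ?S"
    by blast+
  show ?thesis
    unfolding e[OF *(1)] e[OF *(2)] e[OF *(3)]
    by (simp add: lookup_add distrib_right single_add sum.distrib)
qed

lemma bilin_add_right: "bilin b v (u + u') = bilin b v u + bilin b v u'"
proof -
  let ?S = "Poly_Mapping.keys u \<union> Poly_Mapping.keys u' \<union> Poly_Mapping.keys (u + u')"
  have e: "bilin b v w = (\<Sum>x\<in>Poly_Mapping.keys v. \<Sum>y\<in>?S. Poly_Mapping.single (b (fst x) (snd x) (fst y) (snd y))
    (Poly_Mapping.lookup v x * Poly_Mapping.lookup w y))"
    if "Poly_Mapping.keys w \<subseteq> ?S" for w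
    by (rule bilin_superset) (use that in auto)
  have *: "Poly_Mapping.keys u \<subseteq> ?S" "Poly_Mapping.keys u' \<subseteq> ?S" "Poly_Mapping.keys (u + u') \<subseteq> ?S"
    by blast+
  show ?thesis
    unfolding e[OF *(1)] e[OF *(2)] e[OF *(3)]
    by (simp add: lookup_add distrib_left single_add sum.distrib)
qed

lemma fscale_sum: "fscale z (sum f S) = (\<Sum>x\<in>S. fscale z (f x))"
  by (rule formal.scale_sum_right)

lemma bilin_scale_left: "bilin b (fscale z v) u = fscale z (bilin b v u)"
proof -
  let ?S = "Poly_Mapping.keys v \<union> Poly_Mapping.keys (fscale z v)"
  have e: "bilin b w u = (\<Sum>x\<in>?S. \<Sum>y\<in>Poly_Mapping.keys u. Poly_Mapping.single (b (fst x) (snd x) (fst y) (snd y))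
    (Poly_Mapping.lookup w x * Poly_Mapping.lookup u y))"
    if "Poly_Mapping.keys w \<subseteq> ?S" for w
    by (rule bilin_superset) (use that in auto)
  have *: "Poly_Mapping.keys v \<subseteq> ?S" "Poly_Mapping.keys (fscale z v) \<subseteq> ?S"
    by blast+
  show ?thesis
    unfolding e[OF *(1)] e[OF *(2)]
    by (simp add: fscale_sum lookup_fscale fscale_single mult.assoc)
qed

lemma bilin_scale_right: "bilin b v (fscale z u) = fscale z (bilin b v u)"
proof -
  let ?S = "Poly_Mapping.keys u \<union> Poly_Mapping.keys (fscale z u)"
  have e: "bilin b v w = (\<Sum>x\<in>Poly_Mapping.keys v. \<Sum>y\<in>?S. Poly_Mapping.single (b (fst x) (snd x) (fst y) (snd y))
    (Poly_Mapping.lookup v x * Poly_Mapping.lookup w y))"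
    if "Poly_Mapping.keys w \<subseteq> ?S" for w
    by (rule bilin_superset) (use that in auto)
  have *: "Poly_Mapping.keys u \<subseteq> ?S" "Poly_Mapping.keys (fscale z u) \<subseteq> ?S"
    by blast+
  show ?thesis
    unfolding e[OF *(1)] e[OF *(2)]
    by (simp add: fscale_sum lookup_fscale fscale_single mult.left_commute)
qed

lemma bilin_zero_left [simp]: "bilin b 0 u = 0" by (simp add: bilin_def)
lemma bilin_zero_right [simp]: "bilin b v 0 = 0" by (simp add: bilin_def)

lemma bilin_diff_left: "bilin b (v - v') u = bilin b v u - bilin b v' u"
  using bilin_add_left[of b "v - v'" v' u] by (simp add: algebra_simps)

lemma bilin_diff_right: "bilin b v (u - u') = bilin b v u - bilin b v u'"
  using bilin_add_right[of b v "u - u'" u'] by (simp add: algebra_simps)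

lemma bilin_pair: "bilin b (pair r \<rho>) (pair p \<sigma>) = Poly_Mapping.single (b r \<rho> p \<sigma>) 1"
  by (simp add: bilin_def)

text \<open>By linearity in each variable it is enough to look at generators. In this way relations
  are seen to form an ideal and degrees to add up.\<close>

lemma bilin_span_in:
  assumes "v \<in> fspan S" "u \<in> fspan T"
    and "\<And>v u. v \<in> S \<Longrightarrow> u \<in> T \<Longrightarrow> bilin b v u \<in> fspan N"
  shows "bilin b v u \<in> fspan N"
proof -
  have 1: "bilin b v u \<in> fspan N" if "v \<in> S" "u \<in> fspan T" for v u
    using that(2) unfolding fspan_eq
    by (induction rule: formal.span_induct_alt)
      (use assms(3) that(1) in \<open>auto simp: fspan_eq bilin_add_right bilin_scale_right
        intro: formal.span_zero formal.span_add formal.span_scale\<close>)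
  show ?thesis
    using assms(1) unfolding fspan_eq
    by (induction rule: formal.span_induct_alt)
      (use 1 assms(2) in \<open>auto simp: fspan_eq bilin_add_left bilin_scale_left
        intro: formal.span_zero formal.span_add formal.span_scale\<close>)
qed

lemma coset_eq_iff: "coset (fspan G) v = coset (fspan G) w \<longleftrightarrow> v - w \<in> fspan G"
proof
  assume "coset (fspan G) v = coset (fspan G) w"
  moreover have "v \<in> coset (fspan G) v" by (simp add: coset_def fspan_eq formal.span_zero)
  ultimately show "v - w \<in> fspan G" by (simp add: coset_def)
next
  assume vw: "v - w \<in> fspan G"
  show "coset (fspan G) v = coset (fspan G) w"
    unfolding coset_def
  proof (intro Collect_cong iffI)
    fix x assume "x - v \<in> fspan G"
    then have "(x - v) + (v - w) \<in> fspan G" using vw unfolding fspan_eq by (rule formal.span_add)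
    then show "x - w \<in> fspan G" by simp
  next
    fix x assume "x - w \<in> fspan G"
    then have "(x - w) - (v - w) \<in> fspan G" using vw unfolding fspan_eq by (rule formal.span_diff)
    then show "x - v \<in> fspan G" by simp
  qed
qed

lemma coset_add_coset: "coset_add (fspan G) (coset (fspan G) v) (coset (fspan G) u) = coset (fspan G) (v + u)"
proof -
  have "coset (fspan G) (v' + u') = coset (fspan G) (v + u)"
    if "v' \<in> coset (fspan G) v" "u' \<in> coset (fspan G) u" for v' u'
  proof -
    have "(v' - v) + (u' - u) \<in> fspan G"
      using that unfolding coset_def fspan_eq by (auto intro: formal.span_add)
    then show ?thesis by (simp add: coset_eq_iff algebra_simps)
  qed
  moreover have "v \<in> coset (fspan G) v" "u \<in> coset (fspan G) u"
    by (auto simp: coset_def fspan_eq formal.span_zero)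
  ultimately show ?thesis unfolding coset_add_def by blast
qed

text \<open>The composite of cosets is a union over all representatives. It is a single coset
  because v' u' - v u = (v' - v) u + v' (u' - u) and both terms are null. The inclusion of
  \<open>N1\<close> in the span keeps the changed representative v' admissible for the second
  term.\<close>

lemma coset_comp_coset:
  assumes v: "v \<in> fspan S" and u: "u \<in> fspan T" and S: "N1 \<subseteq> fspan S"
    and 1: "\<And>n u. n \<in> N1 \<Longrightarrow> u \<in> fspan T \<Longrightarrow> bilin b n u \<in> fspan G"
    and 2: "\<And>v n. v \<in> fspan S \<Longrightarrow> n \<in> N2 \<Longrightarrow> bilin b v n \<in> fspan G"
    and N1: "0 \<in> N1" and N2: "0 \<in> N2"
  shows "coset_comp (fspan G) b (coset N1 v) (coset N2 u) = coset (fspan G) (bilin b v u)"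
proof -
  have "coset (fspan G) (bilin b v' u') = coset (fspan G) (bilin b v u)"
    if "v' \<in> coset N1 v" "u' \<in> coset N2 u" for v' u'
  proof -
    have v': "v' - v \<in> N1" "v' \<in> fspan S" and u': "u' - u \<in> N2"
      using that v S formal.span_add[of v S "v' - v"] unfolding coset_def fspan_eq by auto
    have "bilin b (v' - v) u + bilin b v' (u' - u) \<in> fspan G"
      using 1[OF v'(1) u] 2[OF v'(2) u'] unfolding fspan_eq by (rule formal.span_add)
    then show ?thesis by (simp add: coset_eq_iff bilin_diff_left bilin_diff_right)
  qed
  moreover have "v \<in> coset N1 v" "u \<in> coset N2 u" using N1 N2 by (auto simp: coset_def)
  ultimately show ?thesis unfolding coset_comp_def by blast
qed

lemma bilin_cong:
  assumes "v \<in> fspan {pair p \<sigma> | p \<sigma>. P p \<sigma>}" "u \<in> fspan {pair p \<sigma> | p \<sigma>. Q p \<sigma>}"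
    and "\<And>r \<rho> p \<sigma>. P r \<rho> \<Longrightarrow> Q p \<sigma> \<Longrightarrow> b r \<rho> p \<sigma> = b' r \<rho> p \<sigma>"
  shows "bilin b v u = bilin b' v u"
proof -
  have 1: "bilin b (pair r \<rho>) u = bilin b' (pair r \<rho>) u" if "P r \<rho>" for r \<rho>
    using assms(2) unfolding fspan_eq
    by (induction rule: formal.span_induct_alt)
      (use assms(3) that in \<open>auto simp: bilin_add_right bilin_scale_right bilin_pair\<close>)
  show ?thesis
    using assms(1) unfolding fspan_eq
    by (induction rule: formal.span_induct_alt)
      (use 1 in \<open>auto simp: bilin_add_left bilin_scale_left\<close>)
qed

section \<open>Strict graded linear 2-categories\<close>

text \<open>The notation lives in a locale without assumptions so that the axioms of
  \<open>gl2\<close> can be phrased with \<open>ar\<close>, \<open>H\<close> and \<open>HD\<close>.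
  The parameter \<open>Z\<close> supplies the zero 2-morphisms, for which the record has no
  field.\<close>

locale gl2_data =
  fixes D :: "('o, 'p, 'm) gl2cat" and Z :: "'p \<Rightarrow> 'p \<Rightarrow> 'm"
begin

abbreviation comp (infixr "**" 75) where "r ** p \<equiv> comp1 D r p"
abbreviation "idm \<equiv> id2 D"
abbreviation "U \<equiv> unit1 D"
abbreviation "lw \<equiv> lwhisker D"
abbreviation "rw \<equiv> rwhisker D"
abbreviation "vc \<equiv> vcomp D"

definition ar :: "'o \<Rightarrow> 'o \<Rightarrow> 'p \<Rightarrow> bool" where
  "ar c d p \<longleftrightarrow> c \<in> obj2 D \<and> d \<in> obj2 D \<and> p \<in> one D c d"

text \<open>The typing predicate includes the typing of both 1-morphisms and of their end objects,
  so that one premise carries all side conditions of a law.\<close>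

definition H :: "'o \<Rightarrow> 'o \<Rightarrow> 'p \<Rightarrow> 'p \<Rightarrow> 'm \<Rightarrow> bool" where
  "H c d p q \<sigma> \<longleftrightarrow> ar c d p \<and> ar c d q \<and> \<sigma> \<in> two D p q"

definition HD :: "'o \<Rightarrow> 'o \<Rightarrow> 'p \<Rightarrow> 'p \<Rightarrow> int \<Rightarrow> 'm \<Rightarrow> bool" where
  "HD c d p q k \<sigma> \<longleftrightarrow> ar c d p \<and> ar c d q \<and> \<sigma> \<in> two_deg D p q k"

end

text \<open>A strict graded linear 2-category, with every law relative to types. The law for the
  scalar 0 ties \<open>Z\<close> to the linear structure.\<close>

locale gl2 = gl2_data D Z for D :: "('o, 'p, 'm) gl2cat" and Z +
  assumes unit_in: "c \<in> obj2 D \<Longrightarrow> U c \<in> one D c c"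
    and ar_comp: "\<lbrakk>ar c d p; ar d e r\<rbrakk> \<Longrightarrow> ar c e (r ** p)"
    and ar_assoc: "\<lbrakk>ar c d p; ar d e r; ar e e' t\<rbrakk> \<Longrightarrow> (t ** r) ** p = t ** r ** p"
    and ar_unit_left: "ar c d p \<Longrightarrow> U d ** p = p"
    and ar_unit_right: "ar c d p \<Longrightarrow> p ** U c = p"
    and HD_H: "HD c d p q k \<sigma> \<Longrightarrow> H c d p q \<sigma>"
    and HD_id: "ar c d p \<Longrightarrow> HD c d p p 0 (idm p)"
    and H_vc: "\<lbrakk>H c d p q \<sigma>; H c d q r \<rho>\<rbrakk> \<Longrightarrow> H c d p r (vc p q r \<rho> \<sigma>)"
    and HD_vc: "\<lbrakk>HD c d p q k \<sigma>; HD c d q r l \<rho>\<rbrakk> \<Longrightarrow> HD c d p r (l + k) (vc p q r \<rho> \<sigma>)"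
    and H_hcomp: "\<lbrakk>H c d p p' \<sigma>; H d e r r' \<rho>\<rbrakk> \<Longrightarrow> H c e (r ** p) (r' ** p') (hcomp D r r' p p' \<rho> \<sigma>)"
    and HD_hcomp: "\<lbrakk>HD c d p p' k \<sigma>; HD d e r r' l \<rho>\<rbrakk> \<Longrightarrow>
      HD c e (r ** p) (r' ** p') (l + k) (hcomp D r r' p p' \<rho> \<sigma>)"
    and vc_assoc: "\<lbrakk>H c d p q \<sigma>; H c d q r \<rho>; H c d r s \<theta>\<rbrakk> \<Longrightarrow>
      vc p q s (vc q r s \<theta> \<rho>) \<sigma> = vc p r s \<theta> (vc p q r \<rho> \<sigma>)"
    and vc_id_left: "H c d p q \<sigma> \<Longrightarrow> vc p q q (idm q) \<sigma> = \<sigma>"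
    and vc_id_right: "H c d p q \<sigma> \<Longrightarrow> vc p p q \<sigma> (idm p) = \<sigma>"
    and hcomp_id: "\<lbrakk>ar c d p; ar d e r\<rbrakk> \<Longrightarrow> hcomp D r r p p (idm r) (idm p) = idm (r ** p)"
    and vc_hcomp: "\<lbrakk>H c d p p' \<sigma>; H c d p' p'' \<sigma>'; H d e r r' \<rho>; H d e r' r'' \<rho>'\<rbrakk> \<Longrightarrow>
      vc (r ** p) (r' ** p') (r'' ** p'') (hcomp D r' r'' p' p'' \<rho>' \<sigma>') (hcomp D r r' p p' \<rho> \<sigma>) =
      hcomp D r r'' p p'' (vc r r' r'' \<rho>' \<rho>) (vc p p' p'' \<sigma>' \<sigma>)"
    and hc_assoc: "\<lbrakk>H c d p p' \<sigma>; H d e r r' \<rho>; H e e' t t' \<theta>\<rbrakk> \<Longrightarrow>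
      hcomp D (t ** r) (t' ** r') p p' (hcomp D t t' r r' \<theta> \<rho>) \<sigma> =
      hcomp D t t' (r ** p) (r' ** p') \<theta> (hcomp D r r' p p' \<rho> \<sigma>)"
    and hcomp_unit_left: "H c d p q \<sigma> \<Longrightarrow> hcomp D (U d) (U d) p q (idm (U d)) \<sigma> = \<sigma>"
    and hcomp_unit_right: "H c d p q \<sigma> \<Longrightarrow> hcomp D p q (U c) (U c) \<sigma> (idm (U c)) = \<sigma>"
    and H_add: "\<lbrakk>H c d p q \<sigma>; H c d p q \<rho>\<rbrakk> \<Longrightarrow> H c d p q (add2 D p q \<sigma> \<rho>)"
    and H_scale: "H c d p q \<sigma> \<Longrightarrow> H c d p q (scale2 D p q z \<sigma>)"
    and HD_zero: "\<lbrakk>ar c d p; ar c d q\<rbrakk> \<Longrightarrow> HD c d p q k (Z p q)"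
    and scale_zero: "H c d p q \<sigma> \<Longrightarrow> scale2 D p q 0 \<sigma> = Z p q"
    and vc_add_left: "\<lbrakk>H c d p q \<sigma>; H c d q r \<rho>; H c d q r \<rho>'\<rbrakk> \<Longrightarrow>
      vc p q r (add2 D q r \<rho> \<rho>') \<sigma> = add2 D p r (vc p q r \<rho> \<sigma>) (vc p q r \<rho>' \<sigma>)"
    and vc_add_right: "\<lbrakk>H c d p q \<sigma>; H c d p q \<sigma>'; H c d q r \<rho>\<rbrakk> \<Longrightarrow>
      vc p q r \<rho> (add2 D p q \<sigma> \<sigma>') = add2 D p r (vc p q r \<rho> \<sigma>) (vc p q r \<rho> \<sigma>')"
    and vc_scale_left: "\<lbrakk>H c d p q \<sigma>; H c d q r \<rho>\<rbrakk> \<Longrightarrow>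
      vc p q r (scale2 D q r z \<rho>) \<sigma> = scale2 D p r z (vc p q r \<rho> \<sigma>)"
    and vc_scale_right: "\<lbrakk>H c d p q \<sigma>; H c d q r \<rho>\<rbrakk> \<Longrightarrow>
      vc p q r \<rho> (scale2 D p q z \<sigma>) = scale2 D p r z (vc p q r \<rho> \<sigma>)"
    and hcomp_add_left: "\<lbrakk>H c d p p' \<sigma>; H d e r r' \<rho>; H d e r r' \<rho>'\<rbrakk> \<Longrightarrow> hcomp D r r' p p' (add2 D r r' \<rho> \<rho>') \<sigma> =
      add2 D (r ** p) (r' ** p') (hcomp D r r' p p' \<rho> \<sigma>) (hcomp D r r' p p' \<rho>' \<sigma>)"
    and hcomp_add_right: "\<lbrakk>H c d p p' \<sigma>; H c d p p' \<sigma>'; H d e r r' \<rho>\<rbrakk> \<Longrightarrow> hcomp D r r' p p' \<rho> (add2 D p p' \<sigma> \<sigma>') =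
      add2 D (r ** p) (r' ** p') (hcomp D r r' p p' \<rho> \<sigma>) (hcomp D r r' p p' \<rho> \<sigma>')"
    and hcomp_scale_left: "\<lbrakk>H c d p p' \<sigma>; H d e r r' \<rho>\<rbrakk> \<Longrightarrow>
      hcomp D r r' p p' (scale2 D r r' z \<rho>) \<sigma> = scale2 D (r ** p) (r' ** p') z (hcomp D r r' p p' \<rho> \<sigma>)"
    and hcomp_scale_right: "\<lbrakk>H c d p p' \<sigma>; H d e r r' \<rho>\<rbrakk> \<Longrightarrow>
      hcomp D r r' p p' \<rho> (scale2 D p p' z \<sigma>) = scale2 D (r ** p) (r' ** p') z (hcomp D r r' p p' \<rho> \<sigma>)"
begin

lemma ar_unit: "c \<in> obj2 D \<Longrightarrow> ar c c (U c)" by (simp add: ar_def unit_in)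
lemma H_id: "ar c d p \<Longrightarrow> H c d p p (idm p)" by (rule HD_H[OF HD_id])
lemma H_ar: "H c d p q \<sigma> \<Longrightarrow> ar c d p" "H c d p q \<sigma> \<Longrightarrow> ar c d q" by (auto simp: H_def)

lemma HD_lw: "HD c d p q k \<sigma> \<Longrightarrow> ar d e r \<Longrightarrow> HD c e (r ** p) (r ** q) k (lw r p q \<sigma>)"
  using HD_hcomp[OF _ HD_id] unfolding lwhisker_def by fastforce
lemma HD_rw: "HD d e p q k \<sigma> \<Longrightarrow> ar c d r \<Longrightarrow> HD c e (p ** r) (q ** r) k (rw p q r \<sigma>)"
  using HD_hcomp[OF HD_id] unfolding rwhisker_def by fastforce
lemma H_lw: "H c d p q \<sigma> \<Longrightarrow> ar d e r \<Longrightarrow> H c e (r ** p) (r ** q) (lw r p q \<sigma>)"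
  using H_hcomp[OF _ H_id] unfolding lwhisker_def by fastforce
lemma H_rw: "H d e p q \<sigma> \<Longrightarrow> ar c d r \<Longrightarrow> H c e (p ** r) (q ** r) (rw p q r \<sigma>)"
  using H_hcomp[OF H_id] unfolding rwhisker_def by fastforce

lemma lw_vc: "\<lbrakk>H c d p q \<sigma>; H c d q s \<rho>; ar d e r\<rbrakk> \<Longrightarrow>
    lw r p s (vc p q s \<rho> \<sigma>) = vc (r ** p) (r ** q) (r ** s) (lw r q s \<rho>) (lw r p q \<sigma>)"
  unfolding lwhisker_def by (subst vc_hcomp) (auto intro: H_id simp: vc_id_left[OF H_id])
lemma rw_vc: "\<lbrakk>H d e p q \<sigma>; H d e q s \<rho>; ar c d r\<rbrakk> \<Longrightarrow>
    rw p s r (vc p q s \<rho> \<sigma>) = vc (p ** r) (q ** r) (s ** r) (rw q s r \<rho>) (rw p q r \<sigma>)"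
  unfolding rwhisker_def by (subst vc_hcomp) (auto intro: H_id simp: vc_id_left[OF H_id])

lemma lw_id: "ar c d p \<Longrightarrow> ar d e r \<Longrightarrow> lw r p p (idm p) = idm (r ** p)"
  unfolding lwhisker_def by (rule hcomp_id)
lemma rw_id: "ar d e p \<Longrightarrow> ar c d r \<Longrightarrow> rw p p r (idm p) = idm (p ** r)"
  unfolding rwhisker_def by (rule hcomp_id)
lemma lw_unit: "H c d p q \<sigma> \<Longrightarrow> lw (U d) p q \<sigma> = \<sigma>"
  unfolding lwhisker_def by (rule hcomp_unit_left)
lemma rw_unit: "H c d p q \<sigma> \<Longrightarrow> rw p q (U c) \<sigma> = \<sigma>"
  unfolding rwhisker_def by (rule hcomp_unit_right)

lemma lw_lw: "\<lbrakk>H c d p q \<sigma>; ar d e r; ar e e' t\<rbrakk> \<Longrightarrow>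
    lw t (r ** p) (r ** q) (lw r p q \<sigma>) = lw (t ** r) p q \<sigma>"
  unfolding lwhisker_def
  by (subst hc_assoc[symmetric]) (auto intro: H_id simp: lw_id[unfolded lwhisker_def])
lemma rw_rw: "\<lbrakk>H d e p q \<sigma>; ar c d r; ar c' c t\<rbrakk> \<Longrightarrow>
    rw (p ** r) (q ** r) t (rw p q r \<sigma>) = rw p q (r ** t) \<sigma>"
  unfolding rwhisker_def
  by (subst hc_assoc) (auto intro: H_id simp: rw_id[unfolded rwhisker_def])
lemma lw_rw: "\<lbrakk>H c d p q \<sigma>; ar c' c f; ar d e t\<rbrakk> \<Longrightarrow>
    lw t (p ** f) (q ** f) (rw p q f \<sigma>) = rw (t ** p) (t ** q) f (lw t p q \<sigma>)"
  unfolding rwhisker_def lwhisker_def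
  by (rule hc_assoc[symmetric]) (auto intro: H_id)

text \<open>\<open>exch1\<close> and \<open>exch2\<close> resolve a horizontal composite into
  whiskerings in the two possible orders. Together they say that two 2-morphisms lying side by side
  may slide past each other.\<close>

lemma exch1: "H c d p p' \<sigma> \<Longrightarrow> H d e r r' \<rho> \<Longrightarrow>
    vc (r ** p) (r' ** p) (r' ** p') (lw r' p p' \<sigma>) (rw r r' p \<rho>) = hcomp D r r' p p' \<rho> \<sigma>"
  unfolding rwhisker_def lwhisker_def
  by (subst vc_hcomp) (auto intro: H_id H_ar simp: vc_id_left vc_id_right)
lemma exch2: "H c d p p' \<sigma> \<Longrightarrow> H d e r r' \<rho> \<Longrightarrow>
    vc (r ** p) (r ** p') (r' ** p') (rw r r' p' \<rho>) (lw r p p' \<sigma>) = hcomp D r r' p p' \<rho> \<sigma>"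
  unfolding rwhisker_def lwhisker_def
  by (subst vc_hcomp) (auto intro: H_id H_ar simp: vc_id_left vc_id_right)

lemma H_zero: "ar c d p \<Longrightarrow> ar c d q \<Longrightarrow> H c d p q (Z p q)"
  using HD_H HD_zero by blast
lemma lw_add: "\<lbrakk>H c d p q \<sigma>; H c d p q \<sigma>'; ar d e r\<rbrakk> \<Longrightarrow>
    lw r p q (add2 D p q \<sigma> \<sigma>') = add2 D (r ** p) (r ** q) (lw r p q \<sigma>) (lw r p q \<sigma>')"
  unfolding lwhisker_def by (rule hcomp_add_right) (auto intro: H_id)
lemma lw_scale: "H c d p q \<sigma> \<Longrightarrow> ar d e r \<Longrightarrow>
    lw r p q (scale2 D p q z \<sigma>) = scale2 D (r ** p) (r ** q) z (lw r p q \<sigma>)"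
  unfolding lwhisker_def by (rule hcomp_scale_right) (auto intro: H_id)
lemma rw_add: "\<lbrakk>H d e p q \<sigma>; H d e p q \<sigma>'; ar c d r\<rbrakk> \<Longrightarrow>
    rw p q r (add2 D p q \<sigma> \<sigma>') = add2 D (p ** r) (q ** r) (rw p q r \<sigma>) (rw p q r \<sigma>')"
  unfolding rwhisker_def by (rule hcomp_add_left) (auto intro: H_id)
lemma rw_scale: "H d e p q \<sigma> \<Longrightarrow> ar c d r \<Longrightarrow>
    rw p q r (scale2 D p q z \<sigma>) = scale2 D (p ** r) (q ** r) z (rw p q r \<sigma>)"
  unfolding rwhisker_def by (rule hcomp_scale_left) (auto intro: H_id)

text \<open>A zero 2-morphism is 0 times itself, so its behaviour under whiskering follows from
  homogeneity.\<close>

lemma lw_zero: "\<lbrakk>ar c d p; ar c d q; ar d e r\<rbrakk> \<Longrightarrow> lw r p q (Z p q) = Z (r ** p) (r ** q)"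
  using lw_scale[OF H_zero, of c d p q e r 0] scale_zero[OF H_zero, of c d p q]
    scale_zero[OF H_lw[OF H_zero], of c d p q e r] by simp
lemma rw_zero: "\<lbrakk>ar d e p; ar d e q; ar c d r\<rbrakk> \<Longrightarrow> rw p q r (Z p q) = Z (p ** r) (q ** r)"
  using rw_scale[OF H_zero, of d e p q c r 0] scale_zero[OF H_zero, of d e p q]
    scale_zero[OF H_rw[OF H_zero], of d e p q c r] by simp

end

text \<open>Associativity of formal sums follows from associativity of pairs. There are four
  composition rules because each depends on the end objects of its factors; \<open>FFE_incl\<close>
  is here a variable for the rule that composes w and v.\<close>

lemma bilin_assoc:
  assumes "w \<in> fspan {pair p \<sigma> | p \<sigma>. P p \<sigma>}" "v \<in> fspan {pair p \<sigma> | p \<sigma>. Q p \<sigma>}"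
    "u \<in> fspan {pair p \<sigma> | p \<sigma>. R p \<sigma>}"
    and b: "\<And>t \<theta> r \<rho> p \<sigma>. P t \<theta> \<Longrightarrow> Q r \<rho> \<Longrightarrow> R p \<sigma> \<Longrightarrow>
      b1 t \<theta> (fst (b2 r \<rho> p \<sigma>)) (snd (b2 r \<rho> p \<sigma>)) = b3 (fst (FFE_incl t \<theta> r \<rho>)) (snd (FFE_incl t \<theta> r \<rho>)) p \<sigma>"
  shows "bilin b1 w (bilin b2 v u) = bilin b3 (bilin FFE_incl w v) u"
proof -
  have 1: "bilin b1 (pair t \<theta>) (bilin b2 (pair r \<rho>) u) = bilin b3 (bilin FFE_incl (pair t \<theta>) (pair r \<rho>)) u"
    if "P t \<theta>" "Q r \<rho>" for t \<theta> r \<rho>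
    using assms(3) unfolding fspan_eq
  proof (induction rule: formal.span_induct_alt)
    case (step c x y)
    then obtain p \<sigma> where x: "x = pair p \<sigma>" "R p \<sigma>" by blast
    have "bilin b1 (pair t \<theta>) (bilin b2 (pair r \<rho>) x) = bilin b3 (bilin FFE_incl (pair t \<theta>) (pair r \<rho>)) x"
      using b[OF that x(2)] bilin_pair[of b1 t \<theta> "fst (b2 r \<rho> p \<sigma>)" "snd (b2 r \<rho> p \<sigma>)"]
        bilin_pair[of b3 "fst (FFE_incl t \<theta> r \<rho>)" "snd (FFE_incl t \<theta> r \<rho>)" p \<sigma>]
      by (simp add: x bilin_pair)
    then show ?case using step by (simp add: bilin_add_right bilin_scale_right)
  qed simp
  have 2: "bilin b1 (pair t \<theta>) (bilin b2 v u) = bilin b3 (bilin FFE_incl (pair t \<theta>) v) u" if "P t \<theta>" for t \<theta>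
    using assms(2) unfolding fspan_eq
    by (induction rule: formal.span_induct_alt)
      (use 1[OF that] in \<open>auto simp: bilin_add_left bilin_scale_left bilin_add_right bilin_scale_right\<close>)
  show ?thesis
    using assms(1) unfolding fspan_eq
    by (induction rule: formal.span_induct_alt)
      (use 2 in \<open>auto simp: bilin_add_left bilin_scale_left bilin_add_right bilin_scale_right\<close>)
qed

lemma bilin_unit_left:
  assumes "u \<in> fspan {pair p \<sigma> | p \<sigma>. R p \<sigma>}" "\<And>p \<sigma>. R p \<sigma> \<Longrightarrow> b r \<rho> p \<sigma> = (p, \<sigma>)"
  shows "bilin b (pair r \<rho>) u = u"
  using assms(1) unfolding fspan_eq
  by (induction rule: formal.span_induct_alt)
    (use assms(2) in \<open>auto simp: bilin_add_right bilin_scale_right bilin_pair\<close>)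

lemma bilin_unit_right:
  assumes "u \<in> fspan {pair p \<sigma> | p \<sigma>. R p \<sigma>}" "\<And>p \<sigma>. R p \<sigma> \<Longrightarrow> b p \<sigma> r \<rho> = (p, \<sigma>)"
  shows "bilin b u (pair r \<rho>) = u"
  using assms(1) unfolding fspan_eq
  by (induction rule: formal.span_induct_alt)
    (use assms(2) in \<open>auto simp: bilin_add_left bilin_scale_left bilin_pair\<close>)

context gl2
begin

subsection \<open>The horizontal trace is additive\<close>

text \<open>The three families of relations are additivity, homogeneity and cyclicity. The last one
  lets a 2-morphism \<tau> between 1-morphisms p and p' travel once around the annulus.\<close>

definition hG :: "'o \<Rightarrow> 'p \<Rightarrow> 'o \<Rightarrow> 'p \<Rightarrow> ('p, 'm) formal set" where
  "hG c f d g =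
     {pair p (add2 D (p ** f) (g ** p) \<sigma> \<sigma>') - pair p \<sigma> - pair p \<sigma>' | p \<sigma> \<sigma>'.
         p \<in> one D c d \<and> \<sigma> \<in> two D (p ** f) (g ** p) \<and> \<sigma>' \<in> two D (p ** f) (g ** p)} \<union>
      {pair p (scale2 D (p ** f) (g ** p) z \<sigma>) - fscale z (pair p \<sigma>) | p z \<sigma>.
         p \<in> one D c d \<and> \<sigma> \<in> two D (p ** f) (g ** p)} \<union>
      {pair p (vc (p ** f) (p' ** f) (g ** p) \<sigma> (rw p p' f \<tau>)) -
       pair p' (vc (p' ** f) (g ** p) (g ** p') (lw g p p' \<tau>) \<sigma>)
       | p p' \<tau> \<sigma>. p \<in> one D c d \<and> p' \<in> one D c d \<and> \<tau> \<in> two D p p' \<and>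
         \<sigma> \<in> two D (p' ** f) (g ** p)}"

lemma h_null_eq: "h_null D (c, f) (d, g) = fspan (hG c f d g)"
  by (simp add: h_null_def hG_def)

text \<open>The ambient space of well-typed pairs, of which \<open>hSd\<close> is the part of one
  degree. Composition passes to cosets inside this space.\<close>

definition hS :: "'o \<Rightarrow> 'p \<Rightarrow> 'o \<Rightarrow> 'p \<Rightarrow> ('p, 'm) formal set" where
  "hS c f d g = fspan {pair p \<sigma> | p \<sigma>. ar c d p \<and> H c d (p ** f) (g ** p) \<sigma>}"

definition hSd :: "'o \<Rightarrow> 'p \<Rightarrow> 'o \<Rightarrow> 'p \<Rightarrow> int \<Rightarrow> ('p, 'm) formal set" where
  "hSd c f d g k = fspan {pair p \<sigma> | p \<sigma>. ar c d p \<and> HD c d (p ** f) (g ** p) k \<sigma>}"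

abbreviation "cl c f d g \<equiv> coset (fspan (hG c f d g))"

lemma hS_base: "ar c d p \<Longrightarrow> H c d (p ** f) (g ** p) \<sigma> \<Longrightarrow> pair p \<sigma> \<in> hS c f d g"
  unfolding hS_def fspan_eq by (rule formal.span_base) blast

lemma hSd_base: "ar c d p \<Longrightarrow> HD c d (p ** f) (g ** p) k \<sigma> \<Longrightarrow> pair p \<sigma> \<in> hSd c f d g k"
  unfolding hSd_def fspan_eq by (rule formal.span_base) blast

lemma hSd_hS: "hSd c f d g k \<subseteq> hS c f d g"
  unfolding hSd_def hS_def fspan_eq by (rule formal.span_mono) (auto dest: HD_H)

lemma null_add: "\<lbrakk>ar c d p; H c d (p ** f) (g ** p) \<sigma>; H c d (p ** f) (g ** p) \<sigma>'\<rbrakk> \<Longrightarrow>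
    pair p (add2 D (p ** f) (g ** p) \<sigma> \<sigma>') - pair p \<sigma> - pair p \<sigma>' \<in> fspan (hG c f d g)"
  unfolding fspan_eq by (rule formal.span_base) (auto simp: hG_def ar_def H_def)

lemma null_scale: "ar c d p \<Longrightarrow> H c d (p ** f) (g ** p) \<sigma> \<Longrightarrow>
    pair p (scale2 D (p ** f) (g ** p) z \<sigma>) - fscale z (pair p \<sigma>) \<in> fspan (hG c f d g)"
  unfolding fspan_eq by (rule formal.span_base) (auto simp: hG_def ar_def H_def)

lemma null_cyc: "H c d p p' \<tau> \<Longrightarrow> H c d (p' ** f) (g ** p) \<sigma> \<Longrightarrow>
    pair p (vc (p ** f) (p' ** f) (g ** p) \<sigma> (rw p p' f \<tau>)) -
       pair p' (vc (p' ** f) (g ** p) (g ** p') (lw g p p' \<tau>) \<sigma>) \<in> fspan (hG c f d g)"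
  unfolding fspan_eq by (rule formal.span_base) (auto simp: hG_def ar_def H_def)

text \<open>The generators are given with raw membership; the typing is recovered because all
  sources and targets are composites of typed 1-morphisms.\<close>

lemma hG_cases:
  assumes "x \<in> hG c f d g" and f: "ar c c f" and g: "ar d d g"
  obtains (add) p \<sigma> \<sigma>' where "ar c d p" "H c d (p ** f) (g ** p) \<sigma>" "H c d (p ** f) (g ** p) \<sigma>'"
      "x = pair p (add2 D (p ** f) (g ** p) \<sigma> \<sigma>') - pair p \<sigma> - pair p \<sigma>'"
    | (scale) p z \<sigma> where "ar c d p" "H c d (p ** f) (g ** p) \<sigma>"
      "x = pair p (scale2 D (p ** f) (g ** p) z \<sigma>) - fscale z (pair p \<sigma>)"
    | (cyc) p p' \<tau> \<sigma> where "H c d p p' \<tau>" "H c d (p' ** f) (g ** p) \<sigma>"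
      "x = pair p (vc (p ** f) (p' ** f) (g ** p) \<sigma> (rw p p' f \<tau>)) -
        pair p' (vc (p' ** f) (g ** p) (g ** p') (lw g p p' \<tau>) \<sigma>)"
proof -
  have o: "c \<in> obj2 D" "d \<in> obj2 D" using f g by (auto simp: ar_def)
  have a: "ar c d p \<longleftrightarrow> p \<in> one D c d" for p using o by (simp add: ar_def)
  have h: "H c d (p ** f) (g ** p') \<sigma> \<longleftrightarrow> \<sigma> \<in> two D (p ** f) (g ** p')"
    if "p \<in> one D c d" "p' \<in> one D c d" for p p' \<sigma>
    using that f g by (auto simp: H_def a[symmetric] intro: ar_comp)
  have t: "H c d p p' \<tau> \<longleftrightarrow> p \<in> one D c d \<and> p' \<in> one D c d \<and> \<tau> \<in> two D p p'" for p p' \<tau>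
    by (auto simp: H_def a)
  from assms(1) show ?thesis
    unfolding hG_def
    apply (elim UnE CollectE exE conjE)
    subgoal for p \<sigma> \<sigma>' by (rule that(1)[of p \<sigma> \<sigma>']) (simp_all add: a h)
    subgoal for p z \<sigma> by (rule that(2)[of p \<sigma> z]) (simp_all add: a h)
    subgoal for p p' \<tau> \<sigma>
      using h[of p' p \<sigma>] t[of p p' \<tau>] by (intro that(3)[of p p' \<tau> \<sigma>]) blast+
    done
qed

lemma hS_eq:
  assumes f: "ar c c f" and g: "ar d d g"
  shows "fspan {pair p \<sigma> | p \<sigma>. p \<in> one D c d \<and> \<sigma> \<in> two_deg D (p ** f) (g ** p) k} = hSd c f d g k"
proof -
  have o: "c \<in> obj2 D" "d \<in> obj2 D" using f g by (auto simp: ar_def)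
  have a: "ar c d p \<longleftrightarrow> p \<in> one D c d" for p using o by (simp add: ar_def)
  have h: "HD c d (p ** f) (g ** p) k \<sigma> \<longleftrightarrow> \<sigma> \<in> two_deg D (p ** f) (g ** p) k"
    if "p \<in> one D c d" for p \<sigma>
    using that f g by (auto simp: HD_def a[symmetric] intro: ar_comp)
  show ?thesis unfolding hSd_def
    by (intro arg_cong[of _ _ fspan] Collect_cong ex_cong1 conj_cong refl) (simp_all add: a h)
qed

lemma null_hS:
  assumes f: "ar c c f" and g: "ar d d g"
  shows "fspan (hG c f d g) \<subseteq> hS c f d g"
  unfolding fspan_eq hS_def
proof (rule formal.span_minimal)
  show "hG c f d g \<subseteq> formal.span {pair p \<sigma> | p \<sigma>. ar c d p \<and> H c d (p ** f) (g ** p) \<sigma>}"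
    (is "_ \<subseteq> ?S")
  proof
    fix x assume "x \<in> hG c f d g"
    have b: "pair p \<sigma> \<in> ?S" if "ar c d p" "H c d (p ** f) (g ** p) \<sigma>" for p \<sigma>
      using hS_base[OF that] by (simp add: hS_def fspan_eq)
    from \<open>x \<in> hG c f d g\<close> f g show "x \<in> ?S"
    proof (cases rule: hG_cases)
      case (add p \<sigma> \<sigma>')
      then show ?thesis by (auto intro!: formal.span_diff b H_add)
    next
      case (scale p z \<sigma>)
      then show ?thesis by (auto intro!: formal.span_diff formal.span_scale b H_scale)
    next
      case (cyc p p' \<tau> \<sigma>)
      then show ?thesis using f g H_ar[OF cyc(1)]
        by (auto intro!: formal.span_diff b H_vc[OF H_rw] H_vc[OF _ H_lw])
    qed
  qed
qed (rule formal.subspace_span)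

section \<open>Composition descends to trace classes\<close>

definition hcm :: "'p \<Rightarrow> 'p \<Rightarrow> 'p \<Rightarrow> 'p \<Rightarrow> 'm \<Rightarrow> 'p \<Rightarrow> 'm \<Rightarrow> 'm" where
  "hcm f g h r \<rho> p \<sigma> = vc (r ** p ** f) (r ** g ** p) (h ** r ** p)
        (rw (r ** g) (h ** r) p \<rho>) (lw r (p ** f) (g ** p) \<sigma>)"

lemma h_comp_eq: "h_comp D f g h r \<rho> p \<sigma> = (r ** p, hcm f g h r \<rho> p \<sigma>)"
  by (simp add: h_comp_def hcm_def)

lemma hcm_rw:
  assumes "ar c c f" "ar d d g" "ar e e h" "ar c d p" "ar d e r" "H d e (r ** g) (h ** r) \<rho>"
  shows "H c e (r ** g ** p) (h ** r ** p) (rw (r ** g) (h ** r) p \<rho>)"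
  using H_rw[OF assms(6,4)] by (simp add: ar_assoc[OF assms(4,2,5)] ar_assoc[OF assms(4,5,3)])

lemma hcm_lw:
  assumes "ar c c f" "ar d d g" "ar c d p" "ar d e r" "H c d (p ** f) (g ** p) \<sigma>"
  shows "H c e (r ** p ** f) (r ** g ** p) (lw r (p ** f) (g ** p) \<sigma>)"
  by (rule H_lw[OF assms(5,4)])

lemma hcm_H:
  assumes "ar c c f" "ar d d g" "ar e e h" "ar c d p" "ar d e r" "H d e (r ** g) (h ** r) \<rho>"
    "H c d (p ** f) (g ** p) \<sigma>"
  shows "H c e ((r ** p) ** f) (h ** r ** p) (hcm f g h r \<rho> p \<sigma>)"
  unfolding ar_assoc[OF assms(1,4,5)] hcm_def
  by (rule H_vc[OF hcm_lw[OF assms(1,2,4,5,7)] hcm_rw[OF assms(1-6)]])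

lemma hcm_HD:
  assumes "ar c c f" "ar d d g" "ar e e h" "ar c d p" "ar d e r" "HD d e (r ** g) (h ** r) l \<rho>"
    "HD c d (p ** f) (g ** p) k \<sigma>"
  shows "HD c e ((r ** p) ** f) (h ** r ** p) (l + k) (hcm f g h r \<rho> p \<sigma>)"
proof -
  have "HD c e (r ** g ** p) (h ** r ** p) l (rw (r ** g) (h ** r) p \<rho>)"
    using HD_rw[OF assms(6,4)] by (simp add: ar_assoc[OF assms(4,2,5)] ar_assoc[OF assms(4,5,3)])
  then show ?thesis
    unfolding ar_assoc[OF assms(1,4,5)] hcm_def by (rule HD_vc[OF HD_lw[OF assms(7,5)]])
qed

text \<open>Composing a cyclicity relation for \<tau> with (p, \<sigma>) gives the cyclicity
  relation for \<tau>p, with \<open>S\<close> = (\<rho>p)(r'\<sigma>) as the remaining 2-morphism.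
  The one real step exchanges \<tau> and \<sigma>, which lie side by side.\<close>

lemma hcm_cyc_left:
  assumes f: "ar c c f" and g: "ar d d g" and h: "ar e e h" and p: "ar c d p" and r: "ar d e r" "ar d e r'"
    and \<tau>: "H d e r r' \<tau>" and \<rho>: "H d e (r' ** g) (h ** r) \<rho>" and \<sigma>: "H c d (p ** f) (g ** p) \<sigma>"
  defines "S \<equiv> vc (r' ** p ** f) (r' ** g ** p) (h ** r ** p) (rw (r' ** g) (h ** r) p \<rho>) (lw r' (p ** f) (g ** p) \<sigma>)"
  shows "H c e ((r' ** p) ** f) (h ** r ** p) S"
    and "hcm f g h r (vc (r ** g) (r' ** g) (h ** r) \<rho> (rw r r' g \<tau>)) p \<sigma> =
      vc ((r ** p) ** f) ((r' ** p) ** f) (h ** r ** p) S (rw (r ** p) (r' ** p) f (rw r r' p \<tau>))"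
    and "hcm f g h r' (vc (r' ** g) (h ** r) (h ** r') (lw h r r' \<tau>) \<rho>) p \<sigma> =
      vc ((r' ** p) ** f) (h ** r ** p) (h ** r' ** p) (lw h (r ** p) (r' ** p) (rw r r' p \<tau>)) S"
proof -
  note as = ar_assoc[OF f p r(1)] ar_assoc[OF f p r(2)] ar_assoc[OF p g r(1)] ar_assoc[OF p g r(2)]
    ar_assoc[OF p r(1) h] ar_assoc[OF p r(2) h]
  have L: "H c e (r' ** p ** f) (r' ** g ** p) (lw r' (p ** f) (g ** p) \<sigma>)" by (rule H_lw[OF \<sigma> r(2)])
  have R: "H c e (r' ** g ** p) (h ** r ** p) (rw (r' ** g) (h ** r) p \<rho>)"
    using H_rw[OF \<rho> p] by (simp add: as)
  show "H c e ((r' ** p) ** f) (h ** r ** p) S" unfolding S_def as by (rule H_vc[OF L R])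
  have Lr: "H c e (r ** p ** f) (r ** g ** p) (lw r (p ** f) (g ** p) \<sigma>)" by (rule H_lw[OF \<sigma> r(1)])
  have T: "H c e (r ** g ** p) (r' ** g ** p) (rw r r' (g ** p) \<tau>)" by (rule H_rw[OF \<tau> ar_comp[OF p g]])
  have T2: "H c e (r ** p ** f) (r' ** p ** f) (rw r r' (p ** f) \<tau>)" by (rule H_rw[OF \<tau> ar_comp[OF f p]])
  have "hcm f g h r (vc (r ** g) (r' ** g) (h ** r) \<rho> (rw r r' g \<tau>)) p \<sigma> =
    vc (r ** p ** f) (r ** g ** p) (h ** r ** p)
      (vc (r ** g ** p) (r' ** g ** p) (h ** r ** p) (rw (r' ** g) (h ** r) p \<rho>) (rw r r' (g ** p) \<tau>))
      (lw r (p ** f) (g ** p) \<sigma>)"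
    unfolding hcm_def rw_vc[OF H_rw[OF \<tau> g] \<rho> p] rw_rw[OF \<tau> g p] as ..
  also have "\<dots> = vc (r ** p ** f) (r' ** g ** p) (h ** r ** p) (rw (r' ** g) (h ** r) p \<rho>)
      (vc (r ** p ** f) (r ** g ** p) (r' ** g ** p) (rw r r' (g ** p) \<tau>) (lw r (p ** f) (g ** p) \<sigma>))"
    by (rule vc_assoc[OF Lr T R])
  also have "vc (r ** p ** f) (r ** g ** p) (r' ** g ** p) (rw r r' (g ** p) \<tau>) (lw r (p ** f) (g ** p) \<sigma>) =
    vc (r ** p ** f) (r' ** p ** f) (r' ** g ** p) (lw r' (p ** f) (g ** p) \<sigma>) (rw r r' (p ** f) \<tau>)"
    unfolding exch1[OF \<sigma> \<tau>] exch2[OF \<sigma> \<tau>] ..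
  also have "vc (r ** p ** f) (r' ** g ** p) (h ** r ** p) (rw (r' ** g) (h ** r) p \<rho>)
      (vc (r ** p ** f) (r' ** p ** f) (r' ** g ** p) (lw r' (p ** f) (g ** p) \<sigma>) (rw r r' (p ** f) \<tau>)) =
    vc (r ** p ** f) (r' ** p ** f) (h ** r ** p) S (rw r r' (p ** f) \<tau>)"
    unfolding S_def by (rule vc_assoc[OF T2 L R, symmetric])
  finally show "hcm f g h r (vc (r ** g) (r' ** g) (h ** r) \<rho> (rw r r' g \<tau>)) p \<sigma> =
      vc ((r ** p) ** f) ((r' ** p) ** f) (h ** r ** p) S (rw (r ** p) (r' ** p) f (rw r r' p \<tau>))"
    by (simp add: rw_rw[OF \<tau> p f] as)
  have "hcm f g h r' (vc (r' ** g) (h ** r) (h ** r') (lw h r r' \<tau>) \<rho>) p \<sigma> =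
    vc (r' ** p ** f) (r' ** g ** p) (h ** r' ** p)
      (vc (r' ** g ** p) (h ** r ** p) (h ** r' ** p) (lw h (r ** p) (r' ** p) (rw r r' p \<tau>)) (rw (r' ** g) (h ** r) p \<rho>))
      (lw r' (p ** f) (g ** p) \<sigma>)"
    unfolding hcm_def rw_vc[OF \<rho> H_lw[OF \<tau> h] p] lw_rw[OF \<tau> p h] as ..
  also have "\<dots> = vc (r' ** p ** f) (h ** r ** p) (h ** r' ** p) (lw h (r ** p) (r' ** p) (rw r r' p \<tau>)) S"
    unfolding S_def by (rule vc_assoc[OF L R H_lw[OF H_rw[OF \<tau> p] h]])
  finally show "hcm f g h r' (vc (r' ** g) (h ** r) (h ** r') (lw h r r' \<tau>) \<rho>) p \<sigma> =
      vc ((r' ** p) ** f) (h ** r ** p) (h ** r' ** p) (lw h (r ** p) (r' ** p) (rw r r' p \<tau>)) S"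
    by (simp add: as)
qed

text \<open>The mirror image: composing with (r, \<rho>) turns the relation for \<tau> into the one
  for r\<tau>, and now \<rho> and \<tau> have to be exchanged.\<close>

lemma hcm_cyc_right:
  assumes f: "ar c c f" and g: "ar d d g" and h: "ar e e h" and p: "ar c d p" "ar c d p'" and r: "ar d e r"
    and \<tau>: "H c d p p' \<tau>" and \<sigma>: "H c d (p' ** f) (g ** p) \<sigma>" and \<rho>: "H d e (r ** g) (h ** r) \<rho>"
  defines "S \<equiv> vc (r ** p' ** f) (r ** g ** p) (h ** r ** p) (rw (r ** g) (h ** r) p \<rho>) (lw r (p' ** f) (g ** p) \<sigma>)"
  shows "H c e ((r ** p') ** f) (h ** r ** p) S"
    and "hcm f g h r \<rho> p (vc (p ** f) (p' ** f) (g ** p) \<sigma> (rw p p' f \<tau>)) =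
      vc ((r ** p) ** f) ((r ** p') ** f) (h ** r ** p) S (rw (r ** p) (r ** p') f (lw r p p' \<tau>))"
    and "hcm f g h r \<rho> p' (vc (p' ** f) (g ** p) (g ** p') (lw g p p' \<tau>) \<sigma>) =
      vc ((r ** p') ** f) (h ** r ** p) (h ** r ** p') (lw h (r ** p) (r ** p') (lw r p p' \<tau>)) S"
proof -
  note as = ar_assoc[OF f p(1) r] ar_assoc[OF f p(2) r] ar_assoc[OF p(1) g r] ar_assoc[OF p(2) g r]
    ar_assoc[OF p(1) r h] ar_assoc[OF p(2) r h]
  have L: "H c e (r ** p' ** f) (r ** g ** p) (lw r (p' ** f) (g ** p) \<sigma>)" by (rule H_lw[OF \<sigma> r])
  have R: "H c e (r ** g ** p) (h ** r ** p) (rw (r ** g) (h ** r) p \<rho>)"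
    using H_rw[OF \<rho> p(1)] by (simp add: as)
  have R': "H c e (r ** g ** p') (h ** r ** p') (rw (r ** g) (h ** r) p' \<rho>)"
    using H_rw[OF \<rho> p(2)] by (simp add: as)
  show "H c e ((r ** p') ** f) (h ** r ** p) S" unfolding S_def as by (rule H_vc[OF L R])
  have T: "H c e (r ** p ** f) (r ** p' ** f) (lw r (p ** f) (p' ** f) (rw p p' f \<tau>))"
    by (rule H_lw[OF H_rw[OF \<tau> f] r])
  have T2: "H c e (r ** g ** p) (r ** g ** p') (lw r (g ** p) (g ** p') (lw g p p' \<tau>))"
    by (rule H_lw[OF H_lw[OF \<tau> g] r])
  have "hcm f g h r \<rho> p (vc (p ** f) (p' ** f) (g ** p) \<sigma> (rw p p' f \<tau>)) =
    vc (r ** p ** f) (r ** g ** p) (h ** r ** p) (rw (r ** g) (h ** r) p \<rho>)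
     (vc (r ** p ** f) (r ** p' ** f) (r ** g ** p) (lw r (p' ** f) (g ** p) \<sigma>) (lw r (p ** f) (p' ** f) (rw p p' f \<tau>)))"
    unfolding hcm_def lw_vc[OF H_rw[OF \<tau> f] \<sigma> r] ..
  also have "\<dots> = vc (r ** p ** f) (r ** p' ** f) (h ** r ** p) S (lw r (p ** f) (p' ** f) (rw p p' f \<tau>))"
    unfolding S_def by (rule vc_assoc[OF T L R, symmetric])
  finally show "hcm f g h r \<rho> p (vc (p ** f) (p' ** f) (g ** p) \<sigma> (rw p p' f \<tau>)) =
      vc ((r ** p) ** f) ((r ** p') ** f) (h ** r ** p) S (rw (r ** p) (r ** p') f (lw r p p' \<tau>))"
    by (simp add: lw_rw[OF \<tau> f r] as)
  have "hcm f g h r \<rho> p' (vc (p' ** f) (g ** p) (g ** p') (lw g p p' \<tau>) \<sigma>) =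
    vc (r ** p' ** f) (r ** g ** p') (h ** r ** p') (rw (r ** g) (h ** r) p' \<rho>)
     (vc (r ** p' ** f) (r ** g ** p) (r ** g ** p') (lw r (g ** p) (g ** p') (lw g p p' \<tau>)) (lw r (p' ** f) (g ** p) \<sigma>))"
    unfolding hcm_def lw_vc[OF \<sigma> H_lw[OF \<tau> g] r] ..
  also have "\<dots> = vc (r ** p' ** f) (r ** g ** p) (h ** r ** p')
     (vc (r ** g ** p) (r ** g ** p') (h ** r ** p') (rw (r ** g) (h ** r) p' \<rho>) (lw r (g ** p) (g ** p') (lw g p p' \<tau>)))
     (lw r (p' ** f) (g ** p) \<sigma>)"
    by (rule vc_assoc[OF L T2 R', symmetric])
  also have "vc (r ** g ** p) (r ** g ** p') (h ** r ** p') (rw (r ** g) (h ** r) p' \<rho>) (lw r (g ** p) (g ** p') (lw g p p' \<tau>)) =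
    vc (r ** g ** p) (h ** r ** p) (h ** r ** p') (lw h (r ** p) (r ** p') (lw r p p' \<tau>)) (rw (r ** g) (h ** r) p \<rho>)"
    using exch1[OF \<tau> \<rho>] exch2[OF \<tau> \<rho>] unfolding lw_lw[OF \<tau> g r] lw_lw[OF \<tau> r h] as by simp
  also have "vc (r ** p' ** f) (r ** g ** p) (h ** r ** p')
     (vc (r ** g ** p) (h ** r ** p) (h ** r ** p') (lw h (r ** p) (r ** p') (lw r p p' \<tau>)) (rw (r ** g) (h ** r) p \<rho>))
     (lw r (p' ** f) (g ** p) \<sigma>) =
     vc (r ** p' ** f) (h ** r ** p) (h ** r ** p') (lw h (r ** p) (r ** p') (lw r p p' \<tau>)) S"
    unfolding S_def by (rule vc_assoc[OF L R H_lw[OF H_lw[OF \<tau> r] h]])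
  finally show "hcm f g h r \<rho> p' (vc (p' ** f) (g ** p) (g ** p') (lw g p p' \<tau>) \<sigma>) =
      vc ((r ** p') ** f) (h ** r ** p) (h ** r ** p') (lw h (r ** p) (r ** p') (lw r p p' \<tau>)) S"
    by (simp add: as)
qed

text \<open>With \<open>null_bilin_right\<close> this says that the relations form a two-sided
  ideal. Each of the three families of generators is carried into the family of the same
  kind.\<close>

lemma null_bilin_left:
  assumes f: "ar c c f" and g: "ar d d g" and h: "ar e e h"
    and n: "n \<in> fspan (hG d g e h)" and u: "u \<in> hS c f d g"
  shows "bilin (h_comp D f g h) n u \<in> fspan (hG c f e h)"
proof (rule bilin_span_in[OF n u[unfolded hS_def]])
  fix v x assume v: "v \<in> hG d g e h" and "x \<in> {pair p \<sigma> |p \<sigma>. ar c d p \<and> H c d (p ** f) (g ** p) \<sigma>}"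
  then obtain p \<sigma> where x: "x = pair p \<sigma>" and p: "ar c d p" and \<sigma>: "H c d (p ** f) (g ** p) \<sigma>" by blast
  from v g h show "bilin (h_comp D f g h) v x \<in> fspan (hG c f e h)"
  proof (cases rule: hG_cases)
    case (add r \<rho> \<rho>')
    note R = hcm_rw[OF f g h p add(1) add(2)] hcm_rw[OF f g h p add(1) add(3)]
    note L = hcm_lw[OF f g p add(1) \<sigma>]
    have "hcm f g h r (add2 D (r ** g) (h ** r) \<rho> \<rho>') p \<sigma> =
      add2 D ((r ** p) ** f) (h ** r ** p) (hcm f g h r \<rho> p \<sigma>) (hcm f g h r \<rho>' p \<sigma>)"
      using vc_add_left[OF L R] rw_add[OF add(2,3) p]
      unfolding hcm_def ar_assoc[OF p g add(1)] ar_assoc[OF p add(1) h] ar_assoc[OF f p add(1)] by simp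
    moreover have "pair (r ** p) (add2 D ((r ** p) ** f) (h ** r ** p) (hcm f g h r \<rho> p \<sigma>) (hcm f g h r \<rho>' p \<sigma>)) -
        pair (r ** p) (hcm f g h r \<rho> p \<sigma>) - pair (r ** p) (hcm f g h r \<rho>' p \<sigma>) \<in> fspan (hG c f e h)"
      by (intro null_add ar_comp[OF p add(1)] hcm_H[OF f g h p add(1)] add \<sigma>)
    ultimately show ?thesis
      by (simp add: x add(4) bilin_diff_left bilin_pair h_comp_eq)
  next
    case (scale r z \<rho>)
    note R = hcm_rw[OF f g h p scale(1) scale(2)]
    note L = hcm_lw[OF f g p scale(1) \<sigma>]
    have "hcm f g h r (scale2 D (r ** g) (h ** r) z \<rho>) p \<sigma> =
      scale2 D ((r ** p) ** f) (h ** r ** p) z (hcm f g h r \<rho> p \<sigma>)"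
      using vc_scale_left[OF L R] rw_scale[OF scale(2) p]
      unfolding hcm_def ar_assoc[OF p g scale(1)] ar_assoc[OF p scale(1) h] ar_assoc[OF f p scale(1)] by simp
    moreover have "pair (r ** p) (scale2 D ((r ** p) ** f) (h ** r ** p) z (hcm f g h r \<rho> p \<sigma>)) -
        fscale z (pair (r ** p) (hcm f g h r \<rho> p \<sigma>)) \<in> fspan (hG c f e h)"
      by (intro null_scale ar_comp[OF p scale(1)] hcm_H[OF f g h p scale(1)] scale \<sigma>)
    ultimately show ?thesis
      by (simp add: x scale(3) bilin_diff_left bilin_scale_left bilin_pair h_comp_eq)
  next
    case (cyc r r' \<tau> \<rho>)
    note r = H_ar[OF cyc(1)]
    note k = hcm_cyc_left[OF f g h p r cyc(1,2) \<sigma>]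
    show ?thesis
      unfolding x cyc(3) bilin_diff_left bilin_pair h_comp_eq k(2,3)
      by (rule null_cyc[OF H_rw[OF cyc(1) p] k(1)])
  qed
qed

lemma null_bilin_right:
  assumes f: "ar c c f" and g: "ar d d g" and h: "ar e e h"
    and u: "u \<in> hS d g e h" and n: "n \<in> fspan (hG c f d g)"
  shows "bilin (h_comp D f g h) u n \<in> fspan (hG c f e h)"
proof (rule bilin_span_in[OF u[unfolded hS_def] n])
  fix v x assume v: "v \<in> hG c f d g" and "x \<in> {pair r \<rho> |r \<rho>. ar d e r \<and> H d e (r ** g) (h ** r) \<rho>}"
  then obtain r \<rho> where x: "x = pair r \<rho>" and r: "ar d e r" and \<rho>: "H d e (r ** g) (h ** r) \<rho>" by blast
  from v f g show "bilin (h_comp D f g h) x v \<in> fspan (hG c f e h)"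
  proof (cases rule: hG_cases)
    case (add p \<sigma> \<sigma>')
    note R = hcm_rw[OF f g h add(1) r \<rho>]
    note L = hcm_lw[OF f g add(1) r add(2)] hcm_lw[OF f g add(1) r add(3)]
    have "hcm f g h r \<rho> p (add2 D (p ** f) (g ** p) \<sigma> \<sigma>') =
      add2 D ((r ** p) ** f) (h ** r ** p) (hcm f g h r \<rho> p \<sigma>) (hcm f g h r \<rho> p \<sigma>')"
      using vc_add_right[OF L R] lw_add[OF add(2,3) r]
      unfolding hcm_def ar_assoc[OF f add(1) r] by simp
    moreover have "pair (r ** p) (add2 D ((r ** p) ** f) (h ** r ** p) (hcm f g h r \<rho> p \<sigma>) (hcm f g h r \<rho> p \<sigma>')) -
        pair (r ** p) (hcm f g h r \<rho> p \<sigma>) - pair (r ** p) (hcm f g h r \<rho> p \<sigma>') \<in> fspan (hG c f e h)"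
      by (intro null_add ar_comp[OF add(1) r] hcm_H[OF f g h add(1) r \<rho>] add)
    ultimately show ?thesis
      by (simp add: x add(4) bilin_diff_right bilin_pair h_comp_eq)
  next
    case (scale p z \<sigma>)
    note R = hcm_rw[OF f g h scale(1) r \<rho>]
    note L = hcm_lw[OF f g scale(1) r scale(2)]
    have "hcm f g h r \<rho> p (scale2 D (p ** f) (g ** p) z \<sigma>) =
      scale2 D ((r ** p) ** f) (h ** r ** p) z (hcm f g h r \<rho> p \<sigma>)"
      using vc_scale_right[OF L R] lw_scale[OF scale(2) r]
      unfolding hcm_def ar_assoc[OF f scale(1) r] by simp
    moreover have "pair (r ** p) (scale2 D ((r ** p) ** f) (h ** r ** p) z (hcm f g h r \<rho> p \<sigma>)) -
        fscale z (pair (r ** p) (hcm f g h r \<rho> p \<sigma>)) \<in> fspan (hG c f e h)"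
      by (intro null_scale ar_comp[OF scale(1) r] hcm_H[OF f g h scale(1) r \<rho>] scale)
    ultimately show ?thesis
      by (simp add: x scale(3) bilin_diff_right bilin_scale_right bilin_pair h_comp_eq)
  next
    case (cyc p p' \<tau> \<sigma>)
    note p = H_ar[OF cyc(1)]
    note k = hcm_cyc_right[OF f g h p r cyc(1,2) \<rho>]
    show ?thesis
      unfolding x cyc(3) bilin_diff_right bilin_pair h_comp_eq k(2,3)
      by (rule null_cyc[OF H_lw[OF cyc(1) r] k(1)])
  qed
qed

lemma hcm_id_left:
  assumes f: "ar c c f" and g: "ar d d g" and p: "ar c d p" and \<sigma>: "H c d (p ** f) (g ** p) \<sigma>"
  shows "h_comp D f g g (U d) (idm g) p \<sigma> = (p, \<sigma>)"
proof -
  have d: "d \<in> obj2 D" using g by (simp add: ar_def)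
  show ?thesis
    using rw_id[OF g p] vc_id_left[OF \<sigma>] lw_unit[OF \<sigma>]
    by (simp add: h_comp_eq hcm_def ar_unit_left[OF p] ar_unit_left[OF g] ar_unit_left[OF ar_comp[OF f p]]
      ar_unit_left[OF ar_comp[OF p g]] ar_unit_right[OF g])
qed

lemma hcm_id_right:
  assumes f: "ar c c f" and g: "ar d d g" and p: "ar c d p" and \<sigma>: "H c d (p ** f) (g ** p) \<sigma>"
  shows "h_comp D f f g p \<sigma> (U c) (idm f) = (p, \<sigma>)"
proof -
  show ?thesis
    using lw_id[OF f p] vc_id_right[OF \<sigma>] rw_unit[OF \<sigma>]
    by (simp add: h_comp_eq hcm_def ar_unit_right[OF p] ar_unit_left[OF f] ar_unit_right[OF f])
qed

text \<open>Both sides are the vertical composite (\<theta>rp)(tr'p)(tr\<sigma>) with r' replaced by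
  \<rho>, bracketed in two ways.\<close>

lemma hcm_assoc:
  assumes f: "ar c c f" and g: "ar d d g" and h: "ar e e h" and k: "ar e' e' k"
    and p: "ar c d p" and r: "ar d e r" and t: "ar e e' t"
    and \<sigma>: "H c d (p ** f) (g ** p) \<sigma>" and \<rho>: "H d e (r ** g) (h ** r) \<rho>" and \<theta>: "H e e' (t ** h) (k ** t) \<theta>"
  shows "hcm f h k t \<theta> (r ** p) (hcm f g h r \<rho> p \<sigma>) = hcm f g k (t ** r) (hcm g h k t \<theta> r \<rho>) p \<sigma>"
proof -
  note as = ar_assoc[OF f p r] ar_assoc[OF p g r] ar_assoc[OF p r h] ar_assoc[OF p r t]
    ar_assoc[OF ar_comp[OF p r] h t] ar_assoc[OF ar_comp[OF p r] t k] ar_assoc[OF g r t] ar_assoc[OF r h t]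
    ar_assoc[OF r t k] ar_assoc[OF p ar_comp[OF g r] t] ar_assoc[OF p ar_comp[OF r h] t]
    ar_assoc[OF p ar_comp[OF r t] k] ar_assoc[OF ar_comp[OF f p] r t] ar_assoc[OF ar_comp[OF p g] r t]
  note L = hcm_lw[OF f g p r \<sigma>] and R = hcm_rw[OF f g h p r \<rho>]
  have R2: "H d e' (t ** h ** r) (k ** t ** r) (rw (t ** h) (k ** t) r \<theta>)"
    using H_rw[OF \<theta> r] by (simp add: as)
  have R3: "H c e' (t ** h ** r ** p) (k ** t ** r ** p) (rw (t ** h) (k ** t) (r ** p) \<theta>)"
    using H_rw[OF \<theta> ar_comp[OF p r]] by (simp add: as)
  have Lt: "H c e' (t ** r ** p ** f) (t ** r ** g ** p) (lw t (r ** p ** f) (r ** g ** p) (lw r (p ** f) (g ** p) \<sigma>))"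
    and Rt: "H c e' (t ** r ** g ** p) (t ** h ** r ** p) (lw t (r ** g ** p) (h ** r ** p) (rw (r ** g) (h ** r) p \<rho>))"
    by (rule H_lw[OF L t], rule H_lw[OF R t])
  have "hcm f h k t \<theta> (r ** p) (hcm f g h r \<rho> p \<sigma>) =
    vc (t ** r ** p ** f) (t ** h ** r ** p) (k ** t ** r ** p) (rw (t ** h) (k ** t) (r ** p) \<theta>)
      (vc (t ** r ** p ** f) (t ** r ** g ** p) (t ** h ** r ** p)
        (lw t (r ** g ** p) (h ** r ** p) (rw (r ** g) (h ** r) p \<rho>))
        (lw t (r ** p ** f) (r ** g ** p) (lw r (p ** f) (g ** p) \<sigma>)))"
    using lw_vc[OF L R t] unfolding hcm_def as by simp
  also have "\<dots> = vc (t ** r ** p ** f) (t ** r ** g ** p) (k ** t ** r ** p)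
      (vc (t ** r ** g ** p) (t ** h ** r ** p) (k ** t ** r ** p) (rw (t ** h) (k ** t) (r ** p) \<theta>)
        (lw t (r ** g ** p) (h ** r ** p) (rw (r ** g) (h ** r) p \<rho>)))
      (lw t (r ** p ** f) (r ** g ** p) (lw r (p ** f) (g ** p) \<sigma>))"
    by (rule vc_assoc[OF Lt Rt R3, symmetric])
  also have "\<dots> = hcm f g k (t ** r) (hcm g h k t \<theta> r \<rho>) p \<sigma>"
    using rw_vc[OF H_lw[OF \<rho> t] R2 p] lw_lw[OF \<sigma> r t] lw_rw[OF \<rho> p t] rw_rw[OF \<theta> r p]
    unfolding hcm_def as by simp
  finally show ?thesis .
qed

section \<open>Laws of composition for trace classes\<close>

lemma h_pairs_simps:
  "obj (h_pairs D) = {(k, c, f). ar c c f}"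
  "idt (h_pairs D) (k, c, f) = cl c f c f (pair (U c) (idm f))"
  "cmp (h_pairs D) (k, c, f) (l, d, g) (m, e, h) = coset_comp (fspan (hG c f e h)) (h_comp D f g h)"
  "hadd (h_pairs D) (k, c, f) (l, d, g) = coset_add (fspan (hG c f d g))"
  "hzero (h_pairs D) (k, c, f) (l, d, g) = cl c f d g 0"
  by (auto simp: h_pairs_def h_null_eq ar_def)

lemma h_pairs_hom: "ar c c f \<Longrightarrow> ar d d g \<Longrightarrow>
    hom (h_pairs D) (k, c, f) (l, d, g) = cl c f d g ` hSd c f d g (l - k)"
  using hS_eq[of c f d g "l - k"] by (simp add: h_pairs_def h_hom_def h_null_eq)

lemma h_pairs_cmp:
  assumes f: "ar c c f" and g: "ar d d g" and h: "ar e e h" and v: "v \<in> hS d g e h" and u: "u \<in> hS c f d g"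
  shows "cmp (h_pairs D) (k, c, f) (l, d, g) (m, e, h) (cl d g e h v) (cl c f d g u) =
    cl c f e h (bilin (h_comp D f g h) v u)"
proof -
  have "coset_comp (fspan (hG c f e h)) (h_comp D f g h)
      (coset (fspan (hG d g e h)) v) (coset (fspan (hG c f d g)) u) =
    coset (fspan (hG c f e h)) (bilin (h_comp D f g h) v u)"
    by (rule coset_comp_coset[OF v[unfolded hS_def] u[unfolded hS_def], folded hS_def])
      (use null_hS[OF g h] null_bilin_left[OF f g h] null_bilin_right[OF f g h]
        in \<open>simp_all add: fspan_eq formal.span_zero\<close>)
  then show ?thesis by (simp add: h_pairs_simps)
qed

lemma hSd_bilin:
  assumes f: "ar c c f" and g: "ar d d g" and h: "ar e e h" and v: "v \<in> hSd d g e h l" and u: "u \<in> hSd c f d g k"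
  shows "bilin (h_comp D f g h) v u \<in> hSd c f e h (l + k)"
  using v u unfolding hSd_def
proof (rule bilin_span_in)
  fix x y
  assume "x \<in> {pair p \<sigma> |p \<sigma>. ar d e p \<and> HD d e (p ** g) (h ** p) l \<sigma>}"
    and "y \<in> {pair p \<sigma> |p \<sigma>. ar c d p \<and> HD c d (p ** f) (g ** p) k \<sigma>}"
  then obtain r \<rho> p \<sigma> where x: "x = pair r \<rho>" "ar d e r" "HD d e (r ** g) (h ** r) l \<rho>"
    and y: "y = pair p \<sigma>" "ar c d p" "HD c d (p ** f) (g ** p) k \<sigma>" by blast
  show "bilin (h_comp D f g h) x y \<in> fspan {pair p \<sigma> |p \<sigma>. ar c e p \<and> HD c e (p ** f) (h ** p) (l + k) \<sigma>}"
    unfolding x(1) y(1) bilin_pair h_comp_eq hSd_def[symmetric]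
    by (rule hSd_base[OF ar_comp[OF y(2) x(2)] hcm_HD[OF f g h y(2) x(2,3) y(3)]])
qed

lemma hSd_add: "u \<in> hSd c f d g k \<Longrightarrow> v \<in> hSd c f d g k \<Longrightarrow> u + v \<in> hSd c f d g k"
  unfolding hSd_def fspan_eq by (rule formal.span_add)

lemma hSd_zero: "0 \<in> hSd c f d g k"
  unfolding hSd_def fspan_eq by (rule formal.span_zero)

text \<open>All laws are checked on representatives in \<open>hSd\<close>, where the composition is
  \<open>bilin\<close>. They hold there exactly, not only up to null elements, because the
  2-category is strict.\<close>

lemma preadditive_h_pairs: "preadditive (h_pairs D)"
proof
  note hs = subsetD[OF hSd_hS]
  fix x assume "x \<in> obj (h_pairs D)"
  then obtain k c f where x: "x = (k, c, f)" and f: "ar c c f" by (auto simp: h_pairs_simps)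
  have "HD c c (U c ** f) (f ** U c) 0 (idm f)"
    unfolding ar_unit_left[OF f] ar_unit_right[OF f] by (rule HD_id[OF f])
  moreover have "ar c c (U c)" using f by (auto simp: ar_def intro: unit_in)
  ultimately have idS: "pair (U c) (idm f) \<in> hSd c f c f 0" by (intro hSd_base)
  then show "idt (h_pairs D) x \<in> hom (h_pairs D) x x"
    by (simp add: x h_pairs_simps(2) h_pairs_hom f)
  fix y assume "y \<in> obj (h_pairs D)"
  then obtain l d g where y: "y = (l, d, g)" and g: "ar d d g" by (auto simp: h_pairs_simps)
  have idS': "pair (U d) (idm g) \<in> hSd d g d g 0"
    by (rule hSd_base)
      (use g ar_unit_left[OF g] ar_unit_right[OF g] HD_id[OF g] in \<open>auto simp: ar_def intro: unit_in\<close>)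
  show "hzero (h_pairs D) x y \<in> hom (h_pairs D) x y"
    by (auto simp: x y h_pairs_simps h_pairs_hom f g hSd_zero)
  {
    fix F assume "F \<in> hom (h_pairs D) x y"
    then obtain u where F: "F = cl c f d g u" and u: "u \<in> hSd c f d g (l - k)"
      by (auto simp: x y h_pairs_hom f g)
    show "cmp (h_pairs D) x y y (idt (h_pairs D) y) F = F"
      unfolding x y F h_pairs_simps(2) h_pairs_cmp[OF f g g hs[OF idS'] hs[OF u]]
      by (subst bilin_unit_left[OF u[unfolded hSd_def]]) (auto intro: hcm_id_left[OF f g] HD_H)
    show "cmp (h_pairs D) x x y F (idt (h_pairs D) x) = F"
      unfolding x y F h_pairs_simps(2) h_pairs_cmp[OF f f g hs[OF u] hs[OF idS]]
      by (subst bilin_unit_right[OF u[unfolded hSd_def]]) (auto intro: hcm_id_right[OF f g] HD_H)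
    show "hadd (h_pairs D) x y F (hzero (h_pairs D) x y) = F"
      by (simp add: x y F h_pairs_simps coset_add_coset)
    fix F' assume "F' \<in> hom (h_pairs D) x y"
    then obtain u' where F': "F' = cl c f d g u'" and u': "u' \<in> hSd c f d g (l - k)"
      by (auto simp: x y h_pairs_hom f g)
    show "hadd (h_pairs D) x y F F' \<in> hom (h_pairs D) x y"
      by (auto simp: x y F F' h_pairs_simps coset_add_coset h_pairs_hom f g u u' hSd_add)
    show "hadd (h_pairs D) x y F F' = hadd (h_pairs D) x y F' F"
      by (simp add: x y F F' h_pairs_simps coset_add_coset add.commute)
    fix F'' assume "F'' \<in> hom (h_pairs D) x y"
    then obtain u'' where F'': "F'' = cl c f d g u''" and u'': "u'' \<in> hSd c f d g (l - k)"
      by (auto simp: x y h_pairs_hom f g)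
    show "hadd (h_pairs D) x y (hadd (h_pairs D) x y F F') F'' = hadd (h_pairs D) x y F (hadd (h_pairs D) x y F' F'')"
      by (simp add: x y F F' F'' h_pairs_simps coset_add_coset add.assoc)
  }
  fix z assume "z \<in> obj (h_pairs D)"
  then obtain m e h where z: "z = (m, e, h)" and h: "ar e e h" by (auto simp: h_pairs_simps)
  {
    fix F G assume "F \<in> hom (h_pairs D) x y" "G \<in> hom (h_pairs D) y z"
    then obtain u v where F: "F = cl c f d g u" and u: "u \<in> hSd c f d g (l - k)"
      and G: "G = cl d g e h v" and v: "v \<in> hSd d g e h (m - l)"
      by (auto simp: x y z h_pairs_hom f g h)
    have "bilin (h_comp D f g h) v u \<in> hSd c f e h (m - k)"
      using hSd_bilin[OF f g h v u] by simp
    then show "cmp (h_pairs D) x y z G F \<in> hom (h_pairs D) x z"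
      unfolding x y z F G h_pairs_cmp[OF f g h hs[OF v] hs[OF u]]
      by (auto simp: h_pairs_hom f h)
  }
  {
    fix F assume "F \<in> hom (h_pairs D) x y"
    then obtain u where F: "F = cl c f d g u" and u: "u \<in> hSd c f d g (l - k)"
      by (auto simp: x y h_pairs_hom f g)
    show "cmp (h_pairs D) x y z (hzero (h_pairs D) y z) F = hzero (h_pairs D) x z"
      unfolding x y z F h_pairs_simps(5) h_pairs_cmp[OF f g h hs[OF hSd_zero] hs[OF u]] by simp
    fix G assume "G \<in> hom (h_pairs D) y z"
    then obtain v where G: "G = cl d g e h v" and v: "v \<in> hSd d g e h (m - l)"
      by (auto simp: y z h_pairs_hom g h)
    {
      fix G' assume "G' \<in> hom (h_pairs D) y z"
      then obtain v' where G': "G' = cl d g e h v'" and v': "v' \<in> hSd d g e h (m - l)"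
        by (auto simp: y z h_pairs_hom g h)
      show "cmp (h_pairs D) x y z (hadd (h_pairs D) y z G G') F =
        hadd (h_pairs D) x z (cmp (h_pairs D) x y z G F) (cmp (h_pairs D) x y z G' F)"
        unfolding x y z F G G' h_pairs_simps(4) coset_add_coset
          h_pairs_cmp[OF f g h hs[OF v] hs[OF u]] h_pairs_cmp[OF f g h hs[OF v'] hs[OF u]]
          h_pairs_cmp[OF f g h hs[OF hSd_add[OF v v']] hs[OF u]] bilin_add_left ..
    }
    fix F' assume "F' \<in> hom (h_pairs D) x y"
    then obtain u' where F': "F' = cl c f d g u'" and u': "u' \<in> hSd c f d g (l - k)"
      by (auto simp: x y h_pairs_hom f g)
    show "cmp (h_pairs D) x y z G (hadd (h_pairs D) x y F F') =
        hadd (h_pairs D) x z (cmp (h_pairs D) x y z G F) (cmp (h_pairs D) x y z G F')"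
      unfolding x y z F F' G h_pairs_simps(4) coset_add_coset
          h_pairs_cmp[OF f g h hs[OF v] hs[OF u]] h_pairs_cmp[OF f g h hs[OF v] hs[OF u']]
          h_pairs_cmp[OF f g h hs[OF v] hs[OF hSd_add[OF u u']]] bilin_add_right ..
  }
  {
    fix G assume "G \<in> hom (h_pairs D) y z"
    then obtain v where G: "G = cl d g e h v" and v: "v \<in> hSd d g e h (m - l)"
      by (auto simp: y z h_pairs_hom g h)
    show "cmp (h_pairs D) x y z G (hzero (h_pairs D) x y) = hzero (h_pairs D) x z"
      unfolding x y z G h_pairs_simps(5) h_pairs_cmp[OF f g h hs[OF v] hs[OF hSd_zero]] by simp
  }
next
  note hs = subsetD[OF hSd_hS]
  fix x y z w F G K
  assume o: "w \<in> obj (h_pairs D)" "x \<in> obj (h_pairs D)" "y \<in> obj (h_pairs D)" "z \<in> obj (h_pairs D)"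
    and m: "F \<in> hom (h_pairs D) w x" "G \<in> hom (h_pairs D) x y" "K \<in> hom (h_pairs D) y z"
  from o obtain k1 c f k2 d g k3 e h k4 e' k where
    w: "w = (k1, c, f)" and f: "ar c c f" and x: "x = (k2, d, g)" and g: "ar d d g"
    and y: "y = (k3, e, h)" and h: "ar e e h" and z: "z = (k4, e', k)" and k: "ar e' e' k"
    by (auto simp: h_pairs_simps)
  from m obtain a b v where F: "F = cl c f d g a" and a: "a \<in> hSd c f d g (k2 - k1)"
    and G: "G = cl d g e h b" and b: "b \<in> hSd d g e h (k3 - k2)"
    and K: "K = cl e h e' k v" and v: "v \<in> hSd e h e' k (k4 - k3)"
    by (auto simp: w x y z h_pairs_hom f g h k)
  note ba = hs[OF hSd_bilin[OF f g h b a]] and vb = hs[OF hSd_bilin[OF g h k v b]]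
  have "bilin (h_comp D f h k) v (bilin (h_comp D f g h) b a) = bilin (h_comp D f g k) (bilin (h_comp D g h k) v b) a"
    using hs[OF v, unfolded hS_def] hs[OF b, unfolded hS_def] hs[OF a, unfolded hS_def]
  proof (rule bilin_assoc)
    fix t \<theta> r \<rho> p \<sigma>
    assume "ar e e' t \<and> H e e' (t ** h) (k ** t) \<theta>" "ar d e r \<and> H d e (r ** g) (h ** r) \<rho>"
      "ar c d p \<and> H c d (p ** f) (g ** p) \<sigma>"
    then show "h_comp D f h k t \<theta> (fst (h_comp D f g h r \<rho> p \<sigma>)) (snd (h_comp D f g h r \<rho> p \<sigma>)) =
      h_comp D f g k (fst (h_comp D g h k t \<theta> r \<rho>)) (snd (h_comp D g h k t \<theta> r \<rho>)) p \<sigma>"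
      using hcm_assoc[OF f g h k, of p r t \<sigma> \<rho> \<theta>] by (auto simp: h_comp_eq ar_assoc)
  qed
  then show "cmp (h_pairs D) w y z K (cmp (h_pairs D) w x y G F) = cmp (h_pairs D) w x z (cmp (h_pairs D) x y z K G) F"
    unfolding w x y z F G K h_pairs_cmp[OF f g h hs[OF b] hs[OF a]] h_pairs_cmp[OF g h k hs[OF v] hs[OF b]]
      h_pairs_cmp[OF f h k hs[OF v] ba] h_pairs_cmp[OF f g k vb hs[OF a]] by simp
qed

end

text \<open>Allows the composition rule to be exchanged for one that agrees on admissible pairs: the
  vertical trace composes by \<open>hcomp\<close>, the horizontal one by
  \<open>h_comp\<close>.\<close>

lemma coset_comp_cong:
  assumes V: "V \<subseteq> fspan {pair p \<sigma> | p \<sigma>. P p \<sigma>}" and U: "U \<subseteq> fspan {pair p \<sigma> | p \<sigma>. Q p \<sigma>}"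
    and b: "\<And>r \<rho> p \<sigma>. P r \<rho> \<Longrightarrow> Q p \<sigma> \<Longrightarrow> b r \<rho> p \<sigma> = b' r \<rho> p \<sigma>"
  shows "coset_comp N b V U = coset_comp N b' V U"
  unfolding coset_comp_def
proof (rule SUP_cong[OF HOL.refl], rule SUP_cong[OF HOL.refl])
  fix v u assume "v \<in> V" "u \<in> U"
  then have "bilin b v u = bilin b' v u" by (intro bilin_cong[OF subsetD[OF V] subsetD[OF U] b])
  then show "coset N (bilin b v u) = coset N (bilin b' v u)" by simp
qed

lemma UN_coset: "(\<Union>v\<in>coset (fspan G) u. coset (fspan G) v) = coset (fspan G) u"
proof -
  have "coset (fspan G) v = coset (fspan G) u" if "v \<in> coset (fspan G) u" for v
    using that by (simp add: coset_eq_iff) (simp add: coset_def)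
  moreover have "u \<in> coset (fspan G) u" by (simp add: coset_def fspan_eq formal.span_zero)
  ultimately show ?thesis by blast
qed

text \<open>The hom-sets of A and of its image in B are the same sets. The matrix category over A
  therefore inherits associativity and units from B, and a functor that leaves matrices alone is
  fully faithful.\<close>

locale full_embedding = B: preadditive B + A: hom_matrices A
  for B :: "('y, 'h) lincat" and A :: "('x, 'h) lincat" +
  fixes \<iota> :: "'x \<Rightarrow> 'y"
  assumes emb_obj: "x \<in> obj A \<Longrightarrow> \<iota> x \<in> obj B"
    and emb_hom: "x \<in> obj A \<Longrightarrow> y \<in> obj A \<Longrightarrow> hom A x y = hom B (\<iota> x) (\<iota> y)"
    and emb_idt: "x \<in> obj A \<Longrightarrow> idt A x = idt B (\<iota> x)"
    and emb_cmp: "\<lbrakk>x \<in> obj A; y \<in> obj A; z \<in> obj A; f \<in> hom A x y; g \<in> hom A y z\<rbrakk> \<Longrightarrow>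
      cmp A x y z g f = cmp B (\<iota> x) (\<iota> y) (\<iota> z) g f"
    and emb_hadd: "x \<in> obj A \<Longrightarrow> y \<in> obj A \<Longrightarrow> hadd A x y = hadd B (\<iota> x) (\<iota> y)"
    and emb_hzero: "x \<in> obj A \<Longrightarrow> y \<in> obj A \<Longrightarrow> hzero A x y = hzero B (\<iota> x) (\<iota> y)"
begin

lemma map_obj: "X \<in> lists (obj A) \<Longrightarrow> map \<iota> X \<in> lists (obj B)"
  by (auto simp: in_lists_conv_set emb_obj)

lemma mhom_map: "X \<in> lists (obj A) \<Longrightarrow> Y \<in> lists (obj A) \<Longrightarrow> mhom B (map \<iota> X) (map \<iota> Y) = mhom A X Y"
  by (rule set_eqI) (auto simp: A.mhom_iff B.mhom_iff emb_hom A.obj_nth)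

lemma mid_map: "X \<in> lists (obj A) \<Longrightarrow> mid B (map \<iota> X) = mid A X"
  unfolding mid_def by (rule ext) (auto simp: restrict_def emb_idt emb_hzero A.obj_nth)

lemma mcmp_map:
  assumes o: "X \<in> lists (obj A)" "Y \<in> lists (obj A)" "Z \<in> lists (obj A)"
    and M: "M \<in> mhom A X Y" and N: "N \<in> mhom A Y Z"
  shows "mcmp B (map \<iota> X) (map \<iota> Y) (map \<iota> Z) N M = mcmp A X Y Z N M"
proof -
  have "hsum B (\<iota> x) (\<iota> y) hs = hsum A x y hs" if "x \<in> obj A" "y \<in> obj A" for x y hs
    by (induction hs) (simp_all add: hsum_def that emb_hadd emb_hzero)
  then show ?thesis
    unfolding mcmp_def
    by (intro ext)
      (auto simp: restrict_def o A.obj_nth A.mhom_entry[OF M] A.mhom_entry[OF N] emb_cmp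
        intro!: arg_cong[of _ _ "hsum A _ _"])
qed

lemma mid_in: "X \<in> lists (obj A) \<Longrightarrow> mid A X \<in> mhom A X X"
  using B.mid_in[OF map_obj] by (simp add: mid_map mhom_map)

lemma mcmp_in:
  assumes o: "X \<in> lists (obj A)" "Y \<in> lists (obj A)" "Z \<in> lists (obj A)" and m: "M \<in> mhom A X Y" "N \<in> mhom A Y Z"
  shows "mcmp A X Y Z N M \<in> mhom A X Z"
  using B.mcmp_in[OF o[THEN map_obj], of M N] o m by (simp add: mcmp_map mhom_map)

lemma is_category_mat_cat: "is_category (mat_cat A)"
  unfolding is_category_def mat_cat_def cat.simps
proof (intro conjI ballI mid_in mcmp_in)
  fix X Y M assume o: "X \<in> lists (obj A)" "Y \<in> lists (obj A)" and M: "M \<in> mhom A X Y"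
  show "mcmp A X X Y M (mid A X) = M" "mcmp A X Y Y (mid A Y) M = M"
    using B.mid_right[OF o[THEN map_obj], of M] B.mid_left[OF o[THEN map_obj], of M] o M
    by (simp_all add: mcmp_map mhom_map mid_map mid_in)
next
  fix W X Y Z L M N
  assume o: "W \<in> lists (obj A)" "X \<in> lists (obj A)" "Y \<in> lists (obj A)" "Z \<in> lists (obj A)"
    and m: "L \<in> mhom A W X" "M \<in> mhom A X Y" "N \<in> mhom A Y Z"
  show "mcmp A W Y Z N (mcmp A W X Y M L) = mcmp A W X Z (mcmp A X Y Z N M) L"
    using B.mcmp_assoc[OF o[THEN map_obj], of L M N] o m mcmp_in[OF o(1-3) m(1,2)] mcmp_in[OF o(2-4) m(2,3)]
    by (simp add: mcmp_map mhom_map)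
qed

text \<open>On hom-sets F is the identity, hence bijective; a direct sum in B is brought into the
  image by treating its summands separately.\<close>

lemma equivalence:
  assumes F: "omap F = map \<iota>"
    "\<And>X Y M. \<lbrakk>X \<in> lists (obj A); Y \<in> lists (obj A); M \<in> mhom A X Y\<rbrakk> \<Longrightarrow> hmap F X Y M = M"
    and ess: "\<And>y. y \<in> obj B \<Longrightarrow> \<exists>X\<in>lists (obj A). isomorphic (mat_cat B) [y] (map \<iota> X)"
  shows "is_equivalence (mat_cat A) (mat_cat B) F"
proof (rule equivalence_criterion[OF is_category_mat_cat B.is_category_mat_cat])
  show "is_functor (mat_cat A) (mat_cat B) F"
    unfolding is_functor_def mat_cat_def cat.simps F(1)
    using mid_in mcmp_in by (auto simp: F(2) map_obj mhom_map mid_map mcmp_map)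
  fix X Y assume "X \<in> obj (mat_cat A)" "Y \<in> obj (mat_cat A)"
  then have o: "X \<in> lists (obj A)" "Y \<in> lists (obj A)" by (simp_all add: mat_cat_def)
  have "bij_betw (hmap F X Y) (mhom A X Y) (mhom A X Y)"
    by (rule bij_betw_cong[THEN iffD2, OF _ bij_betw_id]) (simp add: F(2) o)
  then show "bij_betw (hmap F X Y) (hom (mat_cat A) X Y) (hom (mat_cat B) (omap F X) (omap F Y))"
    by (simp add: mat_cat_def F(1) mhom_map o)
next
  fix Y assume "Y \<in> obj (mat_cat B)"
  then have Y: "Y \<in> lists (obj B)" by (simp add: mat_cat_def)
  from ess obtain X where X: "\<And>y. y \<in> obj B \<Longrightarrow> X y \<in> lists (obj A)"
    "\<And>y. y \<in> obj B \<Longrightarrow> isomorphic (mat_cat B) [y] (map \<iota> (X y))" by metis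
  have "isomorphic (mat_cat B) Y (concat (map (\<lambda>y. map \<iota> (X y)) Y))"
    by (rule B.isomorphic_concat) (use X Y in \<open>auto simp: in_lists_conv_set intro: emb_obj\<close>)
  moreover have "concat (map (\<lambda>y. map \<iota> (X y)) Y) = omap F (concat (map X Y))"
    by (simp add: F(1) map_concat comp_def)
  moreover have "concat (map X Y) \<in> obj (mat_cat A)"
    using X(1) Y by (auto simp: mat_cat_def in_lists_conv_set)
  ultimately show "\<exists>X\<in>obj (mat_cat A). \<exists>f. is_iso (mat_cat B) (omap F X) Y f"
    using isomorphic_sym unfolding isomorphic_def by metis
qed

end

context gl2
begin

subsection \<open>The vertical trace as a full subcategory\<close>

lemma hom_units:
  assumes "ar c d p"
  shows "p ** U c = p" "U d ** p = p"
  using assms ar_unit_left ar_unit_right by auto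

text \<open>When both end 1-morphisms are identities, the whiskerings drop out and cyclicity becomes
  fg - gf. The two families then differ only by the names of the two 1-morphisms.\<close>

lemma v_null_eq:
  assumes c: "c \<in> obj2 D" and d: "d \<in> obj2 D"
  shows "v_null D c d = fspan (hG c (U c) d (U d))"
proof -
  have a: "ar c d p \<longleftrightarrow> p \<in> one D c d" for p using c d by (simp add: ar_def)
  have r: "rw p p' (U c) \<tau> = \<tau>" "lw (U d) p p' \<tau> = \<tau>"
    if "p \<in> one D c d" "p' \<in> one D c d" "\<tau> \<in> two D p p'" for p p' \<tau>
    using that rw_unit[of c d p p' \<tau>] lw_unit[of c d p p' \<tau>] by (auto simp: H_def a)
  have u: "p ** U c = p" "U d ** p = p" if "p \<in> one D c d" for p
    using that hom_units[of c d p] by (simp_all add: a)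
  have 1: "{pair p (add2 D p p \<sigma> \<sigma>') - pair p \<sigma> - pair p \<sigma>' | p \<sigma> \<sigma>'.
         p \<in> one D c d \<and> \<sigma> \<in> two D p p \<and> \<sigma>' \<in> two D p p} =
     {pair p (add2 D (p ** U c) (U d ** p) \<sigma> \<sigma>') - pair p \<sigma> - pair p \<sigma>' | p \<sigma> \<sigma>'.
         p \<in> one D c d \<and> \<sigma> \<in> two D (p ** U c) (U d ** p) \<and> \<sigma>' \<in> two D (p ** U c) (U d ** p)}"
    by (intro Collect_cong ex_cong1) (auto simp: u)
  have 2: "{pair p (scale2 D p p z \<sigma>) - fscale z (pair p \<sigma>) | p z \<sigma>.
         p \<in> one D c d \<and> \<sigma> \<in> two D p p} =
     {pair p (scale2 D (p ** U c) (U d ** p) z \<sigma>) - fscale z (pair p \<sigma>) | p z \<sigma>.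
         p \<in> one D c d \<and> \<sigma> \<in> two D (p ** U c) (U d ** p)}"
    by (intro Collect_cong ex_cong1) (auto simp: u)
  have 3: "{pair p' (vc p' p p' f g) - pair p (vc p p' p g f) | p p' f g.
         p \<in> one D c d \<and> p' \<in> one D c d \<and> f \<in> two D p p' \<and> g \<in> two D p' p} =
    {pair p (vc (p ** U c) (p' ** U c) (U d ** p) \<sigma> (rw p p' (U c) \<tau>)) -
       pair p' (vc (p' ** U c) (U d ** p) (U d ** p') (lw (U d) p p' \<tau>) \<sigma>)
       | p p' \<tau> \<sigma>. p \<in> one D c d \<and> p' \<in> one D c d \<and> \<tau> \<in> two D p p' \<and>
         \<sigma> \<in> two D (p' ** U c) (U d ** p)}" (is "?A = ?B")
  proof -
    have "?B = {pair p (vc p p' p \<sigma> \<tau>) - pair p' (vc p' p p' \<tau> \<sigma>)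
       | p p' \<tau> \<sigma>. p \<in> one D c d \<and> p' \<in> one D c d \<and> \<tau> \<in> two D p p' \<and> \<sigma> \<in> two D p' p}"
      by (intro Collect_cong ex_cong1) (auto simp: u r)
    also have "\<dots> = ?A"
      by (rule set_eqI) blast
    finally show ?thesis by simp
  qed
  show ?thesis unfolding v_null_def hG_def 1 2 3 ..
qed

lemma v_pairs_hom:
  assumes c: "c \<in> obj2 D" and d: "d \<in> obj2 D"
  shows "hom (v_pairs D) (k, c) (l, d) = hom (h_pairs D) (k, c, U c) (l, d, U d)"
proof -
  have a: "ar c d p \<longleftrightarrow> p \<in> one D c d" for p using c d by (simp add: ar_def)
  have u: "p ** U c = p" "U d ** p = p" if "p \<in> one D c d" for p
    using that hom_units[of c d p] by (simp_all add: a)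
  have "{pair p \<sigma> | p \<sigma>. p \<in> one D c d \<and> \<sigma> \<in> two_deg D p p (l - k)} =
    {pair p \<sigma> | p \<sigma>. p \<in> one D c d \<and> \<sigma> \<in> two_deg D (p ** U c) (U d ** p) (l - k)}"
    by (intro Collect_cong ex_cong1) (auto simp: u)
  then show ?thesis
    by (simp add: v_pairs_def h_pairs_def v_hom_def h_hom_def v_null_eq c d h_null_eq)
qed

lemma h_comp_units:
  assumes "ar c d p" "H c d (p ** U c) (U d ** p) \<sigma>" "ar d e r" "H d e (r ** U d) (U e ** r) \<rho>"
  shows "h_comp D (U c) (U d) (U e) r \<rho> p \<sigma> = (r ** p, hcomp D r r p p \<rho> \<sigma>)"
proof -
  note u = hom_units[OF assms(1)] hom_units[OF assms(3)]
  have "H c d p p \<sigma>" "H d e r r \<rho>" using assms by (simp_all add: u)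
  then show ?thesis
    using exch2 by (simp add: h_comp_eq hcm_def u hom_units(2)[OF ar_comp[OF assms(1,3)]])
qed

text \<open>Relations are themselves combinations of well-typed pairs, so every element of a coset
  is well-typed. This is what \<open>coset_comp_cong\<close> asks for.\<close>

lemma hom_subset: "\<lbrakk>ar c c f; ar d d g; F \<in> hom (h_pairs D) (k, c, f) (l, d, g)\<rbrakk> \<Longrightarrow> F \<subseteq> hS c f d g"
proof
  fix x assume f: "ar c c f" and g: "ar d d g" and "F \<in> hom (h_pairs D) (k, c, f) (l, d, g)" "x \<in> F"
  then obtain u where "u \<in> hS c f d g" "x - u \<in> fspan (hG c f d g)"
    using subsetD[OF hSd_hS, of _ c f d g "l - k"] unfolding h_pairs_hom[OF f g] coset_def by blast
  moreover have "x - u \<in> hS c f d g" using null_hS[OF f g] calculation by auto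
  ultimately show "x \<in> hS c f d g"
    unfolding hS_def fspan_eq using formal.span_add by fastforce
qed

text \<open>Since \<open>h_pairs\<close> is already known to be preadditive, composition in
  \<open>v_pairs\<close> only has to be compared with composition there; the difference between the
  two rules is settled by \<open>h_comp_units\<close>.\<close>

sublocale trace: full_embedding "h_pairs D" "v_pairs D" "\<lambda>(k, c). (k, c, U c)"
proof (rule full_embedding.intro[OF preadditive_h_pairs], unfold_locales)
  fix x assume "x \<in> obj (v_pairs D)"
  then obtain k c where x: "x = (k, c)" and c: "c \<in> obj2 D" by (auto simp: v_pairs_def)
  note ac = ar_unit[OF c]
  show "(case x of (k, c) \<Rightarrow> (k, c, U c)) \<in> obj (h_pairs D)" by (simp add: x h_pairs_simps ac)
  show "idt (v_pairs D) x = idt (h_pairs D) (case x of (k, c) \<Rightarrow> (k, c, U c))"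
    by (simp add: x v_pairs_def h_pairs_def v_null_eq h_null_eq c)
  fix y assume "y \<in> obj (v_pairs D)"
  then obtain l d where y: "y = (l, d)" and d: "d \<in> obj2 D" by (auto simp: v_pairs_def)
  note ad = ar_unit[OF d]
  show "hom (v_pairs D) x y = hom (h_pairs D) (case x of (k, c) \<Rightarrow> (k, c, U c)) (case y of (k, c) \<Rightarrow> (k, c, U c))"
    by (simp add: x y v_pairs_hom c d)
  show "hadd (v_pairs D) x y = hadd (h_pairs D) (case x of (k, c) \<Rightarrow> (k, c, U c)) (case y of (k, c) \<Rightarrow> (k, c, U c))"
    "hzero (v_pairs D) x y = hzero (h_pairs D) (case x of (k, c) \<Rightarrow> (k, c, U c)) (case y of (k, c) \<Rightarrow> (k, c, U c))"
    by (simp_all add: x y v_pairs_def h_pairs_def v_null_eq h_null_eq c d)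
  fix z f g assume "z \<in> obj (v_pairs D)" and f: "f \<in> hom (v_pairs D) x y" and g: "g \<in> hom (v_pairs D) y z"
  then obtain m e where z: "z = (m, e)" and e: "e \<in> obj2 D" by (auto simp: v_pairs_def)
  note ae = ar_unit[OF e]
  have f: "f \<subseteq> hS c (U c) d (U d)" using f hom_subset[OF ac ad] by (simp add: x y v_pairs_hom c d)
  have g: "g \<subseteq> hS d (U d) e (U e)" using g hom_subset[OF ad ae] by (simp add: y z v_pairs_hom d e)
  have "coset_comp (fspan (hG c (U c) e (U e))) (\<lambda>r \<rho> p \<sigma>. (r ** p, hcomp D r r p p \<rho> \<sigma>)) g f =
    coset_comp (fspan (hG c (U c) e (U e))) (h_comp D (U c) (U d) (U e)) g f"
    by (rule coset_comp_cong[OF g[unfolded hS_def] f[unfolded hS_def]]) (auto simp: h_comp_units)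
  then show "cmp (v_pairs D) x y z g f = cmp (h_pairs D) (case x of (k, c) \<Rightarrow> (k, c, U c))
    (case y of (k, c) \<Rightarrow> (k, c, U c)) (case z of (k, c) \<Rightarrow> (k, c, U c)) g f"
    by (simp add: x y z h_pairs_simps) (simp add: v_pairs_def v_null_eq c e)
qed

text \<open>The null spaces of the two traces agree, so the union over representatives in
  \<open>trace_inclusion\<close> returns the coset it starts from. What remains is essential
  surjectivity on single objects.\<close>

lemma trace_equivalence:
  assumes "\<And>k c f. ar c c f \<Longrightarrow> \<exists>L. set L \<subseteq> UNIV \<times> obj2 D \<and>
    isomorphic (hTr D) [(k, c, f)] (map (\<lambda>(k, c). (k, c, U c)) L)"
  shows "is_equivalence (vTr D) (hTr D) (trace_inclusion D)"
  unfolding vTr_def hTr_def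
proof (rule trace.equivalence)
  show "omap (trace_inclusion D) = map (\<lambda>(k, c). (k, c, U c))" by (simp add: trace_inclusion_def)
next
  fix y assume "y \<in> obj (h_pairs D)"
  then obtain k c f where y: "y = (k, c, f)" "ar c c f" by (auto simp: h_pairs_simps)
  have "obj (v_pairs D) = UNIV \<times> obj2 D" by (simp add: v_pairs_def)
  then show "\<exists>X\<in>lists (obj (v_pairs D)). isomorphic (mat_cat (h_pairs D)) [y] (map (\<lambda>(k, c). (k, c, U c)) X)"
    using assms[OF y(2), of k] unfolding y hTr_def lists_eq_set by auto
next
  fix X Y M assume o: "X \<in> lists (obj (v_pairs D))" "Y \<in> lists (obj (v_pairs D))"
    and M: "M \<in> mhom (v_pairs D) X Y"
  show "hmap (trace_inclusion D) X Y M = M"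
  proof (rule ext)
    fix x :: "nat \<times> nat"
    obtain i j where x: "x = (i, j)" by force
    show "hmap (trace_inclusion D) X Y M x = M x"
    proof (cases "i < length Y \<and> j < length X")
      case True
      obtain k c where c: "X ! j = (k, c)" "c \<in> obj2 D"
        using trace.A.obj_nth[OF o(1), of j] True by (cases "X ! j") (auto simp: v_pairs_def)
      obtain l d where d: "Y ! i = (l, d)" "d \<in> obj2 D"
        using trace.A.obj_nth[OF o(2), of i] True by (cases "Y ! i") (auto simp: v_pairs_def)
      have "M (i, j) \<in> hom (v_pairs D) (X ! j) (Y ! i)" using M True by (auto dest: trace.A.mhom_entry)
      then obtain u where "M (i, j) = cl c (U c) d (U d) u"
        by (auto simp: c d v_pairs_hom h_pairs_hom ar_unit)
      then show ?thesis
        using True UN_coset[of "hG c (U c) d (U d)" u] by (simp add: x trace_inclusion_def c d h_null_eq)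
    next
      case False
      have "M \<in> extensional ({..<length Y} \<times> {..<length X})" using M by (simp add: trace.A.mhom_iff)
      then show ?thesis using False by (auto simp: x trace_inclusion_def extensional_def)
    qed
  qed
qed

subsection \<open>Cyclicity and direct sums in the horizontal trace\<close>

lemma h_pairs_cmp_pair:
  assumes "ar c c f" "ar d d g" "ar e e h" "ar d e r" "H d e (r ** g) (h ** r) \<rho>"
    "ar c d p" "H c d (p ** f) (g ** p) \<sigma>"
  shows "cmp (h_pairs D) (k, c, f) (l, d, g) (m, e, h) (cl d g e h (pair r \<rho>)) (cl c f d g (pair p \<sigma>)) =
    cl c f e h (pair (r ** p) (hcm f g h r \<rho> p \<sigma>))"
  using h_pairs_cmp[OF assms(1-3) hS_base[OF assms(4,5)] hS_base[OF assms(6,7)]]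
  by (simp add: bilin_pair h_comp_eq)

lemma hTr_isoI:
  assumes o: "x \<in> obj (h_pairs D)" "y \<in> obj (h_pairs D)"
    and "F \<in> hom (h_pairs D) x y" "G \<in> hom (h_pairs D) y x"
    and "cmp (h_pairs D) x y x G F = idt (h_pairs D) x" "cmp (h_pairs D) y x y F G = idt (h_pairs D) y"
  shows "isomorphic (hTr D) [x] [y]"
  unfolding hTr_def
proof (rule trace.B.isomorphic_splitI[of x "[y]" "\<lambda>_. F" "\<lambda>_. G"])
  show "hsum (h_pairs D) x x (map (\<lambda>i. cmp (h_pairs D) x ([y] ! i) x G F) [0..<length [y]]) = idt (h_pairs D) x"
    using assms trace.B.idt_in[OF o(1)] by (simp add: hsum_def trace.B.add_zero)
qed (use assms in auto)

text \<open>The counit \<epsilon> and the unit \<eta> make \<open>fs\<close> a left adjoint of f.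
  The isomorphism is f with the identity of f g f, and its inverse is \<open>fs\<close> with
  \<sigma> = (g\<eta>)(\<epsilon>g); the opposite degrees of \<epsilon> and \<eta> give \<sigma>
  degree 0. In each composite, cyclicity carries \<epsilon> or \<eta> around the annulus, where it
  meets its partner in the triangle identity for f.\<close>

lemma rotate:
  assumes f: "ar c d f" and fs: "ar d c fs" and g: "ar d c g"
    and \<epsilon>: "HD c c (fs ** f) (U c) m \<epsilon>" and \<eta>: "HD d d (U d) (f ** fs) (- m) \<eta>"
    and zigzag: "vc f (f ** fs ** f) f (lw f (fs ** f) (U c) \<epsilon>) (rw (U d) (f ** fs) f \<eta>) = idm f"
  shows "isomorphic (hTr D) [(k, c, g ** f)] [(k, d, f ** g)]"
proof -
  have gf: "ar c c (g ** f)" and fg: "ar d d (f ** g)" using ar_comp f g by blast+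
  have o: "c \<in> obj2 D" "d \<in> obj2 D" using f by (auto simp: ar_def)
  note \<epsilon>' = HD_H[OF \<epsilon>] and \<eta>' = HD_H[OF \<eta>]
  define \<sigma> where "\<sigma> = vc (fs ** f ** g) g (g ** f ** fs) (lw g (U d) (f ** fs) \<eta>) (rw (fs ** f) (U c) g \<epsilon>)"
  have eg: "HD d c (fs ** f ** g) g m (rw (fs ** f) (U c) g \<epsilon>)"
    using HD_rw[OF \<epsilon> g] by (simp add: ar_unit_left[OF g] ar_assoc[OF g f fs])
  have ge: "HD d c g (g ** f ** fs) (- m) (lw g (U d) (f ** fs) \<eta>)"
    using HD_lw[OF \<eta> g] by (simp add: ar_unit_right[OF g])
  have \<sigma>d: "HD d c (fs ** f ** g) (g ** f ** fs) 0 \<sigma>"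
    using HD_vc[OF eg ge] by (simp add: \<sigma>_def)
  have id1: "HD c d (f ** g ** f) (f ** g ** f) 0 (idm (f ** g ** f))" by (rule HD_id[OF ar_comp[OF gf f]])
  have a1: "(f ** g) ** f = f ** g ** f" by (rule ar_assoc[OF f g f])
  have a2: "(g ** f) ** fs = g ** f ** fs" by (rule ar_assoc[OF fs f g])
  let ?F = "cl c (g ** f) d (f ** g) (pair f (idm (f ** g ** f)))"
  let ?G = "cl d (f ** g) c (g ** f) (pair fs \<sigma>)"
  have Fi: "?F \<in> hom (h_pairs D) (k, c, g ** f) (k, d, f ** g)"
    unfolding h_pairs_hom[OF gf fg] by (intro imageI) (rule hSd_base, use f id1 a1 in auto)
  have Gi: "?G \<in> hom (h_pairs D) (k, d, f ** g) (k, c, g ** f)"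
    unfolding h_pairs_hom[OF fg gf] by (intro imageI) (rule hSd_base, use fs \<sigma>d a2 in auto)
  have zz: "vc f (f ** fs ** f) f (lw f (fs ** f) (U c) \<epsilon>) (rw (U d) (f ** fs) f \<eta>) = idm f" by (rule zigzag)
  have E1: "H c d (f ** fs ** f) f (lw f (fs ** f) (U c) \<epsilon>)"
    using H_lw[OF \<epsilon>' f] by (simp add: ar_unit_right[OF f])
  have N1: "H c d f (f ** fs ** f) (rw (U d) (f ** fs) f \<eta>)"
    using H_rw[OF \<eta>' f] by (simp add: ar_unit_left[OF f] ar_assoc[OF f fs f])
  have GF: "cmp (h_pairs D) (k, c, g ** f) (k, d, f ** g) (k, c, g ** f) ?G ?F = idt (h_pairs D) (k, c, g ** f)"
  proof -
    have h: "hcm (g ** f) (f ** g) (g ** f) fs \<sigma> f (idm (f ** g ** f)) = rw (fs ** f ** g) (g ** f ** fs) f \<sigma>"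
    proof -
      have "H c c (fs ** f ** g ** f) (g ** f ** fs ** f) (rw (fs ** f ** g) (g ** f ** fs) f \<sigma>)"
        using H_rw[OF HD_H[OF \<sigma>d] f]
        by (simp add: ar_assoc[OF f ar_comp[OF g f] fs] ar_assoc[OF f g f] ar_assoc[OF f ar_comp[OF fs f] g] ar_assoc[OF f fs f])
      from vc_id_right[OF this] show ?thesis
        by (simp add: hcm_def a1 a2 lw_id[OF ar_comp[OF gf f] fs] ar_assoc[OF ar_comp[OF f fs] f g])
    qed
    have T: "H c c (fs ** f) (U c) \<epsilon>" by (rule \<epsilon>')
    define S where "S = rw g (g ** f ** fs) f (lw g (U d) (f ** fs) \<eta>)"
    have S: "H c c (g ** f) (g ** f ** fs ** f) S"
      using H_rw[OF HD_H[OF ge] f] unfolding S_def by (simp add: ar_assoc[OF f ar_comp[OF fs f] g] ar_assoc[OF f fs f])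
    have Seq: "S = lw g f (f ** fs ** f) (rw (U d) (f ** fs) f \<eta>)"
      using lw_rw[OF \<eta>' f g] by (simp add: S_def ar_unit_left[OF f] ar_unit_right[OF g] ar_assoc[OF f fs f])
    have e: "rw (fs ** f ** g) (g ** f ** fs) f \<sigma> =
      vc ((fs ** f) ** g ** f) (U c ** g ** f) ((g ** f) ** fs ** f) S (rw (fs ** f) (U c) (g ** f) \<epsilon>)"
      using rw_vc[OF HD_H[OF eg] HD_H[OF ge] f] rw_rw[OF \<epsilon>' g f]
      by (simp add: \<sigma>_def S_def ar_unit_left[OF g] ar_unit_left[OF gf] ar_assoc[OF g f fs] ar_assoc[OF gf f fs]
        ar_assoc[OF f ar_comp[OF g f] fs] a1 ar_assoc[OF f ar_comp[OF fs f] g] ar_assoc[OF f fs f] ar_assoc[OF ar_comp[OF f fs] f g])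
    have S': "H c c (U c ** g ** f) ((g ** f) ** fs ** f) S"
      using S by (simp add: ar_unit_left[OF gf] ar_assoc[OF ar_comp[OF f fs] f g])
    have r: "vc (U c ** g ** f) ((g ** f) ** fs ** f) ((g ** f) ** U c) (lw (g ** f) (fs ** f) (U c) \<epsilon>) S = idm (g ** f)"
      using lw_vc[OF N1 E1 g] lw_lw[OF \<epsilon>' f g] lw_id[OF f g] zz
      by (simp add: Seq ar_unit_left[OF gf] ar_unit_right[OF gf] ar_unit_right[OF f] ar_assoc[OF ar_comp[OF f fs] f g])
    \<comment> \<open>Cyclicity for \<epsilon> replaces the 1-morphism \<open>fs ** f\<close> by the
      identity of c; on the other side of \<open>S\<close> = g\<eta>f, \<epsilon> completes the
      triangle identity.\<close>
    have "cl c (g ** f) c (g ** f) (pair (fs ** f) (rw (fs ** f ** g) (g ** f ** fs) f \<sigma>)) =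
      cl c (g ** f) c (g ** f) (pair (U c) (idm (g ** f)))"
      unfolding coset_eq_iff e r[symmetric] by (rule null_cyc[OF \<epsilon>' S'])
    then show ?thesis
      by (subst h_pairs_cmp_pair[OF gf fg gf fs _ f]) 
        (use HD_H[OF \<sigma>d] HD_H[OF id1] in \<open>simp_all add: h h_pairs_simps a1 a2\<close>)
  qed
  have FG: "cmp (h_pairs D) (k, d, f ** g) (k, c, g ** f) (k, d, f ** g) ?F ?G = idt (h_pairs D) (k, d, f ** g)"
  proof -
    have h: "hcm (f ** g) (g ** f) (f ** g) f (idm (f ** g ** f)) fs \<sigma> = lw f (fs ** f ** g) (g ** f ** fs) \<sigma>"
    proof -
      have "H d d (f ** fs ** f ** g) (f ** g ** f ** fs) (lw f (fs ** f ** g) (g ** f ** fs) \<sigma>)"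
        by (rule H_lw[OF HD_H[OF \<sigma>d] f])
      from vc_id_left[OF this] show ?thesis
        using rw_id[OF ar_comp[OF gf f] fs]
        by (simp add: hcm_def a1 a2 ar_assoc[OF fs gf f] ar_assoc[OF ar_comp[OF fs f] g f])
    qed
    define S where "S = lw f (fs ** f ** g) g (rw (fs ** f) (U c) g \<epsilon>)"
    have S: "H d d ((f ** fs) ** f ** g) ((f ** g) ** U d) S"
      using H_lw[OF HD_H[OF eg] f] by (simp add: S_def ar_unit_right[OF fg] ar_assoc[OF fg fs f])
    have Seq: "S = rw (f ** fs ** f) f g (lw f (fs ** f) (U c) \<epsilon>)"
      using lw_rw[OF \<epsilon>' g f] by (simp add: S_def ar_unit_left[OF g] ar_unit_right[OF f] ar_assoc[OF g f fs])
    have e: "lw f (fs ** f ** g) (g ** f ** fs) \<sigma> =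
      vc ((f ** fs) ** f ** g) ((f ** g) ** U d) ((f ** g) ** f ** fs) (lw (f ** g) (U d) (f ** fs) \<eta>) S"
      using lw_vc[OF HD_H[OF eg] HD_H[OF ge] f] lw_lw[OF \<eta>' g f]
      by (simp add: \<sigma>_def S_def ar_unit_right[OF g] ar_unit_right[OF fg] ar_assoc[OF fg fs f] ar_assoc[OF ar_comp[OF fs f] g f])
    have r: "vc (U d ** f ** g) ((f ** fs) ** f ** g) ((f ** g) ** U d) S (rw (U d) (f ** fs) (f ** g) \<eta>) = idm (f ** g)"
      using rw_vc[OF N1 E1 g] rw_rw[OF \<eta>' f g] rw_id[OF f g] zz
      by (simp add: Seq ar_unit_left[OF fg] ar_unit_right[OF fg] ar_unit_left[OF f] ar_assoc[OF fg fs f]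
        ar_assoc[OF f fs f] ar_assoc[OF g ar_comp[OF f fs] f] ar_assoc[OF g f fs])
    \<comment> \<open>The same with \<eta>, which leads from the identity of d to
      \<open>f ** fs\<close>.\<close>
    have "cl d (f ** g) d (f ** g) (pair (U d) (idm (f ** g))) =
      cl d (f ** g) d (f ** g) (pair (f ** fs) (lw f (fs ** f ** g) (g ** f ** fs) \<sigma>))"
      unfolding coset_eq_iff e r[symmetric] by (rule null_cyc[OF \<eta>' S])
    then show ?thesis
      by (subst h_pairs_cmp_pair[OF fg gf fg f _ fs])
        (use HD_H[OF \<sigma>d] HD_H[OF id1] in \<open>simp_all add: h h_pairs_simps a1 a2\<close>)
  qed
  show ?thesis
    by (rule hTr_isoI[OF _ _ Fi Gi GF FG]) (use gf fg in \<open>simp_all add: h_pairs_simps\<close>)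
qed

text \<open>The canonical functor from the endomorphisms of c and their 2-morphisms to the
  horizontal trace: a 2-morphism is paired with the identity 1-morphism.\<close>

definition emb :: "'o \<Rightarrow> 'p \<Rightarrow> 'p \<Rightarrow> 'm \<Rightarrow> ('p, 'm) formal set" where
  "emb c f g \<sigma> = cl c f c g (pair (U c) \<sigma>)"

lemma emb_in: "\<lbrakk>ar c c f; ar c c g; HD c c f g (l - k) \<sigma>\<rbrakk> \<Longrightarrow> emb c f g \<sigma> \<in> hom (h_pairs D) (k, c, f) (l, c, g)"
  unfolding emb_def h_pairs_hom
  by (intro imageI hSd_base) (auto simp: ar_unit_left ar_unit_right, auto simp: ar_def intro: unit_in)

lemma emb_cmp: "H c c f g \<sigma> \<Longrightarrow> H c c g h \<rho> \<Longrightarrow>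
   cmp (h_pairs D) (k, c, f) (l, c, g) (m, c, h) (emb c g h \<rho>) (emb c f g \<sigma>) = emb c f h (vc f g h \<rho> \<sigma>)"
proof -
  assume s: "H c c f g \<sigma>" and r: "H c c g h \<rho>"
  have f: "ar c c f" and g: "ar c c g" and h: "ar c c h" using s r by (auto simp: H_def)
  have u: "ar c c (U c)" using f by (auto simp: ar_def intro: unit_in)
  note us = ar_unit_left[OF f] ar_unit_left[OF g] ar_unit_left[OF h] ar_unit_right[OF f] ar_unit_right[OF g]
    ar_unit_right[OF h] ar_unit_left[OF u]
  show ?thesis
    unfolding emb_def
    by (subst h_pairs_cmp_pair[OF f g h u _ u])
      (use s r in \<open>simp_all add: us hcm_def rw_unit lw_unit\<close>)
qed

lemma emb_add: "H c c f g \<sigma> \<Longrightarrow> H c c f g \<rho> \<Longrightarrow>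
    hadd (h_pairs D) (k, c, f) (l, c, g) (emb c f g \<sigma>) (emb c f g \<rho>) = emb c f g (add2 D f g \<sigma> \<rho>)"
proof -
  assume s: "H c c f g \<sigma>" and r: "H c c f g \<rho>"
  have f: "ar c c f" and g: "ar c c g" using s r by (auto simp: H_def)
  have u: "ar c c (U c)" using f by (auto simp: ar_def intro: unit_in)
  note us = ar_unit_left[OF f] ar_unit_right[OF g]
  have "pair (U c) (add2 D f g \<sigma> \<rho>) - pair (U c) \<sigma> - pair (U c) \<rho> \<in> fspan (hG c f c g)"
    using null_add[OF u, of f g \<sigma> \<rho>] s r by (simp add: us)
  then have "cl c f c g (pair (U c) (add2 D f g \<sigma> \<rho>)) = cl c f c g (pair (U c) \<sigma> + pair (U c) \<rho>)"
    by (simp add: coset_eq_iff diff_diff_eq)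
  then show ?thesis by (simp add: emb_def h_pairs_simps coset_add_coset)
qed

lemma emb_zero: "ar c c f \<Longrightarrow> ar c c g \<Longrightarrow> emb c f g (Z f g) = hzero (h_pairs D) (k, c, f) (l, c, g)"
proof -
  assume f: "ar c c f" and g: "ar c c g"
  have u: "ar c c (U c)" using f by (auto simp: ar_def intro: unit_in)
  note us = ar_unit_left[OF f] ar_unit_right[OF g]
  have "pair (U c) (Z f g) - fscale 0 (pair (U c) (Z f g)) \<in> fspan (hG c f c g)"
    using null_scale[OF u, of f g "Z f g" 0] H_zero[OF f g] scale_zero[OF H_zero[OF f g]] by (simp add: us)
  then show ?thesis by (simp add: emb_def h_pairs_simps coset_eq_iff fscale_single)
qed

text \<open>A splitting of p into shifted summands, with projections \<alpha> and inclusions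
  \<beta>. The integer attached to a summand is the degree of its projection, which becomes its
  shift in the horizontal trace.\<close>

definition decomposes :: "'o \<Rightarrow> 'o \<Rightarrow> 'p \<Rightarrow> (int \<times> 'p) list \<Rightarrow> bool" where
  "decomposes c d p L \<longleftrightarrow> ar c d p \<and> (\<exists>\<alpha> \<beta>.
     (\<forall>i<length L. HD c d p (snd (L ! i)) (fst (L ! i)) (\<alpha> i) \<and> HD c d (snd (L ! i)) p (- fst (L ! i)) (\<beta> i)) \<and>
     (\<forall>i<length L. \<forall>j<length L. vc (snd (L ! j)) p (snd (L ! i)) (\<alpha> i) (\<beta> j) =
        (if i = j then idm (snd (L ! i)) else Z (snd (L ! j)) (snd (L ! i)))) \<and>
     foldr (add2 D p p) (map (\<lambda>i. vc p (snd (L ! i)) p (\<beta> i) (\<alpha> i)) [0..<length L]) (Z p p) = idm p)"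

lemma decomposesE:
  assumes "decomposes c d p L"
  obtains \<alpha> \<beta> where "ar c d p"
    "\<And>i. i < length L \<Longrightarrow> HD c d p (snd (L ! i)) (fst (L ! i)) (\<alpha> i)"
    "\<And>i. i < length L \<Longrightarrow> HD c d (snd (L ! i)) p (- fst (L ! i)) (\<beta> i)"
    "\<And>i j. i < length L \<Longrightarrow> j < length L \<Longrightarrow> vc (snd (L ! j)) p (snd (L ! i)) (\<alpha> i) (\<beta> j) =
        (if i = j then idm (snd (L ! i)) else Z (snd (L ! j)) (snd (L ! i)))"
    "foldr (add2 D p p) (map (\<lambda>i. vc p (snd (L ! i)) p (\<beta> i) (\<alpha> i)) [0..<length L]) (Z p p) = idm p"
  using assms unfolding decomposes_def by blast

lemma decomposesI:
  assumes "ar c d p" "\<And>i. i < length L \<Longrightarrow> L ! i = (k i, q i)"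
    "\<And>i. i < length L \<Longrightarrow> HD c d p (q i) (k i) (\<alpha> i)"
    "\<And>i. i < length L \<Longrightarrow> HD c d (q i) p (- k i) (\<beta> i)"
    "\<And>i j. i < length L \<Longrightarrow> j < length L \<Longrightarrow> vc (q j) p (q i) (\<alpha> i) (\<beta> j) =
        (if i = j then idm (q i) else Z (q j) (q i))"
    "foldr (add2 D p p) (map (\<lambda>i. vc p (q i) p (\<beta> i) (\<alpha> i)) [0..<length L]) (Z p p) = idm p"
  shows "decomposes c d p L"
proof -
  have "map (\<lambda>i. vc p (snd (L ! i)) p (\<beta> i) (\<alpha> i)) [0..<length L] =
      map (\<lambda>i. vc p (q i) p (\<beta> i) (\<alpha> i)) [0..<length L]"
    by (simp add: assms(2))
  then have "foldr (add2 D p p) (map (\<lambda>i. vc p (snd (L ! i)) p (\<beta> i) (\<alpha> i)) [0..<length L]) (Z p p) = idm p"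
    using assms(6) by (simp only:)
  then show ?thesis
    unfolding decomposes_def using assms(1-5) by (intro conjI, simp) (rule exI[of _ \<alpha>], rule exI[of _ \<beta>], simp)
qed

lemma H_foldr: "ar c d p \<Longrightarrow> (\<And>s. s \<in> set xs \<Longrightarrow> H c d p p s) \<Longrightarrow> H c d p p (foldr (add2 D p p) xs (Z p p))"
  by (induction xs) (auto intro: H_zero H_add)

lemma foldr_lw: "ar c d p \<Longrightarrow> ar d e r \<Longrightarrow> (\<And>s. s \<in> set xs \<Longrightarrow> H c d p p s) \<Longrightarrow>
    lw r p p (foldr (add2 D p p) xs (Z p p)) =
    foldr (add2 D (r ** p) (r ** p)) (map (lw r p p) xs) (Z (r ** p) (r ** p))"
proof (induction xs)
  case (Cons s xs)
  have "H c d p p s" "H c d p p (foldr (add2 D p p) xs (Z p p))" using Cons.prems by (auto intro: H_foldr)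
  then show ?case using Cons by (simp add: lw_add[of c d p p _ _ e r])
qed (simp add: lw_zero[of c d])

lemma foldr_rw: "ar d e p \<Longrightarrow> ar c d r \<Longrightarrow> (\<And>s. s \<in> set xs \<Longrightarrow> H d e p p s) \<Longrightarrow>
    rw p p r (foldr (add2 D p p) xs (Z p p)) =
    foldr (add2 D (p ** r) (p ** r)) (map (rw p p r) xs) (Z (p ** r) (p ** r))"
proof (induction xs)
  case (Cons s xs)
  have "H d e p p s" "H d e p p (foldr (add2 D p p) xs (Z p p))" using Cons.prems by (auto intro: H_foldr)
  then show ?case using Cons by (simp add: rw_add[of d e p p _ _ c r])
qed (simp add: rw_zero[of d e])

text \<open>Whiskering is an additive functor that preserves degrees, so it can be applied to all
  projections and inclusions at once.\<close>

lemma decomposes_lw: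
  assumes "decomposes c d p L" and r: "ar d e r"
  shows "decomposes c e (r ** p) (map (\<lambda>(k, q). (k, r ** q)) L)"
  using assms(1)
proof (rule decomposesE)
  fix \<alpha> \<beta>
  assume p: "ar c d p"
    and a: "\<And>i. i < length L \<Longrightarrow> HD c d p (snd (L ! i)) (fst (L ! i)) (\<alpha> i)"
    and b: "\<And>i. i < length L \<Longrightarrow> HD c d (snd (L ! i)) p (- fst (L ! i)) (\<beta> i)"
    and ab: "\<And>i j. i < length L \<Longrightarrow> j < length L \<Longrightarrow> vc (snd (L ! j)) p (snd (L ! i)) (\<alpha> i) (\<beta> j) =
        (if i = j then idm (snd (L ! i)) else Z (snd (L ! j)) (snd (L ! i)))"
    and s: "foldr (add2 D p p) (map (\<lambda>i. vc p (snd (L ! i)) p (\<beta> i) (\<alpha> i)) [0..<length L]) (Z p p) = idm p"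
  have q: "ar c d (snd (L ! i))" if "i < length L" for i using a[OF that] by (simp add: HD_def)
  have "foldr (add2 D (r ** p) (r ** p)) (map (\<lambda>i. vc (r ** p) (r ** snd (L ! i)) (r ** p)
      (lw r (snd (L ! i)) p (\<beta> i)) (lw r p (snd (L ! i)) (\<alpha> i))) [0..<length L]) (Z (r ** p) (r ** p)) =
    foldr (add2 D (r ** p) (r ** p)) (map (lw r p p) (map (\<lambda>i. vc p (snd (L ! i)) p (\<beta> i) (\<alpha> i)) [0..<length L])) (Z (r ** p) (r ** p))"
    by (intro arg_cong2[where f = "foldr _"] HOL.refl) (auto simp: lw_vc[OF HD_H[OF a] HD_H[OF b] r])
  also have "\<dots> = lw r p p (idm p)"
    unfolding s[symmetric] by (rule foldr_lw[symmetric, OF p r]) (auto intro: H_vc[OF HD_H[OF a] HD_H[OF b]])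
  finally have sum: "foldr (add2 D (r ** p) (r ** p)) (map (\<lambda>i. vc (r ** p) (r ** snd (L ! i)) (r ** p)
      (lw r (snd (L ! i)) p (\<beta> i)) (lw r p (snd (L ! i)) (\<alpha> i))) [0..<length L]) (Z (r ** p) (r ** p)) = idm (r ** p)"
    using lw_id[OF p r] by simp
  show ?thesis
  proof (rule decomposesI[where \<alpha> = "\<lambda>i. lw r p (snd (L ! i)) (\<alpha> i)" and \<beta> = "\<lambda>i. lw r (snd (L ! i)) p (\<beta> i)" and k = "\<lambda>i. fst (L ! i)"
      and q = "\<lambda>i. r ** snd (L ! i)"], unfold length_map)
    show "ar c e (r ** p)" by (rule ar_comp[OF p r])
    show "foldr (add2 D (r ** p) (r ** p)) (map (\<lambda>i. vc (r ** p) (r ** snd (L ! i)) (r ** p)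
      (lw r (snd (L ! i)) p (\<beta> i)) (lw r p (snd (L ! i)) (\<alpha> i))) [0..<length L]) (Z (r ** p) (r ** p)) = idm (r ** p)" by (rule sum)
    fix i assume i: "i < length L"
    then show "map (\<lambda>(k, q). (k, r ** q)) L ! i = (fst (L ! i), r ** snd (L ! i))"
      by (simp add: case_prod_beta)
    show "HD c e (r ** p) (r ** snd (L ! i)) (fst (L ! i)) (lw r p (snd (L ! i)) (\<alpha> i))" by (rule HD_lw[OF a[OF i] r])
    show "HD c e (r ** snd (L ! i)) (r ** p) (- fst (L ! i)) (lw r (snd (L ! i)) p (\<beta> i))" by (rule HD_lw[OF b[OF i] r])
    fix j assume j: "j < length L"
    show "vc (r ** snd (L ! j)) (r ** p) (r ** snd (L ! i)) (lw r p (snd (L ! i)) (\<alpha> i)) (lw r (snd (L ! j)) p (\<beta> j)) =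
        (if i = j then idm (r ** snd (L ! i)) else Z (r ** snd (L ! j)) (r ** snd (L ! i)))"
      unfolding lw_vc[OF HD_H[OF b[OF j]] HD_H[OF a[OF i]] r, symmetric] ab[OF i j]
      using lw_id[OF q[OF i] r] lw_zero[OF q[OF j] q[OF i] r] by (cases "i = j") simp_all
  qed
qed

lemma decomposes_rw:
  assumes "decomposes d e p L" and r: "ar c d r"
  shows "decomposes c e (p ** r) (map (\<lambda>(k, q). (k, q ** r)) L)"
  using assms(1)
proof (rule decomposesE)
  fix \<alpha> \<beta>
  assume p: "ar d e p"
    and a: "\<And>i. i < length L \<Longrightarrow> HD d e p (snd (L ! i)) (fst (L ! i)) (\<alpha> i)"
    and b: "\<And>i. i < length L \<Longrightarrow> HD d e (snd (L ! i)) p (- fst (L ! i)) (\<beta> i)"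
    and ab: "\<And>i j. i < length L \<Longrightarrow> j < length L \<Longrightarrow> vc (snd (L ! j)) p (snd (L ! i)) (\<alpha> i) (\<beta> j) =
        (if i = j then idm (snd (L ! i)) else Z (snd (L ! j)) (snd (L ! i)))"
    and s: "foldr (add2 D p p) (map (\<lambda>i. vc p (snd (L ! i)) p (\<beta> i) (\<alpha> i)) [0..<length L]) (Z p p) = idm p"
  have q: "ar d e (snd (L ! i))" if "i < length L" for i using a[OF that] by (simp add: HD_def)
  have "foldr (add2 D (p ** r) (p ** r)) (map (\<lambda>i. vc (p ** r) (snd (L ! i) ** r) (p ** r)
      (rw (snd (L ! i)) p r (\<beta> i)) (rw p (snd (L ! i)) r (\<alpha> i))) [0..<length L]) (Z (p ** r) (p ** r)) =
    foldr (add2 D (p ** r) (p ** r)) (map (rw p p r) (map (\<lambda>i. vc p (snd (L ! i)) p (\<beta> i) (\<alpha> i)) [0..<length L])) (Z (p ** r) (p ** r))"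
    by (intro arg_cong2[where f = "foldr _"] HOL.refl) (auto simp: rw_vc[OF HD_H[OF a] HD_H[OF b] r])
  also have "\<dots> = rw p p r (idm p)"
    unfolding s[symmetric] by (rule foldr_rw[symmetric, OF p r]) (auto intro: H_vc[OF HD_H[OF a] HD_H[OF b]])
  finally have sum: "foldr (add2 D (p ** r) (p ** r)) (map (\<lambda>i. vc (p ** r) (snd (L ! i) ** r) (p ** r)
      (rw (snd (L ! i)) p r (\<beta> i)) (rw p (snd (L ! i)) r (\<alpha> i))) [0..<length L]) (Z (p ** r) (p ** r)) = idm (p ** r)"
    using rw_id[OF p r] by simp
  show ?thesis
  proof (rule decomposesI[where \<alpha> = "\<lambda>i. rw p (snd (L ! i)) r (\<alpha> i)" and \<beta> = "\<lambda>i. rw (snd (L ! i)) p r (\<beta> i)" and k = "\<lambda>i. fst (L ! i)"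
      and q = "\<lambda>i. snd (L ! i) ** r"], unfold length_map)
    show "ar c e (p ** r)" by (rule ar_comp[OF r p])
    show "foldr (add2 D (p ** r) (p ** r)) (map (\<lambda>i. vc (p ** r) (snd (L ! i) ** r) (p ** r)
      (rw (snd (L ! i)) p r (\<beta> i)) (rw p (snd (L ! i)) r (\<alpha> i))) [0..<length L]) (Z (p ** r) (p ** r)) = idm (p ** r)" by (rule sum)
    fix i assume i: "i < length L"
    then show "map (\<lambda>(k, q). (k, q ** r)) L ! i = (fst (L ! i), snd (L ! i) ** r)"
      by (simp add: case_prod_beta)
    show "HD c e (p ** r) (snd (L ! i) ** r) (fst (L ! i)) (rw p (snd (L ! i)) r (\<alpha> i))" by (rule HD_rw[OF a[OF i] r])
    show "HD c e (snd (L ! i) ** r) (p ** r) (- fst (L ! i)) (rw (snd (L ! i)) p r (\<beta> i))" by (rule HD_rw[OF b[OF i] r])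
    fix j assume j: "j < length L"
    show "vc (snd (L ! j) ** r) (p ** r) (snd (L ! i) ** r) (rw p (snd (L ! i)) r (\<alpha> i)) (rw (snd (L ! j)) p r (\<beta> j)) =
        (if i = j then idm (snd (L ! i) ** r) else Z (snd (L ! j) ** r) (snd (L ! i) ** r))"
      unfolding rw_vc[OF HD_H[OF b[OF j]] HD_H[OF a[OF i]] r, symmetric] ab[OF i j]
      using rw_id[OF q[OF i] r] rw_zero[OF q[OF j] q[OF i] r] by (cases "i = j") simp_all
  qed
qed

lemma foldr_emb: "ar c c p \<Longrightarrow> (\<And>s. s \<in> set xs \<Longrightarrow> H c c p p s) \<Longrightarrow>
    emb c p p (foldr (add2 D p p) xs (Z p p)) = hsum (h_pairs D) (k, c, p) (k, c, p) (map (emb c p p) xs)"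
proof (induction xs)
  case (Cons s xs)
  have "H c c p p s" "H c c p p (foldr (add2 D p p) xs (Z p p))" using Cons.prems by (auto intro: H_foldr)
  then have "emb c p p (foldr (add2 D p p) (s # xs) (Z p p)) =
      hadd (h_pairs D) (k, c, p) (k, c, p) (emb c p p s) (emb c p p (foldr (add2 D p p) xs (Z p p)))"
    by (simp add: emb_add[of c p p s _ k k])
  then show ?case using Cons by (simp add: hsum_def)
qed (simp add: hsum_def emb_zero[of c p p k k])

text \<open>\<open>emb\<close> respects composition, sums and zeros, so it carries projections and
  inclusions to the data required by \<open>isomorphic_splitI\<close>.\<close>

lemma decomposes_hTr:
  assumes "decomposes c c p L"
  shows "isomorphic (hTr D) [(k, c, p)] (map (\<lambda>(l, q). (k + l, c, q)) L)"
  using assms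
proof (rule decomposesE)
  fix \<alpha> \<beta>
  assume p: "ar c c p"
    and a: "\<And>i. i < length L \<Longrightarrow> HD c c p (snd (L ! i)) (fst (L ! i)) (\<alpha> i)"
    and b: "\<And>i. i < length L \<Longrightarrow> HD c c (snd (L ! i)) p (- fst (L ! i)) (\<beta> i)"
    and ab: "\<And>i j. i < length L \<Longrightarrow> j < length L \<Longrightarrow> vc (snd (L ! j)) p (snd (L ! i)) (\<alpha> i) (\<beta> j) =
        (if i = j then idm (snd (L ! i)) else Z (snd (L ! j)) (snd (L ! i)))"
    and s: "foldr (add2 D p p) (map (\<lambda>i. vc p (snd (L ! i)) p (\<beta> i) (\<alpha> i)) [0..<length L]) (Z p p) = idm p"
  let ?Y = "map (\<lambda>(l, q). (k + l, c, q)) L"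
  have q: "ar c c (snd (L ! i))" if "i < length L" for i using a[OF that] by (simp add: HD_def)
  have Yi: "?Y ! i = (k + fst (L ! i), c, snd (L ! i))" if "i < length L" for i
    using that by (simp add: case_prod_beta)
  have idt: "idt (h_pairs D) (l, c, r) = emb c r r (idm r)" for l r by (simp add: h_pairs_simps emb_def)
  have m: "map (\<lambda>i. cmp (h_pairs D) (k, c, p) (?Y ! i) (k, c, p) (emb c (snd (L ! i)) p (\<beta> i)) (emb c p (snd (L ! i)) (\<alpha> i)))
     [0..<length ?Y] = map (emb c p p) (map (\<lambda>i. vc p (snd (L ! i)) p (\<beta> i) (\<alpha> i)) [0..<length L])"
    unfolding map_map length_map
  proof (rule map_cong[OF HOL.refl])
    fix i assume "i \<in> set [0..<length L]"
    then have i: "i < length L" by simp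
    show "cmp (h_pairs D) (k, c, p) (?Y ! i) (k, c, p) (emb c (snd (L ! i)) p (\<beta> i)) (emb c p (snd (L ! i)) (\<alpha> i)) =
        (emb c p p \<circ> (\<lambda>i. vc p (snd (L ! i)) p (\<beta> i) (\<alpha> i))) i"
      unfolding Yi[OF i] comp_def by (rule emb_cmp[OF HD_H[OF a[OF i]] HD_H[OF b[OF i]]])
  qed
  show ?thesis
    unfolding hTr_def
  proof (rule trace.B.isomorphic_splitI[of _ _ "\<lambda>i. emb c p (snd (L ! i)) (\<alpha> i)" "\<lambda>i. emb c (snd (L ! i)) p (\<beta> i)"])
    show "(k, c, p) \<in> obj (h_pairs D)" using p by (simp add: h_pairs_simps)
    show "?Y \<in> lists (obj (h_pairs D))"
      using q by (fastforce simp: h_pairs_simps in_lists_conv_set in_set_conv_nth)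
    show "hsum (h_pairs D) (k, c, p) (k, c, p)
      (map (\<lambda>i. cmp (h_pairs D) (k, c, p) (?Y ! i) (k, c, p) (emb c (snd (L ! i)) p (\<beta> i)) (emb c p (snd (L ! i)) (\<alpha> i)))
         [0..<length ?Y]) = idt (h_pairs D) (k, c, p)"
      unfolding m idt s[symmetric]
      by (rule foldr_emb[symmetric, OF p]) (auto intro: H_vc[OF HD_H[OF a] HD_H[OF b]])
    fix i assume "i < length ?Y"
    then have i: "i < length L" by simp
    show "emb c p (snd (L ! i)) (\<alpha> i) \<in> hom (h_pairs D) (k, c, p) (?Y ! i)"
      unfolding Yi[OF i] by (rule emb_in[OF p q[OF i]]) (use a[OF i] in simp)
    show "emb c (snd (L ! i)) p (\<beta> i) \<in> hom (h_pairs D) (?Y ! i) (k, c, p)"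
      unfolding Yi[OF i] by (rule emb_in[OF q[OF i] p]) (use b[OF i] in simp)
    fix j assume "j < length ?Y"
    then have j: "j < length L" by simp
    show "cmp (h_pairs D) (?Y ! j) (k, c, p) (?Y ! i) (emb c p (snd (L ! i)) (\<alpha> i)) (emb c (snd (L ! j)) p (\<beta> j)) =
       (if i = j then idt (h_pairs D) (?Y ! i) else hzero (h_pairs D) (?Y ! j) (?Y ! i))"
      using q i j unfolding Yi[OF i] Yi[OF j] emb_cmp[OF HD_H[OF b[OF j]] HD_H[OF a[OF i]]] ab[OF i j]
      by (auto simp: idt emb_zero)
  qed
qed

end

section \<open>Classes of diagrams\<close>

lemma word_ok_mono: "word_ok m w \<Longrightarrow> m \<le> m' \<Longrightarrow> word_ok m' w"
  by (induction w) (auto elim!: letter_ok.elims)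

lemma weights_mono: "a \<in> weights m \<Longrightarrow> m \<le> m' \<Longrightarrow> a \<in> weights m'"
  by (auto simp: weights_def)

lemma act_append: "act (u @ v) a = act u (act v a)"
  by (simp add: act_def)

lemma act_Nil [simp]: "act [] a = a" by (simp add: act_def)
lemma act_Cons [simp]: "act (l # w) a = act_letter l (act w a)" by (simp add: act_def)

lemma act_letter_weights: "letter_ok m l \<Longrightarrow> a \<in> weights m \<Longrightarrow> act_letter l a \<in> weights m"
  by (cases l) (auto simp: weights_def eps_def)

lemma act_weights: "word_ok m w \<Longrightarrow> a \<in> weights m \<Longrightarrow> act w a \<in> weights m"
  by (induction w) (auto simp: act_letter_weights)

lemma wf_mono: "wf_dgm m a t \<Longrightarrow> m \<le> m' \<Longrightarrow> wf_dgm m' a t"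
  by (induction t arbitrary: a) (auto intro: word_ok_mono)

lemma wf_dom: "wf_dgm m a t \<Longrightarrow> word_ok m (dom t) \<and> word_ok m (cod t) \<and> act (dom t) a = act (cod t) a"
  by (induction t arbitrary: a) (auto simp: act_append, (auto simp: fun_eq_iff)?)

lemma dom_dots [simp]: "dom (dots i r) = [Ee i]" by (induction r) auto
lemma cod_dots [simp]: "cod (dots i r) = [Ee i]" by (induction r) auto

lemma ax_dom: "\<lbrakk>ax s t; wf_dgm m a s; wf_dgm m a t\<rbrakk> \<Longrightarrow> dom s = dom t \<and> cod s = cod t"
  by (induction rule: ax.induct) auto

lemma rel_dom: "rel a s t \<Longrightarrow> dom s = dom t \<and> cod s = cod t"
  by (induction rule: rel.induct) (auto simp: sigma_def cap_dots_def cup_dots_def)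

lemma dgm_eq_wf: "dgm_eq m K a s t \<Longrightarrow> wf_dgm m a s \<and> wf_dgm m a t \<and> dom s = dom t \<and> cod s = cod t"
proof (induction rule: dgm_eq.induct)
  case (ax s t a)
  then show ?case using ax_dom by blast
next
  case (rel a s t)
  then show ?case using rel_dom by blast
qed auto

lemma dgm_eq_mono: "dgm_eq m K a s t \<Longrightarrow> m \<le> m' \<Longrightarrow> dgm_eq m' K a s t"
proof (induction rule: dgm_eq.induct)
  case (refl a t) then show ?case by (intro dgm_eq.refl) (rule wf_mono)
next
  case (sym a s t) then show ?case by (simp add: dgm_eq.sym)
next
  case (trans a r s t) then show ?case using dgm_eq.trans by blast
next
  case (ver a s s' t t') then show ?case by (intro dgm_eq.ver) simp_all
next
  case (hor t a s s' t') then show ?case by (intro dgm_eq.hor) simp_all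
next
  case (add a s s' t t') then show ?case by (intro dgm_eq.add) simp_all
next
  case (scl a t t' z) then show ?case by (intro dgm_eq.scl) simp
next
  case (ax s t a) then show ?case by (intro dgm_eq.ax) (auto intro: wf_mono)
next
  case (rel a s t) then show ?case by (intro dgm_eq.rel) (auto intro: wf_mono)
next
  case (kill a) then show ?case by (intro dgm_eq.kill)
qed

text \<open>The weights of the colimit. Once m is forgotten, of the conditions on a word only the
  positivity of its indices is left, which is \<open>okw\<close>.\<close>

definition Wts :: "weight set" where "Wts = (\<Union>m. weights m)"

abbreviation "fo \<equiv> foam_of"

definition wfo :: "weight \<Rightarrow> dgm \<Rightarrow> bool" where
  "wfo a t \<longleftrightarrow> (\<exists>m. a \<in> weights m \<and> wf_dgm m a t)"

fun lindex :: "letter \<Rightarrow> nat" where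
  "lindex (Ee i) = i" | "lindex (Ff i) = i"

definition okw :: "word \<Rightarrow> bool" where "okw w \<longleftrightarrow> (\<forall>l\<in>set w. 1 \<le> lindex l)"

lemma okw_Nil [simp]: "okw []" by (simp add: okw_def)
lemma okw_Cons [simp]: "okw (l # w) \<longleftrightarrow> 1 \<le> lindex l \<and> okw w" by (simp add: okw_def)
lemma okw_append [simp]: "okw (u @ w) \<longleftrightarrow> okw u \<and> okw w" by (auto simp: okw_def)

lemma okw_word_ok: "okw w \<longleftrightarrow> (\<exists>m. word_ok m w)"
proof
  show "\<exists>m. word_ok m w \<Longrightarrow> okw w"
    by (auto simp: okw_def list_all_iff elim!: letter_ok.elims)
  show "okw w \<Longrightarrow> \<exists>m. word_ok m w"
  proof (induction w)
    case (Cons l w)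
    then obtain m where "word_ok m w" by auto
    then have "word_ok (max m (Suc (lindex l))) w" by (rule word_ok_mono) simp
    moreover have "letter_ok (max m (Suc (lindex l))) l" using Cons.prems by (cases l) auto
    ultimately show ?case by auto
  qed simp
qed

text \<open>Everything is monotone in m, so two well-formed diagrams live over a common gl(m). This
  makes well-formedness in the colimit compositional.\<close>

lemma wfo_common:
  assumes "wfo a s" "wfo a t"
  obtains m where "a \<in> weights m" "wf_dgm m a s" "wf_dgm m a t"
proof -
  from assms obtain m m' where "a \<in> weights m" "wf_dgm m a s" "wf_dgm m' a t" unfolding wfo_def by blast
  then show ?thesis by (intro that[of "max m m'"]) (auto intro: wf_mono weights_mono)
qed

lemma wfo_ver [simp]: "wfo a (s \<odot> t) \<longleftrightarrow> wfo a s \<and> wfo a t \<and> dom s = cod t"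
  by (auto simp: wfo_def) (meson nat_le_linear weights_mono wf_mono)

lemma wfo_add [simp]: "wfo a (s \<oplus> t) \<longleftrightarrow> wfo a s \<and> wfo a t \<and> dom s = dom t \<and> cod s = cod t"
  by (auto simp: wfo_def) (meson nat_le_linear weights_mono wf_mono)

lemma wfo_scl [simp]: "wfo a (z \<cdot> t) \<longleftrightarrow> wfo a t" by (auto simp: wfo_def)

lemma wfo_Wts: "wfo a t \<Longrightarrow> a \<in> Wts" by (auto simp: wfo_def Wts_def)

lemma act_Wts: "okw w \<Longrightarrow> a \<in> Wts \<Longrightarrow> act w a \<in> Wts"
  unfolding Wts_def okw_word_ok
proof clarify
  fix m m' assume "word_ok m w" "a \<in> weights m'"
  then have "act w a \<in> weights (max m m')"
    using act_weights[OF word_ok_mono[of m w "max m m'"] weights_mono[of a m' "max m m'"]] by simp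
  then show "act w a \<in> (\<Union>m. weights m)" by blast
qed

lemma wfo_Idn [simp]: "wfo a (Idn w) \<longleftrightarrow> a \<in> Wts \<and> okw w"
  unfolding wfo_def Wts_def okw_word_ok
  by simp (meson nat_le_linear weights_mono word_ok_mono)

lemma wfo_Nul [simp]: "wfo a (Nul v w) \<longleftrightarrow> a \<in> Wts \<and> okw v \<and> okw w \<and> act v a = act w a"
  unfolding wfo_def Wts_def okw_word_ok
proof safe
  fix m m1 m2 assume *: "a \<in> weights m" "word_ok m1 v" "word_ok m2 w" "act v a = act w a"
  let ?m = "max m (max m1 m2)"
  show "\<exists>m. a \<in> weights m \<and> wf_dgm m a (Nul v w)"
    using * weights_mono[of a m ?m] word_ok_mono[of m1 v ?m] word_ok_mono[of m2 w ?m] by auto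
qed auto

lemma wfo_hor: "wfo a (s \<otimes> t) \<longleftrightarrow> wfo (act (dom t) a) s \<and> wfo a t"
proof
  assume "wfo a (s \<otimes> t)"
  then obtain m where "a \<in> weights m" "wf_dgm m (act (dom t) a) s" "wf_dgm m a t" by (auto simp: wfo_def)
  then show "wfo (act (dom t) a) s \<and> wfo a t" unfolding wfo_def using act_weights wf_dom by blast
next
  assume "wfo (act (dom t) a) s \<and> wfo a t"
  then obtain m m' where "wf_dgm m (act (dom t) a) s" "a \<in> weights m'" "wf_dgm m' a t" by (auto simp: wfo_def)
  then have "a \<in> weights (max m m')" "wf_dgm (max m m') a (s \<otimes> t)" by (auto intro: weights_mono wf_mono)
  then show "wfo a (s \<otimes> t)" unfolding wfo_def by blast
qed

lemma wfo_gen: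
  "wfo a (Dot i) \<longleftrightarrow> a \<in> Wts \<and> 1 \<le> i"
  "wfo a (Crs i j) \<longleftrightarrow> a \<in> Wts \<and> 1 \<le> i \<and> 1 \<le> j"
  "wfo a (Cup i) \<longleftrightarrow> a \<in> Wts \<and> 1 \<le> i"
  "wfo a (Cap i) \<longleftrightarrow> a \<in> Wts \<and> 1 \<le> i"
  "wfo a (SInv i j) \<longleftrightarrow> a \<in> Wts \<and> 1 \<le> i \<and> 1 \<le> j"
  "wfo a (CupInv i r) \<longleftrightarrow> a \<in> Wts \<and> 1 \<le> i \<and> int r < lam a i"
  "wfo a (CapInv i r) \<longleftrightarrow> a \<in> Wts \<and> 1 \<le> i \<and> int r < - lam a i"
proof -
  have 1: "(\<exists>m. a \<in> weights m \<and> i < m) \<longleftrightarrow> a \<in> Wts" for i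
    unfolding Wts_def by (auto) (meson lessI max.cobounded1 max.strict_coboundedI2 weights_mono)
  have 2: "(\<exists>m. a \<in> weights m \<and> i < m \<and> j < m) \<longleftrightarrow> a \<in> Wts" for i j
    using 1[of "max i j"] by auto
  show "wfo a (Dot i) \<longleftrightarrow> a \<in> Wts \<and> 1 \<le> i" "wfo a (Cup i) \<longleftrightarrow> a \<in> Wts \<and> 1 \<le> i"
    "wfo a (Cap i) \<longleftrightarrow> a \<in> Wts \<and> 1 \<le> i"
    "wfo a (CupInv i r) \<longleftrightarrow> a \<in> Wts \<and> 1 \<le> i \<and> int r < lam a i"
    "wfo a (CapInv i r) \<longleftrightarrow> a \<in> Wts \<and> 1 \<le> i \<and> int r < - lam a i"
    unfolding wfo_def wf_dgm.simps 1[of i, symmetric] by blast+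
  show "wfo a (Crs i j) \<longleftrightarrow> a \<in> Wts \<and> 1 \<le> i \<and> 1 \<le> j" "wfo a (SInv i j) \<longleftrightarrow> a \<in> Wts \<and> 1 \<le> i \<and> 1 \<le> j"
    unfolding wfo_def wf_dgm.simps 2[of i j, symmetric] by blast+
qed

lemma foam_eq_wfo: "foam_eq a s t \<Longrightarrow> wfo a s \<and> wfo a t \<and> dom s = dom t \<and> cod s = cod t"
  unfolding foam_eq_def wfo_def using dgm_eq_wf by blast

lemma foam_eq_refl: "wfo a t \<Longrightarrow> foam_eq a t t"
  unfolding foam_eq_def wfo_def using dgm_eq.refl by blast

lemma foam_eq_sym: "foam_eq a s t \<Longrightarrow> foam_eq a t s"
  unfolding foam_eq_def using dgm_eq.sym by blast

lemma foam_eq_common: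
  assumes "foam_eq a s s'" "foam_eq a t t'"
  obtains m where "a \<in> weights m" "dgm_eq m killed a s s'" "dgm_eq m killed a t t'"
proof -
  from assms obtain m m' where "a \<in> weights m" "dgm_eq m killed a s s'" "dgm_eq m' killed a t t'"
    unfolding foam_eq_def by blast
  then show ?thesis by (intro that[of "max m m'"]) (auto intro: dgm_eq_mono weights_mono)
qed

lemma foam_eq_trans: "foam_eq a r s \<Longrightarrow> foam_eq a s t \<Longrightarrow> foam_eq a r t"
  by (erule (1) foam_eq_common) (auto simp: foam_eq_def intro: dgm_eq.trans)

lemma foam_eq_ver: "\<lbrakk>foam_eq a s s'; foam_eq a t t'; dom s = cod t\<rbrakk> \<Longrightarrow> foam_eq a (s \<odot> t) (s' \<odot> t')"
  by (erule (1) foam_eq_common) (auto simp: foam_eq_def intro: dgm_eq.ver)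

lemma foam_eq_add: "\<lbrakk>foam_eq a s s'; foam_eq a t t'; dom s = dom t; cod s = cod t\<rbrakk> \<Longrightarrow>
    foam_eq a (s \<oplus> t) (s' \<oplus> t')"
  by (erule (1) foam_eq_common) (auto simp: foam_eq_def intro: dgm_eq.add)

lemma foam_eq_scl: "foam_eq a t t' \<Longrightarrow> foam_eq a (z \<cdot> t) (z \<cdot> t')"
  by (auto simp: foam_eq_def intro: dgm_eq.scl)

lemma foam_eq_hor:
  assumes "foam_eq (act (dom t) a) s s'" "foam_eq a t t'"
  shows "foam_eq a (s \<otimes> t) (s' \<otimes> t')"
proof -
  from assms obtain m m' where "dgm_eq m killed (act (dom t) a) s s'" "a \<in> weights m'" "dgm_eq m' killed a t t'"
    unfolding foam_eq_def by blast
  then have "a \<in> weights (max m m')" "dgm_eq (max m m') killed (act (dom t) a) s s'"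
    "dgm_eq (max m m') killed a t t'" by (auto intro: dgm_eq_mono weights_mono)
  then show ?thesis unfolding foam_eq_def using dgm_eq.hor by blast
qed

lemma mem_fo: "s \<in> fo a t \<longleftrightarrow> foam_eq a t s" by (simp add: foam_of_def)

lemma fo_empty: "\<not> wfo a t \<Longrightarrow> fo a t = {}"
  using foam_eq_wfo by (auto simp: foam_of_def)

lemma fo_eqI: "foam_eq a s t \<Longrightarrow> fo a s = fo a t"
proof -
  assume st: "foam_eq a s t"
  have "foam_eq a s x \<longleftrightarrow> foam_eq a t x" for x
    using foam_eq_trans[OF st, of x] foam_eq_trans[OF foam_eq_sym[OF st], of x] by blast
  then show ?thesis unfolding foam_of_def by blast
qed

lemma fo_eq_iff: "wfo a s \<Longrightarrow> fo a s = fo a t \<longleftrightarrow> foam_eq a s t"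
  using fo_eqI foam_eq_refl mem_fo foam_eq_sym by blast

lemma fo_eqD: "wfo a s \<Longrightarrow> fo a s = fo a t \<Longrightarrow> wfo a t \<and> dom s = dom t \<and> cod s = cod t"
  by (simp add: fo_eq_iff) (drule foam_eq_wfo, simp)

text \<open>The class of an ill-formed diagram is empty, and operations on empty classes return the empty class,
  so many of the following laws need no well-formedness assumptions.\<close>

definition V :: "weight \<Rightarrow> foam \<Rightarrow> foam \<Rightarrow> foam" where
  "V a S T = (\<Union>s\<in>S. \<Union>t\<in>T. fo a (s \<odot> t))"

definition A :: "weight \<Rightarrow> foam \<Rightarrow> foam \<Rightarrow> foam" where
  "A a S T = (\<Union>s\<in>S. \<Union>t\<in>T. fo a (s \<oplus> t))"

abbreviation "Hc \<equiv> foam_hcomp"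
abbreviation "Sc \<equiv> foam_scale"

lemma fo_ver: "fo a (s \<odot> t) = V a (fo a s) (fo a t)"
proof (cases "wfo a (s \<odot> t)")
  case True
  have "fo a (s' \<odot> t') = fo a (s \<odot> t)" if "s' \<in> fo a s" "t' \<in> fo a t" for s' t'
    using that True unfolding mem_fo by (intro fo_eqI foam_eq_sym[OF foam_eq_ver]) auto
  moreover have "s \<in> fo a s" "t \<in> fo a t" using True by (auto simp: mem_fo intro: foam_eq_refl)
  ultimately show ?thesis unfolding V_def by blast
next
  case False
  have "fo a (s' \<odot> t') = {}" if "s' \<in> fo a s" "t' \<in> fo a t" for s' t'
    using that False foam_eq_wfo[of a s s'] foam_eq_wfo[of a t t'] unfolding mem_fo by (intro fo_empty) auto
  then show ?thesis using False unfolding V_def by (simp add: fo_empty)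
qed

lemma fo_add: "fo a (s \<oplus> t) = A a (fo a s) (fo a t)"
proof (cases "wfo a (s \<oplus> t)")
  case True
  have "fo a (s' \<oplus> t') = fo a (s \<oplus> t)" if "s' \<in> fo a s" "t' \<in> fo a t" for s' t'
    using that True unfolding mem_fo by (intro fo_eqI foam_eq_sym[OF foam_eq_add]) auto
  moreover have "s \<in> fo a s" "t \<in> fo a t" using True by (auto simp: mem_fo intro: foam_eq_refl)
  ultimately show ?thesis unfolding A_def by blast
next
  case False
  have "fo a (s' \<oplus> t') = {}" if "s' \<in> fo a s" "t' \<in> fo a t" for s' t'
    using that False foam_eq_wfo[of a s s'] foam_eq_wfo[of a t t'] unfolding mem_fo by (intro fo_empty) auto
  then show ?thesis using False unfolding A_def by (simp add: fo_empty)
qed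

lemma fo_scl: "fo a (z \<cdot> t) = Sc a z (fo a t)"
proof (cases "wfo a t")
  case True
  have "fo a (z \<cdot> t') = fo a (z \<cdot> t)" if "t' \<in> fo a t" for t'
    using that unfolding mem_fo by (intro fo_eqI foam_eq_sym[OF foam_eq_scl])
  moreover have "t \<in> fo a t" using True by (auto simp: mem_fo intro: foam_eq_refl)
  ultimately show ?thesis unfolding foam_scale_def by blast
next
  case False
  then show ?thesis by (simp add: fo_empty foam_scale_def)
qed

lemma fo_hor: "fo a (s \<otimes> t) = Hc a (fo (act (dom t) a) s) (fo a t)"
proof (cases "wfo a (s \<otimes> t)")
  case True
  have "fo a (s' \<otimes> t') = fo a (s \<otimes> t)" if "s' \<in> fo (act (dom t) a) s" "t' \<in> fo a t" for s' t'
    using that unfolding mem_fo by (intro fo_eqI foam_eq_sym[OF foam_eq_hor]) auto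
  moreover have "s \<in> fo (act (dom t) a) s" "t \<in> fo a t" using True by (auto simp: mem_fo wfo_hor intro: foam_eq_refl)
  ultimately show ?thesis unfolding foam_hcomp_def by blast
next
  case False
  then show ?thesis by (auto simp: fo_empty foam_hcomp_def wfo_hor)
qed

text \<open>If neither side is well-formed, both classes are empty. So an axiom can be used as soon
  as the two sides are well-formed under the same conditions.\<close>

lemma fo_ax: "ax s t \<Longrightarrow> (wfo a s \<longleftrightarrow> wfo a t) \<Longrightarrow> fo a s = fo a t"
proof (cases "wfo a s")
  case True
  assume *: "ax s t" "wfo a s \<longleftrightarrow> wfo a t"
  with True have "wfo a s" "wfo a t" by auto
  then obtain m where "a \<in> weights m" "wf_dgm m a s" "wf_dgm m a t" by (rule wfo_common)
  then have "foam_eq a s t" unfolding foam_eq_def using dgm_eq.ax[OF *(1)] by blast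
  then show ?thesis by (rule fo_eqI)
qed (simp add: fo_empty)

lemma fo_rel: "\<lbrakk>rel a s t; wfo a s; wfo a t\<rbrakk> \<Longrightarrow> fo a s = fo a t"
proof -
  assume *: "rel a s t" "wfo a s" "wfo a t"
  then obtain m where "a \<in> weights m" "wf_dgm m a s" "wf_dgm m a t" by (blast elim: wfo_common)
  then have "foam_eq a s t" unfolding foam_eq_def using dgm_eq.rel[OF *(1)] by blast
  then show ?thesis by (rule fo_eqI)
qed

lemma fo_kill: "a \<in> killed \<Longrightarrow> a \<in> Wts \<Longrightarrow> fo a (Idn []) = fo a (Nul [] [])"
proof -
  assume *: "a \<in> killed" "a \<in> Wts"
  then obtain m where "a \<in> weights m" by (auto simp: Wts_def)
  then have "foam_eq a (Idn []) (Nul [] [])" unfolding foam_eq_def using dgm_eq.kill[OF *(1)] by blast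
  then show ?thesis by (rule fo_eqI)
qed

section \<open>Linear and vertical laws for classes of diagrams\<close>

definition cls :: "weight \<Rightarrow> foam \<Rightarrow> bool" where
  "cls a S \<longleftrightarrow> (\<exists>t. S = fo a t)"

text \<open>The empty class has every word as a source, because ill-formed representatives are
  allowed. This keeps well-formedness out of the laws below.\<close>

definition src :: "weight \<Rightarrow> word \<Rightarrow> foam \<Rightarrow> bool" where
  "src a v S \<longleftrightarrow> (\<exists>t. S = fo a t \<and> dom t = v)"

definition tgt :: "weight \<Rightarrow> word \<Rightarrow> foam \<Rightarrow> bool" where
  "tgt a v S \<longleftrightarrow> (\<exists>t. S = fo a t \<and> cod t = v)"

lemma src_cls: "src a v S \<Longrightarrow> cls a S" by (auto simp: src_def cls_def)
lemma cls_fo [simp]: "cls a (fo a t)" by (auto simp: cls_def)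
lemma src_fo [simp]: "dom t = v \<Longrightarrow> src a v (fo a t)" by (auto simp: src_def)
lemma tgt_fo [simp]: "cod t = v \<Longrightarrow> tgt a v (fo a t)" by (auto simp: tgt_def)

lemma cls_V [simp]: "cls a S \<Longrightarrow> cls a T \<Longrightarrow> cls a (V a S T)"
  by (auto simp: cls_def fo_ver[symmetric])
lemma src_V [simp]: "cls a S \<Longrightarrow> src a v T \<Longrightarrow> src a v (V a S T)"
  by (auto simp: cls_def src_def fo_ver[symmetric])
lemma tgt_V [simp]: "tgt a v S \<Longrightarrow> cls a T \<Longrightarrow> tgt a v (V a S T)"
  by (auto simp: cls_def tgt_def fo_ver[symmetric])
lemma cls_A [simp]: "cls a S \<Longrightarrow> cls a T \<Longrightarrow> cls a (A a S T)"
  by (auto simp: cls_def fo_add[symmetric])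
lemma src_A [simp]: "src a v S \<Longrightarrow> cls a T \<Longrightarrow> src a v (A a S T)"
  by (auto simp: cls_def src_def fo_add[symmetric])
lemma tgt_A [simp]: "tgt a v S \<Longrightarrow> cls a T \<Longrightarrow> tgt a v (A a S T)"
  by (auto simp: cls_def tgt_def fo_add[symmetric])
lemma cls_Sc [simp]: "cls a S \<Longrightarrow> cls a (Sc a z S)"
  by (auto simp: cls_def fo_scl[symmetric])
lemma src_Sc [simp]: "src a v S \<Longrightarrow> src a v (Sc a z S)"
  by (auto simp: src_def fo_scl[symmetric])
lemma tgt_Sc [simp]: "tgt a v S \<Longrightarrow> tgt a v (Sc a z S)"
  by (auto simp: tgt_def fo_scl[symmetric])

text \<open>The witnesses for source and target may differ. If the class is inhabited they have the
  same end words, so one of them serves both purposes.\<close>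

lemma src_tgtE:
  assumes "src a v S" "tgt a w S"
  obtains t where "S = fo a t" "wfo a t \<longrightarrow> dom t = v \<and> cod t = w" 
proof -
  from assms obtain t t' where "S = fo a t" "dom t = v" "S = fo a t'" "cod t' = w" by (auto simp: src_def tgt_def)
  then show ?thesis using fo_eqD[of a t t'] by (intro that[of t]) auto
qed

lemma V_assoc: "\<lbrakk>cls a R; cls a S; cls a T\<rbrakk> \<Longrightarrow> V a (V a R S) T = V a R (V a S T)"
  unfolding cls_def by (elim exE, simp only: fo_ver[symmetric], rule fo_ax[OF ax.ver_assoc], auto)

lemma V_id_left: "tgt a w S \<Longrightarrow> V a (fo a (Idn w)) S = S"
proof -
  assume "tgt a w S"
  then obtain t where t: "S = fo a t" "cod t = w" by (auto simp: tgt_def)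
  have "okw (cod t)" if "wfo a t" using that wf_dom okw_word_ok unfolding wfo_def by blast
  then show ?thesis
    using ax.ver_id_left[of t] unfolding t(1) fo_ver[symmetric] unfolding t(2)[symmetric] by (intro fo_ax) (auto simp: wfo_Wts)
qed

lemma V_id_right: "src a v S \<Longrightarrow> V a S (fo a (Idn v)) = S"
proof -
  assume "src a v S"
  then obtain t where t: "S = fo a t" "dom t = v" by (auto simp: src_def)
  have "okw (dom t)" if "wfo a t" using that wf_dom okw_word_ok unfolding wfo_def by blast
  then show ?thesis
    using ax.ver_id_right[of t] unfolding t(1) fo_ver[symmetric] unfolding t(2)[symmetric] by (intro fo_ax) (auto simp: wfo_Wts)
qed

lemma wfo_okw: "wfo a t \<Longrightarrow> okw (dom t) \<and> okw (cod t) \<and> act (dom t) a = act (cod t) a"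
  using wf_dom okw_word_ok unfolding wfo_def by blast

lemma A_assoc: "\<lbrakk>cls a R; cls a S; cls a T\<rbrakk> \<Longrightarrow> A a (A a R S) T = A a R (A a S T)"
  unfolding cls_def by (elim exE, simp only: fo_add[symmetric], rule fo_ax[OF ax.add_assoc], auto)

lemma A_comm: "cls a S \<Longrightarrow> cls a T \<Longrightarrow> A a S T = A a T S"
  unfolding cls_def by (elim exE, simp only: fo_add[symmetric], rule fo_ax[OF ax.add_comm], auto)

lemma A_zero: "src a v S \<Longrightarrow> tgt a w S \<Longrightarrow> A a S (fo a (Nul v w)) = S"
proof (erule (1) src_tgtE)
  fix t assume S: "S = fo a t" and t: "wfo a t \<longrightarrow> dom t = v \<and> cod t = w"
  show ?thesis
  proof (cases "wfo a t")
    case True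
    then show ?thesis
      using ax.add_zero[of t] t unfolding S fo_add[symmetric]
      by (intro fo_ax) (auto simp: wfo_Wts wfo_okw)
  next
    case False
    then show ?thesis by (simp add: S fo_empty A_def)
  qed
qed

lemma V_A_left: "\<lbrakk>cls a S; cls a S'; cls a T\<rbrakk> \<Longrightarrow> V a (A a S S') T = A a (V a S T) (V a S' T)"
  unfolding cls_def by (elim exE, simp only: fo_ver[symmetric] fo_add[symmetric], rule fo_ax[OF ax.ver_add_left], auto)
lemma V_A_right: "\<lbrakk>cls a S; cls a T; cls a T'\<rbrakk> \<Longrightarrow> V a S (A a T T') = A a (V a S T) (V a S T')"
  unfolding cls_def by (elim exE, simp only: fo_ver[symmetric] fo_add[symmetric], rule fo_ax[OF ax.ver_add_right], auto)
lemma V_Sc_left: "cls a S \<Longrightarrow> cls a T \<Longrightarrow> V a (Sc a z S) T = Sc a z (V a S T)"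
  unfolding cls_def by (elim exE, simp only: fo_ver[symmetric] fo_scl[symmetric], rule fo_ax[OF ax.ver_scl_left], auto)
lemma V_Sc_right: "cls a S \<Longrightarrow> cls a T \<Longrightarrow> V a S (Sc a z T) = Sc a z (V a S T)"
  unfolding cls_def by (elim exE, simp only: fo_ver[symmetric] fo_scl[symmetric], rule fo_ax[OF ax.ver_scl_right], auto)
lemma Sc_Sc: "cls a T \<Longrightarrow> Sc a y (Sc a z T) = Sc a (y * z) T"
  unfolding cls_def by (elim exE, simp only: fo_scl[symmetric], rule fo_ax[OF ax.scl_scl], auto)
lemma Sc_one: "cls a T \<Longrightarrow> Sc a 1 T = T"
  unfolding cls_def by (elim exE, simp only: fo_scl[symmetric], rule fo_ax[OF ax.scl_one], auto)
lemma Sc_A: "cls a S \<Longrightarrow> cls a T \<Longrightarrow> Sc a z (A a S T) = A a (Sc a z S) (Sc a z T)"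
  unfolding cls_def by (elim exE, simp only: fo_scl[symmetric] fo_add[symmetric], rule fo_ax[OF ax.scl_add], auto)
lemma A_Sc: "cls a T \<Longrightarrow> Sc a (y + z) T = A a (Sc a y T) (Sc a z T)"
  unfolding cls_def by (elim exE, simp only: fo_scl[symmetric] fo_add[symmetric], rule fo_ax[OF ax.add_scl], auto)

text \<open>The sum with an empty class is empty while the zero class on the right may be inhabited;
  hence the condition on S.\<close>

lemma A_minus: "\<lbrakk>src a v S; tgt a w S; S \<noteq> {}\<rbrakk> \<Longrightarrow> A a S (Sc a (-1) S) = fo a (Nul v w)"
proof (erule (1) src_tgtE)
  fix t assume S: "S = fo a t" and t: "wfo a t \<longrightarrow> dom t = v \<and> cod t = w" and "S \<noteq> {}"
  then have "wfo a t" using fo_empty by blast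
  then show ?thesis
    using ax.add_minus[of t] t unfolding S fo_add[symmetric] fo_scl[symmetric]
    by (intro fo_ax) (auto simp: wfo_Wts wfo_okw)
qed

lemma Sc_zero: "\<lbrakk>src a v S; tgt a w S; S \<noteq> {}\<rbrakk> \<Longrightarrow> Sc a 0 S = fo a (Nul v w)"
  using A_Sc[of a S 1 "-1"] A_minus[of a v S w] by (simp add: Sc_one src_cls)

lemma cls_ne: "wfo a t \<Longrightarrow> fo a t \<noteq> {}"
  using foam_eq_refl mem_fo by force

lemma Sc_Nul: "wfo a (Nul v w) \<Longrightarrow> Sc a z (fo a (Nul v w)) = fo a (Nul v w)"
proof -
  assume w: "wfo a (Nul v w)"
  have "fo a (Nul v w) = Sc a 0 (fo a (Nul v w))"
    by (rule Sc_zero[symmetric]) (use cls_ne[OF w] in auto)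
  then show ?thesis using Sc_Sc[of a "fo a (Nul v w)" z 0] by simp
qed

text \<open>Absorption of zero under composition is derived from linearity: a zero morphism is 0
  times itself, and scalars can be pulled out of composites.\<close>

lemma V_Nul_left:
  assumes "src a u S" "tgt a v S" "S \<noteq> {}" "wfo a (Nul v w)"
  shows "V a (fo a (Nul v w)) S = fo a (Nul u w)"
proof -
  from assms(1,2) obtain t where S: "S = fo a t" and t: "wfo a t \<longrightarrow> dom t = u \<and> cod t = v" by (rule src_tgtE)
  have wt: "wfo a t" using assms(3) S fo_empty by blast
  have ne: "V a (fo a (Nul v w)) S \<noteq> {}"
    unfolding S fo_ver[symmetric] by (rule cls_ne) (use wt t assms(4) in auto)
  have "V a (fo a (Nul v w)) S = V a (Sc a 0 (fo a (Nul v w))) S" using Sc_Nul[OF assms(4)] by simp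
  also have "\<dots> = Sc a 0 (V a (fo a (Nul v w)) S)" by (rule V_Sc_left) (auto intro: src_cls assms)
  also have "\<dots> = fo a (Nul u w)" by (rule Sc_zero) (use assms ne src_cls[OF assms(1)] in auto)
  finally show ?thesis .
qed

lemma V_Nul_right:
  assumes "src a v S" "tgt a w S" "S \<noteq> {}" "wfo a (Nul u v)"
  shows "V a S (fo a (Nul u v)) = fo a (Nul u w)"
proof -
  from assms(1,2) obtain t where S: "S = fo a t" and t: "wfo a t \<longrightarrow> dom t = v \<and> cod t = w" by (rule src_tgtE)
  have wt: "wfo a t" using assms(3) S fo_empty by blast
  have ne: "V a S (fo a (Nul u v)) \<noteq> {}"
    unfolding S fo_ver[symmetric] by (rule cls_ne) (use wt t assms(4) in auto)
  have "V a S (fo a (Nul u v)) = V a S (Sc a 0 (fo a (Nul u v)))" using Sc_Nul[OF assms(4)] by simp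
  also have "\<dots> = Sc a 0 (V a S (fo a (Nul u v)))" by (rule V_Sc_right) (auto intro: src_cls assms)
  also have "\<dots> = fo a (Nul u w)" by (rule Sc_zero) (use assms ne src_cls[OF assms(1)] in auto)
  finally show ?thesis .
qed

lemma A_move: 
  assumes "A a X (Sc a (-1) Y) = Z" "src a v X" "tgt a w X" "src a v Y" "tgt a w Y" "Y \<noteq> {}"
  shows "X = A a Z Y"
proof -
  have c: "cls a X" "cls a Y" using assms src_cls by auto
  have "A a Z Y = A a X (A a (Sc a (-1) Y) Y)" unfolding assms(1)[symmetric] using c by (simp add: A_assoc)
  also have "A a (Sc a (-1) Y) Y = fo a (Nul v w)"
    using A_minus[OF assms(4-6)] A_comm[of a Y "Sc a (-1) Y"] c by simp
  finally show ?thesis using A_zero[OF assms(2,3)] by simp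
qed

text \<open>A diagram is viewed as a natural transformation between the functors that put its source and
  target word in front of a given word; \<open>cp a g v\<close> is the component of \<open>g\<close> at \<open>v\<close>, and \<open>LW a u\<close> is the
  action of the functor \<open>u\<close> on morphisms.\<close>

definition LW :: "weight \<Rightarrow> word \<Rightarrow> foam \<Rightarrow> foam" where
  "LW a u S = (\<Union>t\<in>S. fo a (Idn u \<otimes> t))"

definition cp :: "weight \<Rightarrow> dgm \<Rightarrow> word \<Rightarrow> foam" where
  "cp a g v = fo a (g \<otimes> Idn v)"

lemma LW_fo: "LW a u (fo a t) = fo a (Idn u \<otimes> t)"
proof (cases "wfo a t")
  case True
  have "fo a (Idn u \<otimes> t') = fo a (Idn u \<otimes> t)" if "t' \<in> fo a t" for t'
  proof -
    have tt: "foam_eq a t t'" using that by (simp add: mem_fo)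
    then have d: "dom t' = dom t" "wfo a t'" by (auto dest: foam_eq_wfo)
    show ?thesis
    proof (cases "okw u")
      case True
      then have "foam_eq (act (dom t) a) (Idn u) (Idn u)"
        using wfo_okw[OF \<open>wfo a t\<close>] wfo_Wts[OF \<open>wfo a t\<close>] by (intro foam_eq_refl) (auto intro: act_Wts)
      from foam_eq_hor[OF this tt] show ?thesis by (rule fo_eqI[OF foam_eq_sym])
    qed (simp add: fo_empty wfo_hor)
  qed
  moreover have "t \<in> fo a t" using True by (simp add: mem_fo foam_eq_refl)
  ultimately show ?thesis unfolding LW_def by blast
qed (simp add: LW_def fo_empty wfo_hor)

lemma LW_empty [simp]: "LW a u {} = {}" by (simp add: LW_def)

lemma cls_LW [simp]: "cls a S \<Longrightarrow> cls a (LW a u S)"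
  by (auto simp: cls_def LW_fo)
lemma src_LW: "src a v S \<Longrightarrow> w = u @ v \<Longrightarrow> src a w (LW a u S)"
  by (auto simp: src_def LW_fo)
lemma tgt_LW: "tgt a v S \<Longrightarrow> w = u @ v \<Longrightarrow> tgt a w (LW a u S)"
  by (auto simp: tgt_def LW_fo)
lemma cls_cp [simp]: "cls a (cp a g v)" by (simp add: cp_def)
lemma src_cp [simp]: "w = dom g @ v \<Longrightarrow> src a w (cp a g v)" by (simp add: cp_def)
lemma tgt_cp [simp]: "w = cod g @ v \<Longrightarrow> tgt a w (cp a g v)" by (simp add: cp_def)

lemma fo_id_id: "wfo a (Idn v) \<Longrightarrow> fo a (Idn v \<odot> Idn v) = fo a (Idn v)"
  unfolding fo_ver by (rule V_id_left) simp

lemma fo_interchange: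
  assumes "dom s = cod t" "dom s' = cod t'"
  shows "fo a ((s \<otimes> s') \<odot> (t \<otimes> t')) = fo a ((s \<odot> t) \<otimes> (s' \<odot> t'))"
proof (rule fo_ax[OF ax.interchange])
  show "wfo a ((s \<otimes> s') \<odot> (t \<otimes> t')) \<longleftrightarrow> wfo a ((s \<odot> t) \<otimes> (s' \<odot> t'))"
    using assms wfo_okw[of a t'] by (auto simp: wfo_hor)
qed

lemma fo_hor_cong: "\<lbrakk>fo (act (dom t) a) s = fo (act (dom t) a) s'; fo a t = fo a t'; dom t = dom t'\<rbrakk> \<Longrightarrow>
    fo a (s \<otimes> t) = fo a (s' \<otimes> t')"
  by (simp add: fo_hor)

lemma cp_cong: "fo (act v a) s = fo (act v a) s' \<Longrightarrow> cp a s v = cp a s' v"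
  unfolding cp_def by (rule fo_hor_cong) simp_all

lemma cp_ver: "cp a (s \<odot> t) v = V a (cp a s v) (cp a t v)"
proof (cases "dom s = cod t")
  case True
  have "fo a ((s \<odot> t) \<otimes> Idn v) = fo a ((s \<odot> t) \<otimes> (Idn v \<odot> Idn v))"
  proof (cases "wfo a (Idn v)")
    case True
    show ?thesis by (rule fo_hor_cong) (simp_all add: fo_id_id[OF True])
  qed (simp add: fo_empty wfo_hor)
  then show ?thesis unfolding cp_def fo_ver[symmetric] by (subst fo_interchange) (simp_all add: True)
qed (simp add: cp_def fo_ver[symmetric] fo_empty wfo_hor)

lemma cp_Idn: "cp a (Idn u) v = fo a (Idn (u @ v))"
  unfolding cp_def by (rule fo_ax[OF ax.hor_Idn]) (auto simp: wfo_hor act_Wts)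

lemma LW_Idn: "LW a u (fo a (Idn v)) = fo a (Idn (u @ v))"
  unfolding LW_fo by (rule fo_ax[OF ax.hor_Idn]) (auto simp: wfo_hor act_Wts)

lemma cp_lw: "cp a (Idn u \<otimes> g) v = LW a u (cp a g v)"
  unfolding cp_def LW_fo by (rule fo_ax[OF ax.hor_assoc]) (auto simp: wfo_hor act_append)

lemma cp_rw: "cp a (g \<otimes> Idn u) v = cp a g (u @ v)"
proof -
  have "fo a ((g \<otimes> Idn u) \<otimes> Idn v) = fo a (g \<otimes> (Idn u \<otimes> Idn v))"
    by (rule fo_ax[OF ax.hor_assoc]) (auto simp: wfo_hor act_append)
  also have "\<dots> = fo a (g \<otimes> Idn (u @ v))"
  proof -
    have "fo a (Idn u \<otimes> Idn v) = fo a (Idn (u @ v))" using cp_Idn[of a u v] by (simp add: cp_def)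
    then show ?thesis by (intro fo_hor_cong) simp_all
  qed
  finally show ?thesis by (simp add: cp_def)
qed

lemma cp_add: "cp a (s \<oplus> t) v = A a (cp a s v) (cp a t v)"
  unfolding cp_def fo_add[symmetric] by (rule fo_ax[OF ax.hor_add_left]) (auto simp: wfo_hor)

lemma cp_scl: "cp a (z \<cdot> t) v = Sc a z (cp a t v)"
  unfolding cp_def fo_scl[symmetric] by (rule fo_ax[OF ax.hor_scl_left]) (auto simp: wfo_hor)

lemma cp_Nul: "wfo a (Idn v) \<Longrightarrow> wfo (act v a) (Nul u w) \<Longrightarrow> cp a (Nul u w) v = fo a (Nul (u @ v) (w @ v))"
proof -
  assume *: "wfo a (Idn v)" "wfo (act v a) (Nul u w)"
  have "cp a (Nul u w) v = cp a (0 \<cdot> Nul u w) v"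
    by (rule cp_cong) (use Sc_Nul[OF *(2), of 0] in \<open>simp add: fo_scl\<close>)
  also have "\<dots> = fo a (Nul (u @ v) (w @ v))"
    unfolding cp_scl by (rule Sc_zero) (use * in \<open>auto simp: cp_def wfo_hor cls_ne\<close>)
  finally show ?thesis .
qed

lemma LW_V: "cls a S \<Longrightarrow> cls a T \<Longrightarrow> LW a u (V a S T) = V a (LW a u S) (LW a u T)"
  unfolding cls_def
proof (elim exE)
  fix s t assume S: "S = fo a s" and T: "T = fo a t"
  show ?thesis
  proof (cases "dom s = cod t")
    case True
    have "fo a (Idn u \<otimes> (s \<odot> t)) = fo a ((Idn u \<odot> Idn u) \<otimes> (s \<odot> t))"
    proof (cases "wfo (act (dom t) a) (Idn u)")
      case True
      show ?thesis by (rule fo_hor_cong) (simp_all add: fo_id_id[OF True])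
    next
      case False
      then show ?thesis by (subst (1 2) fo_empty) (auto simp: wfo_hor)
    qed
    then show ?thesis unfolding S T LW_fo fo_ver[symmetric] by (subst fo_interchange) (simp_all add: True)
  qed (simp add: S T LW_fo fo_ver[symmetric] fo_empty wfo_hor)
qed

lemma LW_LW: "cls a S \<Longrightarrow> LW a u (LW a v S) = LW a (u @ v) S"
  unfolding cls_def
proof (elim exE)
  fix s assume S: "S = fo a s"
  have "fo a (Idn u \<otimes> (Idn v \<otimes> s)) = fo a ((Idn u \<otimes> Idn v) \<otimes> s)"
    by (rule fo_ax[OF ax.hor_assoc, symmetric]) (auto simp: wfo_hor act_append)
  also have "\<dots> = fo a (Idn (u @ v) \<otimes> s)"
    by (rule fo_hor_cong) (use cp_Idn[of _ u v] in \<open>simp_all add: cp_def\<close>)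
  finally show ?thesis by (simp add: S LW_fo)
qed

lemma LW_Nil: "cls a S \<Longrightarrow> LW a [] S = S"
  unfolding cls_def
  by (elim exE, simp only: LW_fo, rule fo_ax[OF ax.hor_id_left]) (auto simp: wfo_hor dest: wfo_Wts wfo_okw intro!: act_Wts)

lemma LW_A: "cls a S \<Longrightarrow> cls a T \<Longrightarrow> LW a u (A a S T) = A a (LW a u S) (LW a u T)"
  unfolding cls_def
  by (elim exE, simp only: LW_fo fo_add[symmetric], rule fo_ax[OF ax.hor_add_right]) (auto simp: wfo_hor)

lemma LW_Sc: "cls a S \<Longrightarrow> LW a u (Sc a z S) = Sc a z (LW a u S)"
  unfolding cls_def
  by (elim exE, simp only: LW_fo fo_scl[symmetric], rule fo_ax[OF ax.hor_scl_right]) (auto simp: wfo_hor)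

lemma LW_Nul: "okw u \<Longrightarrow> wfo a (Nul v w) \<Longrightarrow> LW a u (fo a (Nul v w)) = fo a (Nul (u @ v) (u @ w))"
proof -
  assume *: "okw u" "wfo a (Nul v w)"
  have "LW a u (fo a (Nul v w)) = LW a u (Sc a 0 (fo a (Nul v w)))" using Sc_Nul[OF *(2)] by simp
  also have "\<dots> = Sc a 0 (LW a u (fo a (Nul v w)))" by (simp add: LW_Sc)
  also have "\<dots> = fo a (Nul (u @ v) (u @ w))"
    by (rule Sc_zero) (use * in \<open>auto simp: LW_fo wfo_hor act_Wts intro!: cls_ne\<close>)
  finally show ?thesis .
qed

text \<open>The interchange law. If everything is well-formed, both sides are the class of g
  \<otimes> s for a representative s of S; otherwise both are empty.\<close>

lemma naturality:
  assumes "src a v S" "tgt a w S" "dom g = p" "cod g = q"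
  shows "V a (cp a g w) (LW a p S) = V a (LW a q S) (cp a g v)"
proof -
  from assms(1,2) obtain s where S: "S = fo a s" and s: "wfo a s \<longrightarrow> dom s = v \<and> cod s = w" by (rule src_tgtE)
  show ?thesis
  proof (cases "wfo a s")
    case False
    then show ?thesis by (simp add: S LW_def V_def fo_empty)
  next
    case True
    then have d: "dom s = v" "cod s = w" using s by auto
    show ?thesis
    proof (cases "wfo (act v a) g")
      case False
      then show ?thesis using wfo_okw[OF True] by (simp add: cp_def fo_empty wfo_hor V_def d)
    next
      case g: True
      have e: "act v a = act w a" using wfo_okw[OF True] d by simp
      have s1: "fo a (Idn w \<odot> s) = fo a s" "fo a (s \<odot> Idn v) = fo a s"
        unfolding fo_ver using V_id_left[of a w "fo a s"] V_id_right[of a v "fo a s"] d by auto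
      have g1: "fo (act v a) (g \<odot> Idn p) = fo (act v a) g" "fo (act v a) (Idn q \<odot> g) = fo (act v a) g"
        unfolding fo_ver using V_id_left[of "act v a" q "fo (act v a) g"] V_id_right[of "act v a" p "fo (act v a) g"] assms by auto
      have "V a (cp a g w) (LW a p S) = fo a ((g \<odot> Idn p) \<otimes> (Idn w \<odot> s))"
        unfolding cp_def S LW_fo fo_ver[symmetric] by (rule fo_interchange) (simp_all add: d assms)
      also have "\<dots> = fo a (g \<otimes> s)" by (rule fo_hor_cong) (simp_all add: s1 g1 d)
      also have "\<dots> = fo a ((Idn q \<odot> g) \<otimes> (s \<odot> Idn v))"
        by (rule fo_hor_cong) (simp_all add: s1 g1 d)
      also have "\<dots> = V a (LW a q S) (cp a g v)"
        unfolding cp_def S LW_fo fo_ver[symmetric] by (rule fo_interchange[symmetric]) (simp_all add: d assms)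
      finally show ?thesis .
    qed
  qed
qed

lemmas cp_simps = cp_ver cp_Idn cp_lw cp_rw cp_add cp_scl
lemmas LW_simps = LW_V LW_Idn LW_LW LW_Nil LW_A LW_Sc

text \<open>The transpose of an endomorphism of the left adjoint word: both ends of t are bent
  around with the cup \<open>cu\<close> and the cap \<open>ca\<close>.\<close>

definition mate :: "word \<Rightarrow> dgm \<Rightarrow> dgm \<Rightarrow> dgm \<Rightarrow> dgm" where
  "mate Bs cu ca t = (Idn Bs \<otimes> ca) \<odot> (Idn Bs \<otimes> t \<otimes> Idn Bs) \<odot> (cu \<otimes> Idn Bs)"

text \<open>\<open>B\<close> is left adjoint to \<open>Bs\<close>, with unit \<open>cu\<close> and
  counit \<open>ca\<close>. The triangle identities are required on components at every word, the
  form in which they are applied.\<close>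

locale adjoint_words =
  fixes B Bs :: word and cu ca :: dgm
  assumes dom_cu: "dom cu = []" and cod_cu: "cod cu = Bs @ B"
    and dom_ca: "dom ca = B @ Bs" and cod_ca: "cod ca = []"
    and wf_cu: "a \<in> Wts \<Longrightarrow> wfo a cu" and wf_ca: "a \<in> Wts \<Longrightarrow> wfo a ca"
    and zig_B: "wfo a (Idn v) \<Longrightarrow> V a (cp a ca (B @ v)) (LW a B (cp a cu v)) = fo a (Idn (B @ v))"
    and zig_Bs: "wfo a (Idn v) \<Longrightarrow> V a (LW a Bs (cp a ca v)) (cp a cu (Bs @ v)) = fo a (Idn (Bs @ v))"
begin

abbreviation "mt \<equiv> mate Bs cu ca"

lemmas dc = dom_cu cod_cu dom_ca cod_ca

lemma okw_B: "okw B" "okw Bs"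
proof -
  \<comment> \<open>The letters do not depend on the weight, so their indices can be read off from
    \<open>cu\<close> at the zero weight.\<close>
  have "(\<lambda>_. 0) \<in> Wts" by (auto simp: Wts_def weights_def)
  from wfo_okw[OF wf_cu[OF this]] show "okw B" "okw Bs" by (simp_all add: cod_cu)
qed

lemma cp_mate: "cp a (mt t) v = V a (LW a Bs (cp a ca v)) (V a (LW a Bs (cp a t (Bs @ v))) (cp a cu (Bs @ v)))"
  by (simp add: mate_def cp_simps)

lemma cu_nat: "src a v S \<Longrightarrow> tgt a w S \<Longrightarrow> V a (cp a cu w) S = V a (LW a (Bs @ B) S) (cp a cu v)"
  using naturality[of a v S w cu "[]" "Bs @ B"] by (simp add: dc LW_Nil src_cls)

lemma ca_nat: "src a v S \<Longrightarrow> tgt a w S \<Longrightarrow> V a (cp a ca w) (LW a (B @ Bs) S) = V a S (cp a ca v)"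
  using naturality[of a v S w ca "B @ Bs" "[]"] by (simp add: dc LW_Nil src_cls)

text \<open>An endomorphism slides along a cup to the other strand, where it becomes its mate;
  \<open>mate_cap\<close> is the same for caps. The proof cancels the new cup against the cap of the
  mate.\<close>

lemma mate_cup:
  assumes v: "wfo a (Idn v)" and t: "dom t = B" "cod t = B"
  shows "V a (cp a (mt t) (B @ v)) (cp a cu v) = V a (LW a Bs (cp a t v)) (cp a cu v)"
proof -
  have "V a (cp a (mt t) (B @ v)) (cp a cu v) =
    V a (LW a Bs (V a (cp a ca (B @ v)) (cp a t (Bs @ B @ v)))) (V a (cp a cu (Bs @ B @ v)) (cp a cu v))"
    by (simp add: cp_mate V_assoc LW_V)
  also have "V a (cp a cu (Bs @ B @ v)) (cp a cu v) = V a (LW a (Bs @ B) (cp a cu v)) (cp a cu v)"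
    by (rule cu_nat) (simp_all add: dc)
  also have "V a (LW a Bs (V a (cp a ca (B @ v)) (cp a t (Bs @ B @ v)))) (V a (LW a (Bs @ B) (cp a cu v)) (cp a cu v)) =
    V a (LW a Bs (V a (cp a ca (B @ v)) (V a (cp a t (Bs @ B @ v)) (LW a B (cp a cu v))))) (cp a cu v)"
    by (simp add: V_assoc LW_V LW_LW)
  also have "V a (cp a t (Bs @ B @ v)) (LW a B (cp a cu v)) = V a (LW a B (cp a cu v)) (cp a t v)"
    by (rule naturality) (simp_all add: dc t)
  also have "V a (cp a ca (B @ v)) (V a (LW a B (cp a cu v)) (cp a t v)) = cp a t v"
    by (simp add: V_assoc[symmetric] zig_B[OF v] V_id_left t)
  finally show ?thesis .
qed

lemma mate_cap:
  assumes v: "wfo a (Idn v)" and t: "dom t = B" "cod t = B"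
  shows "V a (cp a ca v) (LW a B (cp a (mt t) v)) = V a (cp a ca v) (cp a t (Bs @ v))"
proof -
  have v': "wfo a (Idn (Bs @ v))" using v okw_B by simp
  have "V a (cp a ca v) (LW a B (cp a (mt t) v)) =
    V a (V a (cp a ca v) (LW a (B @ Bs) (V a (cp a ca v) (cp a t (Bs @ v))))) (LW a B (cp a cu (Bs @ v)))"
    by (simp add: cp_mate V_assoc LW_V LW_LW)
  also have "V a (cp a ca v) (LW a (B @ Bs) (V a (cp a ca v) (cp a t (Bs @ v)))) =
    V a (V a (cp a ca v) (cp a t (Bs @ v))) (cp a ca (B @ Bs @ v))"
    by (rule ca_nat) (simp_all add: dc t)
  also have "V a (V a (V a (cp a ca v) (cp a t (Bs @ v))) (cp a ca (B @ Bs @ v))) (LW a B (cp a cu (Bs @ v))) =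
    V a (cp a ca v) (cp a t (Bs @ v))"
    by (simp add: V_assoc zig_B[OF v'] V_id_right t)
  finally show ?thesis .
qed

text \<open>Passing to mates reverses composition. The mate of s is moved through the cup and past t
  up to the cap, where \<open>mate_cap\<close> turns it back into s.\<close>

lemma mate_ver:
  assumes v: "wfo a (Idn v)" and t: "dom t = B" "cod t = B" and s: "dom s = B" "cod s = B"
  shows "cp a (mt (s \<odot> t)) v = V a (cp a (mt t) v) (cp a (mt s) v)"
proof -
  have ms: "src a (Bs @ v) (cp a (mt s) v)" "tgt a (Bs @ v) (cp a (mt s) v)" by (simp_all add: mate_def dc)
  have "V a (cp a (mt t) v) (cp a (mt s) v) =
    V a (LW a Bs (V a (cp a ca v) (cp a t (Bs @ v)))) (V a (cp a cu (Bs @ v)) (cp a (mt s) v))"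
    by (simp add: cp_mate[of a t] V_assoc LW_V)
  also have "V a (cp a cu (Bs @ v)) (cp a (mt s) v) = V a (LW a (Bs @ B) (cp a (mt s) v)) (cp a cu (Bs @ v))"
    by (rule cu_nat[OF ms])
  also have "V a (LW a Bs (V a (cp a ca v) (cp a t (Bs @ v)))) (V a (LW a (Bs @ B) (cp a (mt s) v)) (cp a cu (Bs @ v))) =
    V a (LW a Bs (V a (cp a ca v) (V a (cp a t (Bs @ v)) (LW a B (cp a (mt s) v))))) (cp a cu (Bs @ v))"
    by (simp add: V_assoc LW_V LW_LW)
  also have "V a (cp a t (Bs @ v)) (LW a B (cp a (mt s) v)) = V a (LW a B (cp a (mt s) v)) (cp a t (Bs @ v))"
    by (rule naturality[OF ms t])
  also have "V a (cp a ca v) (V a (LW a B (cp a (mt s) v)) (cp a t (Bs @ v))) =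
     V a (cp a ca v) (V a (cp a s (Bs @ v)) (cp a t (Bs @ v)))"
    by (simp add: V_assoc[symmetric] mate_cap[OF v s])
  also have "V a (LW a Bs (V a (cp a ca v) (V a (cp a s (Bs @ v)) (cp a t (Bs @ v))))) (cp a cu (Bs @ v)) =
     cp a (mt (s \<odot> t)) v"
    by (simp add: cp_mate cp_ver V_assoc LW_V)
  finally show ?thesis by simp
qed

lemma mate_cong: "cp a s (Bs @ v) = cp a t (Bs @ v) \<Longrightarrow> cp a (mt s) v = cp a (mt t) v"
  by (simp add: cp_mate)

lemma mate_id: "wfo a (Idn v) \<Longrightarrow> cp a (mt (Idn B)) v = fo a (Idn (Bs @ v))"
  using zig_Bs[of a v] by (simp add: cp_mate cp_Idn LW_Idn V_id_left[of a] dc)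

end

lemma adjoint_words_1:
  assumes i: "1 \<le> i"
  shows "adjoint_words [Ee i] [Ff i] (Cup i) (Cap i)"
proof
  fix a v assume v: "wfo a (Idn v)"
  have w: "a \<in> Wts" "okw v" "act v a \<in> Wts" using v by (auto intro: act_Wts)
  have "fo (act v a) ((Cap i \<otimes> E\<^sub>1 i) \<odot> (E\<^sub>1 i \<otimes> Cup i)) = fo (act v a) (E\<^sub>1 i)"
    by (rule fo_rel[OF rel.zigzag_E]) (use i w act_Wts[of "[Ee i]" "act v a"] act_Wts[of "[Ff i, Ee i]" "act v a"] in \<open>simp_all add: wfo_hor wfo_gen\<close>)
  from cp_cong[OF this] show "V a (cp a (Cap i) ([Ee i] @ v)) (LW a [Ee i] (cp a (Cup i) v)) = fo a (Idn ([Ee i] @ v))"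
    by (simp add: cp_simps)
  have "fo (act v a) ((F\<^sub>1 i \<otimes> Cap i) \<odot> (Cup i \<otimes> F\<^sub>1 i)) = fo (act v a) (F\<^sub>1 i)"
    by (rule fo_rel[OF rel.zigzag_F]) (use i w act_Wts[of "[Ff i]" "act v a"] act_Wts[of "[Ee i, Ff i]" "act v a"] in \<open>simp_all add: wfo_hor wfo_gen\<close>)
  from cp_cong[OF this] show "V a (LW a [Ff i] (cp a (Cap i) v)) (cp a (Cup i) ([Ff i] @ v)) = fo a (Idn ([Ff i] @ v))"
    by (simp add: cp_simps)
qed (use i in \<open>simp_all add: wfo_gen\<close>)

text \<open>Adjunctions compose. The cups and caps are nested, and one interchange of a cup with a
  cap separates the two zigzags.\<close>

lemma adjoint_words_2:
  assumes i: "1 \<le> i"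
  shows "adjoint_words [Ee i, Ee i] [Ff i, Ff i] (cups i 2) (caps i 2)"
proof -
  interpret one: adjoint_words "[Ee i]" "[Ff i]" "Cup i" "Cap i" by (rule adjoint_words_1[OF i])
  have cu: "cp a (cups i 2) v = V a (LW a [Ff i] (cp a (Cup i) (Ee i # v))) (cp a (Cup i) v)" for a v
    by (simp add: numeral_2_eq_2 cp_simps LW_simps V_id_left V_id_right)
  have ca: "cp a (caps i 2) v = V a (cp a (Cap i) v) (LW a [Ee i] (cp a (Cap i) (Ff i # v)))" for a v
    by (simp add: numeral_2_eq_2 cp_simps LW_simps V_id_left V_id_right)
  show ?thesis
  proof
    fix a v assume v: "wfo a (Idn v)"
    then have v': "wfo a (Idn (Ee i # v))" "wfo a (Idn (Ff i # v))" using i by auto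
    have n: "V a (cp a (Cap i) (Ff i # Ee i # Ee i # v)) (LW a [Ee i, Ff i] (cp a (Cup i) (Ee i # v))) =
      V a (cp a (Cup i) (Ee i # v)) (cp a (Cap i) (Ee i # v))"
      using one.ca_nat[of a "Ee i # v" "cp a (Cup i) (Ee i # v)"] by simp
    have "V a (cp a (caps i 2) ([Ee i, Ee i] @ v)) (LW a [Ee i, Ee i] (cp a (cups i 2) v)) =
      V a (cp a (Cap i) (Ee i # Ee i # v)) (V a (LW a [Ee i]
        (V a (cp a (Cap i) (Ff i # Ee i # Ee i # v)) (LW a [Ee i, Ff i] (cp a (Cup i) (Ee i # v)))))
         (LW a [Ee i, Ee i] (cp a (Cup i) v)))"
      by (simp add: cu ca LW_simps V_assoc)
    also have "\<dots> = V a (V a (cp a (Cap i) (Ee i # Ee i # v)) (LW a [Ee i] (cp a (Cup i) (Ee i # v))))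
       (LW a [Ee i] (V a (cp a (Cap i) (Ee i # v)) (LW a [Ee i] (cp a (Cup i) v))))"
      unfolding n by (simp add: LW_simps V_assoc)
    also have "\<dots> = fo a (Idn ([Ee i, Ee i] @ v))"
      using one.zig_B[OF v] one.zig_B[OF v'(1)] by (simp add: LW_simps V_id_left)
    finally show "V a (cp a (caps i 2) ([Ee i, Ee i] @ v)) (LW a [Ee i, Ee i] (cp a (cups i 2) v)) =
      fo a (Idn ([Ee i, Ee i] @ v))" .
    have n: "V a (cp a (Cup i) (Ee i # Ff i # Ff i # v)) X = V a (LW a [Ff i, Ee i] X) (cp a (Cup i) (Ee i # Ff i # Ff i # v))"
      if "src a (Ee i # Ff i # Ff i # v) X" "tgt a (Ee i # Ff i # Ff i # v) X" for X
      using one.cu_nat[OF that] by simp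
    have n: "V a (LW a [Ff i, Ee i] (cp a (Cap i) (Ff i # v))) (cp a (Cup i) (Ee i # Ff i # Ff i # v)) =
      V a (cp a (Cup i) (Ff i # v)) (cp a (Cap i) (Ff i # v))"
      using one.cu_nat[of a "Ee i # Ff i # Ff i # v" "cp a (Cap i) (Ff i # v)" "Ff i # v"] by simp
    have "V a (LW a [Ff i, Ff i] (cp a (caps i 2) v)) (cp a (cups i 2) ([Ff i, Ff i] @ v)) =
      V a (LW a [Ff i, Ff i] (cp a (Cap i) v)) (V a (LW a [Ff i]
        (V a (LW a [Ff i, Ee i] (cp a (Cap i) (Ff i # v))) (cp a (Cup i) (Ee i # Ff i # Ff i # v))))
         (cp a (Cup i) (Ff i # Ff i # v)))"
      by (simp add: cu ca LW_simps V_assoc)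
    also have "\<dots> = V a (LW a [Ff i] (V a (LW a [Ff i] (cp a (Cap i) v)) (cp a (Cup i) (Ff i # v))))
      (V a (LW a [Ff i] (cp a (Cap i) (Ff i # v))) (cp a (Cup i) (Ff i # Ff i # v)))"
      unfolding n by (simp add: LW_simps V_assoc)
    also have "\<dots> = fo a (Idn ([Ff i, Ff i] @ v))"
      using one.zig_Bs[OF v] one.zig_Bs[OF v'(2)] by (simp add: LW_simps V_id_left)
    finally show "V a (LW a [Ff i, Ff i] (cp a (caps i 2) v)) (cp a (cups i 2) ([Ff i, Ff i] @ v)) =
      fo a (Idn ([Ff i, Ff i] @ v))" .
  next
    fix a assume a: "a \<in> Wts"
    have "okw [Ee i]" "okw [Ff i]" using i by simp_all
    note w = act_Wts[OF this(1) a] act_Wts[OF this(2) a]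
    show "wfo a (cups i 2)" "wfo a (caps i 2)"
      using i a w by (simp_all add: numeral_2_eq_2 wfo_hor wfo_gen)
  qed (simp_all add: numeral_2_eq_2)
qed

declare act_Cons [simp del] act_Wts [simp]

section \<open>Typed classes\<close>

text \<open>In contrast to \<open>src\<close> and \<open>tgt\<close>, this includes that the class
  is inhabited and that one representative has both end words.\<close>

definition ty :: "weight \<Rightarrow> word \<Rightarrow> word \<Rightarrow> foam \<Rightarrow> bool" where
  "ty a v w S \<longleftrightarrow> (\<exists>t. S = fo a t \<and> wfo a t \<and> dom t = v \<and> cod t = w)"

text \<open>Degrees belong to expressions. A class is assigned a degree through one representative,
  and the zero class has every degree through \<open>Nul\<close>.\<close>

definition tyd :: "weight \<Rightarrow> word \<Rightarrow> word \<Rightarrow> int \<Rightarrow> foam \<Rightarrow> bool" where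
  "tyd a v w d S \<longleftrightarrow> (\<exists>t. S = fo a t \<and> wfo a t \<and> dom t = v \<and> cod t = w \<and> has_deg a t d)"

lemma tyd_ty: "tyd a v w d S \<Longrightarrow> ty a v w S" by (auto simp: tyd_def ty_def)
lemma ty_src: "ty a v w S \<Longrightarrow> src a v S" by (auto simp: ty_def)
lemma ty_tgt: "ty a v w S \<Longrightarrow> tgt a w S" by (auto simp: ty_def)
lemma ty_cls: "ty a v w S \<Longrightarrow> cls a S" by (auto simp: ty_def)
lemma ty_ne: "ty a v w S \<Longrightarrow> S \<noteq> {}" by (auto simp: ty_def dest: cls_ne)
lemma ty_okw: "ty a v w S \<Longrightarrow> okw v \<and> okw w \<and> a \<in> Wts \<and> act v a = act w a"
  by (auto simp: ty_def dest: wfo_okw wfo_Wts)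
lemma ty_fo: "\<lbrakk>wfo a t; dom t = v; cod t = w\<rbrakk> \<Longrightarrow> ty a v w (fo a t)" by (auto simp: ty_def)
lemma tyd_fo: "\<lbrakk>wfo a t; dom t = v; cod t = w; has_deg a t d\<rbrakk> \<Longrightarrow> tyd a v w d (fo a t)" by (auto simp: tyd_def)

lemma ty_V: "ty a u v T \<Longrightarrow> ty a v w S \<Longrightarrow> ty a u w (V a S T)"
  unfolding ty_def
  apply (elim exE conjE)
  subgoal for t s by (rule exI[of _ "s \<odot> t"]) (auto simp: fo_ver)
  done
lemma tyd_V: "tyd a u v d T \<Longrightarrow> tyd a v w e S \<Longrightarrow> tyd a u w (e + d) (V a S T)"
  unfolding tyd_def
  apply (elim exE conjE)
  subgoal for t s by (rule exI[of _ "s \<odot> t"]) (auto simp: fo_ver)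
  done
lemma ty_A: "ty a v w S \<Longrightarrow> ty a v w T \<Longrightarrow> ty a v w (A a S T)"
  unfolding ty_def
  apply (elim exE conjE)
  subgoal for s t by (rule exI[of _ "s \<oplus> t"]) (auto simp: fo_add)
  done
lemma tyd_A: "tyd a v w d S \<Longrightarrow> tyd a v w d T \<Longrightarrow> tyd a v w d (A a S T)"
  unfolding tyd_def
  apply (elim exE conjE)
  subgoal for s t by (rule exI[of _ "s \<oplus> t"]) (auto simp: fo_add)
  done
lemma ty_Sc: "ty a v w S \<Longrightarrow> ty a v w (Sc a z S)"
  unfolding ty_def
  apply (elim exE conjE)
  subgoal for t by (rule exI[of _ "z \<cdot> t"]) (auto simp: fo_scl)
  done
lemma tyd_Idn: "a \<in> Wts \<Longrightarrow> okw w \<Longrightarrow> tyd a w w 0 (fo a (Idn w))" by (rule tyd_fo) auto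
lemma ty_Idn: "a \<in> Wts \<Longrightarrow> okw w \<Longrightarrow> ty a w w (fo a (Idn w))" by (rule ty_fo) auto
lemma tyd_Nul: "\<lbrakk>a \<in> Wts; okw v; okw w; act v a = act w a\<rbrakk> \<Longrightarrow> tyd a v w d (fo a (Nul v w))" by (rule tyd_fo) auto
lemma ty_Nul: "\<lbrakk>a \<in> Wts; okw v; okw w; act v a = act w a\<rbrakk> \<Longrightarrow> ty a v w (fo a (Nul v w))" by (rule ty_fo) auto
lemma ty_Hc: "ty (act v a) v' w' S \<Longrightarrow> ty a v w T \<Longrightarrow> ty a (v' @ v) (w' @ w) (Hc a S T)"
  unfolding ty_def
  apply (elim exE conjE)
  subgoal for s t by (rule exI[of _ "s \<otimes> t"]) (auto simp: fo_hor wfo_hor)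
  done
lemma tyd_Hc: "tyd (act v a) v' w' e S \<Longrightarrow> tyd a v w d T \<Longrightarrow> tyd a (v' @ v) (w' @ w) (e + d) (Hc a S T)"
  unfolding tyd_def
  apply (elim exE conjE)
  subgoal for s t by (rule exI[of _ "s \<otimes> t"]) (auto simp: fo_hor wfo_hor)
  done
lemma ty_LW: "ty a v w S \<Longrightarrow> okw u \<Longrightarrow> ty a (u @ v) (u @ w) (LW a u S)"
  unfolding ty_def
  apply (elim exE conjE)
  subgoal for t
    using wfo_okw[of a t] wfo_Wts[of a t] act_Wts[of "dom t" a]
    by (intro exI[of _ "Idn u \<otimes> t"]) (simp add: LW_fo wfo_hor)
  done
lemma tyd_LW: "tyd a v w d S \<Longrightarrow> okw u \<Longrightarrow> tyd a (u @ v) (u @ w) d (LW a u S)"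
  unfolding tyd_def
  apply (elim exE conjE)
  subgoal for t
    using wfo_okw[of a t] wfo_Wts[of a t] act_Wts[of "dom t" a]
    by (intro exI[of _ "Idn u \<otimes> t"]) (simp add: LW_fo wfo_hor)
  done
lemma tyd_cp: "\<lbrakk>has_deg (act v a) g d; wfo (act v a) g; okw v; a \<in> Wts\<rbrakk> \<Longrightarrow>
    tyd a (dom g @ v) (cod g @ v) d (cp a g v)"
  unfolding cp_def by (rule tyd_fo) (auto simp: wfo_hor)
lemma ty_cp: "\<lbrakk>wfo (act v a) g; okw v; a \<in> Wts\<rbrakk> \<Longrightarrow> ty a (dom g @ v) (cod g @ v) (cp a g v)"
  unfolding cp_def by (rule ty_fo) (auto simp: wfo_hor)

lemma ty_V_assoc: "\<lbrakk>ty a u v T; ty a v w S; ty a w x R\<rbrakk> \<Longrightarrow> V a (V a R S) T = V a R (V a S T)"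
  by (rule V_assoc) (auto intro: ty_cls)

lemma ty_V_Nul_left: "\<lbrakk>ty a u v S; okw w; act v a = act w a\<rbrakk> \<Longrightarrow> V a (fo a (Nul v w)) S = fo a (Nul u w)"
  by (rule V_Nul_left) (auto intro: ty_src ty_tgt dest: ty_ne ty_okw)
lemma ty_V_Nul_right: "\<lbrakk>ty a v w S; okw u; act u a = act v a\<rbrakk> \<Longrightarrow> V a S (fo a (Nul u v)) = fo a (Nul u w)"
  by (rule V_Nul_right) (auto intro: ty_src ty_tgt dest: ty_ne ty_okw)

lemma cp_Nil: "cp a t [] = fo a t"
  unfolding cp_def by (rule fo_ax[OF ax.hor_id_right]) (auto simp: wfo_hor dest: wfo_Wts)

lemma cp_hor_Idn: "cp a (s \<otimes> Idn u \<otimes> Idn w) v = cp a s (u @ w @ v)"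
proof -
  have "cp a (s \<otimes> Idn u \<otimes> Idn w) v = cp a (s \<otimes> Idn (u @ w)) v"
    by (rule cp_cong, rule fo_hor_cong) (use cp_Idn[of _ u w] in \<open>simp_all add: cp_def\<close>)
  then show ?thesis by (simp add: cp_rw)
qed

section \<open>Horizontal composition of typed classes\<close>

lemma Hc_V:
  assumes "ty b x y S" "ty b y z S'" "ty a u v T" "ty a v w T'" "b = act u a"
  shows "V a (Hc a S' T') (Hc a S T) = Hc a (V b S' S) (V a T' T)"
proof -
  from assms obtain s s' t t' where S: "S = fo b s" "wfo b s" "dom s = x" "cod s = y"
    "S' = fo b s'" "wfo b s'" "dom s' = y" "cod s' = z"
    and T: "T = fo a t" "wfo a t" "dom t = u" "cod t = v" "T' = fo a t'" "wfo a t'" "dom t' = v" "cod t' = w"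
    unfolding ty_def by blast
  have b: "b = act (dom t) a" "b = act (dom t') a" "b = act (dom (t' \<odot> t)) a"
    using assms(5) T wfo_okw[OF T(2)] by auto
  have "V a (Hc a S' T') (Hc a S T) = fo a ((s' \<otimes> t') \<odot> (s \<otimes> t))"
    unfolding fo_ver fo_hor b(1)[symmetric] b(2)[symmetric] S(1,5) T(1,5) ..
  also have "\<dots> = fo a ((s' \<odot> s) \<otimes> (t' \<odot> t))" by (rule fo_interchange) (simp_all add: S T)
  also have "\<dots> = Hc a (V b S' S) (V a T' T)" unfolding fo_hor b(3)[symmetric] fo_ver S(1,5) T(1,5) ..
  finally show ?thesis .
qed

lemma Hc_assoc:
  assumes "ty c x x' R" "ty b y y' S" "ty a z z' T" "b = act z a" "c = act y b"
  shows "Hc a (Hc b R S) T = Hc a R (Hc a S T)"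
proof -
  from assms obtain r s t where R: "R = fo c r" and S: "S = fo b s" "dom s = y" and T: "T = fo a t" "dom t = z"
    unfolding ty_def by blast
  have "Hc a (Hc b R S) T = fo a ((r \<otimes> s) \<otimes> t)" using assms by (simp add: fo_hor R S T)
  also have "\<dots> = fo a (r \<otimes> (s \<otimes> t))" by (rule fo_ax[OF ax.hor_assoc]) (auto simp: wfo_hor act_append)
  also have "\<dots> = Hc a R (Hc a S T)" using assms by (simp add: fo_hor R S T act_append)
  finally show ?thesis .
qed

lemma Hc_Idn: "Hc a (fo (act v a) (Idn u)) (fo a (Idn v)) = fo a (Idn (u @ v))"
  using cp_Idn[of a u v] by (simp add: cp_def fo_hor)

lemma Hc_unit_left: "ty a v w T \<Longrightarrow> b = act v a \<Longrightarrow> Hc a (fo b (Idn [])) T = T"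
proof -
  assume "ty a v w T" and b: "b = act v a"
  then obtain t where T: "T = fo a t" "dom t = v" by (auto simp: ty_def)
  have "Hc a (fo b (Idn [])) T = LW a [] (fo a t)" using T b by (simp add: LW_fo fo_hor)
  then show ?thesis by (simp add: LW_Nil T)
qed

lemma Hc_unit_right: "ty a v w T \<Longrightarrow> Hc a T (fo a (Idn [])) = T"
proof -
  assume "ty a v w T"
  then obtain t where T: "T = fo a t" "dom t = v" by (auto simp: ty_def)
  show ?thesis using cp_Nil[of a t] T by (simp add: cp_def fo_hor)
qed

lemma Hc_A_left: "\<lbrakk>ty b x y S; ty b x y S'; ty a v w T; b = act v a\<rbrakk> \<Longrightarrow>
    Hc a (A b S S') T = A a (Hc a S T) (Hc a S' T)"
proof -
  assume "ty b x y S" "ty b x y S'" "ty a v w T" and b: "b = act v a"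
  then obtain s s' t where T: "S = fo b s" "S' = fo b s'" "T = fo a t" "dom t = v" unfolding ty_def by blast
  have "fo a ((s \<oplus> s') \<otimes> t) = fo a (s \<otimes> t \<oplus> s' \<otimes> t)" by (rule fo_ax[OF ax.hor_add_left]) (auto simp: wfo_hor)
  then show ?thesis using T b by (simp add: fo_hor fo_add)
qed

lemma Hc_A_right: "\<lbrakk>ty b x y S; ty a v w T; ty a v w T'; b = act v a\<rbrakk> \<Longrightarrow>
    Hc a S (A a T T') = A a (Hc a S T) (Hc a S T')"
proof -
  assume "ty b x y S" "ty a v w T" "ty a v w T'" and b: "b = act v a"
  then obtain s t t' where T: "S = fo b s" "T = fo a t" "dom t = v" "T' = fo a t'" "dom t' = v" unfolding ty_def by blast
  have "fo a (s \<otimes> (t \<oplus> t')) = fo a (s \<otimes> t \<oplus> s \<otimes> t')" by (rule fo_ax[OF ax.hor_add_right]) (auto simp: wfo_hor T)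
  then show ?thesis using T b by (simp add: fo_hor fo_add)
qed

lemma Hc_Sc_left: "\<lbrakk>ty b x y S; ty a v w T; b = act v a\<rbrakk> \<Longrightarrow> Hc a (Sc b z S) T = Sc a z (Hc a S T)"
proof -
  assume "ty b x y S" "ty a v w T" and b: "b = act v a"
  then obtain s t where T: "S = fo b s" "T = fo a t" "dom t = v" unfolding ty_def by blast
  have "fo a ((z \<cdot> s) \<otimes> t) = fo a (z \<cdot> (s \<otimes> t))" by (rule fo_ax[OF ax.hor_scl_left]) (auto simp: wfo_hor)
  then show ?thesis using T b by (simp add: fo_hor fo_scl)
qed

lemma Hc_Sc_right: "\<lbrakk>ty b x y S; ty a v w T; b = act v a\<rbrakk> \<Longrightarrow> Hc a S (Sc a z T) = Sc a z (Hc a S T)"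
proof -
  assume "ty b x y S" "ty a v w T" and b: "b = act v a"
  then obtain s t where T: "S = fo b s" "T = fo a t" "dom t = v" unfolding ty_def by blast
  have "fo a (s \<otimes> (z \<cdot> t)) = fo a (z \<cdot> (s \<otimes> t))" by (rule fo_ax[OF ax.hor_scl_right]) (auto simp: wfo_hor)
  then show ?thesis using T b by (simp add: fo_hor fo_scl)
qed

lemma Hc_Nul_left: "\<lbrakk>ty a v w T; b = act v a; okw x; okw y; act x b = act y b\<rbrakk> \<Longrightarrow>
    Hc a (fo b (Nul x y)) T = fo a (Nul (x @ v) (y @ w))"
proof -
  assume T: "ty a v w T" and b: "b = act v a" and xy: "okw x" "okw y" "act x b = act y b"
  note o = ty_okw[OF T]
  have n: "ty b x y (fo b (Nul x y))" by (rule ty_Nul) (use xy b o in auto)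
  have h: "ty a (x @ v) (y @ w) (Hc a (fo b (Nul x y)) T)" by (rule ty_Hc) (use n b T in auto)
  have "Hc a (fo b (Nul x y)) T = Hc a (Sc b 0 (fo b (Nul x y))) T"
    by (subst Sc_Nul) (use xy b o in auto)
  also have "\<dots> = Sc a 0 (Hc a (fo b (Nul x y)) T)" by (rule Hc_Sc_left[OF n T b])
  also have "\<dots> = fo a (Nul (x @ v) (y @ w))" by (rule Sc_zero[OF ty_src[OF h] ty_tgt[OF h] ty_ne[OF h]])
  finally show ?thesis .
qed

lemma Hc_Nul_right: "\<lbrakk>ty b x y S; a \<in> Wts; okw v; okw w; act v a = act w a; b = act v a\<rbrakk> \<Longrightarrow>
    Hc a S (fo a (Nul v w)) = fo a (Nul (x @ v) (y @ w))"
proof -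
  assume S: "ty b x y S" and a: "a \<in> Wts" and vw: "okw v" "okw w" "act v a = act w a" and b: "b = act v a"
  have n: "ty a v w (fo a (Nul v w))" by (rule ty_Nul) (use vw a in auto)
  have h: "ty a (x @ v) (y @ w) (Hc a S (fo a (Nul v w)))" by (rule ty_Hc) (use n b S in auto)
  have "Hc a S (fo a (Nul v w)) = Hc a S (Sc a 0 (fo a (Nul v w)))"
    by (subst Sc_Nul) (use vw a in auto)
  also have "\<dots> = Sc a 0 (Hc a S (fo a (Nul v w)))" by (rule Hc_Sc_right[OF S n b])
  also have "\<dots> = fo a (Nul (x @ v) (y @ w))" by (rule Sc_zero[OF ty_src[OF h] ty_tgt[OF h] ty_ne[OF h]])
  finally show ?thesis .
qed

section \<open>Divided powers\<close>

text \<open>The rule \<open>kill\<close> speaks of the empty word only; whiskering with u and v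
  extends it to every word that passes through a killed weight.\<close>

lemma kill_word:
  assumes "act v a \<in> killed" "a \<in> Wts" "okw u" "okw v"
  shows "fo a (Idn (u @ v)) = fo a (Nul (u @ v) (u @ v))"
proof -
  have "cp a (Idn []) v = cp a (Nul [] []) v" by (rule cp_cong[OF fo_kill]) (use assms in auto)
  then have "fo a (Idn v) = fo a (Nul v v)" using assms cp_Nul[of a v "[]" "[]"] by (simp add: cp_Idn)
  then have "LW a u (fo a (Idn v)) = LW a u (fo a (Nul v v))" by simp
  then show ?thesis using assms by (simp add: LW_Idn LW_Nul)
qed

lemma zero_word:
  assumes "fo a (Idn w) = fo a (Nul w w)" "ty a v w S"
  shows "S = fo a (Nul v w)"
proof -
  have "S = V a (fo a (Idn w)) S" using ty_tgt[OF assms(2)] by (simp add: V_id_left)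
  also have "\<dots> = fo a (Nul v w)" unfolding assms(1) by (rule ty_V_Nul_left[OF assms(2)]) (use ty_okw[OF assms(2)] in auto)
  finally show ?thesis .
qed

lemma act_E: "act (replicate k (Ee i)) a = (\<lambda>n. a n + int k * eps i n)"
  by (induction k) (auto simp: act_Cons fun_eq_iff algebra_simps)
lemma act_F: "act (replicate k (Ff i)) a = (\<lambda>n. a n - int k * eps i n)"
  by (induction k) (auto simp: act_Cons fun_eq_iff algebra_simps)

lemma okw_replicate [simp]: "okw (replicate k l) \<longleftrightarrow> k = 0 \<or> 1 \<le> lindex l"
  by (auto simp: okw_def)

text \<open>Each copy of the letter moves the entry at its own index by one in a fixed direction,
  and three such moves cannot stay inside {0, 1, 2}.\<close>

lemma cube_zero:
  assumes a: "a \<in> Wts" and l: "1 \<le> lindex l" and k: "3 \<le> k"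
  shows "fo a (Idn (replicate k l)) = fo a (Nul (replicate k l) (replicate k l))"
proof -
  have "\<exists>j\<le>3. act (replicate j l) a \<in> killed"
  proof (rule ccontr)
    assume "\<not> (\<exists>j\<le>3. act (replicate j l) a \<in> killed)"
    then have n: "act (replicate j l) a (lindex l) \<in> {0, 1, 2}" if "j \<le> 3" for j
      using that unfolding killed_def by blast
    have s: "act (replicate j l) a (lindex l) = a (lindex l) + int j \<or>
        act (replicate j l) a (lindex l) = a (lindex l) - int j" for j
      by (cases l) (auto simp: act_E act_F eps_def)
    have "act (replicate 3 l) a (lindex l) = a (lindex l) + 3 \<or> act (replicate 3 l) a (lindex l) = a (lindex l) - 3"
      using s[of 3] by simp
    then show False using n[of 0] n[of 3] by auto
  qed
  then obtain j where j: "j \<le> 3" "act (replicate j l) a \<in> killed" by blast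
  have "replicate k l = replicate (k - j) l @ replicate j l" using j k by (simp add: replicate_add[symmetric])
  then show ?thesis using kill_word[OF j(2) a, of "replicate (k - j) l"] l by simp
qed

lemma dom_sweep [simp]: "dom (sweep i k) = replicate (Suc k) (Ee i)" "cod (sweep i k) = replicate (Suc k) (Ee i)"
  by (induction k) (auto simp: replicate_append_same)
lemma wfo_sweep: "1 \<le> i \<Longrightarrow> a \<in> Wts \<Longrightarrow> wfo a (sweep i k)"
  by (induction k arbitrary: a) (auto simp: wfo_hor wfo_gen)
lemma dom_half_twist [simp]: "dom (half_twist i k) = replicate k (Ee i)" "cod (half_twist i k) = replicate k (Ee i)"
  by (induction k) auto
lemma wfo_half_twist: "1 \<le> i \<Longrightarrow> a \<in> Wts \<Longrightarrow> wfo a (half_twist i k)"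
  by (induction k arbitrary: a) (auto simp: wfo_hor wfo_gen wfo_sweep)
lemma wfo_dots: "1 \<le> i \<Longrightarrow> a \<in> Wts \<Longrightarrow> wfo a (dots i k)"
  by (induction k arbitrary: a) (auto simp: wfo_hor wfo_gen)
lemma dom_staircase [simp]: "dom (staircase i k) = replicate k (Ee i)" "cod (staircase i k) = replicate k (Ee i)"
  by (induction k) auto
lemma wfo_staircase: "1 \<le> i \<Longrightarrow> a \<in> Wts \<Longrightarrow> wfo a (staircase i k)"
  by (induction k arbitrary: a) (auto simp: wfo_hor wfo_dots)
lemma dom_cups [simp]: "dom (cups i k) = []" "cod (cups i k) = replicate k (Ff i) @ replicate k (Ee i)"
  by (induction k) (auto simp: replicate_append_same replicate_app_Cons_same)
lemma wfo_cups: "1 \<le> i \<Longrightarrow> a \<in> Wts \<Longrightarrow> wfo a (cups i k)"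
  by (induction k arbitrary: a) (auto simp: wfo_hor wfo_gen)
lemma dom_caps [simp]: "dom (caps i k) = replicate k (Ee i) @ replicate k (Ff i)" "cod (caps i k) = []"
  by (induction k) (auto simp: replicate_append_same replicate_app_Cons_same)
lemma wfo_caps: "1 \<le> i \<Longrightarrow> a \<in> Wts \<Longrightarrow> wfo a (caps i k)"
  by (induction k arbitrary: a) (auto simp: wfo_hor wfo_gen replicate_append_same replicate_app_Cons_same)

lemma dom_idem_letter [simp]: "dom (idem_letter l) = expand_letter l" "cod (idem_letter l) = expand_letter l"
  by (cases l; simp add: E_idem_def F_idem_def)+

fun okl :: "dletter \<Rightarrow> bool" where
  "okl (Ed i k) \<longleftrightarrow> 1 \<le> i \<and> 1 \<le> k" | "okl (Fd i k) \<longleftrightarrow> 1 \<le> i \<and> 1 \<le> k"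

lemma okl_okw [simp]: "okl l \<Longrightarrow> okw (expand_letter l)" by (cases l) auto

lemma wfo_idem_letter: "okl l \<Longrightarrow> a \<in> Wts \<Longrightarrow> wfo a (idem_letter l)"
  by (cases l) (auto simp: E_idem_def F_idem_def wfo_hor wfo_staircase wfo_half_twist wfo_cups wfo_caps)

section \<open>The nilHecke algebra on two strands\<close>

context
  fixes a :: weight and i :: nat and v :: word
  assumes i: "1 \<le> i" and v: "wfo a (Idn v)"
begin

abbreviation (input) "EEv \<equiv> Ee i # Ee i # v"
abbreviation (input) "x1 \<equiv> cp a (Dot i) (Ee i # v)"
abbreviation (input) "x2 \<equiv> LW a [Ee i] (cp a (Dot i) v)"
abbreviation (input) "tau \<equiv> cp a (Crs i i) v"

lemma wv: "a \<in> Wts" "okw v" using v by auto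

lemma ty_x1: "ty a EEv EEv x1"
  using ty_cp[of "Ee i # v" a "Dot i"] wv i by (simp add: wfo_gen)
lemma ty_x2: "ty a EEv EEv x2"
  using ty_LW[OF ty_cp[of v a "Dot i"], of "[Ee i]"] wv i by (simp add: wfo_gen)
lemma ty_tau: "ty a EEv EEv tau"
  using ty_cp[of v a "Crs i i"] wv i by (simp add: wfo_gen)

lemma tau_tau: "V a tau tau = fo a (Nul EEv EEv)"
proof -
  have "fo (act v a) (Crs i i \<odot> Crs i i) = fo (act v a) (Nul [Ee i, Ee i] [Ee i, Ee i])"
    using fo_rel[OF rel.quadratic[of "act v a" i i]] i wv by (simp add: wfo_gen)
  from cp_cong[OF this] show ?thesis using i wv by (simp add: cp_ver cp_Nul)
qed

lemma slide_left: "A a (V a tau x1) (Sc a (-1) (V a x2 tau)) = fo a (Idn EEv)"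
proof -
  have "fo (act v a) (Crs i i \<odot> (Dot i \<otimes> E\<^sub>1 i) \<ominus> (E\<^sub>1 i \<otimes> Dot i) \<odot> Crs i i) = fo (act v a) (Idn [Ee i, Ee i])"
    using fo_rel[OF rel.dot_slide_left[of "act v a" i i]] i wv by (simp add: wfo_gen wfo_hor)
  from cp_cong[OF this] show ?thesis by (simp add: cp_simps)
qed

lemma slide_right: "A a (V a x1 tau) (Sc a (-1) (V a tau x2)) = fo a (Idn EEv)"
proof -
  have "fo (act v a) ((Dot i \<otimes> E\<^sub>1 i) \<odot> Crs i i \<ominus> Crs i i \<odot> (E\<^sub>1 i \<otimes> Dot i)) = fo (act v a) (Idn [Ee i, Ee i])"
    using fo_rel[OF rel.dot_slide_right[of "act v a" i i]] i wv by (simp add: wfo_gen wfo_hor)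
  from cp_cong[OF this] show ?thesis by (simp add: cp_simps)
qed

text \<open>Multiply \<tau> x1 - x2 \<tau> = 1 by \<tau> from the right and use \<tau>\<tau> = 0.
  This makes the element x1 \<tau> idempotent.\<close>

lemma tau_x1_tau: "V a tau (V a x1 tau) = tau"
proof -
  have "tau = V a (A a (V a tau x1) (Sc a (-1) (V a x2 tau))) tau"
    unfolding slide_left by (simp add: V_id_left)
  also have "\<dots> = A a (V a tau (V a x1 tau)) (Sc a (-1) (V a x2 (V a tau tau)))"
    by (simp add: V_A_left V_Sc_left V_assoc)
  also have "V a x2 (V a tau tau) = fo a (Nul EEv EEv)"
    unfolding tau_tau by (rule ty_V_Nul_right[OF ty_x2]) (use i wv in auto)
  also have "Sc a (-1) (fo a (Nul EEv EEv)) = fo a (Nul EEv EEv)" by (rule Sc_Nul) (use i wv in auto)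
  also have "A a (V a tau (V a x1 tau)) (fo a (Nul EEv EEv)) = V a tau (V a x1 tau)"
    using ty_V[OF ty_V[OF ty_tau ty_x1] ty_tau] by (intro A_zero) (auto intro: ty_src ty_tgt)
  finally show ?thesis by (rule HOL.sym)
qed

text \<open>The same with x1 \<tau> - \<tau> x2 = 1, where the surviving term carries the sign. The
  equation reappears as the assumption on X in \<open>split_half\<close>.\<close>

lemma tau_x2_tau: "V a tau (V a x2 tau) = Sc a (-1) tau"
proof -
  let ?X = "V a tau (V a x2 tau)"
  have X: "ty a EEv EEv ?X" by (rule ty_V[OF ty_V[OF ty_tau ty_x2] ty_tau])
  have "tau = V a (A a (V a x1 tau) (Sc a (-1) (V a tau x2))) tau"
    unfolding slide_right by (simp add: V_id_left)
  also have "\<dots> = A a (V a x1 (V a tau tau)) (Sc a (-1) ?X)"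
    by (simp add: V_A_left V_Sc_left V_assoc)
  also have "V a x1 (V a tau tau) = fo a (Nul EEv EEv)"
    unfolding tau_tau by (rule ty_V_Nul_right[OF ty_x1]) (use i wv in auto)
  also have "A a (fo a (Nul EEv EEv)) (Sc a (-1) ?X) = Sc a (-1) ?X"
    by (subst A_comm, simp, simp, rule A_zero) (use ty_src[OF X] ty_tgt[OF X] in simp_all)
  finally have "Sc a (-1) tau = Sc a (-1) (Sc a (-1) ?X)" by (rule arg_cong)
  then show ?thesis by (simp add: Sc_Sc Sc_one)
qed

lemma E_idem_2: "cp a (E_idem i 2) v = V a x1 tau"
  by (simp add: E_idem_def numeral_2_eq_2 cp_simps cp_hor_Idn LW_simps V_id_left V_id_right V_assoc)

lemma E_idem_1: "cp a (E_idem i (Suc 0)) v = fo a (Idn (Ee i # v))"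
  by (simp add: E_idem_def cp_simps LW_simps V_id_left)

lemma E_idem_2_idem: "cp a (E_idem i 2 \<odot> E_idem i 2) v = cp a (E_idem i 2) v"
  unfolding cp_ver E_idem_2 by (simp add: V_assoc tau_x1_tau)

end

section \<open>Idempotents of divided powers\<close>

lemma F_idem_mate: "F_idem i k = mate (replicate k (Ff i)) (cups i k) (caps i k) (E_idem i k)"
  by (simp add: F_idem_def mate_def)

lemma F_idem_1:
  assumes i: "1 \<le> i" and v: "wfo a (Idn v)"
  shows "cp a (F_idem i (Suc 0)) v = fo a (Idn (Ff i # v))"
proof -
  interpret adjoint_words "[Ee i]" "[Ff i]" "Cup i" "Cap i" by (rule adjoint_words_1[OF i])
  have v': "wfo a (Idn (Ff i # v))" using i v by simp
  have "cp a (F_idem i (Suc 0)) v = cp a (mt (Idn [Ee i])) v"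
    by (simp add: F_idem_def mate_def cp_simps LW_simps V_id_left V_id_right V_assoc E_idem_1[OF i v'])
  then show ?thesis using mate_id[OF v] by simp
qed

text \<open>Mates reverse composition, so the mate of an idempotent is idempotent.\<close>

lemma F_idem_2_idem:
  assumes i: "1 \<le> i" and v: "wfo a (Idn v)"
  shows "cp a (F_idem i 2 \<odot> F_idem i 2) v = cp a (F_idem i 2) v"
proof -
  interpret adjoint_words "[Ee i, Ee i]" "[Ff i, Ff i]" "cups i 2" "caps i 2" by (rule adjoint_words_2[OF i])
  have v': "wfo a (Idn (Ff i # Ff i # v))" using i v by simp
  have F: "F_idem i 2 = mt (E_idem i 2)" by (simp add: F_idem_mate numeral_2_eq_2)
  have d: "dom (E_idem i 2) = [Ee i, Ee i]" "cod (E_idem i 2) = [Ee i, Ee i]"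
    using dom_idem_letter[of "Ed i 2"] by (simp_all add: numeral_2_eq_2)
  have "cp a (F_idem i 2 \<odot> F_idem i 2) v = cp a (mt (E_idem i 2 \<odot> E_idem i 2)) v"
    unfolding F cp_ver using mate_ver[OF v d d] by simp
  also have "\<dots> = cp a (mt (E_idem i 2)) v"
    by (rule mate_cong) (use E_idem_2_idem[OF i v'] in simp)
  finally show ?thesis by (simp add: F)
qed

text \<open>Exponents from 3 on give zero after killing weights, so the properties of the
  idempotents have to be computed for exponents 1 and 2 only. This bypasses nilHecke algebras of
  higher rank.\<close>

lemma idem_letter_cases:
  assumes "okl l"
  obtains i where "l = Ed i 1" "1 \<le> i" | i where "l = Fd i 1" "1 \<le> i" | i where "l = Ed i 2" "1 \<le> i" | i where "l = Fd i 2" "1 \<le> i"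
  | k s where "expand_letter l = replicate k s" "3 \<le> k" "1 \<le> lindex s"
proof (cases l)
  case (Ed i k)
  then have "k = 1 \<or> k = 2 \<or> 3 \<le> k" "1 \<le> i" using assms by auto
  then show ?thesis using that Ed by fastforce
next
  case (Fd i k)
  then have "k = 1 \<or> k = 2 \<or> 3 \<le> k" "1 \<le> i" using assms by auto
  then show ?thesis using that Fd by fastforce
qed

lemma ty_idem_letter: "okl l \<Longrightarrow> a \<in> Wts \<Longrightarrow> ty a (expand_letter l) (expand_letter l) (fo a (idem_letter l))"
  by (rule ty_fo) (simp_all add: wfo_idem_letter)

lemma idem_letter_zero:
  assumes "okl l" "a \<in> Wts" "expand_letter l = replicate k s" "3 \<le> k" "1 \<le> lindex s"
  shows "fo a (idem_letter l) = fo a (Nul (expand_letter l) (expand_letter l))"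
  using zero_word[OF _ ty_idem_letter[OF assms(1,2)]] cube_zero[OF assms(2,5,4)] by (simp add: assms(3))

lemma idem_letter_idem:
  assumes "okl l" "a \<in> Wts"
  shows "V a (fo a (idem_letter l)) (fo a (idem_letter l)) = fo a (idem_letter l)"
  using assms(1)
proof (cases rule: idem_letter_cases)
  case (1 i)
  then show ?thesis using E_idem_1[of i a "[]"] assms by (simp add: cp_Nil V_id_left)
next
  case (2 i)
  then show ?thesis using F_idem_1[of i a "[]"] assms by (simp add: cp_Nil V_id_left)
next
  case (3 i)
  then show ?thesis using E_idem_2_idem[of i a "[]"] assms by (simp add: cp_Nil fo_ver)
next
  case (4 i)
  then show ?thesis using F_idem_2_idem[of i a "[]"] assms by (simp add: cp_Nil fo_ver)
next
  case (5 k s)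
  have "ty a (expand_letter l) (expand_letter l) (V a (fo a (idem_letter l)) (fo a (idem_letter l)))"
    using ty_V ty_idem_letter[OF assms] by blast
  from zero_word[OF _ this] show ?thesis
    using idem_letter_zero[OF assms 5] cube_zero[OF assms(2) 5(3,2)] 5 by simp
qed

lemma lam_act [simp]: "lam (act (Ee i # w) a) i = lam (act w a) i + 2" "lam (act (Ff i # w) a) i = lam (act w a) i - 2"
  by (auto simp: act_Cons lam_def eps_def)

lemma tyd_idem_letter:
  assumes l: "okl l" and a: "a \<in> Wts"
  shows "tyd a (expand_letter l) (expand_letter l) 0 (fo a (idem_letter l))"
  using l
proof (cases rule: idem_letter_cases)
  case (1 i)
  then show ?thesis using E_idem_1[of i a "[]"] l a tyd_Idn[of a "[Ee i]"] by (simp add: cp_Nil)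
next
  case (2 i)
  then show ?thesis using F_idem_1[of i a "[]"] l a tyd_Idn[of a "[Ff i]"] by (simp add: cp_Nil)
next
  case (3 i)
  have "has_deg a (E_idem i 2) 0"
    by (simp add: E_idem_def numeral_2_eq_2)
  then have "tyd a [Ee i, Ee i] [Ee i, Ee i] 0 (fo a (E_idem i 2))"
    using wfo_idem_letter[OF l a] dom_idem_letter[of l] 3 by (intro tyd_fo) (simp_all add: numeral_2_eq_2)
  then show ?thesis using 3 by (simp add: numeral_2_eq_2)
next
  case (4 i)
  have "has_deg a (F_idem i 2) 0"
    by (simp add: F_idem_def E_idem_def numeral_2_eq_2)
  then have "tyd a [Ff i, Ff i] [Ff i, Ff i] 0 (fo a (F_idem i 2))"
    using wfo_idem_letter[OF l a] dom_idem_letter[of l] 4 by (intro tyd_fo) (simp_all add: numeral_2_eq_2)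
  then show ?thesis using 4 by (simp add: numeral_2_eq_2)
next
  case (5 k s)
  \<comment> \<open>The class is zero and gets degree 0 from the representative
    \<open>Nul\<close>.\<close>
  then show ?thesis using tyd_Nul[of a "expand_letter l" "expand_letter l" 0] idem_letter_zero[OF l a 5] l a
    by simp
qed

section \<open>The foam 2-category\<close>

definition okd :: "dword \<Rightarrow> bool" where "okd P \<longleftrightarrow> (\<forall>l\<in>set P. okl l)"

lemma okd_simps [simp]: "okd []" "okd (l # P) \<longleftrightarrow> okl l \<and> okd P" "okd (P @ Q) \<longleftrightarrow> okd P \<and> okd Q"
  by (auto simp: okd_def)

lemma expand_simps [simp]: "expand [] = []" "expand (l # P) = expand_letter l @ expand P"
  "expand (P @ Q) = expand P @ expand Q"
  by (auto simp: expand_def)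

lemma okd_okw [simp]: "okd P \<Longrightarrow> okw (expand P)"
  by (induction P) auto

lemma web_words_eq: "web_words a b = {P. a \<in> Wts \<and> okd P \<and> act (expand P) a = b}"
proof -
  have "(\<exists>m. a \<in> weights m \<and> list_all (dletter_ok m) P) \<longleftrightarrow> a \<in> Wts \<and> okd P" for P
  proof
    assume "\<exists>m. a \<in> weights m \<and> list_all (dletter_ok m) P"
    moreover have "dletter_ok m l \<Longrightarrow> okl l" for m l by (cases l) auto
    ultimately show "a \<in> Wts \<and> okd P" by (auto simp: Wts_def okd_def list_all_iff)
  next
    have mono: "dletter_ok m l \<Longrightarrow> m \<le> m' \<Longrightarrow> dletter_ok m' l" for m m' l by (cases l) auto
    assume *: "a \<in> Wts \<and> okd P"
    then obtain m where m: "a \<in> weights m" by (auto simp: Wts_def)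
    have "\<exists>m'. list_all (dletter_ok m') P"
      using conjunct2[OF *]
    proof (induction P)
      case (Cons l P)
      then obtain m1 where m1: "list_all (dletter_ok m1) P" by auto
      obtain m2 where "dletter_ok m2 l" using Cons.prems by (cases l) auto
      then have "list_all (dletter_ok (max m1 m2)) (l # P)"
        using m1 mono[of m1 _ "max m1 m2"] mono[of m2 _ "max m1 m2"] by (auto simp: list_all_iff)
      then show ?case by blast
    qed simp
    then obtain m' where "list_all (dletter_ok m') P" by blast
    then have "a \<in> weights (max m m') \<and> list_all (dletter_ok (max m m')) P"
      using weights_mono[OF m, of "max m m'"] mono[of m' _ "max m m'"] by (auto simp: list_all_iff)
    then show "\<exists>m. a \<in> weights m \<and> list_all (dletter_ok m) P" by blast
  qed
  then show ?thesis unfolding web_words_def by blast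
qed

definition ip :: "weight \<Rightarrow> dword \<Rightarrow> foam" where "ip a P = fo a (idem P)"

lemma dom_idem [simp]: "dom (idem P) = expand P" "cod (idem P) = expand P"
  by (induction P) (auto simp: idem_def)

lemma ip_Nil [simp]: "ip a [] = fo a (Idn [])" by (simp add: ip_def idem_def)

lemma ip_Cons: "ip a (l # P) = Hc a (fo (act (expand P) a) (idem_letter l)) (ip a P)"
  using dom_idem(1)[of P] by (simp add: ip_def idem_def fo_hor)

lemma tyd_ip: "okd P \<Longrightarrow> a \<in> Wts \<Longrightarrow> tyd a (expand P) (expand P) 0 (ip a P)"
proof (induction P)
  case Nil
  then show ?case using tyd_Idn[of a "[]"] by simp
next
  case (Cons l P)
  then have "tyd a (expand_letter l @ expand P) (expand_letter l @ expand P) (0 + 0) (ip a (l # P))"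
    unfolding ip_Cons by (intro tyd_Hc tyd_idem_letter) auto
  then show ?case by simp
qed

lemma ty_ip: "okd P \<Longrightarrow> a \<in> Wts \<Longrightarrow> ty a (expand P) (expand P) (ip a P)"
  using tyd_ty tyd_ip by blast

lemma ip_ip: "okd P \<Longrightarrow> a \<in> Wts \<Longrightarrow> V a (ip a P) (ip a P) = ip a P"
proof (induction P)
  case Nil
  then show ?case by (simp add: V_id_left)
next
  case (Cons l P)
  note l = ty_idem_letter[of l "act (expand P) a"] and P = ty_ip[of P a]
  show ?case
    unfolding ip_Cons using Cons l P by (subst Hc_V[OF l l P P]) (auto simp: idem_letter_idem)
qed

lemma ip_append: "\<lbrakk>okd R; okd P; a \<in> Wts\<rbrakk> \<Longrightarrow> ip a (R @ P) = Hc a (ip (act (expand P) a) R) (ip a P)"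
proof (induction R)
  case Nil
  then show ?case using Hc_unit_left[OF ty_ip] by simp
next
  case (Cons l R)
  let ?b = "act (expand P) a"
  have b: "?b \<in> Wts" using Cons.prems by simp
  note l = ty_idem_letter[of l "act (expand R) ?b"] and R = ty_ip[of R ?b] and P = ty_ip[of P a]
  show ?case
    using Cons l R P b
    by (simp add: ip_Cons act_append) (rule Hc_assoc[OF l R P, symmetric], auto)
qed

text \<open>The 2-morphisms of the idempotent completion: classes that absorb the idempotents of
  source and target.\<close>

definition hk :: "weight \<Rightarrow> dword \<Rightarrow> dword \<Rightarrow> foam \<Rightarrow> bool" where
  "hk a P Q F \<longleftrightarrow> ty a (expand P) (expand Q) F \<and> V a (ip a Q) F = F \<and> V a F (ip a P) = F"

definition hkd :: "weight \<Rightarrow> dword \<Rightarrow> dword \<Rightarrow> int \<Rightarrow> foam \<Rightarrow> bool" where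
  "hkd a P Q d F \<longleftrightarrow> tyd a (expand P) (expand Q) d F \<and> V a (ip a Q) F = F \<and> V a F (ip a P) = F"

lemma hkd_hk: "hkd a P Q d F \<Longrightarrow> hk a P Q F"
  by (auto simp: hk_def hkd_def dest: tyd_ty)

text \<open>For idempotents e and f, the single equation f t e = t is equivalent to f t = t and t e
  = t. The second form is the one that composes well.\<close>

lemma foam_dgms_iff:
  assumes "okd P" "okd Q"
  shows "t \<in> foam_dgms a P Q \<longleftrightarrow> wfo a t \<and> dom t = expand P \<and> cod t = expand Q \<and>
     V a (ip a Q) (fo a t) = fo a t \<and> V a (fo a t) (ip a P) = fo a t"
proof -
  have "foam_eq a (idem Q \<odot> t \<odot> idem P) t \<longleftrightarrow> V a (ip a Q) (fo a t) = fo a t \<and> V a (fo a t) (ip a P) = fo a t"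
    if t: "wfo a t" "dom t = expand P" "cod t = expand Q"
  proof -
    have a: "a \<in> Wts" using t by (simp add: wfo_Wts)
    note p = ty_ip[OF assms(1) a] and q = ty_ip[OF assms(2) a] and tt = ty_fo[OF t]
    have "foam_eq a (idem Q \<odot> t \<odot> idem P) t \<longleftrightarrow> fo a (idem Q \<odot> t \<odot> idem P) = fo a t"
      using fo_eq_iff[OF t(1), of "idem Q \<odot> t \<odot> idem P"] foam_eq_sym by blast
    also have "\<dots> \<longleftrightarrow> V a (ip a Q) (V a (fo a t) (ip a P)) = fo a t" by (simp add: fo_ver ip_def)
    also have "\<dots> \<longleftrightarrow> V a (ip a Q) (fo a t) = fo a t \<and> V a (fo a t) (ip a P) = fo a t"
    proof
      assume e: "V a (ip a Q) (V a (fo a t) (ip a P)) = fo a t"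
      have "V a (ip a Q) (fo a t) = V a (ip a Q) (V a (ip a Q) (V a (fo a t) (ip a P)))" by (simp add: e)
      also have "\<dots> = fo a t"
        using ty_V_assoc[OF ty_V[OF p tt] q q] by (simp add: ip_ip[OF assms(2) a] e)
      finally have 1: "V a (ip a Q) (fo a t) = fo a t" .
      have "V a (fo a t) (ip a P) = V a (V a (ip a Q) (V a (fo a t) (ip a P))) (ip a P)" unfolding e ..
      also have "\<dots> = fo a t"
        unfolding ty_V_assoc[OF p ty_V[OF p tt] q] ty_V_assoc[OF p p tt] ip_ip[OF assms(1) a] by (rule e)
      finally show "V a (ip a Q) (fo a t) = fo a t \<and> V a (fo a t) (ip a P) = fo a t" using 1 by simp
    qed simp
    finally show ?thesis .
  qed
  then show ?thesis unfolding foam_dgms_def wfo_def by auto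
qed

lemma foam_hom: "okd P \<Longrightarrow> okd Q \<Longrightarrow> F \<in> fo a ` foam_dgms a P Q \<longleftrightarrow> hk a P Q F"
  by (auto simp: foam_dgms_iff hk_def ty_def image_iff Bex_def)

lemma foam_hom_deg: "okd P \<Longrightarrow> okd Q \<Longrightarrow> F \<in> fo a ` {t \<in> foam_dgms a P Q. has_deg a t d} \<longleftrightarrow> hkd a P Q d F"
  by (auto simp: foam_dgms_iff hkd_def tyd_def image_iff Bex_def)

lemma hk_ty: "hk a P Q F \<Longrightarrow> ty a (expand P) (expand Q) F" by (simp add: hk_def)

lemma hk_ip: "okd P \<Longrightarrow> a \<in> Wts \<Longrightarrow> hk a P P (ip a P)"
  by (simp add: hk_def ty_ip ip_ip)
lemma hkd_ip: "okd P \<Longrightarrow> a \<in> Wts \<Longrightarrow> hkd a P P 0 (ip a P)"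
  by (simp add: hkd_def tyd_ip ip_ip)

lemma hkdI: "hk a P Q F \<Longrightarrow> tyd a (expand P) (expand Q) d F \<Longrightarrow> hkd a P Q d F"
  by (simp add: hk_def hkd_def)

lemma hkd_tyd: "hkd a P Q d F \<Longrightarrow> tyd a (expand P) (expand Q) d F" by (simp add: hkd_def)

lemma hk_V:
  assumes "hk a P Q F" "hk a Q R G" "okd P" "okd Q" "okd R"
  shows "hk a P R (V a G F)"
proof -
  have a: "a \<in> Wts" using ty_okw[OF hk_ty[OF assms(1)]] by simp
  note p = ty_ip[OF assms(3) a] and q = ty_ip[OF assms(5) a] and f = hk_ty[OF assms(1)] and g = hk_ty[OF assms(2)]
  show ?thesis
    using ty_V_assoc[OF p f g] ty_V_assoc[OF f g q, symmetric] assms ty_V[OF f g]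
    by (simp add: hk_def)
qed

lemma hkd_V: "\<lbrakk>hkd a P Q d F; hkd a Q R e G; okd P; okd Q; okd R\<rbrakk> \<Longrightarrow> hkd a P R (e + d) (V a G F)"
  by (rule hkdI[OF hk_V[of a P Q F R G]]) (auto intro: hkd_hk tyd_V hkd_tyd)

lemma hk_A: "\<lbrakk>hk a P Q F; hk a P Q G; okd P; okd Q\<rbrakk> \<Longrightarrow> hk a P Q (A a F G)"
  using ty_okw[of a "expand P" "expand Q" F] ty_cls[of a "expand P" "expand Q" F] ty_cls[of a "expand P" "expand Q" G]
    ty_cls[OF ty_ip[of P a]] ty_cls[OF ty_ip[of Q a]]
  by (auto simp: hk_def V_A_left V_A_right ty_A)

lemma hkd_A: "\<lbrakk>hkd a P Q d F; hkd a P Q d G; okd P; okd Q\<rbrakk> \<Longrightarrow> hkd a P Q d (A a F G)"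
  by (rule hkdI[OF hk_A]) (auto intro: hkd_hk tyd_A hkd_tyd)

lemma hk_Sc: "\<lbrakk>hk a P Q F; okd P; okd Q\<rbrakk> \<Longrightarrow> hk a P Q (Sc a z F)"
  using ty_okw[of a "expand P" "expand Q" F] ty_cls[of a "expand P" "expand Q" F]
    ty_cls[OF ty_ip[of P a]] ty_cls[OF ty_ip[of Q a]]
  by (auto simp: hk_def V_Sc_left V_Sc_right ty_Sc)

lemma hk_Nul: "\<lbrakk>okd P; okd Q; a \<in> Wts; act (expand P) a = act (expand Q) a\<rbrakk> \<Longrightarrow>
    hk a P Q (fo a (Nul (expand P) (expand Q)))"
  using ty_V_Nul_left[OF ty_ip[of P a], of "expand Q"] ty_V_Nul_right[OF ty_ip[of Q a], of "expand P"]
  by (auto simp: hk_def ty_Nul)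

lemma hkd_Nul: "\<lbrakk>okd P; okd Q; a \<in> Wts; act (expand P) a = act (expand Q) a\<rbrakk> \<Longrightarrow>
    hkd a P Q d (fo a (Nul (expand P) (expand Q)))"
  by (rule hkdI[OF hk_Nul]) (auto intro: tyd_Nul)

lemma hk_Hc:
  assumes G: "hk b R R' G" and F: "hk a P P' F" and b: "b = act (expand P) a" and ok: "okd P" "okd P'" "okd R" "okd R'"
  shows "hk a (R @ P) (R' @ P') (Hc a G F)"
proof -
  note f = hk_ty[OF F] and g = hk_ty[OF G]
  have a: "a \<in> Wts" and b': "b = act (expand P') a" "b \<in> Wts" using ty_okw[OF f] ty_okw[OF g] b by auto
  note p = ty_ip[OF ok(1) a] ty_ip[OF ok(2) a] ty_ip[OF ok(3) b'(2)] ty_ip[OF ok(4) b'(2)]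
  have "ty a (expand R @ expand P) (expand R' @ expand P') (Hc a G F)" by (rule ty_Hc) (use f g b in auto)
  then show ?thesis
    using G F Hc_V[OF g p(4) f p(2) b] Hc_V[OF p(3) g p(1) f b]
    by (simp add: hk_def ip_append ok a b[symmetric] b'(1)[symmetric])
qed

lemma hkd_Hc: "\<lbrakk>hkd b R R' e G; hkd a P P' d F; b = act (expand P) a; okd P; okd P'; okd R; okd R'\<rbrakk> \<Longrightarrow>
    hkd a (R @ P) (R' @ P') (e + d) (Hc a G F)"
  by (rule hkdI[OF hk_Hc]) (auto intro: hkd_hk tyd_Hc hkd_tyd)

lemma foam_cat_simps [simp]:
  "obj (foam_cat a b) = web_words a b"
  "idt (foam_cat a b) P = ip a P"
  "cmp (foam_cat a b) P Q R S T = V a S T"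
  "hadd (foam_cat a b) P Q S T = A a S T"
  "hzero (foam_cat a b) P Q = fo a (Nul (expand P) (expand Q))"
  by (auto simp: foam_cat_def ip_def V_def A_def)

lemma foam_cat_hom: "P \<in> web_words a b \<Longrightarrow> Q \<in> web_words a b \<Longrightarrow> F \<in> hom (foam_cat a b) P Q \<longleftrightarrow> hk a P Q F"
  by (simp add: foam_cat_def foam_hom web_words_eq)

lemma preadditive_foam_cat: "preadditive (foam_cat a b)"
proof (unfold_locales, unfold foam_cat_simps)
  note ww = web_words_eq
  fix x assume x: "x \<in> web_words a b"
  show "ip a x \<in> hom (foam_cat a b) x x" using x by (simp add: foam_cat_hom hk_ip ww)
  fix y assume y: "y \<in> web_words a b"
  show "fo a (Nul (expand x) (expand y)) \<in> hom (foam_cat a b) x y"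
    using x y by (simp add: foam_cat_hom, auto simp: ww intro!: hk_Nul)
  {
    fix f assume "f \<in> hom (foam_cat a b) x y"
    then have f: "hk a x y f" using x y by (simp add: foam_cat_hom)
    note tf = hk_ty[OF f]
    show "V a (ip a y) f = f" "V a f (ip a x) = f" using f by (simp_all add: hk_def)
    show "A a f (fo a (Nul (expand x) (expand y))) = f" by (rule A_zero[OF ty_src[OF tf] ty_tgt[OF tf]])
    fix g assume "g \<in> hom (foam_cat a b) x y"
    then have g: "hk a x y g" using x y by (simp add: foam_cat_hom)
    note tg = hk_ty[OF g]
    show "A a f g \<in> hom (foam_cat a b) x y"
      using x y hk_A[OF f g] by (simp add: foam_cat_hom, simp add: ww)
    show "A a f g = A a g f" by (rule A_comm[OF ty_cls[OF tf] ty_cls[OF tg]])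
    fix h assume "h \<in> hom (foam_cat a b) x y"
    then have h: "hk a x y h" using x y by (simp add: foam_cat_hom)
    show "A a (A a f g) h = A a f (A a g h)"
      by (rule A_assoc[OF ty_cls[OF tf] ty_cls[OF tg] ty_cls[OF hk_ty[OF h]]])
  }
  fix z assume z: "z \<in> web_words a b"
  {
    fix f g assume "f \<in> hom (foam_cat a b) x y" "g \<in> hom (foam_cat a b) y z"
    then have f: "hk a x y f" and g: "hk a y z g" using x y z by (simp_all add: foam_cat_hom)
    show "V a g f \<in> hom (foam_cat a b) x z"
      using x y z hk_V[OF f g] by (simp add: foam_cat_hom, simp add: ww)
  }
  {
    fix f g h assume "f \<in> hom (foam_cat a b) x y" "g \<in> hom (foam_cat a b) y z" "h \<in> hom (foam_cat a b) y z"
    then have "cls a f" "cls a g" "cls a h"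
      using x y z by (auto simp: foam_cat_hom dest!: hk_ty intro: ty_cls)
    then show "V a (A a g h) f = A a (V a g f) (V a h f)" by (rule V_A_left[rotated, rotated]) 
  }
  {
    fix f g h assume "f \<in> hom (foam_cat a b) x y" "g \<in> hom (foam_cat a b) x y" "h \<in> hom (foam_cat a b) y z"
    then have "cls a f" "cls a g" "cls a h"
      using x y z by (auto simp: foam_cat_hom dest!: hk_ty intro: ty_cls)
    then show "V a h (A a f g) = A a (V a h f) (V a h g)" by (simp add: V_A_right)
  }
  {
    fix f assume "f \<in> hom (foam_cat a b) x y"
    then have f: "hk a x y f" using x y by (simp add: foam_cat_hom)
    show "V a (fo a (Nul (expand y) (expand z))) f = fo a (Nul (expand x) (expand z))"
      by (rule ty_V_Nul_left[OF hk_ty[OF f]]) (use y z in \<open>auto simp: ww\<close>)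
  }
  {
    fix g assume "g \<in> hom (foam_cat a b) y z"
    then have g: "hk a y z g" using z y by (simp add: foam_cat_hom)
    show "V a g (fo a (Nul (expand x) (expand y))) = fo a (Nul (expand x) (expand z))"
      by (rule ty_V_Nul_right[OF hk_ty[OF g]]) (use x y in \<open>auto simp: ww\<close>)
  }
  fix w f g h assume w: "w \<in> web_words a b"
    and "f \<in> hom (foam_cat a b) w x" "g \<in> hom (foam_cat a b) x y" "h \<in> hom (foam_cat a b) y z"
  then have "hk a w x f" "hk a x y g" "hk a y z h" using x y z by (simp_all add: foam_cat_hom)
  then show "V a h (V a g f) = V a (V a h g) f"
    using ty_V_assoc[OF hk_ty hk_ty hk_ty] by metis
qed

interpretation fc: preadditive "foam_cat a b" for a b
  by (rule preadditive_foam_cat)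

subsection \<open>Matrices of foams\<close>

lemma length_tens: "length [R @ P. R \<leftarrow> Rs, P \<leftarrow> Ps] = length Rs * length Ps"
  by (induction Rs) auto

lemma nth_tens: "i < length Rs * length Ps \<Longrightarrow>
    [R @ P. R \<leftarrow> Rs, P \<leftarrow> Ps] ! i = Rs ! (i div length Ps) @ Ps ! (i mod length Ps)"
proof (induction Rs arbitrary: i)
  case (Cons R Rs)
  show ?case
  proof (cases "i < length Ps")
    case True
    then show ?thesis by (simp add: nth_append)
  next
    case False
    then obtain j where j: "i = length Ps + j" using le_Suc_ex not_less by blast
    have "0 < length Ps" using Cons.prems by (cases Ps) auto
    then show ?thesis using Cons.IH[of j] Cons.prems by (simp add: nth_append j)
  qed
qed simp

lemma divmod_less: "i < m * (n::nat) \<Longrightarrow> i div n < m \<and> i mod n < n"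
  by (cases "n = 0") (auto simp: less_mult_imp_div_less)

lemma fm_hcomp_entry: "i < length Rs' * length Ps' \<Longrightarrow> j < length Rs * length Ps \<Longrightarrow>
    fm_hcomp (b, Rs, c) (b', Rs', c') (a, Ps, b'') (a', Ps', b''') N M (i, j) =
    Hc a (N (i div length Ps', j div length Ps)) (M (i mod length Ps', j mod length Ps))"
  by simp

declare fm_hcomp.simps [simp del]

text \<open>The value of the parameter \<open>Z\<close> of \<open>gl2\<close> for foams.\<close>

definition zero_fm :: "web \<Rightarrow> web \<Rightarrow> foam_matrix" where
  "zero_fm = (\<lambda>(a, Ps, b) (a', Qs, b'). \<lambda>(i, j) \<in> {..<length Qs} \<times> {..<length Ps}.
     fo a (Nul (expand (Ps ! j)) (expand (Qs ! i))))"

definition ws :: "weight \<Rightarrow> weight \<Rightarrow> dword list \<Rightarrow> bool" where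
  "ws a b Ps \<longleftrightarrow> a \<in> Wts \<and> b \<in> Wts \<and> set Ps \<subseteq> web_words a b"

lemma ws_lists: "ws a b Ps \<Longrightarrow> Ps \<in> lists (web_words a b)" by (auto simp: ws_def)
lemma ws_nth: "ws a b Ps \<Longrightarrow> i < length Ps \<Longrightarrow> Ps ! i \<in> web_words a b" by (auto simp: ws_def)
lemma ws_nth': "ws a b Ps \<Longrightarrow> i < length Ps \<Longrightarrow> okd (Ps ! i) \<and> act (expand (Ps ! i)) a = b"
  using ws_nth[of a b Ps i] by (simp add: web_words_eq)

lemma TwoFoam_one: "a \<in> Wts \<Longrightarrow> b \<in> Wts \<Longrightarrow> p \<in> one TwoFoam a b \<longleftrightarrow> (\<exists>Ps. p = (a, Ps, b) \<and> ws a b Ps)"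
  by (auto simp: TwoFoam_def ws_def Wts_def)

text \<open>Matrices of foams without reference to the target weight. All hom-sets of
  \<open>TwoFoam\<close> between well-formed webs are reduced to this predicate or to its graded
  form \<open>fmd\<close>.\<close>

definition fm :: "weight \<Rightarrow> dword list \<Rightarrow> dword list \<Rightarrow> foam_matrix \<Rightarrow> bool" where
  "fm a Ps Qs M \<longleftrightarrow> M \<in> extensional ({..<length Qs} \<times> {..<length Ps}) \<and>
    (\<forall>i<length Qs. \<forall>j<length Ps. hk a (Ps ! j) (Qs ! i) (M (i, j)))"

definition fmd :: "weight \<Rightarrow> dword list \<Rightarrow> dword list \<Rightarrow> int \<Rightarrow> foam_matrix \<Rightarrow> bool" where
  "fmd a Ps Qs d M \<longleftrightarrow> M \<in> extensional ({..<length Qs} \<times> {..<length Ps}) \<and>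
    (\<forall>i<length Qs. \<forall>j<length Ps. hkd a (Ps ! j) (Qs ! i) d (M (i, j)))"

lemma fm_entry: "\<lbrakk>fm a Ps Qs M; i < length Qs; j < length Ps\<rbrakk> \<Longrightarrow> hk a (Ps ! j) (Qs ! i) (M (i, j))"
  by (simp add: fm_def)

lemma fm_eqI: "fm a Ps Qs M \<Longrightarrow> fm a Ps Qs N \<Longrightarrow> (\<And>i j. i < length Qs \<Longrightarrow> j < length Ps \<Longrightarrow> M (i, j) = N (i, j)) \<Longrightarrow> M = N"
  unfolding fm_def by (intro extensionalityI[of M "{..<length Qs} \<times> {..<length Ps}" N]) auto

lemma fmd_fm: "fmd a Ps Qs d M \<Longrightarrow> fm a Ps Qs M" by (auto simp: fm_def fmd_def intro: hkd_hk)

lemma mhom_fm: "ws a b Ps \<Longrightarrow> ws a b Qs \<Longrightarrow> M \<in> mhom (foam_cat a b) Ps Qs \<longleftrightarrow> fm a Ps Qs M"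
  by (auto simp: fc.mhom_iff fm_def foam_cat_hom ws_nth)

lemma TwoFoam_two: "ws a b Ps \<Longrightarrow> ws a b Qs \<Longrightarrow> M \<in> two TwoFoam (a, Ps, b) (a, Qs, b) \<longleftrightarrow> fm a Ps Qs M"
  by (simp add: TwoFoam_def mhom_fm)

lemma TwoFoam_two_deg: "ws a b Ps \<Longrightarrow> ws a b Qs \<Longrightarrow>
    M \<in> two_deg TwoFoam (a, Ps, b) (a, Qs, b) d \<longleftrightarrow> fmd a Ps Qs d M"
proof -
  assume *: "ws a b Ps" "ws a b Qs"
  have "M \<in> (\<Pi>\<^sub>E (i, j) \<in> {..<length Qs} \<times> {..<length Ps}.
           fo a ` {t \<in> foam_dgms a (Ps ! j) (Qs ! i). has_deg a t d}) \<longleftrightarrow> fmd a Ps Qs d M"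
    unfolding PiE_def fmd_def using * by (auto simp: Pi_iff foam_hom_deg ws_nth')
  then show ?thesis by (simp add: TwoFoam_def)
qed

lemma fm_mcmp: "\<lbrakk>ws a b Ps; ws a b Qs; ws a b Rs; fm a Ps Qs M; fm a Qs Rs N\<rbrakk> \<Longrightarrow>
    fm a Ps Rs (mcmp (foam_cat a b) Ps Qs Rs N M)"
  using fc.mcmp_in[of Ps a b Qs Rs M N] by (simp add: mhom_fm ws_lists)

lemma fmd_mcmp:
  assumes "ws a b Ps" "ws a b Qs" "ws a b Rs" "fmd a Ps Qs k M" "fmd a Qs Rs l N"
  shows "fmd a Ps Rs (l + k) (mcmp (foam_cat a b) Ps Qs Rs N M)"
  unfolding fmd_def
proof (intro conjI allI impI)
  fix i j assume ij: "i < length Rs" "j < length Ps"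
  \<comment> \<open>Sums of classes of one degree are homogeneous of that degree, including the
    empty sum, which is the zero class.\<close>
  have s: "hkd a P R d (fc.isum a b P R n f)"
    if "P \<in> web_words a b" "R \<in> web_words a b" "\<And>k. k < n \<Longrightarrow> hkd a P R d (f k)" for P R d n f
    using that(3)
  proof (induction n)
    case 0
    then show ?case using that(1,2) by (auto simp: web_words_eq intro!: hkd_Nul)
  next
    case (Suc n)
    have "hk a P R (f k)" if "k \<le> n" for k using hkd_hk[OF Suc.prems[of k]] that by simp
    then have "fc.isum a b P R (Suc n) f = A a (fc.isum a b P R n f) (f n)"
      using that(1,2) by (subst fc.isum_Suc) (auto simp: foam_cat_hom)
    then show ?case using Suc that(1,2) by (auto simp: web_words_eq intro!: hkd_A)
  qed
  show "hkd a (Ps ! j) (Rs ! i) (l + k) (mcmp (foam_cat a b) Ps Qs Rs N M (i, j))"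
    unfolding fc.mcmp_entry[OF ij]
    by (rule s) (use assms ij ws_nth' in \<open>auto simp: ws_nth fmd_def intro!: hkd_V\<close>)
qed (simp add: mcmp_def)

lemma isum_Sc:
  assumes "P \<in> web_words a b" "R \<in> web_words a b" "\<And>k. k < n \<Longrightarrow> hk a P R (f k)"
  shows "fc.isum a b P R n (\<lambda>k. Sc a z (f k)) = Sc a z (fc.isum a b P R n f)"
  using assms(3)
proof (induction n)
  case 0
  then show ?case using assms(1,2) by (auto simp: web_words_eq Sc_Nul)
next
  case (Suc n)
  have h: "hk a P R (fc.isum a b P R n f)"
    using fc.isum_in[of P a b R n f] assms(1,2) Suc.prems by (simp add: foam_cat_hom)
  have "fc.isum a b P R (Suc n) f = A a (fc.isum a b P R n f) (f n)"
    using assms(1,2) Suc.prems by (subst fc.isum_Suc) (auto simp: foam_cat_hom)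
  moreover have "fc.isum a b P R (Suc n) (\<lambda>k. Sc a z (f k)) = A a (fc.isum a b P R n (\<lambda>k. Sc a z (f k))) (Sc a z (f n))"
    using assms(1,2) Suc.prems by (subst fc.isum_Suc) (auto simp: foam_cat_hom web_words_eq intro!: hk_Sc)
  ultimately show ?case
    using Suc ty_cls[OF hk_ty[OF h]] ty_cls[OF hk_ty[OF Suc.prems[of n]]] by (simp add: Sc_A)
qed

lemma Hc_isum_left:
  assumes R: "R \<in> web_words b c" "R' \<in> web_words b c" and P: "P \<in> web_words a b" "P' \<in> web_words a b"
    and F: "hk a P P' F" and f: "\<And>k. k < n \<Longrightarrow> hk b R R' (f k)"
  shows "Hc a (fc.isum b c R R' n f) F = fc.isum a c (R @ P) (R' @ P') n (\<lambda>k. Hc a (f k) F)"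
proof -
  have RP: "R @ P \<in> web_words a c" "R' @ P' \<in> web_words a c" using R P by (auto simp: web_words_eq act_append)
  have hf: "hk a (R @ P) (R' @ P') (Hc a (f k) F)" if "k < n" for k
    by (rule hk_Hc[OF f[OF that] F]) (use R P in \<open>auto simp: web_words_eq\<close>)
  show ?thesis
    using f hf
  proof (induction n)
    case 0
    then show ?case using Hc_Nul_left[OF hk_ty[OF F], of b "expand R" "expand R'"] R P by (auto simp: web_words_eq)
  next
    case (Suc n)
    have h: "hk b R R' (fc.isum b c R R' n f)"
      using fc.isum_in[of R b c R' n f] R Suc.prems by (simp add: foam_cat_hom)
    have "fc.isum b c R R' (Suc n) f = A b (fc.isum b c R R' n f) (f n)"
      using R Suc.prems by (subst fc.isum_Suc) (auto simp: foam_cat_hom)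
    moreover have "fc.isum a c (R @ P) (R' @ P') (Suc n) (\<lambda>k. Hc a (f k) F) =
        A a (fc.isum a c (R @ P) (R' @ P') n (\<lambda>k. Hc a (f k) F)) (Hc a (f n) F)"
      using RP Suc.prems by (subst fc.isum_Suc) (auto simp: foam_cat_hom)
    ultimately show ?case
      using Suc Hc_A_left[OF hk_ty[OF h] hk_ty[OF Suc.prems(1)[of n]] hk_ty[OF F]] P by (simp add: web_words_eq)
  qed
qed

lemma Hc_isum_right:
  assumes R: "R \<in> web_words b c" "R' \<in> web_words b c" and P: "P \<in> web_words a b" "P' \<in> web_words a b"
    and G: "hk b R R' G" and f: "\<And>k. k < n \<Longrightarrow> hk a P P' (f k)"
  shows "Hc a G (fc.isum a b P P' n f) = fc.isum a c (R @ P) (R' @ P') n (\<lambda>k. Hc a G (f k))"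
proof -
  have RP: "R @ P \<in> web_words a c" "R' @ P' \<in> web_words a c" using R P by (auto simp: web_words_eq act_append)
  have hf: "hk a (R @ P) (R' @ P') (Hc a G (f k))" if "k < n" for k
    by (rule hk_Hc[OF G f[OF that]]) (use R P in \<open>auto simp: web_words_eq\<close>)
  show ?thesis
    using f hf
  proof (induction n)
    case 0
    show ?case unfolding fc.isum_0 foam_cat_simps expand_simps
      by (rule Hc_Nul_right[OF hk_ty[OF G]]) (use P in \<open>simp_all add: web_words_eq\<close>)
  next
    case (Suc n)
    have h: "hk a P P' (fc.isum a b P P' n f)"
      using fc.isum_in[of P a b P' n f] P Suc.prems by (simp add: foam_cat_hom)
    have "fc.isum a b P P' (Suc n) f = A a (fc.isum a b P P' n f) (f n)"
      using P Suc.prems by (subst fc.isum_Suc) (auto simp: foam_cat_hom)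
    moreover have "fc.isum a c (R @ P) (R' @ P') (Suc n) (\<lambda>k. Hc a G (f k)) =
        A a (fc.isum a c (R @ P) (R' @ P') n (\<lambda>k. Hc a G (f k))) (Hc a G (f n))"
      using RP Suc.prems by (subst fc.isum_Suc) (auto simp: foam_cat_hom)
    ultimately show ?case
      using Suc Hc_A_right[OF hk_ty[OF G] hk_ty[OF h] hk_ty[OF Suc.prems(1)[of n]]] P by (simp add: web_words_eq)
  qed
qed

section \<open>Horizontal composition of matrices\<close>

abbreviation tens :: "dword list \<Rightarrow> dword list \<Rightarrow> dword list" where
  "tens Rs Ps \<equiv> [R @ P. R \<leftarrow> Rs, P \<leftarrow> Ps]"

lemma TwoFoam_simps [simp]:
  "obj2 TwoFoam = Wts"
  "unit1 TwoFoam a = (a, [[]], a)"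
  "comp1 TwoFoam (b, Rs, c) (a, Ps, b') = (a, tens Rs Ps, c)"
  "id2 TwoFoam (a, Ps, b) = mid (foam_cat a b) Ps"
  "vcomp TwoFoam (a, Ps, b) (a', Qs, b') (a'', Rs, b'') N M = mcmp (foam_cat a b) Ps Qs Rs N M"
  "hcomp TwoFoam = fm_hcomp"
  "add2 TwoFoam = fm_add"
  "scale2 TwoFoam = fm_scale"
  by (simp_all add: TwoFoam_def Wts_def)

lemma ws_tens: "ws b c Rs \<Longrightarrow> ws a b Ps \<Longrightarrow> ws a c (tens Rs Ps)"
  by (fastforce simp: ws_def web_words_eq act_append)

lemma ws_unit: "a \<in> Wts \<Longrightarrow> ws a a [[]]" by (simp add: ws_def web_words_eq)

text \<open>Associativity on the nose: concatenation of words is associative and both bracketings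
  list the triples in lexicographic order. This makes the 2-category strict.\<close>

lemma tens_assoc: "tens (tens Ts Rs) Ps = tens Ts (tens Rs Ps)"
proof -
  have e: "map ((@) (T @ R)) Ps = map (\<lambda>P. T @ R @ P) Ps" for T R by simp
  show ?thesis by (induction Ts) (auto simp: map_concat comp_def e)
qed

lemma tens_unit_left: "tens [[]] Ps = Ps" by (induction Ps) auto
lemma tens_unit_right: "tens Rs [[]] = Rs" by (induction Rs) auto

abbreviation hm :: "weight \<Rightarrow> weight \<Rightarrow> weight \<Rightarrow> dword list \<Rightarrow> dword list \<Rightarrow> dword list \<Rightarrow> dword list \<Rightarrow>
    foam_matrix \<Rightarrow> foam_matrix \<Rightarrow> foam_matrix" where
  "hm a b c Rs Rs' Ps Ps' \<equiv> fm_hcomp (b, Rs, c) (b, Rs', c) (a, Ps, b) (a, Ps', b)"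

lemma hm_entry: "i < length (tens Rs' Ps') \<Longrightarrow> j < length (tens Rs Ps) \<Longrightarrow>
    hm a b c Rs Rs' Ps Ps' N M (i, j) =
    Hc a (N (i div length Ps', j div length Ps)) (M (i mod length Ps', j mod length Ps))"
  unfolding length_tens by (rule fm_hcomp_entry)

lemma hm_fm:
  assumes w: "ws b c Rs" "ws b c Rs'" "ws a b Ps" "ws a b Ps'" and N: "fm b Rs Rs' N" and M: "fm a Ps Ps' M"
  shows "fm a (tens Rs Ps) (tens Rs' Ps') (hm a b c Rs Rs' Ps Ps' N M)"
  unfolding fm_def
proof (intro conjI allI impI)
  show "hm a b c Rs Rs' Ps Ps' N M \<in> extensional ({..<length (tens Rs' Ps')} \<times> {..<length (tens Rs Ps)})"
    unfolding length_tens by (simp add: fm_hcomp.simps)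
  fix i j assume i: "i < length (tens Rs' Ps')" and j: "j < length (tens Rs Ps)"
  note i' = divmod_less[OF i[unfolded length_tens]] and j' = divmod_less[OF j[unfolded length_tens]]
  show "hk a (tens Rs Ps ! j) (tens Rs' Ps' ! i) (hm a b c Rs Rs' Ps Ps' N M (i, j))"
    unfolding hm_entry[OF i j] nth_tens[OF i[unfolded length_tens]] nth_tens[OF j[unfolded length_tens]]
    by (rule hk_Hc[OF fm_entry[OF N] fm_entry[OF M]]) (use i' j' w ws_nth' in auto)
qed

lemma hm_fmd:
  assumes w: "ws b c Rs" "ws b c Rs'" "ws a b Ps" "ws a b Ps'" and N: "fmd b Rs Rs' l N" and M: "fmd a Ps Ps' k M"
  shows "fmd a (tens Rs Ps) (tens Rs' Ps') (l + k) (hm a b c Rs Rs' Ps Ps' N M)"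
  unfolding fmd_def
proof (intro conjI allI impI)
  show "hm a b c Rs Rs' Ps Ps' N M \<in> extensional ({..<length (tens Rs' Ps')} \<times> {..<length (tens Rs Ps)})"
    unfolding length_tens by (simp add: fm_hcomp.simps)
  fix i j assume i: "i < length (tens Rs' Ps')" and j: "j < length (tens Rs Ps)"
  note i' = divmod_less[OF i[unfolded length_tens]] and j' = divmod_less[OF j[unfolded length_tens]]
  show "hkd a (tens Rs Ps ! j) (tens Rs' Ps' ! i) (l + k) (hm a b c Rs Rs' Ps Ps' N M (i, j))"
    unfolding hm_entry[OF i j] nth_tens[OF i[unfolded length_tens]] nth_tens[OF j[unfolded length_tens]]
    by (rule hkd_Hc) (use i' j' w ws_nth' N M in \<open>auto simp: fmd_def\<close>)
qed

lemma mid_fm: "ws a b Ps \<Longrightarrow> fm a Ps Ps (mid (foam_cat a b) Ps)"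
  using fc.mid_in[of Ps a b] by (simp add: mhom_fm ws_lists)

lemma mid_fmd: "ws a b Ps \<Longrightarrow> fmd a Ps Ps 0 (mid (foam_cat a b) Ps)"
  unfolding fmd_def using ws_nth' by (auto simp: mid_def ws_def intro!: hkd_ip hkd_Nul)

lemma zero_fmd: "ws a b Ps \<Longrightarrow> ws a b Qs \<Longrightarrow> fmd a Ps Qs k (zero_fm (a, Ps, b) (a, Qs, b))"
  unfolding fmd_def zero_fm_def using ws_nth' by (auto simp: ws_def intro!: hkd_Nul)

lemma hm_mid:
  assumes w: "ws b c Rs" "ws a b Ps"
  shows "hm a b c Rs Rs Ps Ps (mid (foam_cat b c) Rs) (mid (foam_cat a b) Ps) = mid (foam_cat a c) (tens Rs Ps)"
proof (rule fm_eqI[OF hm_fm[OF w(1,1,2,2) mid_fm[OF w(1)] mid_fm[OF w(2)]] mid_fm[OF ws_tens[OF w]]])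
  fix i j assume i: "i < length (tens Rs Ps)" and j: "j < length (tens Rs Ps)"
  let ?n = "length Ps"
  note i' = divmod_less[OF i[unfolded length_tens]] and j' = divmod_less[OF j[unfolded length_tens]]
  note wR = ws_nth'[OF w(1)] and wP = ws_nth'[OF w(2)]
  have a: "a \<in> Wts" "b \<in> Wts" using w by (auto simp: ws_def)
  note e = nth_tens[OF i[unfolded length_tens]] nth_tens[OF j[unfolded length_tens]]
  have n: "expand (tens Rs Ps ! i) = expand (Rs ! (i div ?n)) @ expand (Ps ! (i mod ?n))"
    "expand (tens Rs Ps ! j) = expand (Rs ! (j div ?n)) @ expand (Ps ! (j mod ?n))" by (simp_all add: e)
  note M = hk_ty[OF fm_entry[OF mid_fm[OF w(2)]], of "i mod ?n" "j mod ?n"]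
  \<comment> \<open>An index of a product is a pair of a quotient and a remainder. If the indices
    differ, one of the two factors is a zero class, and horizontal composition with it is
    zero.\<close>
  consider "i = j" | "i div ?n = j div ?n" "i mod ?n \<noteq> j mod ?n" | "i div ?n \<noteq> j div ?n"
    by (metis div_mult_mod_eq)
  then have "Hc a (mid (foam_cat b c) Rs (i div ?n, j div ?n)) (mid (foam_cat a b) Ps (i mod ?n, j mod ?n)) =
    (if i = j then ip a (tens Rs Ps ! i) else fo a (Nul (expand (tens Rs Ps ! j)) (expand (tens Rs Ps ! i))))"
  proof cases
    case 1
    then show ?thesis using i' wR wP a by (simp add: mid_def e ip_append)
  next
    case 2
    have "Hc a (ip b (Rs ! (j div ?n))) (fo a (Nul (expand (Ps ! (j mod ?n))) (expand (Ps ! (i mod ?n))))) =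
      fo a (Nul (expand (Rs ! (j div ?n)) @ expand (Ps ! (j mod ?n))) (expand (Rs ! (j div ?n)) @ expand (Ps ! (i mod ?n))))"
      by (rule Hc_Nul_right[OF ty_ip]) (use i' j' wR wP a in auto)
    then show ?thesis using 2 i' j' by (auto simp: mid_def n)
  next
    case 3
    have "Hc a (fo b (Nul (expand (Rs ! (j div ?n))) (expand (Rs ! (i div ?n))))) (mid (foam_cat a b) Ps (i mod ?n, j mod ?n)) =
      fo a (Nul (expand (Rs ! (j div ?n)) @ expand (Ps ! (j mod ?n))) (expand (Rs ! (i div ?n)) @ expand (Ps ! (i mod ?n))))"
      by (rule Hc_Nul_left[OF M]) (use i' j' wR wP a in auto)
    then show ?thesis using 3 i' j' n by (auto simp: mid_def[of "foam_cat b c" Rs])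
  qed
  then show "hm a b c Rs Rs Ps Ps (mid (foam_cat b c) Rs) (mid (foam_cat a b) Ps) (i, j) = mid (foam_cat a c) (tens Rs Ps) (i, j)"
    unfolding hm_entry[OF i j] fc.mid_entry[OF i j] by simp
qed

text \<open>The middle index runs over pairs (j1, j2). Interchange of foams rewrites each term as a
  horizontal composite of a term for j1 and a term for j2, and by bilinearity the double sum
  factors.\<close>

lemma hm_interchange:
  assumes w: "ws b c Rs" "ws b c Rs'" "ws b c Rs''" "ws a b Ps" "ws a b Ps'" "ws a b Ps''"
    and N: "fm b Rs Rs' N" "fm b Rs' Rs'' N'" and M: "fm a Ps Ps' M" "fm a Ps' Ps'' M'"
  shows "mcmp (foam_cat a c) (tens Rs Ps) (tens Rs' Ps') (tens Rs'' Ps'') (hm a b c Rs' Rs'' Ps' Ps'' N' M') (hm a b c Rs Rs' Ps Ps' N M) =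
    hm a b c Rs Rs'' Ps Ps'' (mcmp (foam_cat b c) Rs Rs' Rs'' N' N) (mcmp (foam_cat a b) Ps Ps' Ps'' M' M)"
proof (rule fm_eqI)
  note t = ws_tens[OF w(1,4)] ws_tens[OF w(2,5)] ws_tens[OF w(3,6)]
  note h1 = hm_fm[OF w(1,2,4,5) N(1) M(1)] and h2 = hm_fm[OF w(2,3,5,6) N(2) M(2)]
  show "fm a (tens Rs Ps) (tens Rs'' Ps'') (mcmp (foam_cat a c) (tens Rs Ps) (tens Rs' Ps') (tens Rs'' Ps'')
      (hm a b c Rs' Rs'' Ps' Ps'' N' M') (hm a b c Rs Rs' Ps Ps' N M))" by (rule fm_mcmp[OF t h1 h2])
  show "fm a (tens Rs Ps) (tens Rs'' Ps'') (hm a b c Rs Rs'' Ps Ps'' (mcmp (foam_cat b c) Rs Rs' Rs'' N' N)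
      (mcmp (foam_cat a b) Ps Ps' Ps'' M' M))"
    by (rule hm_fm[OF w(1,3,4,6) fm_mcmp[OF w(1-3) N] fm_mcmp[OF w(4-6) M]])
  fix i k assume i: "i < length (tens Rs'' Ps'')" and k: "k < length (tens Rs Ps)"
  note i' = divmod_less[OF i[unfolded length_tens]] and k' = divmod_less[OF k[unfolded length_tens]]
  let ?n = "length Ps''" and ?m = "length Ps'" and ?l = "length Ps"
  let ?R = "Rs ! (k div ?l)" and ?R2 = "Rs'' ! (i div ?n)" and ?P = "Ps ! (k mod ?l)" and ?P2 = "Ps'' ! (i mod ?n)"
  have RR: "?R \<in> web_words b c" "?R2 \<in> web_words b c" and PP: "?P \<in> web_words a b" "?P2 \<in> web_words a b"
    using w i' k' by (auto simp: ws_nth)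
  have RP: "?R @ ?P \<in> web_words a c" "?R2 @ ?P2 \<in> web_words a c" using RR PP by (auto simp: web_words_eq act_append)
  have n: "tens Rs Ps ! k = ?R @ ?P" "tens Rs'' Ps'' ! i = ?R2 @ ?P2"
    using nth_tens[OF i[unfolded length_tens]] nth_tens[OF k[unfolded length_tens]] by simp_all
  define f where "f j1 = V b (N' (i div ?n, j1)) (N (j1, k div ?l))" for j1
  define g where "g j2 = V a (M' (i mod ?n, j2)) (M (j2, k mod ?l))" for j2
  have hf: "hk b ?R ?R2 (f j1)" if "j1 < length Rs'" for j1
    unfolding f_def by (rule hk_V[of b _ "Rs' ! j1"]) (use i' k' that N w ws_nth' in \<open>auto intro: fm_entry\<close>)
  have hg: "hk a ?P ?P2 (g j2)" if "j2 < ?m" for j2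
    unfolding g_def by (rule hk_V[of a _ "Ps' ! j2"]) (use i' k' that M w ws_nth' in \<open>auto intro: fm_entry\<close>)
  have hfg: "hk a (?R @ ?P) (?R2 @ ?P2) (Hc a (f j1) (g j2))" if "j1 < length Rs'" "j2 < ?m" for j1 j2
    by (rule hk_Hc[OF hf[OF that(1)] hg[OF that(2)]]) (use RR PP in \<open>auto simp: web_words_eq\<close>)
  have "mcmp (foam_cat a c) (tens Rs Ps) (tens Rs' Ps') (tens Rs'' Ps'')
      (hm a b c Rs' Rs'' Ps' Ps'' N' M') (hm a b c Rs Rs' Ps Ps' N M) (i, k) =
    fc.isum a c (?R @ ?P) (?R2 @ ?P2) (length Rs' * ?m) (\<lambda>j. Hc a (f (j div ?m)) (g (j mod ?m)))"
    unfolding fc.mcmp_entry[OF i k] n length_tens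
  proof (rule fc.isum_cong, unfold foam_cat_simps)
    fix j assume j: "j < length Rs' * ?m"
    then have j2: "j < length (tens Rs' Ps')" by (simp add: length_tens)
    note j' = divmod_less[OF j]
    show "V a (hm a b c Rs' Rs'' Ps' Ps'' N' M' (i, j)) (hm a b c Rs Rs' Ps Ps' N M (j, k)) =
      Hc a (f (j div ?m)) (g (j mod ?m))"
      unfolding hm_entry[OF i j2] hm_entry[OF j2 k] f_def g_def
      by (rule Hc_V[OF hk_ty hk_ty hk_ty hk_ty, OF fm_entry[OF N(1)] fm_entry[OF N(2)] fm_entry[OF M(1)] fm_entry[OF M(2)]])
        (use i' j' k' ws_nth'[OF w(4), of "k mod ?l"] in auto)
  qed
  also have "\<dots> = fc.isum a c (?R @ ?P) (?R2 @ ?P2) (length Rs')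
      (\<lambda>j1. fc.isum a c (?R @ ?P) (?R2 @ ?P2) ?m (\<lambda>j2. Hc a (f j1) (g j2)))"
    by (rule fc.isum_mult) (use RP hfg in \<open>auto simp: foam_cat_hom\<close>)
  also have "\<dots> = fc.isum a c (?R @ ?P) (?R2 @ ?P2) (length Rs')
      (\<lambda>j1. Hc a (f j1) (fc.isum a b ?P ?P2 ?m g))"
    by (rule fc.isum_cong) (simp add: Hc_isum_right[OF RR PP hf hg])
  also have "\<dots> = Hc a (fc.isum b c ?R ?R2 (length Rs') f) (fc.isum a b ?P ?P2 ?m g)"
  proof (rule Hc_isum_left[OF RR PP, symmetric])
    show "hk a ?P ?P2 (fc.isum a b ?P ?P2 ?m g)"
      using fc.isum_in[of ?P a b ?P2 ?m g] PP hg by (simp add: foam_cat_hom)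
  qed (rule hf)
  also have "\<dots> = hm a b c Rs Rs'' Ps Ps'' (mcmp (foam_cat b c) Rs Rs' Rs'' N' N) (mcmp (foam_cat a b) Ps Ps' Ps'' M' M) (i, k)"
    unfolding hm_entry[OF i k] f_def[abs_def] g_def[abs_def] using i' k' by (simp add: fc.mcmp_entry)
  finally show "mcmp (foam_cat a c) (tens Rs Ps) (tens Rs' Ps') (tens Rs'' Ps'')
      (hm a b c Rs' Rs'' Ps' Ps'' N' M') (hm a b c Rs Rs' Ps Ps' N M) (i, k) = \<dots>" .
qed

lemma hm_assoc:
  assumes w: "ws c d Ts" "ws c d Ts'" "ws b c Rs" "ws b c Rs'" "ws a b Ps" "ws a b Ps'"
    and L: "fm c Ts Ts' L" and N: "fm b Rs Rs' N" and M: "fm a Ps Ps' M"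
  shows "hm a b d (tens Ts Rs) (tens Ts' Rs') Ps Ps' (hm b c d Ts Ts' Rs Rs' L N) M =
    hm a c d Ts Ts' (tens Rs Ps) (tens Rs' Ps') L (hm a b c Rs Rs' Ps Ps' N M)"
proof (rule fm_eqI)
  note t = ws_tens[OF w(1,3)] ws_tens[OF w(2,4)] ws_tens[OF w(3,5)] ws_tens[OF w(4,6)]
  show "fm a (tens (tens Ts Rs) Ps) (tens (tens Ts' Rs') Ps') (hm a b d (tens Ts Rs) (tens Ts' Rs') Ps Ps' (hm b c d Ts Ts' Rs Rs' L N) M)"
    by (rule hm_fm[OF t(1,2) w(5,6) hm_fm[OF w(1-4) L N] M])
  show "fm a (tens (tens Ts Rs) Ps) (tens (tens Ts' Rs') Ps') (hm a c d Ts Ts' (tens Rs Ps) (tens Rs' Ps') L (hm a b c Rs Rs' Ps Ps' N M))"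
    unfolding tens_assoc by (rule hm_fm[OF w(1,2) t(3,4) L hm_fm[OF w(3-6) N M]])
  fix i j assume i: "i < length (tens (tens Ts' Rs') Ps')" and j: "j < length (tens (tens Ts Rs) Ps)"
  then have i2: "i < length (tens Ts' (tens Rs' Ps'))" and j2: "j < length (tens Ts (tens Rs Ps))"
    by (simp_all only: tens_assoc)
  \<comment> \<open>The two ways of reading k as a triple of coordinates agree, and all coordinates
    are in range.\<close>
  have key: "k div (r * p) = k div p div r" "k mod (r * p) div p = k div p mod r" "k mod (r * p) mod p = k mod p"
    "k div p div r < s" "k div p mod r < r" "k mod p < p" "k div p < s * r" "k mod (r * p) < r * p" "k div (r * p) < s"
    if "k < (s * r) * p" for k s r p :: nat
  proof -
    have pos: "0 < p" "0 < r" using that by (auto intro!: Nat.gr0I)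
    have "k mod (p * r) = p * (k div p mod r) + k mod p" by (rule mod_mult2_eq)
    then have m: "k mod (r * p) = p * (k div p mod r) + k mod p" by (simp add: mult.commute)
    show "k mod (r * p) div p = k div p mod r" "k mod (r * p) mod p = k mod p" using m pos by simp_all
    show "k div (r * p) = k div p div r" by (metis div_mult2_eq mult.commute)
    show "k div p < s * r" using that by (rule less_mult_imp_div_less)
    then show "k div p div r < s" by (rule less_mult_imp_div_less)
    show "k div (r * p) < s" using that by (intro less_mult_imp_div_less) (simp add: mult.assoc)
    show "k div p mod r < r" "k mod p < p" "k mod (r * p) < r * p" using pos by simp_all
  qed
  let ?p' = "length Ps'" and ?p = "length Ps" and ?r' = "length Rs'" and ?r = "length Rs"
  have il: "i < (length Ts' * ?r') * ?p'" and jl: "j < (length Ts * ?r) * ?p" using i j by (simp_all only: length_tens)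
  note ki = key[OF il] and kj = key[OF jl]
  have 1: "i div ?p' < length (tens Ts' Rs')" "j div ?p < length (tens Ts Rs)"
    "i mod (?r' * ?p') < length (tens Rs' Ps')" "j mod (?r * ?p) < length (tens Rs Ps)"
    using ki kj by (simp_all only: length_tens)
  have "hm a b d (tens Ts Rs) (tens Ts' Rs') Ps Ps' (hm b c d Ts Ts' Rs Rs' L N) M (i, j) =
    Hc a (Hc b (L (i div ?p' div ?r', j div ?p div ?r)) (N (i div ?p' mod ?r', j div ?p mod ?r))) (M (i mod ?p', j mod ?p))"
    by (simp only: hm_entry[OF i j] hm_entry[OF 1(1,2)])
  also have "\<dots> = Hc a (L (i div ?p' div ?r', j div ?p div ?r)) (Hc a (N (i div ?p' mod ?r', j div ?p mod ?r)) (M (i mod ?p', j mod ?p)))"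
    by (rule Hc_assoc[OF hk_ty hk_ty hk_ty, OF fm_entry[OF L] fm_entry[OF N] fm_entry[OF M]])
      (use ki kj ws_nth'[OF w(5), of "j mod ?p"] ws_nth'[OF w(3), of "j div ?p mod ?r"] in auto)
  also have "\<dots> = hm a c d Ts Ts' (tens Rs Ps) (tens Rs' Ps') L (hm a b c Rs Rs' Ps Ps' N M) (i, j)"
    using ki kj by (simp only: hm_entry[OF i2 j2] length_tens hm_entry[OF 1(3,4)])
  finally show "hm a b d (tens Ts Rs) (tens Ts' Rs') Ps Ps' (hm b c d Ts Ts' Rs Rs' L N) M (i, j) = \<dots>" .
qed

lemma mid_unit_entry: "mid (foam_cat a a) [[]] (0, 0) = fo a (Idn [])"
  by (simp add: mid_def)

lemma hm_unit_left:
  assumes w: "ws a b Ps" "ws a b Qs" and M: "fm a Ps Qs M"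
  shows "hm a b b [[]] [[]] Ps Qs (mid (foam_cat b b) [[]]) M = M"
proof (rule fm_eqI)
  have b: "b \<in> Wts" using w by (simp add: ws_def)
  note u = ws_unit[OF b]
  show "fm a Ps Qs (hm a b b [[]] [[]] Ps Qs (mid (foam_cat b b) [[]]) M)"
    using hm_fm[OF u u w mid_fm[OF u] M] unfolding tens_unit_left .
  fix i j assume i: "i < length Qs" and j: "j < length Ps"
  then have i2: "i < length (tens [[]] Qs)" and j2: "j < length (tens [[]] Ps)" unfolding tens_unit_left .
  show "hm a b b [[]] [[]] Ps Qs (mid (foam_cat b b) [[]]) M (i, j) = M (i, j)"
    unfolding hm_entry[OF i2 j2] using i j Hc_unit_left[OF hk_ty[OF fm_entry[OF M i j]], of b] ws_nth'[OF w(1) j]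
    by (simp add: mid_unit_entry)
qed (rule M)

lemma hm_unit_right:
  assumes w: "ws a b Ps" "ws a b Qs" and M: "fm a Ps Qs M"
  shows "hm a a b Ps Qs [[]] [[]] M (mid (foam_cat a a) [[]]) = M"
proof (rule fm_eqI)
  have b: "a \<in> Wts" using w by (simp add: ws_def)
  note u = ws_unit[OF b]
  show "fm a Ps Qs (hm a a b Ps Qs [[]] [[]] M (mid (foam_cat a a) [[]]))"
    using hm_fm[OF w u u M mid_fm[OF u]] unfolding tens_unit_right .
  fix i j assume i: "i < length Qs" and j: "j < length Ps"
  then have i2: "i < length (tens Qs [[]])" and j2: "j < length (tens Ps [[]])" unfolding tens_unit_right .
  show "hm a a b Ps Qs [[]] [[]] M (mid (foam_cat a a) [[]]) (i, j) = M (i, j)"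
    unfolding hm_entry[OF i2 j2] using i j Hc_unit_right[OF hk_ty[OF fm_entry[OF M i j]]]
    by (simp add: mid_unit_entry)
qed (rule M)

section \<open>Linearity of both compositions of matrices\<close>

lemma fm_add_entry: "i < length Qs \<Longrightarrow> j < length Ps \<Longrightarrow> fm_add (a, Ps, b) (a', Qs, b') M N (i, j) = A a (M (i, j)) (N (i, j))"
  by simp
lemma fm_scale_entry: "i < length Qs \<Longrightarrow> j < length Ps \<Longrightarrow> fm_scale (a, Ps, b) (a', Qs, b') z M (i, j) = Sc a z (M (i, j))"
  by simp

lemma add_fm: "\<lbrakk>ws a b Ps; ws a b Qs; fm a Ps Qs M; fm a Ps Qs N\<rbrakk> \<Longrightarrow> fm a Ps Qs (fm_add (a, Ps, b) (a, Qs, b) M N)"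
  unfolding fm_def using ws_nth' by (auto intro!: hk_A)
lemma scale_fm: "\<lbrakk>ws a b Ps; ws a b Qs; fm a Ps Qs M\<rbrakk> \<Longrightarrow> fm a Ps Qs (fm_scale (a, Ps, b) (a, Qs, b) z M)"
  unfolding fm_def using ws_nth' by (auto intro!: hk_Sc)

declare fm_add.simps [simp del] fm_scale.simps [simp del]

lemma scale_zero_fm: "\<lbrakk>ws a b Ps; ws a b Qs; fm a Ps Qs M\<rbrakk> \<Longrightarrow> fm_scale (a, Ps, b) (a, Qs, b) 0 M = zero_fm (a, Ps, b) (a, Qs, b)"
proof (rule fm_eqI[OF scale_fm fmd_fm[OF zero_fmd]])
  fix i j assume M: "fm a Ps Qs M" and i: "i < length Qs" and j: "j < length Ps"
  note t = hk_ty[OF fm_entry[OF M i j]]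
  show "fm_scale (a, Ps, b) (a, Qs, b) 0 M (i, j) = zero_fm (a, Ps, b) (a, Qs, b) (i, j)"
    unfolding fm_scale_entry[OF i j] using Sc_zero[OF ty_src[OF t] ty_tgt[OF t] ty_ne[OF t]] i j by (simp add: zero_fm_def)
qed

lemma mcmp_add_left:
  assumes w: "ws a b Ps" "ws a b Qs" "ws a b Rs" and M: "fm a Ps Qs M" and N: "fm a Qs Rs N" "fm a Qs Rs N'"
  shows "mcmp (foam_cat a b) Ps Qs Rs (fm_add (a, Qs, b) (a, Rs, b) N N') M =
    fm_add (a, Ps, b) (a, Rs, b) (mcmp (foam_cat a b) Ps Qs Rs N M) (mcmp (foam_cat a b) Ps Qs Rs N' M)"
proof (rule fm_eqI[OF fm_mcmp[OF w M add_fm[OF w(2,3) N]] add_fm[OF w(1,3) fm_mcmp[OF w M N(1)] fm_mcmp[OF w M N(2)]]])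
  fix i j assume i: "i < length Rs" and j: "j < length Ps"
  note x = ws_nth[OF w(1) j] ws_nth[OF w(3) i]
  have h: "hk a (Ps ! j) (Rs ! i) (V a (L (i, k)) (M (k, j)))" if "fm a Qs Rs L" "k < length Qs" for L k
    by (rule hk_V[OF fm_entry[OF M that(2) j] fm_entry[OF that(1) i that(2)]]) (use w i j that ws_nth' in auto)
  have "mcmp (foam_cat a b) Ps Qs Rs (fm_add (a, Qs, b) (a, Rs, b) N N') M (i, j) =
    fc.isum a b (Ps ! j) (Rs ! i) (length Qs) (\<lambda>k. A a (V a (N (i, k)) (M (k, j))) (V a (N' (i, k)) (M (k, j))))"
    unfolding fc.mcmp_entry[OF i j] foam_cat_simps
    by (rule fc.isum_cong)
      (simp add: fm_add_entry i j V_A_left ty_cls[OF hk_ty[OF fm_entry[OF M]]] ty_cls[OF hk_ty[OF fm_entry[OF N(1)]]]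
        ty_cls[OF hk_ty[OF fm_entry[OF N(2)]]])
  also have "\<dots> = A a (fc.isum a b (Ps ! j) (Rs ! i) (length Qs) (\<lambda>k. V a (N (i, k)) (M (k, j))))
     (fc.isum a b (Ps ! j) (Rs ! i) (length Qs) (\<lambda>k. V a (N' (i, k)) (M (k, j))))"
    using fc.isum_add[of "Ps ! j" a b "Rs ! i" "length Qs"] x h N by (simp add: foam_cat_hom)
  finally show "mcmp (foam_cat a b) Ps Qs Rs (fm_add (a, Qs, b) (a, Rs, b) N N') M (i, j) =
    fm_add (a, Ps, b) (a, Rs, b) (mcmp (foam_cat a b) Ps Qs Rs N M) (mcmp (foam_cat a b) Ps Qs Rs N' M) (i, j)"
    unfolding fm_add_entry[OF i j] fc.mcmp_entry[OF i j] foam_cat_simps .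
qed

lemma mcmp_add_right:
  assumes w: "ws a b Ps" "ws a b Qs" "ws a b Rs" and M: "fm a Ps Qs M" "fm a Ps Qs M'" and N: "fm a Qs Rs N"
  shows "mcmp (foam_cat a b) Ps Qs Rs N (fm_add (a, Ps, b) (a, Qs, b) M M') =
    fm_add (a, Ps, b) (a, Rs, b) (mcmp (foam_cat a b) Ps Qs Rs N M) (mcmp (foam_cat a b) Ps Qs Rs N M')"
proof (rule fm_eqI[OF fm_mcmp[OF w add_fm[OF w(1,2) M] N] add_fm[OF w(1,3) fm_mcmp[OF w M(1) N] fm_mcmp[OF w M(2) N]]])
  fix i j assume i: "i < length Rs" and j: "j < length Ps"
  note x = ws_nth[OF w(1) j] ws_nth[OF w(3) i]
  have h: "hk a (Ps ! j) (Rs ! i) (V a (N (i, k)) (L (k, j)))" if "fm a Ps Qs L" "k < length Qs" for L k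
    by (rule hk_V[OF fm_entry[OF that(1,2) j] fm_entry[OF N i that(2)]]) (use w i j that ws_nth' in auto)
  have "mcmp (foam_cat a b) Ps Qs Rs N (fm_add (a, Ps, b) (a, Qs, b) M M') (i, j) =
    fc.isum a b (Ps ! j) (Rs ! i) (length Qs) (\<lambda>k. A a (V a (N (i, k)) (M (k, j))) (V a (N (i, k)) (M' (k, j))))"
    unfolding fc.mcmp_entry[OF i j] foam_cat_simps
    by (rule fc.isum_cong)
      (simp add: fm_add_entry i j V_A_right ty_cls[OF hk_ty[OF fm_entry[OF N]]] ty_cls[OF hk_ty[OF fm_entry[OF M(1)]]]
        ty_cls[OF hk_ty[OF fm_entry[OF M(2)]]])
  also have "\<dots> = A a (fc.isum a b (Ps ! j) (Rs ! i) (length Qs) (\<lambda>k. V a (N (i, k)) (M (k, j))))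
     (fc.isum a b (Ps ! j) (Rs ! i) (length Qs) (\<lambda>k. V a (N (i, k)) (M' (k, j))))"
    using fc.isum_add[of "Ps ! j" a b "Rs ! i" "length Qs"] x h M by (simp add: foam_cat_hom)
  finally show "mcmp (foam_cat a b) Ps Qs Rs N (fm_add (a, Ps, b) (a, Qs, b) M M') (i, j) =
    fm_add (a, Ps, b) (a, Rs, b) (mcmp (foam_cat a b) Ps Qs Rs N M) (mcmp (foam_cat a b) Ps Qs Rs N M') (i, j)"
    unfolding fm_add_entry[OF i j] fc.mcmp_entry[OF i j] foam_cat_simps .
qed

lemma mcmp_scale_left:
  assumes w: "ws a b Ps" "ws a b Qs" "ws a b Rs" and M: "fm a Ps Qs M" and N: "fm a Qs Rs N"
  shows "mcmp (foam_cat a b) Ps Qs Rs (fm_scale (a, Qs, b) (a, Rs, b) z N) M =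
    fm_scale (a, Ps, b) (a, Rs, b) z (mcmp (foam_cat a b) Ps Qs Rs N M)"
proof (rule fm_eqI[OF fm_mcmp[OF w M scale_fm[OF w(2,3) N]] scale_fm[OF w(1,3) fm_mcmp[OF w M N]]])
  fix i j assume i: "i < length Rs" and j: "j < length Ps"
  note x = ws_nth[OF w(1) j] ws_nth[OF w(3) i]
  have h: "hk a (Ps ! j) (Rs ! i) (V a (N (i, k)) (M (k, j)))" if "k < length Qs" for k
    by (rule hk_V[OF fm_entry[OF M that j] fm_entry[OF N i that]]) (use w i j that ws_nth' in auto)
  have "mcmp (foam_cat a b) Ps Qs Rs (fm_scale (a, Qs, b) (a, Rs, b) z N) M (i, j) =
    fc.isum a b (Ps ! j) (Rs ! i) (length Qs) (\<lambda>k. Sc a z (V a (N (i, k)) (M (k, j))))"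
    unfolding fc.mcmp_entry[OF i j] foam_cat_simps
    by (rule fc.isum_cong)
      (simp add: fm_scale_entry i j V_Sc_left ty_cls[OF hk_ty[OF fm_entry[OF M]]] ty_cls[OF hk_ty[OF fm_entry[OF N]]])
  also have "\<dots> = Sc a z (fc.isum a b (Ps ! j) (Rs ! i) (length Qs) (\<lambda>k. V a (N (i, k)) (M (k, j))))"
    by (rule isum_Sc[OF x h])
  finally show "mcmp (foam_cat a b) Ps Qs Rs (fm_scale (a, Qs, b) (a, Rs, b) z N) M (i, j) =
    fm_scale (a, Ps, b) (a, Rs, b) z (mcmp (foam_cat a b) Ps Qs Rs N M) (i, j)"
    unfolding fm_scale_entry[OF i j] fc.mcmp_entry[OF i j] foam_cat_simps .
qed

lemma mcmp_scale_right:
  assumes w: "ws a b Ps" "ws a b Qs" "ws a b Rs" and M: "fm a Ps Qs M" and N: "fm a Qs Rs N"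
  shows "mcmp (foam_cat a b) Ps Qs Rs N (fm_scale (a, Ps, b) (a, Qs, b) z M) =
    fm_scale (a, Ps, b) (a, Rs, b) z (mcmp (foam_cat a b) Ps Qs Rs N M)"
proof (rule fm_eqI[OF fm_mcmp[OF w scale_fm[OF w(1,2) M] N] scale_fm[OF w(1,3) fm_mcmp[OF w M N]]])
  fix i j assume i: "i < length Rs" and j: "j < length Ps"
  note x = ws_nth[OF w(1) j] ws_nth[OF w(3) i]
  have h: "hk a (Ps ! j) (Rs ! i) (V a (N (i, k)) (M (k, j)))" if "k < length Qs" for k
    by (rule hk_V[OF fm_entry[OF M that j] fm_entry[OF N i that]]) (use w i j that ws_nth' in auto)
  have "mcmp (foam_cat a b) Ps Qs Rs N (fm_scale (a, Ps, b) (a, Qs, b) z M) (i, j) =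
    fc.isum a b (Ps ! j) (Rs ! i) (length Qs) (\<lambda>k. Sc a z (V a (N (i, k)) (M (k, j))))"
    unfolding fc.mcmp_entry[OF i j] foam_cat_simps
    by (rule fc.isum_cong)
      (simp add: fm_scale_entry i j V_Sc_right ty_cls[OF hk_ty[OF fm_entry[OF M]]] ty_cls[OF hk_ty[OF fm_entry[OF N]]])
  also have "\<dots> = Sc a z (fc.isum a b (Ps ! j) (Rs ! i) (length Qs) (\<lambda>k. V a (N (i, k)) (M (k, j))))"
    by (rule isum_Sc[OF x h])
  finally show "mcmp (foam_cat a b) Ps Qs Rs N (fm_scale (a, Ps, b) (a, Qs, b) z M) (i, j) =
    fm_scale (a, Ps, b) (a, Rs, b) z (mcmp (foam_cat a b) Ps Qs Rs N M) (i, j)"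
    unfolding fm_scale_entry[OF i j] fc.mcmp_entry[OF i j] foam_cat_simps .
qed

lemma hm_linear:
  assumes w: "ws b c Rs" "ws b c Rs'" "ws a b Ps" "ws a b Ps'" and N: "fm b Rs Rs' N" "fm b Rs Rs' N'"
    and M: "fm a Ps Ps' M" "fm a Ps Ps' M'"
  shows "hm a b c Rs Rs' Ps Ps' (fm_add (b, Rs, c) (b, Rs', c) N N') M =
      fm_add (a, tens Rs Ps, c) (a, tens Rs' Ps', c) (hm a b c Rs Rs' Ps Ps' N M) (hm a b c Rs Rs' Ps Ps' N' M)"
    and "hm a b c Rs Rs' Ps Ps' N (fm_add (a, Ps, b) (a, Ps', b) M M') =
      fm_add (a, tens Rs Ps, c) (a, tens Rs' Ps', c) (hm a b c Rs Rs' Ps Ps' N M) (hm a b c Rs Rs' Ps Ps' N M')"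
    and "hm a b c Rs Rs' Ps Ps' (fm_scale (b, Rs, c) (b, Rs', c) z N) M =
      fm_scale (a, tens Rs Ps, c) (a, tens Rs' Ps', c) z (hm a b c Rs Rs' Ps Ps' N M)"
    and "hm a b c Rs Rs' Ps Ps' N (fm_scale (a, Ps, b) (a, Ps', b) z M) =
      fm_scale (a, tens Rs Ps, c) (a, tens Rs' Ps', c) z (hm a b c Rs Rs' Ps Ps' N M)"
proof -
  note t = ws_tens[OF w(1,3)] ws_tens[OF w(2,4)]
  note h = hm_fm[OF w]
  have e: "L = L'" if "fm a (tens Rs Ps) (tens Rs' Ps') L" "fm a (tens Rs Ps) (tens Rs' Ps') L'"
    "\<And>i j. \<lbrakk>i < length (tens Rs' Ps'); j < length (tens Rs Ps); i div length Ps' < length Rs'; i mod length Ps' < length Ps';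
      j div length Ps < length Rs; j mod length Ps < length Ps\<rbrakk> \<Longrightarrow> L (i, j) = L' (i, j)" for L L'
    by (rule fm_eqI[OF that(1,2)], rule that(3)) (auto simp only: length_tens dest: divmod_less)
  note te = hk_ty[OF fm_entry]
  have wP: "b = act (expand (Ps ! (j mod length Ps))) a" if "j mod length Ps < length Ps" for j
    using ws_nth'[OF w(3) that] by simp
  show "hm a b c Rs Rs' Ps Ps' (fm_add (b, Rs, c) (b, Rs', c) N N') M =
      fm_add (a, tens Rs Ps, c) (a, tens Rs' Ps', c) (hm a b c Rs Rs' Ps Ps' N M) (hm a b c Rs Rs' Ps Ps' N' M)"
    by (rule e[OF h[OF add_fm[OF w(1,2) N] M(1)] add_fm[OF t h[OF N(1) M(1)] h[OF N(2) M(1)]]],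
        simp only: hm_entry fm_add_entry)
      (rule Hc_A_left[OF te[OF N(1)] te[OF N(2)] te[OF M(1)] wP])
  show "hm a b c Rs Rs' Ps Ps' N (fm_add (a, Ps, b) (a, Ps', b) M M') =
      fm_add (a, tens Rs Ps, c) (a, tens Rs' Ps', c) (hm a b c Rs Rs' Ps Ps' N M) (hm a b c Rs Rs' Ps Ps' N M')"
    by (rule e[OF h[OF N(1) add_fm[OF w(3,4) M]] add_fm[OF t h[OF N(1) M(1)] h[OF N(1) M(2)]]],
        simp only: hm_entry fm_add_entry)
      (rule Hc_A_right[OF te[OF N(1)] te[OF M(1)] te[OF M(2)] wP])
  show "hm a b c Rs Rs' Ps Ps' (fm_scale (b, Rs, c) (b, Rs', c) z N) M =
      fm_scale (a, tens Rs Ps, c) (a, tens Rs' Ps', c) z (hm a b c Rs Rs' Ps Ps' N M)"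
    by (rule e[OF h[OF scale_fm[OF w(1,2) N(1)] M(1)] scale_fm[OF t h[OF N(1) M(1)]]],
        simp only: hm_entry fm_scale_entry)
      (rule Hc_Sc_left[OF te[OF N(1)] te[OF M(1)] wP])
  show "hm a b c Rs Rs' Ps Ps' N (fm_scale (a, Ps, b) (a, Ps', b) z M) =
      fm_scale (a, tens Rs Ps, c) (a, tens Rs' Ps', c) z (hm a b c Rs Rs' Ps Ps' N M)"
    by (rule e[OF h[OF N(1) scale_fm[OF w(3,4) M(1)]] scale_fm[OF t h[OF N(1) M(1)]]],
        simp only: hm_entry fm_scale_entry)
      (rule Hc_Sc_right[OF te[OF N(1)] te[OF M(1)] wP])
qed

interpretation tf: gl2_data TwoFoam zero_fm .

lemma ar_web: "tf.ar a b p \<longleftrightarrow> (\<exists>Ps. p = (a, Ps, b) \<and> ws a b Ps)"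
  using TwoFoam_one[of a b p] by (auto simp: tf.ar_def ws_def)

lemma H_web: "tf.H a b p q M \<longleftrightarrow> (\<exists>Ps Qs. p = (a, Ps, b) \<and> q = (a, Qs, b) \<and> ws a b Ps \<and> ws a b Qs \<and> fm a Ps Qs M)"
  by (auto simp: tf.H_def ar_web TwoFoam_two)

lemma HD_web: "tf.HD a b p q d M \<longleftrightarrow>
    (\<exists>Ps Qs. p = (a, Ps, b) \<and> q = (a, Qs, b) \<and> ws a b Ps \<and> ws a b Qs \<and> fmd a Ps Qs d M)"
  by (auto simp: tf.HD_def ar_web TwoFoam_two_deg)

text \<open>The subgoals come in the order of the axioms of \<open>gl2\<close>. Unfolding the typing
  predicates turns each of them into a statement on matrices that is available above.\<close>

lemma gl2_TwoFoam: "gl2 TwoFoam zero_fm"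
proof -
  note S = ar_web H_web HD_web ws_tens ws_unit TwoFoam_one
  show ?thesis
    apply (unfold_locales, unfold TwoFoam_simps(1,2,6-8))
    subgoal by (simp add: S)
    subgoal by (auto simp: S)
    subgoal by (clarsimp simp: S simp del: concat.simps) (rule tens_assoc)
    subgoal by (clarsimp simp: S) (simp add: map_idI)
    subgoal by (clarsimp simp: S tens_unit_right)
    subgoal by (clarsimp simp: S) (rule fmd_fm)
    subgoal by (clarsimp simp: S) (rule mid_fmd)
    subgoal by (clarsimp simp: S) (rule fm_mcmp; assumption)
    subgoal by (clarsimp simp: S) (rule fmd_mcmp; assumption)
    subgoal by (clarsimp simp: S) (rule hm_fm; assumption)
    subgoal by (clarsimp simp: S) (rule hm_fmd; assumption)
    subgoal by (clarsimp simp: S mhom_fm ws_lists fc.mcmp_assoc)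
    subgoal by (clarsimp simp: S) (rule fc.mid_left; simp add: mhom_fm ws_lists)
    subgoal by (clarsimp simp: S) (rule fc.mid_right; simp add: mhom_fm ws_lists)
    subgoal by (clarsimp simp: S) (rule hm_mid; assumption)
    subgoal by (clarsimp simp: S) (rule hm_interchange; assumption)
    subgoal by (clarsimp simp: S) (rule hm_assoc; assumption)
    subgoal by (clarsimp simp: S) (rule hm_unit_left; assumption)
    subgoal by (clarsimp simp: S) (rule hm_unit_right; assumption)
    subgoal by (clarsimp simp: S) (rule add_fm; assumption)
    subgoal by (clarsimp simp: S) (rule scale_fm; assumption)
    subgoal by (clarsimp simp: S) (rule zero_fmd; assumption)
    subgoal by (clarsimp simp: S) (rule scale_zero_fm; assumption)
    subgoal by (clarsimp simp: S) (rule mcmp_add_left; assumption)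
    subgoal by (clarsimp simp: S) (rule mcmp_add_right; assumption)
    subgoal by (clarsimp simp: S) (rule mcmp_scale_left; assumption)
    subgoal by (clarsimp simp: S) (rule mcmp_scale_right; assumption)
    subgoal by (clarsimp simp: S) (rule hm_linear(1); assumption)
    subgoal by (clarsimp simp: S) (rule hm_linear(2); assumption)
    subgoal by (clarsimp simp: S) (rule hm_linear(3); assumption)
    subgoal by (clarsimp simp: S) (rule hm_linear(4); assumption)
    done
qed

section \<open>Direct sum decompositions of foams\<close>

lemma A_Nul_left: "ty a v w S \<Longrightarrow> A a (fo a (Nul v w)) S = S"
  using A_comm[of a "fo a (Nul v w)" S] A_zero[OF ty_src ty_tgt] ty_cls by simp

lemma A_Nul_right: "ty a v w S \<Longrightarrow> A a S (fo a (Nul v w)) = S"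
  using A_zero[OF ty_src ty_tgt] by simp

text \<open>Since \<open>\<tau>\<close> kills the first half of the isomorphism \<open>(B0, X B0)\<close> and maps the second half to
  minus the first one, it factors through the first half.\<close>

locale split_half =
  fixes a z y \<tau> X C A0 A1 B0 iz iy
  assumes ty: "ty a z z \<tau>" "ty a z z X" "ty a y z C" "ty a z y A0" "ty a z y A1" "ty a z z iz" "ty a y y iy"
    and B0: "B0 = V a \<tau> C"
    and \<tau>\<tau>: "V a \<tau> \<tau> = fo a (Nul z z)" and \<tau>X\<tau>: "V a \<tau> (V a X \<tau>) = Sc a (-1) \<tau>"
    and iz: "V a iz \<tau> = \<tau>" and iy: "V a iy A1 = A1"
    and A0B0: "V a A0 B0 = iy"
    and sum: "A a (V a B0 A0) (V a (V a X B0) A1) = iz"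
begin

lemma c: "cls a \<tau>" "cls a X" "cls a C" "cls a A0" "cls a A1" "cls a B0"
  using ty_cls[OF ty(1)] ty_cls[OF ty(2)] ty_cls[OF ty(3)] ty_cls[OF ty(4)] ty_cls[OF ty(5)] by (auto simp: B0)

lemma tB0: "ty a y z B0" unfolding B0 by (rule ty_V[OF ty(3,1)])

text \<open>Start from \<open>iz\<close> = B0 A0 + X B0 A1 and compose with \<tau> on both sides. As
  \<tau>\<tau> = 0 and \<tau> B0 = 0, what is left is - B0 A1 \<tau> = 0; applying A0 gives A1
  \<tau> = 0, and the second summand of \<tau> disappears.\<close>

lemma factor: "V a B0 (V a A0 \<tau>) = \<tau>"
proof -
  have o: "okw z" "okw y" "act z a = act y a" using ty_okw[OF tB0] by auto
  let ?t = "V a A1 \<tau>"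
  have tt: "ty a z y ?t" by (rule ty_V[OF ty(1,5)])
  have "\<tau> = V a (A a (V a B0 A0) (V a (V a X B0) A1)) \<tau>" unfolding sum by (rule iz[symmetric])
  also have "\<dots> = A a (V a B0 (V a A0 \<tau>)) (V a (V a X B0) ?t)" by (simp add: V_A_left V_assoc c)
  finally have e: "A a (V a B0 (V a A0 \<tau>)) (V a (V a X B0) ?t) = \<tau>" by (rule HOL.sym)
  have 0: "V a \<tau> B0 = fo a (Nul y z)"
  proof -
    have "V a \<tau> B0 = V a (V a \<tau> \<tau>) C" by (simp add: B0 V_assoc c)
    then show ?thesis using ty_V_Nul_left[OF ty(3)] o by (simp add: \<tau>\<tau>)
  qed
  have 1: "V a \<tau> (V a X B0) = Sc a (-1) B0"
  proof -
    have "V a \<tau> (V a X B0) = V a (V a \<tau> (V a X \<tau>)) C" by (simp add: B0 V_assoc c)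
    then show ?thesis by (simp add: \<tau>X\<tau> V_Sc_left B0 c)
  qed
  have "fo a (Nul z z) = V a \<tau> (A a (V a B0 (V a A0 \<tau>)) (V a (V a X B0) ?t))" unfolding e by (rule \<tau>\<tau>[symmetric])
  also have "\<dots> = A a (V a (V a \<tau> B0) (V a A0 \<tau>)) (V a (V a \<tau> (V a X B0)) ?t)"
    by (simp add: V_A_right c V_assoc)
  also have "V a (V a \<tau> B0) (V a A0 \<tau>) = fo a (Nul z z)"
    unfolding 0 by (rule ty_V_Nul_left[OF ty_V[OF ty(1,4)]]) (use o in auto)
  also have "V a (V a \<tau> (V a X B0)) ?t = Sc a (-1) (V a B0 ?t)" unfolding 1 by (rule V_Sc_left) (simp_all add: c)
  also have "A a (fo a (Nul z z)) (Sc a (-1) (V a B0 ?t)) = Sc a (-1) (V a B0 ?t)"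
    by (rule A_Nul_left[OF ty_Sc[OF ty_V[OF tt tB0]]])
  finally have s: "Sc a (-1) (V a B0 ?t) = fo a (Nul z z)" by simp
  have B: "V a B0 ?t = fo a (Nul z z)"
  proof -
    have "V a B0 ?t = Sc a (-1) (Sc a (-1) (V a B0 ?t))" by (simp add: Sc_Sc Sc_one c)
    also have "\<dots> = fo a (Nul z z)" unfolding s using ty_okw[OF tB0] by (subst Sc_Nul) auto
    finally show ?thesis .
  qed
  have "?t = V a (V a iy A1) \<tau>" unfolding iy ..
  also have "\<dots> = V a iy ?t" by (rule V_assoc) (use c ty_cls[OF ty(7)] in auto)
  also have "\<dots> = V a A0 (V a B0 ?t)" unfolding A0B0[symmetric] by (rule V_assoc) (use c in auto)
  also have "\<dots> = fo a (Nul z y)" unfolding B by (rule ty_V_Nul_right[OF ty(4)]) (use o in auto)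
  finally have t: "?t = fo a (Nul z y)" .
  have "V a (V a X B0) ?t = fo a (Nul z z)"
    unfolding t by (rule ty_V_Nul_right[OF ty_V[OF tB0 ty(2)]]) (use o in auto)
  then show ?thesis
    using e A_Nul_right[OF ty_V[OF ty_V[OF ty(1,4)] tB0]] by simp
qed

text \<open>If \<tau> w \<tau> = \<tau>, then w \<tau> is an idempotent with image y, the two maps
  being A0 \<tau> and w B0. The companion \<open>iso_left\<close> treats \<tau> w; it serves the
  divided square of F, whose idempotent has its factors in the opposite order.\<close>

lemma iso_right:
  assumes w: "ty a z z w" and \<tau>w: "V a \<tau> (V a w \<tau>) = \<tau>"
  shows "V a (V a A0 \<tau>) (V a w B0) = iy" "V a (V a w B0) (V a A0 \<tau>) = V a w \<tau>"
proof -
  note cw = ty_cls[OF w]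
  have "V a \<tau> (V a w B0) = B0"
  proof -
    have "V a \<tau> (V a w B0) = V a (V a \<tau> (V a w \<tau>)) C" by (simp add: B0 V_assoc c cw)
    then show ?thesis by (simp add: \<tau>w B0)
  qed
  then show "V a (V a A0 \<tau>) (V a w B0) = iy" by (simp add: V_assoc c cw A0B0)
  show "V a (V a w B0) (V a A0 \<tau>) = V a w \<tau>" by (simp add: V_assoc c cw factor)
qed

lemma iso_left:
  assumes w: "ty a z z w" and \<tau>w: "V a \<tau> (V a w \<tau>) = \<tau>"
  shows "V a (V a A0 (V a \<tau> w)) B0 = iy" "V a B0 (V a A0 (V a \<tau> w)) = V a \<tau> w"
proof -
  note cw = ty_cls[OF w]
  have "V a \<tau> (V a w B0) = B0"
  proof -
    have "V a \<tau> (V a w B0) = V a (V a \<tau> (V a w \<tau>)) C" by (simp add: B0 V_assoc c cw)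
    then show ?thesis by (simp add: \<tau>w B0)
  qed
  then show "V a (V a A0 (V a \<tau> w)) B0 = iy" by (simp add: V_assoc c cw A0B0)
  have "V a B0 (V a A0 (V a \<tau> w)) = V a (V a B0 (V a A0 \<tau>)) w" by (simp add: V_assoc c cw)
  then show "V a B0 (V a A0 (V a \<tau> w)) = V a \<tau> w" by (simp add: factor)
qed

end

lemma dom_sigma [simp]: "dom (sigma i j) = [Ee i, Ff j]" "cod (sigma i j) = [Ff j, Ee i]"
  by (simp_all add: sigma_def)
lemma dom_cup_dots [simp]: "dom (cup_dots i r) = []" "cod (cup_dots i r) = [Ff i, Ee i]"
  by (simp_all add: cup_dots_def)
lemma wfo_sigma: "\<lbrakk>1 \<le> i; 1 \<le> j; a \<in> Wts\<rbrakk> \<Longrightarrow> wfo a (sigma i j)"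
  by (simp add: sigma_def wfo_hor wfo_gen)
lemma wfo_cup_dots: "1 \<le> i \<Longrightarrow> a \<in> Wts \<Longrightarrow> wfo a (cup_dots i r)"
  by (simp add: cup_dots_def wfo_hor wfo_gen wfo_dots)
lemma has_deg_dots [simp]: "has_deg a (dots i r) d \<longleftrightarrow> d = 2 * int r"
  by (induction r arbitrary: d) auto
lemma has_deg_cup_dots: "has_deg a (cup_dots i r) (1 + lam a i + 2 * int r)"
  by (simp add: cup_dots_def)
lemma has_deg_sigma: "has_deg a (sigma i i) 0"
  by (simp add: sigma_def)

lemma cup_dots_0: "cp a (cup_dots i 0) v = cp a (Cup i) v"
  by (simp add: cup_dots_def cp_simps LW_simps V_id_left)
lemma cup_dots_1: "cp a (cup_dots i (Suc 0)) v = V a (LW a [Ff i] (cp a (Dot i) v)) (cp a (Cup i) v)"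
  by (simp add: cup_dots_def cp_simps LW_simps V_id_left V_id_right)

lemma dom_dgm_sum: "(\<And>r. r < n \<Longrightarrow> dom (t r) = p \<and> cod (t r) = q) \<Longrightarrow> dom (dgm_sum p q t n) = p \<and> cod (dgm_sum p q t n) = q"
  by (cases n) (auto simp: dgm_sum_def upt_conv_Cons simp del: upt_Suc)

lemma dgm_sum_wfo:
  assumes "wfo a (Nul p q)" "\<And>r. r < n \<Longrightarrow> wfo a (t r) \<and> dom (t r) = p \<and> cod (t r) = q"
  shows "wfo a (dgm_sum p q t n)"
proof -
  have *: "wfo a (foldr (\<oplus>) ts (Nul p q)) \<and> dom (foldr (\<oplus>) ts (Nul p q)) = p \<and> cod (foldr (\<oplus>) ts (Nul p q)) = q"
    if "\<And>t. t \<in> set ts \<Longrightarrow> wfo a t \<and> dom t = p \<and> cod t = q" for ts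
    using that assms(1) by (induction ts) auto
  have "wfo a (foldr (\<oplus>) (map t [0..<n]) (Nul p q)) \<and> dom (foldr (\<oplus>) (map t [0..<n]) (Nul p q)) = p \<and>
      cod (foldr (\<oplus>) (map t [0..<n]) (Nul p q)) = q"
    by (rule *) (use assms(2) in auto)
  then show ?thesis unfolding dgm_sum_def by simp
qed

lemma cp_dgm_sum: "cp a (dgm_sum p q t n) v = foldr (A a) (map (\<lambda>r. cp a (t r) v) [0..<n]) (cp a (Nul p q) v)"
proof -
  have "cp a (foldr (\<oplus>) ts (Nul p q)) v = foldr (A a) (map (\<lambda>t. cp a t v) ts) (cp a (Nul p q) v)" for ts
    by (induction ts) (auto simp: cp_add)
  then show ?thesis by (simp add: dgm_sum_def comp_def)
qed

section \<open>The isomorphism between EF and FE, as equations between components\<close>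

context
  fixes a :: weight and i :: nat and v :: word
  assumes i: "1 \<le> i" and v: "a \<in> Wts" "okw v"
begin

lemma w: "wfo a (Idn v)" "act v a \<in> Wts" using v by auto

lemma SInv_sigma: "lam (act v a) i \<le> 0 \<Longrightarrow> V a (cp a (SInv i i) v) (cp a (sigma i i) v) = fo a (Idn (Ee i # Ff i # v))"
  using cp_cong[OF fo_rel[OF rel.iso_neg_EF[of "act v a" i]]] i w
  by (simp add: cp_ver cp_Idn wfo_sigma wfo_gen)

lemma sigma_SInv: "0 \<le> lam (act v a) i \<Longrightarrow> V a (cp a (sigma i i) v) (cp a (SInv i i) v) = fo a (Idn (Ff i # Ee i # v))"
  using cp_cong[OF fo_rel[OF rel.iso_pos_FE[of "act v a" i]]] i w
  by (simp add: cp_ver cp_Idn wfo_sigma wfo_gen)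

lemma CapInv_cup: 
  assumes "int r < - lam (act v a) i" "int s < - lam (act v a) i"
  shows "V a (cp a (CapInv i r) v) (cp a (cup_dots i s) v) = (if r = s then fo a (Idn v) else fo a (Nul v v))"
proof -
  have "fo (act v a) (CapInv i r \<odot> cup_dots i s) = fo (act v a) (if r = s then Idn [] else Nul [] [])"
    by (rule fo_rel[OF rel.iso_neg_one]) (use assms i w in \<open>auto simp: wfo_cup_dots wfo_gen\<close>)
  from cp_cong[OF this] show ?thesis using w by (auto simp: cp_ver cp_Idn cp_Nul split: if_splits)
qed

lemma SInv_cup:
  assumes "int r < - lam (act v a) i"
  shows "V a (cp a (SInv i i) v) (cp a (cup_dots i r) v) = fo a (Nul v (Ee i # Ff i # v))"
proof -
  have "act [Ee i, Ff i] (act v a) = act v a" by (auto simp: act_Cons)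
  moreover have "fo (act v a) (SInv i i \<odot> cup_dots i r) = fo (act v a) (Nul [] [Ee i, Ff i])"
    by (rule fo_rel[OF rel.iso_neg_cup]) (use assms i w calculation in \<open>auto simp: wfo_cup_dots wfo_gen\<close>)
  from cp_cong[OF this] show ?thesis using w i calculation by (simp add: cp_ver cp_Nul)
qed

lemma CapInv_sigma:
  assumes "int r < - lam (act v a) i"
  shows "V a (cp a (CapInv i r) v) (cp a (sigma i i) v) = fo a (Nul (Ee i # Ff i # v) v)"
proof -
  have "act [Ee i, Ff i] (act v a) = act v a" by (auto simp: act_Cons)
  moreover have "fo (act v a) (CapInv i r \<odot> sigma i i) = fo (act v a) (Nul [Ee i, Ff i] [])"
    by (rule fo_rel[OF rel.iso_neg_sigma]) (use assms i w calculation in \<open>auto simp: wfo_sigma wfo_gen\<close>)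
  from cp_cong[OF this] show ?thesis using w i calculation by (simp add: cp_ver cp_Nul)
qed

lemma FE_sum:
  assumes "lam (act v a) i \<le> 0"
  shows "A a (V a (cp a (sigma i i) v) (cp a (SInv i i) v))
      (foldr (A a) (map (\<lambda>r. V a (cp a (cup_dots i r) v) (cp a (CapInv i r) v)) [0..<nat (- lam (act v a) i)])
        (fo a (Nul (Ff i # Ee i # v) (Ff i # Ee i # v)))) = fo a (Idn (Ff i # Ee i # v))"
proof -
  let ?d = "dgm_sum [Ff i, Ee i] [Ff i, Ee i] (\<lambda>r. cup_dots i r \<odot> CapInv i r) (nat (- lam (act v a) i))"
  have "wfo (act v a) ?d" by (rule dgm_sum_wfo) (use i w in \<open>auto simp: wfo_cup_dots wfo_gen\<close>)
  moreover have "dom ?d = [Ff i, Ee i] \<and> cod ?d = [Ff i, Ee i]" by (rule dom_dgm_sum) simp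
  ultimately have "fo (act v a) (sigma i i \<odot> SInv i i \<oplus> ?d) = fo (act v a) (Idn [Ff i, Ee i])"
    by (intro fo_rel[OF rel.iso_neg_FE]) (use i w assms in \<open>auto simp: wfo_sigma wfo_gen\<close>)
  from cp_cong[OF this] show ?thesis using w i by (simp add: cp_ver cp_add cp_Idn cp_dgm_sum cp_Nul)
qed

end

lemma V_zero_word: "\<lbrakk>fo a (Idn w) = fo a (Nul w w); ty a v w S; ty a w u T\<rbrakk> \<Longrightarrow> V a T S = fo a (Nul v u)"
  using zero_word[of a w v S] ty_V_Nul_right[of a w u T v] ty_okw[of a v w S] ty_okw[of a w u T] by simp

text \<open>At the entries 0 and 2 the word EF passes through a weight with an entry -1 and
  vanishes. Of the decomposition of FE only the two unit summands remain, with the plain and the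
  dotted cup as inclusions.\<close>

lemma FE_two:
  assumes i: "1 \<le> i" and v: "a \<in> Wts" "okw v" and b: "act v a i = 0" "act v a (Suc i) = 2"
  shows "A a (V a (cp a (Cup i) v) (cp a (CapInv i 0) v))
    (V a (cp a (cup_dots i (Suc 0)) v) (cp a (CapInv i (Suc 0)) v)) = fo a (Idn (Ff i # Ee i # v))"
proof -
  have l: "lam (act v a) i = -2" using b by (simp add: lam_def)
  have "act (Ff i # v) a i = -1" using b by (simp add: act_Cons eps_def)
  then have k: "act (Ff i # v) a \<in> killed" unfolding killed_def by (intro CollectI exI[of _ i]) simp
  have z: "fo a (Idn ([Ee i] @ Ff i # v)) = fo a (Nul ([Ee i] @ Ff i # v) ([Ee i] @ Ff i # v))"
    by (rule kill_word[OF k]) (use i v in auto)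
  have w: "act v a \<in> Wts" using v by simp
  have t: "ty a (Ff i # Ee i # v) (Ee i # Ff i # v) (cp a (SInv i i) v)"
    "ty a (Ee i # Ff i # v) (Ff i # Ee i # v) (cp a (sigma i i) v)"
    using ty_cp[of v a "SInv i i"] ty_cp[of v a "sigma i i"] v i w by (simp_all add: wfo_gen wfo_sigma)
  have c: "ty a (Ff i # Ee i # v) (Ff i # Ee i # v) (V a (cp a (cup_dots i r) v) (cp a (CapInv i r) v))" if "r < 2" for r
    using ty_V[OF ty_cp[of v a "CapInv i r"], of _ "cp a (cup_dots i r) v"] ty_cp[of v a "cup_dots i r"] v i w l that
    by (simp add: wfo_gen wfo_cup_dots)
  have n: "[0..<nat (- lam (act v a) i)] = [0, Suc 0]" using l by (simp add: upt_rec)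
  show ?thesis
    using FE_sum[OF i v] l V_zero_word[OF z[simplified] t] n A_Nul_left[OF ty_A[OF c[of 0] c[of "Suc 0"]]] A_Nul_right[OF c[of "Suc 0"]]
    by (simp add: cup_dots_0)
qed

lemma Hc_LW: "b = act v a \<Longrightarrow> ty a v w S \<Longrightarrow> Hc a (fo b (Idn u)) S = LW a u S"
  unfolding ty_def by (auto simp: LW_fo fo_hor)

text \<open>Resolves a horizontal composite into a component and a whiskering, the two operations in
  which all later computations are carried out.\<close>

lemma Hc_cp_LW:
  assumes T: "ty a v w T" and g: "wfo b g" "dom g = x" "cod g = x'" and b: "b = act v a"
  shows "Hc a (fo b g) T = V a (cp a g w) (LW a x T)"
proof -
  have w: "okw w" "act w a = b" "a \<in> Wts" using ty_okw[OF T] b by auto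
  have gi: "ty b x x' (fo b g)" by (rule ty_fo[OF g])
  have o: "okw x" "b \<in> Wts" using ty_okw[OF gi] by auto
  have "V a (Hc a (fo b g) (fo a (Idn w))) (Hc a (fo b (Idn x)) T) = Hc a (V b (fo b g) (fo b (Idn x))) (V a (fo a (Idn w)) T)"
    by (rule Hc_V[OF ty_Idn[OF o(2,1)] gi T ty_Idn[OF w(3,1)] b])
  moreover have "Hc a (fo b g) (fo a (Idn w)) = cp a g w" using w by (simp add: cp_def fo_hor)
  moreover have "Hc a (fo b (Idn x)) T = LW a x T" by (rule Hc_LW[OF b T])
  ultimately show ?thesis
    using V_id_right[OF ty_src[OF gi]] V_id_left[OF ty_tgt[OF T]] by simp
qed

lemma idem_1 [simp]: "1 \<le> i \<Longrightarrow> a \<in> Wts \<Longrightarrow> fo a (E_idem i (Suc 0)) = fo a (Idn [Ee i])"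
  "1 \<le> i \<Longrightarrow> a \<in> Wts \<Longrightarrow> fo a (F_idem i (Suc 0)) = fo a (Idn [Ff i])"
  using E_idem_1[of i a "[]"] F_idem_1[of i a "[]"] by (simp_all add: cp_Nil)

lemma expand_2: "replicate 2 l = [l, l]" by (simp add: numeral_2_eq_2)

text \<open>A table of the idempotents of single letters and of words with one E and one F, for
  exponents 1 and 2, written as components. For exponent 1 the idempotents are identities.\<close>

lemma ip_words:
  assumes i: "1 \<le> i" "1 \<le> j" and a: "a \<in> Wts"
  shows "ip a [Ed i 1] = fo a (Idn [Ee i])" "ip a [Fd i 1] = fo a (Idn [Ff i])"
    "ip a [Fd j 1, Ed i 1] = fo a (Idn [Ff j, Ee i])" "ip a [Ed i 1, Fd j 1] = fo a (Idn [Ee i, Ff j])"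
    "ip a [Fd j 1, Ed i 2] = LW a [Ff j] (cp a (E_idem i 2) [])" "ip a [Fd j 2, Ed i 1] = cp a (F_idem j 2) [Ee i]"
    "ip a [Fd j 2, Ed i 2] = V a (cp a (F_idem j 2) [Ee i, Ee i]) (LW a [Ff j, Ff j] (cp a (E_idem i 2) []))"
    "ip a [Ed i 2, Fd j 1] = cp a (E_idem i 2) [Ff j]" "ip a [Ed i 1, Fd j 2] = LW a [Ee i] (cp a (F_idem j 2) [])"
    "ip a [Ed i 2, Fd j 2] = V a (cp a (E_idem i 2) [Ff j, Ff j]) (LW a [Ee i, Ee i] (cp a (F_idem j 2) []))"
proof -
  have E2: "ty a [Ee i, Ee i] [Ee i, Ee i] (fo a (E_idem i 2))" and F2: "ty a [Ff j, Ff j] [Ff j, Ff j] (fo a (F_idem j 2))"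
    using ty_idem_letter[of "Ed i 2" a] ty_idem_letter[of "Fd j 2" a] i a by (simp_all add: expand_2)
  have wE: "wfo b (E_idem i 2)" and wF: "wfo b (F_idem j 2)" if "b \<in> Wts" for b
    using wfo_idem_letter[of "Ed i 2" b] wfo_idem_letter[of "Fd j 2" b] i that by auto
  have d: "dom (E_idem i 2) = [Ee i, Ee i]" "cod (E_idem i 2) = [Ee i, Ee i]"
    "dom (F_idem j 2) = [Ff j, Ff j]" "cod (F_idem j 2) = [Ff j, Ff j]"
    using dom_idem_letter[of "Ed i 2"] dom_idem_letter[of "Fd j 2"] by (simp_all add: expand_2)
  have I: "Hc a T (fo a (Idn [])) = T" if "cls a T" for T
    using that cp_Nil by (auto simp: cls_def cp_def fo_hor)
  have H: "Hc a (fo (act [l] a) (Idn [l'])) (fo a (Idn [l])) = fo a (Idn [l', l])" for l l'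
    using Hc_Idn[of a "[l]" "[l']"] by simp
  have o: "act [Ee i] a \<in> Wts" "act [Ff j] a \<in> Wts" "act [Ee i, Ee i] a \<in> Wts" "act [Ff j, Ff j] a \<in> Wts"
    using i a by (auto intro!: act_Wts)
  note s = ip_Cons I H expand_2 cp_Nil
  show "ip a [Ed i 1] = fo a (Idn [Ee i])" "ip a [Fd i 1] = fo a (Idn [Ff i])"
    "ip a [Fd j 1, Ed i 1] = fo a (Idn [Ff j, Ee i])" "ip a [Ed i 1, Fd j 1] = fo a (Idn [Ee i, Ff j])"
    using i a o by (simp_all add: s)
  show "ip a [Fd j 1, Ed i 2] = LW a [Ff j] (cp a (E_idem i 2) [])"
    "ip a [Ed i 1, Fd j 2] = LW a [Ee i] (cp a (F_idem j 2) [])"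
    using i a o Hc_LW[OF HOL.refl E2] Hc_LW[OF HOL.refl F2] by (simp_all add: s)
  show "ip a [Fd j 2, Ed i 1] = cp a (F_idem j 2) [Ee i]" "ip a [Ed i 2, Fd j 1] = cp a (E_idem i 2) [Ff j]"
    using i a o by (simp_all add: s cp_def fo_hor)
  show "ip a [Fd j 2, Ed i 2] = V a (cp a (F_idem j 2) [Ee i, Ee i]) (LW a [Ff j, Ff j] (cp a (E_idem i 2) []))"
    "ip a [Ed i 2, Fd j 2] = V a (cp a (E_idem i 2) [Ff j, Ff j]) (LW a [Ee i, Ee i] (cp a (F_idem j 2) []))"
    using i a o Hc_cp_LW[OF E2 wF d(3,4)] Hc_cp_LW[OF F2 wE d(1,2)] by (simp_all add: s)
qed

text \<open>The analogue of \<open>decomposes\<close> for single words. Working with classes instead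
  of one-by-one matrices keeps the computations free of indices; \<open>dec_decomposes\<close> makes
  the transition.\<close>

definition dec :: "weight \<Rightarrow> dword \<Rightarrow> (int \<times> dword) list \<Rightarrow> bool" where
  "dec a P L \<longleftrightarrow> a \<in> Wts \<and> okd P \<and> (\<forall>(k, Q) \<in> set L. okd Q) \<and> (\<exists>\<alpha> \<beta>.
     (\<forall>r<length L. hkd a P (snd (L ! r)) (fst (L ! r)) (\<alpha> r) \<and> hkd a (snd (L ! r)) P (- fst (L ! r)) (\<beta> r)) \<and>
     (\<forall>r<length L. \<forall>s<length L. V a (\<alpha> r) (\<beta> s) = (if r = s then ip a (snd (L ! r))
        else fo a (Nul (expand (snd (L ! s))) (expand (snd (L ! r)))))) \<and>
     foldr (A a) (map (\<lambda>r. V a (\<beta> r) (\<alpha> r)) [0..<length L]) (fo a (Nul (expand P) (expand P))) = ip a P)"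

lemma decI:
  assumes "a \<in> Wts" "okd P" "\<And>r. r < length L \<Longrightarrow> okd (snd (L ! r))"
    "\<And>r. r < length L \<Longrightarrow> hkd a P (snd (L ! r)) (fst (L ! r)) (\<alpha> r)"
    "\<And>r. r < length L \<Longrightarrow> hkd a (snd (L ! r)) P (- fst (L ! r)) (\<beta> r)"
    "\<And>r s. r < length L \<Longrightarrow> s < length L \<Longrightarrow> V a (\<alpha> r) (\<beta> s) = (if r = s then ip a (snd (L ! r))
        else fo a (Nul (expand (snd (L ! s))) (expand (snd (L ! r)))))"
    "foldr (A a) (map (\<lambda>r. V a (\<beta> r) (\<alpha> r)) [0..<length L]) (fo a (Nul (expand P) (expand P))) = ip a P"
  shows "dec a P L"
  unfolding dec_def
proof (intro conjI)
  show "\<forall>(k, Q)\<in>set L. okd Q" using assms(3) by (fastforce simp: in_set_conv_nth)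
qed (use assms in \<open>simp_all\<close>, rule exI[of _ \<alpha>], rule exI[of _ \<beta>], simp)

lemma dec_iso:
  assumes "okd P" "okd Q" "hkd a P Q k \<alpha>" "hkd a Q P (- k) \<beta>" "V a \<alpha> \<beta> = ip a Q" "V a \<beta> \<alpha> = ip a P"
  shows "dec a P [(k, Q)]"
proof -
  have a: "a \<in> Wts" using hkd_tyd[OF assms(3)] tyd_ty ty_okw by blast
  have "A a (ip a P) (fo a (Nul (expand P) (expand P))) = ip a P" by (rule A_Nul_right[OF ty_ip[OF assms(1) a]])
  then show ?thesis
    using assms a by (intro decI[where \<alpha> = "\<lambda>_. \<alpha>" and \<beta> = "\<lambda>_. \<beta>"]) simp_all
qed

text \<open>When the target idempotent is an identity, \<alpha>\<beta> = 1 and \<beta>\<alpha> = e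
  imply \<alpha> e = \<alpha> and e \<beta> = \<beta>, so absorption comes for free.\<close>

lemma dec_iso_Idn:
  assumes "okd P" "okd Q" "tyd a (expand P) (expand Q) k \<alpha>" "tyd a (expand Q) (expand P) (- k) \<beta>"
    "V a \<alpha> \<beta> = fo a (Idn (expand Q))" "V a \<beta> \<alpha> = ip a P" "ip a Q = fo a (Idn (expand Q))"
  shows "dec a P [(k, Q)]"
proof (rule dec_iso[OF assms(1,2)])
  note ta = tyd_ty[OF assms(3)] and tb = tyd_ty[OF assms(4)]
  note i = V_id_left[OF ty_tgt[OF ta]] V_id_right[OF ty_src[OF tb]]
  have "V a \<alpha> (ip a P) = \<alpha>" "V a (ip a P) \<beta> = \<beta>"
    using V_assoc[of a \<alpha> \<beta> \<alpha>] V_assoc[of a \<beta> \<alpha> \<beta>] i ty_cls[OF ta] ty_cls[OF tb] assms(5,6) by simp_all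
  then show "hkd a P Q k \<alpha>" "hkd a Q P (- k) \<beta>" using assms i by (simp_all add: hkd_def)
qed (use assms in simp_all)

lemma dec_zero: "\<lbrakk>a \<in> Wts; okd P; fo a (Idn (expand P)) = fo a (Nul (expand P) (expand P))\<rbrakk> \<Longrightarrow> dec a P []"
  unfolding dec_def using zero_word[OF _ ty_ip] by auto

text \<open>The rules \<open>iso_neg_\<close> in the format of \<open>dec\<close>: index 0 stands
  for the summand EF, and \<open>Suc r\<close> for the unit summand of index r, whose shift is the
  degree of \<open>CapInv i r\<close>.\<close>

lemma dec_FE:
  assumes i: "1 \<le> i" and a: "a \<in> Wts" and l: "lam a i \<le> 0"
  shows "\<exists>k. dec a [Fd i 1, Ed i 1] ((0, [Ed i 1, Fd i 1]) # map (\<lambda>r. (k r, [])) [0..<nat (- lam a i)])"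
proof (intro exI)
  let ?n = "nat (- lam a i)"
  let ?k = "\<lambda>r. - (1 + lam a i + 2 * int r)"
  let ?L = "(0, [Ed i 1, Fd i 1]) # map (\<lambda>r. (?k r, [])) [0..<?n]"
  let ?\<alpha> = "\<lambda>r. case r of 0 \<Rightarrow> cp a (SInv i i) [] | Suc r \<Rightarrow> cp a (CapInv i r) []"
  let ?\<beta> = "\<lambda>r. case r of 0 \<Rightarrow> cp a (sigma i i) [] | Suc r \<Rightarrow> cp a (cup_dots i r) []"
  have e: "[0..<length ?L] = 0 # map Suc [0..<?n]" by (simp add: upt_conv_Cons map_Suc_upt del: upt_Suc)
  note ips = ip_words(3,4)[OF i i a, simplified]
  have hI: "hkd a P Q d S" if "tyd a (expand P) (expand Q) d S" "ip a P = fo a (Idn (expand P))" "ip a Q = fo a (Idn (expand Q))"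
    for P Q d S
    using that ty_src[OF tyd_ty[OF that(1)]] ty_tgt[OF tyd_ty[OF that(1)]] by (simp add: hkd_def V_id_left V_id_right)
  show "dec a [Fd i 1, Ed i 1] ?L"
  proof (rule decI[where \<alpha> = ?\<alpha> and \<beta> = ?\<beta>])
    show "a \<in> Wts" "okd [Fd i 1, Ed i 1]" using a i by simp_all
    show "foldr (A a) (map (\<lambda>r. V a (?\<beta> r) (?\<alpha> r)) [0..<length ?L])
        (fo a (Nul (expand [Fd i 1, Ed i 1]) (expand [Fd i 1, Ed i 1]))) = ip a [Fd i 1, Ed i 1]"
      unfolding e using FE_sum[OF i a, of "[]"] l ips by (simp add: comp_def)
    fix r assume r: "r < length ?L"
    then show "okd (snd (?L ! r))" using i by (cases r) auto
    show "hkd a [Fd i 1, Ed i 1] (snd (?L ! r)) (fst (?L ! r)) (?\<alpha> r)"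
    proof (cases r)
      case 0
      have "tyd a [Ff i, Ee i] [Ee i, Ff i] 0 (cp a (SInv i i) [])" 
        using tyd_cp[of "[]" a "SInv i i" 0] i a by (simp add: wfo_gen)
      then show ?thesis using 0 ips by (auto intro!: hI)
    next
      case (Suc s)
      have "tyd a [Ff i, Ee i] [] (?k s) (cp a (CapInv i s) [])" 
        using tyd_cp[of "[]" a "CapInv i s" "?k s"] i a r Suc by (simp add: wfo_gen)
      then show ?thesis using Suc r ips by (auto intro!: hI)
    qed
    show "hkd a (snd (?L ! r)) [Fd i 1, Ed i 1] (- fst (?L ! r)) (?\<beta> r)"
    proof (cases r)
      case 0
      have "tyd a [Ee i, Ff i] [Ff i, Ee i] 0 (cp a (sigma i i) [])" 
        using tyd_cp[of "[]" a "sigma i i" 0] i a has_deg_sigma by (simp add: wfo_sigma)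
      then show ?thesis using 0 ips by (auto intro!: hI)
    next
      case (Suc s)
      have "tyd a [] [Ff i, Ee i] (1 + lam a i + 2 * int s) (cp a (cup_dots i s) [])" 
        using tyd_cp[of "[]" a "cup_dots i s" "1 + lam a i + 2 * int s"] i a has_deg_cup_dots[of a i s] by (simp add: wfo_cup_dots)
      then show ?thesis using Suc r ips by (auto intro!: hI simp: algebra_simps)
    qed
    fix s assume s: "s < length ?L"
    show "V a (?\<alpha> r) (?\<beta> s) = (if r = s then ip a (snd (?L ! r))
        else fo a (Nul (expand (snd (?L ! s))) (expand (snd (?L ! r)))))"
      using r s i a l ips SInv_sigma[OF i a, of "[]"] CapInv_cup[OF i a, of "[]"] SInv_cup[OF i a, of "[]"] CapInv_sigma[OF i a, of "[]"]
      by (cases r; cases s) auto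
  qed
qed

text \<open>An inclusion of F into FFE: a cup creates FE to the left of F, and then E is moved past
  F. At the weights used below it is one of two such inclusions, the other one having a dot on the
  cup.\<close>

definition FFE_incl :: "nat \<Rightarrow> dgm" where
  "FFE_incl i = (Idn [Ff i] \<otimes> sigma i i) \<odot> (Cup i \<otimes> Idn [Ff i])"

lemma dom_FFE_incl [simp]: "dom (FFE_incl i) = [Ff i]" "cod (FFE_incl i) = [Ff i, Ff i, Ee i]" by (simp_all add: FFE_incl_def)

lemma cp_FFE_incl: "cp a (FFE_incl i) v = V a (LW a [Ff i] (cp a (sigma i i) v)) (cp a (Cup i) (Ff i # v))"
  by (simp add: FFE_incl_def cp_simps)

lemma cp_sigma: "cp a (sigma i j) v = V a (LW a [Ff j, Ee i] (cp a (Cap j) v))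
    (V a (LW a [Ff j] (cp a (Crs j i) (Ff j # v))) (cp a (Cup j) (Ee i # Ff j # v)))"
  by (simp add: sigma_def cp_simps)

section \<open>Splitting FFE, and the bends needed for FEE\<close>

context
  fixes a :: weight and i :: nat and v :: word
  assumes i: "1 \<le> i" and v: "a \<in> Wts" "okw v"
begin

interpretation one: adjoint_words "[Ee i]" "[Ff i]" "Cup i" "Cap i" by (rule adjoint_words_1[OF i])
interpretation two: adjoint_words "[Ee i, Ee i]" "[Ff i, Ff i]" "cups i 2" "caps i 2" by (rule adjoint_words_2[OF i])

lemma cp_cups2: "cp a (cups i 2) u = V a (LW a [Ff i] (cp a (Cup i) (Ee i # u))) (cp a (Cup i) u)"
  by (simp add: numeral_2_eq_2 cp_simps LW_simps V_id_left V_id_right)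
lemma cp_caps2: "cp a (caps i 2) u = V a (cp a (Cap i) u) (LW a [Ee i] (cp a (Cap i) (Ff i # u)))"
  by (simp add: numeral_2_eq_2 cp_simps LW_simps V_id_left V_id_right)

text \<open>The cup fed into the mate cancels against one of its two caps by a zigzag, so that a
  single cap is left.\<close>

lemma mate_bend:
  assumes t: "dom t = [Ee i, Ee i]" "cod t = [Ee i, Ee i]"
  shows "V a (cp a (two.mt t) (Ee i # v)) (LW a [Ff i] (cp a (Cup i) v)) =
    V a (LW a [Ff i, Ff i, Ee i] (cp a (Cap i) v)) (V a (LW a [Ff i, Ff i] (cp a t (Ff i # v))) (cp a (cups i 2) (Ff i # v)))"
proof -
  let ?S = "LW a [Ff i] (cp a (Cup i) v)"
  have s: "src a (Ff i # v) ?S" "tgt a (Ff i # Ff i # Ee i # v) ?S"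
    by (rule src_LW[of _ v], simp_all) (rule tgt_LW[of _ "Ff i # Ee i # v"], simp_all)
  have "V a (cp a (two.mt t) (Ee i # v)) ?S =
    V a (LW a [Ff i, Ff i] (V a (cp a (caps i 2) (Ee i # v)) (cp a t (Ff i # Ff i # Ee i # v)))) (V a (cp a (cups i 2) (Ff i # Ff i # Ee i # v)) ?S)"
    by (simp add: two.cp_mate V_assoc LW_V)
  also have "V a (cp a (cups i 2) (Ff i # Ff i # Ee i # v)) ?S = V a (LW a [Ff i, Ff i, Ee i, Ee i] ?S) (cp a (cups i 2) (Ff i # v))"
    using two.cu_nat[OF s] by simp
  also have "V a (LW a [Ff i, Ff i] (V a (cp a (caps i 2) (Ee i # v)) (cp a t (Ff i # Ff i # Ee i # v)))) (V a (LW a [Ff i, Ff i, Ee i, Ee i] ?S) (cp a (cups i 2) (Ff i # v))) =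
    V a (LW a [Ff i, Ff i] (V a (cp a (caps i 2) (Ee i # v)) (V a (cp a t (Ff i # Ff i # Ee i # v)) (LW a [Ee i, Ee i] ?S)))) (cp a (cups i 2) (Ff i # v))"
    by (simp add: V_assoc LW_V LW_LW)
  also have "V a (cp a t (Ff i # Ff i # Ee i # v)) (LW a [Ee i, Ee i] ?S) = V a (LW a [Ee i, Ee i] ?S) (cp a t (Ff i # v))"
    by (rule naturality[OF s t])
  also have "V a (cp a (caps i 2) (Ee i # v)) (V a (LW a [Ee i, Ee i] ?S) (cp a t (Ff i # v))) =
    V a (V a (cp a (Cap i) (Ee i # v)) (LW a [Ee i] (V a (cp a (Cap i) (Ff i # Ee i # v)) (LW a [Ee i, Ff i] (cp a (Cup i) v))))) (cp a t (Ff i # v))"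
    by (simp add: cp_caps2 V_assoc LW_V LW_LW)
  also have "V a (cp a (Cap i) (Ff i # Ee i # v)) (LW a [Ee i, Ff i] (cp a (Cup i) v)) = V a (cp a (Cup i) v) (cp a (Cap i) v)"
    using one.ca_nat[of a v "cp a (Cup i) v" "Ff i # Ee i # v"] by simp
  also have "V a (cp a (Cap i) (Ee i # v)) (LW a [Ee i] (V a (cp a (Cup i) v) (cp a (Cap i) v))) = LW a [Ee i] (cp a (Cap i) v)"
  proof -
    have "V a (cp a (Cap i) (Ee i # v)) (LW a [Ee i] (V a (cp a (Cup i) v) (cp a (Cap i) v))) =
      V a (V a (cp a (Cap i) (Ee i # v)) (LW a [Ee i] (cp a (Cup i) v))) (LW a [Ee i] (cp a (Cap i) v))"
      by (simp add: V_assoc LW_V)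
    also have "\<dots> = LW a [Ee i] (cp a (Cap i) v)"
    proof -
      have "tgt a (Ee i # v) (LW a [Ee i] (cp a (Cap i) v))" by (rule tgt_LW[of _ v]) simp_all
      then show ?thesis using one.zig_B[of a v] v by (simp add: V_id_left)
    qed
    finally show ?thesis .
  qed
  finally show ?thesis by (simp add: V_assoc LW_V LW_LW)
qed

abbreviation (input) "tauF \<equiv> cp a (two.mt (Crs i i)) (Ee i # v)"
abbreviation (input) "yF \<equiv> cp a (two.mt (Idn [Ee i] \<otimes> Dot i)) (Ee i # v)"
abbreviation (input) "xF \<equiv> cp a (two.mt (Dot i \<otimes> Idn [Ee i])) (Ee i # v)"

text \<open>Unfolding \<sigma> shows exactly the right-hand side of \<open>mate_bend\<close> for the
  crossing. The inclusion thus has the shape B0 = \<tau> C that \<open>split_half\<close> asks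
  for.\<close>

lemma FFE_incl_mate: "cp a (FFE_incl i) v = V a tauF (LW a [Ff i] (cp a (Cup i) v))"
  using mate_bend[of "Crs i i"] by (simp add: cp_FFE_incl cp_sigma cp_cups2 LW_V LW_LW V_assoc)

text \<open>Moving the dot off the cup and through the diagram turns it into the mate of a dot on
  the second strand. So the second inclusion is X B0 with X = \<open>yF\<close>.\<close>

lemma FFE_incl_dot: "V a (LW a [Ff i] (cp a (sigma i i) v)) (cp a (cup_dots i (Suc 0)) (Ff i # v)) = V a yF (cp a (FFE_incl i) v)"
proof -
  have w: "wfo a (Idn (Ee i # v))" using v i by simp
  have "V a (LW a [Ff i] (cp a (sigma i i) v)) (cp a (cup_dots i (Suc 0)) (Ff i # v)) =
    V a (LW a [Ff i, Ff i, Ee i] (cp a (Cap i) v)) (V a (LW a [Ff i, Ff i] (cp a (Crs i i) (Ff i # v)))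
      (V a (LW a [Ff i] (V a (cp a (Cup i) (Ee i # Ff i # v)) (cp a (Dot i) (Ff i # v)))) (cp a (Cup i) (Ff i # v))))"
    by (simp add: cp_sigma cup_dots_1 LW_V LW_LW V_assoc)
  also have "V a (cp a (Cup i) (Ee i # Ff i # v)) (cp a (Dot i) (Ff i # v)) =
      V a (LW a [Ff i, Ee i] (cp a (Dot i) (Ff i # v))) (cp a (Cup i) (Ee i # Ff i # v))"
    using one.cu_nat[of a "Ee i # Ff i # v" "cp a (Dot i) (Ff i # v)" "Ee i # Ff i # v"] by simp
  also have "V a (LW a [Ff i, Ff i, Ee i] (cp a (Cap i) v)) (V a (LW a [Ff i, Ff i] (cp a (Crs i i) (Ff i # v)))
      (V a (LW a [Ff i] (V a (LW a [Ff i, Ee i] (cp a (Dot i) (Ff i # v))) (cp a (Cup i) (Ee i # Ff i # v)))) (cp a (Cup i) (Ff i # v)))) =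
    V a (LW a [Ff i, Ff i, Ee i] (cp a (Cap i) v)) (V a (LW a [Ff i, Ff i] (cp a (Crs i i \<odot> (Idn [Ee i] \<otimes> Dot i)) (Ff i # v))) (cp a (cups i 2) (Ff i # v)))"
    by (simp add: cp_cups2 cp_ver cp_lw LW_V LW_LW V_assoc)
  also have "\<dots> = V a (cp a (two.mt (Crs i i \<odot> (Idn [Ee i] \<otimes> Dot i))) (Ee i # v)) (LW a [Ff i] (cp a (Cup i) v))"
    by (rule mate_bend[symmetric]) simp_all
  also have "cp a (two.mt (Crs i i \<odot> (Idn [Ee i] \<otimes> Dot i))) (Ee i # v) = V a yF tauF"
    using two.mate_ver[OF w, of "Idn [Ee i] \<otimes> Dot i" "Crs i i"] by simp
  finally show ?thesis by (simp add: FFE_incl_mate V_assoc)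
qed

lemma mate_scl: "cp a (two.mt (z \<cdot> t)) u = Sc a z (cp a (two.mt t) u)"
  by (simp add: two.cp_mate cp_scl LW_Sc V_Sc_left V_Sc_right)

text \<open>The nilHecke relations transported to F by mates. Since composition is reversed, the
  idempotent x1 \<tau> turns into \<open>tauF\<close> after \<open>xF\<close>.\<close>

lemma tauF_rels:
  shows "ty a (Ff i # Ff i # Ee i # v) (Ff i # Ff i # Ee i # v) tauF" "ty a (Ff i # Ff i # Ee i # v) (Ff i # Ff i # Ee i # v) yF"
    "ty a (Ff i # Ff i # Ee i # v) (Ff i # Ff i # Ee i # v) xF"
    "V a tauF tauF = fo a (Nul (Ff i # Ff i # Ee i # v) (Ff i # Ff i # Ee i # v))"
    "V a tauF (V a yF tauF) = Sc a (-1) tauF" "V a tauF (V a xF tauF) = tauF"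
    "cp a (F_idem i 2) (Ee i # v) = V a tauF xF"
proof -
  have w: "wfo a (Idn (Ee i # v))" "wfo a (Idn (Ff i # Ff i # Ee i # v))" using v i by auto
  have wm: "wfo (act (Ee i # v) a) (two.mt t)" if "\<And>b. b \<in> Wts \<Longrightarrow> wfo b t" "dom t = [Ee i, Ee i]" "cod t = [Ee i, Ee i]" for t
    using that i v wfo_cups wfo_caps by (simp add: mate_def wfo_hor expand_2)
  have tm: "ty a (Ff i # Ff i # Ee i # v) (Ff i # Ff i # Ee i # v) (cp a (two.mt t) (Ee i # v))"
    if "\<And>b. b \<in> Wts \<Longrightarrow> wfo b t" "dom t = [Ee i, Ee i]" "cod t = [Ee i, Ee i]" for t
    using ty_cp[OF wm[OF that]] v i by (simp add: mate_def expand_2)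
  show t: "ty a (Ff i # Ff i # Ee i # v) (Ff i # Ff i # Ee i # v) tauF" "ty a (Ff i # Ff i # Ee i # v) (Ff i # Ff i # Ee i # v) yF"
    "ty a (Ff i # Ff i # Ee i # v) (Ff i # Ff i # Ee i # v) xF"
    using i by (auto intro!: tm simp: wfo_gen wfo_hor)
  note m = two.mate_ver[OF w(1)]
  have "V a tauF tauF = cp a (two.mt (Crs i i \<odot> Crs i i)) (Ee i # v)" by (subst m) simp_all
  \<comment> \<open>Zero is written as a multiple of the crossing, because mates are known to
    commute with scalars.\<close>
  also have "\<dots> = cp a (two.mt (0 \<cdot> Crs i i)) (Ee i # v)"
  proof (rule two.mate_cong)
    have "Sc a 0 (cp a (Crs i i) (Ff i # Ff i # Ee i # v)) = fo a (Nul (Ee i # Ee i # Ff i # Ff i # Ee i # v) (Ee i # Ee i # Ff i # Ff i # Ee i # v))"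
      by (rule Sc_zero) (use ty_ne[OF ty_tau[OF i w(2)]] in simp_all)
    then show "cp a (Crs i i \<odot> Crs i i) ([Ff i, Ff i] @ Ee i # v) = cp a (0 \<cdot> Crs i i) ([Ff i, Ff i] @ Ee i # v)"
      using tau_tau[OF i w(2)] by (simp add: cp_ver cp_scl)
  qed
  also have "\<dots> = fo a (Nul (Ff i # Ff i # Ee i # v) (Ff i # Ff i # Ee i # v))"
    unfolding mate_scl by (rule Sc_zero[OF ty_src[OF t(1)] ty_tgt[OF t(1)] ty_ne[OF t(1)]])
  finally show "V a tauF tauF = fo a (Nul (Ff i # Ff i # Ee i # v) (Ff i # Ff i # Ee i # v))" .
  have "V a tauF (V a yF tauF) = cp a (two.mt (Crs i i \<odot> ((Idn [Ee i] \<otimes> Dot i) \<odot> Crs i i))) (Ee i # v)"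
    by (subst m, simp_all, subst m) (simp_all add: V_assoc)
  also have "\<dots> = cp a (two.mt ((-1) \<cdot> Crs i i)) (Ee i # v)"
    by (rule two.mate_cong) (use tau_x2_tau[OF i w(2)] in \<open>simp add: cp_ver cp_lw cp_scl\<close>)
  finally show "V a tauF (V a yF tauF) = Sc a (-1) tauF" by (simp only: mate_scl)
  have "V a tauF (V a xF tauF) = cp a (two.mt (Crs i i \<odot> ((Dot i \<otimes> Idn [Ee i]) \<odot> Crs i i))) (Ee i # v)"
    by (subst m, simp_all, subst m) (simp_all add: V_assoc)
  also have "\<dots> = tauF"
    by (rule two.mate_cong) (use tau_x1_tau[OF i w(2)] in \<open>simp add: cp_ver cp_rw\<close>)
  finally show "V a tauF (V a xF tauF) = tauF" .
  have "cp a (F_idem i 2) (Ee i # v) = cp a (two.mt (E_idem i 2)) (Ee i # v)" by (simp add: F_idem_mate expand_2)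
  also have "\<dots> = cp a (two.mt ((Dot i \<otimes> Idn [Ee i]) \<odot> Crs i i)) (Ee i # v)"
    by (rule two.mate_cong) (use E_idem_2[OF i w(2)] in \<open>simp add: cp_ver cp_rw\<close>)
  also have "\<dots> = V a tauF xF" by (subst m) simp_all
  finally show "cp a (F_idem i 2) (Ee i # v) = V a tauF xF" .
qed

text \<open>The projection to the first copy of F, precomposed with the idempotent of the divided
  square.\<close>

definition FFE_proj :: foam where
  "FFE_proj = V a (V a (cp a (CapInv i 0) (Ff i # v)) (LW a [Ff i] (cp a (SInv i i) v))) (cp a (F_idem i 2) (Ee i # v))"

text \<open>At the entries 1, 1 we have \<lambda> = 0, so \<sigma> is invertible and FFE = FEF. The
  right-hand F leads to the entries 0, 2, where FE is two units; hence FFE is two copies of F, and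
  \<open>iso_left\<close> identifies the divided square with one of them.\<close>

lemma F2E_iso:
  assumes b: "act v a i = 1" "act v a (Suc i) = 1"
  shows "V a FFE_proj (cp a (FFE_incl i) v) = fo a (Idn (Ff i # v))" "V a (cp a (FFE_incl i) v) FFE_proj = cp a (F_idem i 2) (Ee i # v)"
proof -
  let ?z = "Ff i # Ff i # Ee i # v" and ?y = "Ff i # v"
  have l: "lam (act v a) i = 0" "lam (act (Ff i # v) a) i = -2" using b by (simp_all add: lam_def) (simp add: act_Cons eps_def)
  have v': "okw (Ff i # v)" "wfo a (Idn (Ff i # v))" using v i by auto
  have W: "act v a \<in> Wts" "act (Ff i # v) a \<in> Wts" using v i by (auto intro!: act_Wts)
  have b': "act (Ff i # v) a i = 0" "act (Ff i # v) a (Suc i) = 2" using b by (simp_all add: act_Cons eps_def)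
  let ?A = "\<lambda>r. V a (cp a (CapInv i r) (Ff i # v)) (LW a [Ff i] (cp a (SInv i i) v))"
  have tS: "ty a (Ff i # Ff i # Ee i # v) (Ff i # Ee i # Ff i # v) (LW a [Ff i] (cp a (SInv i i) v))"
    using ty_LW[OF ty_cp[of v a "SInv i i"], of "[Ff i]"] v i W by (simp add: wfo_gen)
  have tC: "ty a (Ff i # Ee i # Ff i # v) (Ff i # v) (cp a (CapInv i r) (Ff i # v))" if "r < 2" for r
    using ty_cp[of "Ff i # v" a "CapInv i r"] v' v W l that by (simp add: wfo_gen i[simplified])
  have tA: "ty a ?z ?y (?A r)" if "r < 2" for r by (rule ty_V[OF tS tC[OF that]])
  have tsig: "ty a (Ff i # Ee i # Ff i # v) ?z (LW a [Ff i] (cp a (sigma i i) v))"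
    using ty_LW[OF ty_cp[of v a "sigma i i"], of "[Ff i]"] v i W by (simp add: wfo_sigma)
  have tcup: "ty a ?y (Ff i # Ee i # Ff i # v) (cp a (cup_dots i r) (Ff i # v))" for r
    using ty_cp[of "Ff i # v" a "cup_dots i r"] v' v W i by (simp add: wfo_cup_dots)
  have SS: "V a (LW a [Ff i] (cp a (SInv i i) v)) (LW a [Ff i] (cp a (sigma i i) v)) = fo a (Idn (Ff i # Ee i # Ff i # v))"
    "V a (LW a [Ff i] (cp a (sigma i i) v)) (LW a [Ff i] (cp a (SInv i i) v)) = fo a (Idn ?z)"
    using SInv_sigma[OF i v] sigma_SInv[OF i v] l by (simp_all add: LW_V[symmetric] LW_Idn)
  \<comment> \<open>The two projections use \<open>CapInv\<close> of index 0 and 1 after the inverse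
    of \<sigma>; the two inclusions differ by the dot \<open>yF\<close>.\<close>
  interpret split_half a ?z ?y tauF yF "LW a [Ff i] (cp a (Cup i) v)" "?A 0" "?A (Suc 0)" "cp a (FFE_incl i) v" "fo a (Idn ?z)" "fo a (Idn ?y)"
  proof
    show "ty a ?y ?z (LW a [Ff i] (cp a (Cup i) v))"
      using ty_LW[OF ty_cp[of v a "Cup i"], of "[Ff i]"] v i W by (simp add: wfo_gen)
    have "V a (?A 0) (cp a (FFE_incl i) v) = V a (cp a (CapInv i 0) (Ff i # v)) (V a (V a (LW a [Ff i] (cp a (SInv i i) v))
       (LW a [Ff i] (cp a (sigma i i) v))) (cp a (Cup i) (Ff i # v)))"
      by (simp add: cp_FFE_incl V_assoc)
    also have "\<dots> = fo a (Idn ?y)"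
      using CapInv_cup[OF i v(1) v'(1), of 0 0] l by (simp add: SS V_id_left cup_dots_0)
    finally show "V a (?A 0) (cp a (FFE_incl i) v) = fo a (Idn ?y)" .
    have "A a (V a (cp a (FFE_incl i) v) (?A 0)) (V a (V a yF (cp a (FFE_incl i) v)) (?A (Suc 0))) =
      V a (V a (LW a [Ff i] (cp a (sigma i i) v)) (A a (V a (cp a (Cup i) (Ff i # v)) (cp a (CapInv i 0) (Ff i # v)))
       (V a (cp a (cup_dots i (Suc 0)) (Ff i # v)) (cp a (CapInv i (Suc 0)) (Ff i # v))))) (LW a [Ff i] (cp a (SInv i i) v))"
      unfolding FFE_incl_dot[symmetric] unfolding cp_FFE_incl by (simp add: V_A_left V_A_right V_assoc)
    also have "\<dots> = fo a (Idn ?z)"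
      unfolding FE_two[OF i v(1) v'(1) b'] using SS(2) by (simp add: V_id_right[OF ty_src[OF tsig]])
    finally show "A a (V a (cp a (FFE_incl i) v) (?A 0)) (V a (V a yF (cp a (FFE_incl i) v)) (?A (Suc 0))) = fo a (Idn ?z)" .
    show "V a (fo a (Idn ?z)) tauF = tauF" by (rule V_id_left[OF ty_tgt[OF tauF_rels(1)]])
    show "V a (fo a (Idn ?y)) (?A (Suc 0)) = ?A (Suc 0)" by (rule V_id_left) simp
  qed (use tauF_rels tA v v' i in \<open>auto intro: ty_Idn simp: FFE_incl_mate\<close>)
  show "V a FFE_proj (cp a (FFE_incl i) v) = fo a (Idn (Ff i # v))" "V a (cp a (FFE_incl i) v) FFE_proj = cp a (F_idem i 2) (Ee i # v)"
    using iso_left[OF tauF_rels(3,6)] unfolding FFE_proj_def tauF_rels(7) by simp_all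
qed

lemma has_deg_F_idem_2: "has_deg b (F_idem i 2) 0"
  by (simp add: F_idem_def E_idem_def numeral_2_eq_2)

lemma F2E_deg:
  assumes b: "act v a i = 1" "act v a (Suc i) = 1"
  shows "tyd a (Ff i # Ff i # Ee i # v) (Ff i # v) 1 FFE_proj" "tyd a (Ff i # v) (Ff i # Ff i # Ee i # v) (-1) (cp a (FFE_incl i) v)"
proof -
  have l: "lam (act v a) i = 0" using b by (simp add: lam_def)
  have W: "act w a \<in> Wts" if "okw w" for w using v that by simp
  have dF: "dom (F_idem i 2) = [Ff i, Ff i]" "cod (F_idem i 2) = [Ff i, Ff i]" "\<And>b. b \<in> Wts \<Longrightarrow> wfo b (F_idem i 2)"
    using dom_idem_letter[of "Fd i 2"] wfo_idem_letter[of "Fd i 2"] i by (auto simp: expand_2)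
  have "tyd a (Ff i # Ff i # Ee i # v) (Ff i # Ee i # Ff i # v) 0 (LW a [Ff i] (cp a (SInv i i) v))"
    using tyd_LW[OF tyd_cp[of v a "SInv i i" 0], of "[Ff i]"] v i by (simp add: wfo_gen)
  moreover have "tyd a (Ff i # Ee i # Ff i # v) (Ff i # v) 1 (cp a (CapInv i 0) (Ff i # v))"
    using tyd_cp[of "Ff i # v" a "CapInv i 0" 1] v i l W[of "Ff i # v"] by (simp add: wfo_gen)
  moreover have "tyd a (Ff i # Ff i # Ee i # v) (Ff i # Ff i # Ee i # v) 0 (cp a (F_idem i 2) (Ee i # v))"
    using tyd_cp[OF has_deg_F_idem_2, of "Ee i # v" a] v i W[of "Ee i # v"] by (simp add: dF)
  ultimately show "tyd a (Ff i # Ff i # Ee i # v) (Ff i # v) 1 FFE_proj"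
    unfolding FFE_proj_def using tyd_V[OF _ tyd_V] by fastforce
  have "has_deg (act v a) (FFE_incl i) (-1)"
    using l has_deg_sigma[of "act v a" i] by (auto simp: FFE_incl_def)
  moreover have "wfo (act v a) (FFE_incl i)" using v i W[of v] by (simp add: FFE_incl_def wfo_hor wfo_gen wfo_sigma)
  ultimately show "tyd a (Ff i # v) (Ff i # Ff i # Ee i # v) (-1) (cp a (FFE_incl i) v)"
    using tyd_cp[of v a "FFE_incl i" "-1"] v by simp
qed

text \<open>The counterpart of \<open>FFE_incl_mate\<close> for FEE: after \<sigma>, a cup to the
  right of E becomes a cup to its left followed by a crossing. Again one zigzag cancels.\<close>

lemma bend_E: "V a (cp a (sigma i i) (Ee i # v)) (LW a [Ee i] (cp a (Cup i) v)) =
    V a (LW a [Ff i] (cp a (Crs i i) v)) (cp a (Cup i) (Ee i # v))"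
proof -
  let ?S = "LW a [Ee i] (cp a (Cup i) v)" and ?E = "Ee i" and ?F = "Ff i"
  have s: "src a (?E # v) ?S" "tgt a (?E # ?F # ?E # v) ?S"
    by (rule src_LW[of _ v], simp_all) (rule tgt_LW[of _ "?F # ?E # v"], simp_all)
  have "V a (cp a (sigma i i) (?E # v)) ?S = V a (LW a [?F, ?E] (cp a (Cap i) (?E # v)))
    (V a (LW a [?F] (cp a (Crs i i) (?F # ?E # v))) (V a (cp a (Cup i) (?E # ?F # ?E # v)) ?S))"
    by (simp add: cp_sigma V_assoc)
  also have "V a (cp a (Cup i) (?E # ?F # ?E # v)) ?S = V a (LW a [?F, ?E] ?S) (cp a (Cup i) (?E # v))"
    using one.cu_nat[OF s] by simp
  also have "V a (LW a [?F, ?E] (cp a (Cap i) (?E # v))) (V a (LW a [?F] (cp a (Crs i i) (?F # ?E # v)))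
     (V a (LW a [?F, ?E] ?S) (cp a (Cup i) (?E # v)))) =
    V a (LW a [?F, ?E] (cp a (Cap i) (?E # v))) (V a (LW a [?F] (V a (cp a (Crs i i) (?F # ?E # v)) (LW a [?E, ?E] (cp a (Cup i) v))))
      (cp a (Cup i) (?E # v)))"
    by (simp add: V_assoc LW_V LW_LW)
  also have "V a (cp a (Crs i i) (?F # ?E # v)) (LW a [?E, ?E] (cp a (Cup i) v)) = V a (LW a [?E, ?E] (cp a (Cup i) v)) (cp a (Crs i i) v)"
    by (rule naturality) simp_all
  also have "V a (LW a [?F, ?E] (cp a (Cap i) (?E # v))) (V a (LW a [?F] (V a (LW a [?E, ?E] (cp a (Cup i) v)) (cp a (Crs i i) v)))
      (cp a (Cup i) (?E # v))) =
    V a (LW a [?F, ?E] (V a (cp a (Cap i) (?E # v)) (LW a [?E] (cp a (Cup i) v)))) (V a (LW a [?F] (cp a (Crs i i) v)) (cp a (Cup i) (?E # v)))"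
    by (simp add: V_assoc LW_V LW_LW)
  also have "\<dots> = V a (LW a [?F] (cp a (Crs i i) v)) (cp a (Cup i) (?E # v))"
  proof -
    have "tgt a (?F # ?E # ?E # v) (LW a [?F] (cp a (Crs i i) v))" by (rule tgt_LW[of _ "?E # ?E # v"]) simp_all
    then show ?thesis using one.zig_B[of a v] v by (simp add: LW_Idn V_id_left)
  qed
  finally show ?thesis .
qed

lemma bend_E_dot: "V a (cp a (sigma i i) (Ee i # v)) (LW a [Ee i] (cp a (cup_dots i (Suc 0)) v)) =
    V a (LW a [Ff i, Ee i] (cp a (Dot i) v)) (V a (LW a [Ff i] (cp a (Crs i i) v)) (cp a (Cup i) (Ee i # v)))"
proof -
  have "V a (cp a (sigma i i) (Ee i # v)) (LW a [Ee i] (cp a (cup_dots i (Suc 0)) v)) =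
    V a (V a (cp a (sigma i i) (Ee i # v)) (LW a [Ee i, Ff i] (cp a (Dot i) v))) (LW a [Ee i] (cp a (Cup i) v))"
    by (simp add: cup_dots_1 LW_V LW_LW V_assoc)
  also have "V a (cp a (sigma i i) (Ee i # v)) (LW a [Ee i, Ff i] (cp a (Dot i) v)) =
    V a (LW a [Ff i, Ee i] (cp a (Dot i) v)) (cp a (sigma i i) (Ee i # v))"
    by (rule naturality) simp_all
  finally show ?thesis by (simp add: V_assoc bend_E)
qed

end

section \<open>Decompositions with divided squares\<close>

lemma dec_F2E:
  assumes i: "1 \<le> i" and a: "a \<in> Wts" and b: "a i = 1" "a (Suc i) = 1"
  shows "dec a [Fd i 2, Ed i 1] [(1, [Fd i 1])]"
  by (rule dec_iso_Idn[where \<alpha> = "FFE_proj a i []" and \<beta> = "cp a (FFE_incl i) []"])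
    (use i a b F2E_iso[OF i a, of "[]"] F2E_deg[OF i a, of "[]"] ip_words(2,6)[OF i i a] in \<open>simp_all add: expand_2\<close>)

text \<open>The right-hand E leads from the entries 0, 2 to 1, 1, where F commutes with the other E.
  So FEE = EFE, and this is two copies of E because FE is two units at 0, 2. The roles of \<tau>, X
  and w are played by the crossing and the dots of the two letters E.\<close>

lemma dec_FE2:
  assumes i: "1 \<le> i" and a: "a \<in> Wts" and b: "a i = 0" "a (Suc i) = 2"
  shows "dec a [Fd i 1, Ed i 2] [(-1, [Ed i 1])]"
proof -
  let ?z = "[Ff i, Ee i, Ee i]" and ?y = "[Ee i]"
  have l: "lam a i = -2" "lam (act [Ee i] a) i = 0" using b by (simp_all add: lam_def) (simp add: act_Cons eps_def)
  have v: "okw [Ee i]" "okw []" "wfo a (Idn [Ee i])" "wfo a (Idn [])" using i a by auto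
  have W: "act w a \<in> Wts" if "okw w" for w using a that by simp
  have W1: "act [Ee i] a \<in> Wts" using W v by blast
  let ?A = "\<lambda>r. V a (LW a [Ee i] (cp a (CapInv i r) [])) (cp a (SInv i i) [Ee i])"
  let ?\<tau> = "LW a [Ff i] (cp a (Crs i i) [])" and ?X = "LW a [Ff i] (LW a [Ee i] (cp a (Dot i) []))"
    and ?w = "LW a [Ff i] (cp a (Dot i) [Ee i])" and ?C = "cp a (Cup i) [Ee i]"
  have tS: "ty a ?z [Ee i, Ff i, Ee i] (cp a (SInv i i) [Ee i])"
    using ty_cp[of "[Ee i]" a "SInv i i"] v i W1 a by (simp add: wfo_gen)
  have tsig: "ty a [Ee i, Ff i, Ee i] ?z (cp a (sigma i i) [Ee i])"
    using ty_cp[of "[Ee i]" a "sigma i i"] v i W1 a by (simp add: wfo_sigma)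
  have tC: "ty a [Ee i, Ff i, Ee i] ?y (LW a [Ee i] (cp a (CapInv i r) []))" if "r < 2" for r
    using ty_LW[OF ty_cp[of "[]" a "CapInv i r"], of "[Ee i]"] a l i that by (simp add: wfo_gen)
  have tA: "ty a ?z ?y (?A r)" if "r < 2" for r by (rule ty_V[OF tS tC[OF that]])
  have t: "ty a ?z ?z ?\<tau>" "ty a ?z ?z ?X" "ty a ?z ?z ?w"
    using ty_LW[OF ty_tau[OF i v(4)], of "[Ff i]"] ty_LW[OF ty_x2[OF i v(4)], of "[Ff i]"] ty_LW[OF ty_x1[OF i v(4)], of "[Ff i]"] i
    by simp_all
  have tc: "ty a ?y ?z ?C" using ty_cp[of "[Ee i]" a "Cup i"] v i W1 a by (simp add: wfo_gen)
  have SS: "V a (cp a (SInv i i) [Ee i]) (cp a (sigma i i) [Ee i]) = fo a (Idn [Ee i, Ff i, Ee i])"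
    "V a (cp a (sigma i i) [Ee i]) (cp a (SInv i i) [Ee i]) = fo a (Idn ?z)"
    using SInv_sigma[OF i a v(1)] sigma_SInv[OF i a v(1)] l by simp_all
  note bE = bend_E[OF i a v(2)] bend_E_dot[OF i a v(2)]
  have \<tau>x: "V a ?\<tau> (V a ?w ?\<tau>) = ?\<tau>" using tau_x1_tau[OF i v(4)] by (simp add: LW_V[symmetric])
  interpret split_half a ?z ?y ?\<tau> ?X ?C "?A 0" "?A (Suc 0)" "V a ?\<tau> ?C" "fo a (Idn ?z)" "fo a (Idn ?y)"
  proof
    show "V a ?\<tau> ?\<tau> = fo a (Nul ?z ?z)"
      using tau_tau[OF i v(4)] LW_Nul[of "[Ff i]" a "[Ee i, Ee i]" "[Ee i, Ee i]"] i a by (simp add: LW_V[symmetric])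
    show "V a ?\<tau> (V a ?X ?\<tau>) = Sc a (-1) ?\<tau>" using tau_x2_tau[OF i v(4)] by (simp add: LW_V[symmetric] LW_Sc)
    have "V a (?A 0) (V a ?\<tau> ?C) = V a (LW a [Ee i] (cp a (CapInv i 0) [])) (V a (V a (cp a (SInv i i) [Ee i])
       (cp a (sigma i i) [Ee i])) (LW a [Ee i] (cp a (Cup i) [])))"
      unfolding bE(1)[symmetric] by (simp add: V_assoc)
    also have "\<dots> = LW a [Ee i] (V a (cp a (CapInv i 0) []) (cp a (cup_dots i 0) []))"
      using V_id_left[OF tgt_LW[of a "[Ff i, Ee i]" "cp a (Cup i) []" "[Ee i, Ff i, Ee i]" "[Ee i]"]] unfolding SS cup_dots_0 by (simp add: LW_V)
    also have "\<dots> = fo a (Idn ?y)"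
      using CapInv_cup[OF i a v(2), of 0 0] l by (simp add: LW_Idn)
    finally show "V a (?A 0) (V a ?\<tau> ?C) = fo a (Idn ?y)" .
    have "A a (V a (V a ?\<tau> ?C) (?A 0)) (V a (V a ?X (V a ?\<tau> ?C)) (?A (Suc 0))) =
      V a (V a (cp a (sigma i i) [Ee i]) (LW a [Ee i] (A a (V a (cp a (Cup i) []) (cp a (CapInv i 0) []))
       (V a (cp a (cup_dots i (Suc 0)) []) (cp a (CapInv i (Suc 0)) []))))) (cp a (SInv i i) [Ee i])"
      using bE by (simp add: LW_LW) (simp add: LW_A LW_V V_A_left V_A_right V_assoc[symmetric])
    also have "\<dots> = fo a (Idn ?z)"
      using FE_two[OF i a v(2)] b SS(2) by (simp add: LW_Idn V_id_right[OF ty_src[OF tsig]])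
    finally show "A a (V a (V a ?\<tau> ?C) (?A 0)) (V a (V a ?X (V a ?\<tau> ?C)) (?A (Suc 0))) = fo a (Idn ?z)" .
    show "V a (fo a (Idn ?z)) ?\<tau> = ?\<tau>" by (rule V_id_left[OF ty_tgt[OF t(1)]])
    show "V a (fo a (Idn ?y)) (?A (Suc 0)) = ?A (Suc 0)" by (rule V_id_left[OF ty_tgt[OF tA]]) simp
  qed (use t tA tc i a in \<open>auto intro: ty_Idn\<close>)
  have "has_deg a ((Idn [Ee i] \<otimes> (CapInv i 0 \<otimes> Idn [])) \<odot> (SInv i i \<otimes> Idn [Ee i])) 1" using l by simp
  then have d1: "tyd a ?z ?y 1 (?A 0)"
    unfolding cp_def LW_fo fo_ver[symmetric] by (rule tyd_fo[rotated 3]) (use i a l W1 in \<open>simp_all add: wfo_hor wfo_gen\<close>)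
  have d2: "tyd a ?z ?z (-2) ?\<tau>" "tyd a ?z ?z 2 ?w"
    using tyd_LW[OF tyd_cp[of "[]" a "Crs i i" "-2"], of "[Ff i]"] tyd_LW[OF tyd_cp[of "[Ee i]" a "Dot i" 2], of "[Ff i]"] i a W1
    by (simp_all add: wfo_gen)
  have d3: "tyd a ?y ?z 1 ?C" using tyd_cp[of "[Ee i]" a "Cup i" 1] i a l W1 by (simp add: wfo_gen)
  note r = iso_right[OF t(3) \<tau>x]
  show ?thesis
  proof (rule dec_iso_Idn)
    show "V a (V a (?A 0) ?\<tau>) (V a ?w (V a ?\<tau> ?C)) = fo a (Idn (expand [Ed i 1]))" using r by simp
    show "V a (V a ?w (V a ?\<tau> ?C)) (V a (?A 0) ?\<tau>) = ip a [Fd i 1, Ed i 2]"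
      using r E_idem_2[OF i v(4)] ip_words(5)[OF i i a] by (simp add: LW_V)
    show "tyd a (expand [Fd i 1, Ed i 2]) (expand [Ed i 1]) (-1) (V a (?A 0) ?\<tau>)"
      using tyd_V[OF d2(1) d1] by (simp add: expand_2)
    show "tyd a (expand [Ed i 1]) (expand [Fd i 1, Ed i 2]) (- (-1)) (V a ?w (V a ?\<tau> ?C))"
      using tyd_V[OF tyd_V[OF d3 d2(1)] d2(2)] by (simp add: expand_2)
  qed (use i a ip_words(1)[OF i i a] in simp_all)
qed

text \<open>The right-hand E leads to the entries 1, 1, where the divided square of F times E is F;
  what is left is FE at the entries 0, 2, which is two units. The crossing of the two E, restricted
  to the image of the idempotent of the two F, then picks out one unit.\<close>

lemma dec_F2E2:
  assumes i: "1 \<le> i" and a: "a \<in> Wts" and b: "a i = 0" "a (Suc i) = 2"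
  shows "dec a [Fd i 2, Ed i 2] [(0, [])]"
proof -
  interpret two: adjoint_words "[Ee i, Ee i]" "[Ff i, Ff i]" "cups i 2" "caps i 2" by (rule adjoint_words_2[OF i])
  let ?z = "[Ff i, Ff i, Ee i, Ee i]"
  have l: "lam a i = -2" using b by (simp add: lam_def)
  have v: "okw [Ee i]" "okw []" "wfo a (Idn [])" "wfo a (Idn [Ee i, Ee i])" using i a by auto
  have W: "act w a \<in> Wts" if "okw w" for w using a that by simp
  have b': "act [Ee i] a i = 1" "act [Ee i] a (Suc i) = 1" using b by (simp_all add: act_Cons eps_def)
  let ?e = "cp a (F_idem i 2) [Ee i, Ee i]" and ?FFE_proj = "FFE_proj a i [Ee i]" and ?FFE_incl = "cp a (FFE_incl i) [Ee i]"
  let ?T = "LW a [Ff i, Ff i] (cp a (Crs i i) [])" and ?X = "LW a [Ff i, Ff i] (LW a [Ee i] (cp a (Dot i) []))"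
    and ?w = "LW a [Ff i, Ff i] (cp a (Dot i) [Ee i])" and ?C = "cp a (cups i 2) []"
  let ?\<tau> = "V a ?e ?T" and ?A = "\<lambda>r. V a (cp a (CapInv i r) []) ?FFE_proj" and ?B0 = "V a ?FFE_incl (cp a (Cup i) [])"
  note iso = F2E_iso[OF i a v(1) b'] and deg = F2E_deg[OF i a v(1) b']
  have d4: "ty a ?z [Ff i, Ee i] ?FFE_proj" "ty a [Ff i, Ee i] ?z ?FFE_incl" using deg tyd_ty by blast+
  have c4: "cls a ?FFE_proj" using d4 ty_cls by blast
  have dF: "dom (F_idem i 2) = [Ff i, Ff i]" "cod (F_idem i 2) = [Ff i, Ff i]" "\<And>b. b \<in> Wts \<Longrightarrow> wfo b (F_idem i 2)"
    using dom_idem_letter[of "Fd i 2"] wfo_idem_letter[of "Fd i 2"] i by (auto simp: expand_2)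
  have de: "tyd a ?z ?z 0 ?e"
    using tyd_cp[of "[Ee i, Ee i]" a "F_idem i 2" 0] has_deg_F_idem_2 v i a W[of "[Ee i, Ee i]"] by (simp add: dF)
  note te = tyd_ty[OF de]
  have tT: "ty a ?z ?z ?T" "ty a ?z ?z ?X" "ty a ?z ?z ?w"
    using ty_LW[OF ty_tau[OF i v(3)], of "[Ff i, Ff i]"] ty_LW[OF ty_x2[OF i v(3)], of "[Ff i, Ff i]"]
      ty_LW[OF ty_x1[OF i v(3)], of "[Ff i, Ff i]"] i by simp_all
  have ee: "V a ?e ?e = ?e" using F_idem_2_idem[OF i v(4)] by (simp add: cp_ver)
  \<comment> \<open>Maps on the letters E commute with the idempotent on the letters F, as they act
    on different strands.\<close>
  have sl: "V a ?e (LW a [Ff i, Ff i] S) = V a (LW a [Ff i, Ff i] S) ?e"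
    if "src a [Ee i, Ee i] S" "tgt a [Ee i, Ee i] S" for S
    by (rule naturality[OF that dF(1,2)])
  have s2: "src a [Ee i, Ee i] (LW a [Ee i] (cp a (Dot i) []))" "tgt a [Ee i, Ee i] (LW a [Ee i] (cp a (Dot i) []))"
    by (rule src_LW[of _ "[Ee i]"], simp_all) (rule tgt_LW[of _ "[Ee i]"], simp_all)
  note slT = sl[of "cp a (Crs i i) []"] and slX = sl[OF s2] and slw = sl[of "cp a (Dot i) [Ee i]"]
  have eTe: "V a ?T ?e = V a ?e ?T" "V a ?X ?e = V a ?e ?X" "V a ?w ?e = V a ?e ?w"
    using slT slX slw by simp_all
  have eTe': "V a ?T (V a ?e S) = V a ?e (V a ?T S)" "V a ?X (V a ?e S) = V a ?e (V a ?X S)"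
    "V a ?w (V a ?e S) = V a ?e (V a ?w S)" "V a ?e (V a ?e S) = V a ?e S" if "cls a S" for S
    using that by (simp_all add: V_assoc[symmetric] eTe ee del: cls_V) 
  \<comment> \<open>The crossing slides along the nested cups to the two F, where it is its mate;
    this is the expression that \<open>FFE_incl_mate\<close> recognises.\<close>
  have cups: "V a ?T ?C = ?B0"
  proof -
    have "V a ?T ?C = V a (cp a (two.mt (Crs i i)) [Ee i, Ee i]) ?C"
      using two.mate_cup[OF v(3), of "Crs i i"] by simp
    also have "\<dots> = ?B0"
      using FFE_incl_mate[OF i a v(1)] cp_cups2[OF i a v(1), of "[]"] by (simp add: V_assoc)
    finally show ?thesis .
  qed
  have eb: "V a ?e ?FFE_incl = ?FFE_incl"
    using iso V_assoc[of a ?FFE_incl ?FFE_proj ?FFE_incl] V_id_right[OF ty_src[OF d4(2)]] c4 by simp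
  have ae: "V a ?FFE_proj ?e = ?FFE_proj"
    using iso V_assoc[of a ?FFE_proj ?FFE_incl ?FFE_proj] V_id_left[OF ty_tgt[OF d4(1)]] c4 by simp
  have TT: "V a ?T ?T = fo a (Nul ?z ?z)"
    using tau_tau[OF i v(3)] LW_Nul[of "[Ff i, Ff i]" a "[Ee i, Ee i]" "[Ee i, Ee i]"] i a by (simp add: LW_V[symmetric])
  have TXT: "V a ?T (V a ?X ?T) = Sc a (-1) ?T" using tau_x2_tau[OF i v(3)] by (simp add: LW_V[symmetric] LW_Sc)
  have TwT: "V a ?T (V a ?w ?T) = ?T" using tau_x1_tau[OF i v(3)] by (simp add: LW_V[symmetric])
  have tcap: "ty a [Ff i, Ee i] [] (cp a (CapInv i r) [])" if "r < 2" for r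
    using ty_cp[of "[]" a "CapInv i r"] a l i that by (simp add: wfo_gen)
  have tA: "ty a ?z [] (?A r)" if "r < 2" for r by (rule ty_V[OF d4(1) tcap[OF that]])
  have tC: "ty a [] ?z ?C" using ty_cp[of "[]" a "cups i 2"] a i by (simp add: wfo_cups expand_2)
  have t\<tau>: "ty a ?z ?z ?\<tau>" by (rule ty_V[OF tT(1) te])
  have Xb: "V a ?X ?B0 = V a ?FFE_incl (cp a (cup_dots i (Suc 0)) [])"
  proof -
    have "V a ?FFE_incl (LW a [Ff i] (cp a (Dot i) [])) = V a (LW a [Ff i, Ff i, Ee i] (cp a (Dot i) [])) ?FFE_incl"
      by (rule naturality) simp_all
    then show ?thesis by (simp add: cup_dots_1 LW_LW V_assoc[symmetric])
  qed
  have \<tau>w: "V a ?\<tau> (V a ?w ?\<tau>) = ?\<tau>" by (simp add: V_assoc eTe' TwT)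
  interpret split_half a ?z "[]" ?\<tau> ?X ?C "?A 0" "?A (Suc 0)" ?B0 ?e "fo a (Idn [])"
  proof
    show "?B0 = V a ?\<tau> ?C" using eb by (simp add: V_assoc cups) (simp add: V_assoc[symmetric])
    have "V a ?e (fo a (Nul ?z ?z)) = fo a (Nul ?z ?z)" by (rule ty_V_Nul_right[OF te]) (use i in auto)
    then show "V a ?\<tau> ?\<tau> = fo a (Nul ?z ?z)" by (simp add: V_assoc eTe' TT)
    show "V a ?\<tau> (V a ?X ?\<tau>) = Sc a (-1) ?\<tau>" by (simp add: V_assoc eTe' TXT V_Sc_right)
    show "V a ?e ?\<tau> = ?\<tau>" by (simp add: eTe')
    show "V a (fo a (Idn [])) (?A (Suc 0)) = ?A (Suc 0)" by (rule V_id_left[OF ty_tgt[OF tA]]) simp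
    have "V a (?A 0) ?B0 = V a (cp a (CapInv i 0) []) (V a (V a ?FFE_proj ?FFE_incl) (cp a (Cup i) []))"
      using c4 by (simp add: V_assoc)
    also have "\<dots> = fo a (Idn [])"
      using CapInv_cup[OF i a v(2), of 0 0] l by (simp add: iso V_id_left cup_dots_0)
    finally show "V a (?A 0) ?B0 = fo a (Idn [])" .
    have "A a (V a ?B0 (?A 0)) (V a (V a ?X ?B0) (?A (Suc 0))) = V a (V a ?FFE_incl (A a (V a (cp a (Cup i) []) (cp a (CapInv i 0) []))
       (V a (cp a (cup_dots i (Suc 0)) []) (cp a (CapInv i (Suc 0)) [])))) ?FFE_proj"
      unfolding Xb using c4 by (simp add: V_A_left V_A_right V_assoc)
    also have "\<dots> = ?e" using FE_two[OF i a v(2)] b by (simp add: iso V_id_right)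
    finally show "A a (V a ?B0 (?A 0)) (V a (V a ?X ?B0) (?A (Suc 0))) = ?e" .
  qed (use t\<tau> tT tA tC te a in \<open>auto intro: ty_Idn\<close>)
  note r = iso_right[OF tT(3) \<tau>w]
  have d\<tau>: "tyd a ?z ?z (-2) ?\<tau>"
    using tyd_V[OF tyd_LW[OF tyd_cp[of "[]" a "Crs i i" "-2"], of "[Ff i, Ff i]"] , of ?z 0 ?e] de i a by (simp add: wfo_gen)
  have dw: "tyd a ?z ?z 2 ?w"
    using tyd_LW[OF tyd_cp[of "[Ee i]" a "Dot i" 2], of "[Ff i, Ff i]"] i a W[of "[Ee i]"] by (simp add: wfo_gen)
  have dA: "tyd a ?z [] 2 (?A 0)"
    using tyd_V[OF deg(1) , of "[]" 1 "cp a (CapInv i 0) []"] tyd_cp[of "[]" a "CapInv i 0" 1] i a l by (simp add: wfo_gen)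
  have dB: "tyd a [] ?z (-2) ?B0"
    using tyd_V[OF _ deg(2), of "[]" "-1" "cp a (Cup i) []"] tyd_cp[of "[]" a "Cup i" "-1"] i a l by (simp add: wfo_gen)
  show ?thesis
  proof (rule dec_iso_Idn)
    show "V a (V a (?A 0) ?\<tau>) (V a ?w ?B0) = fo a (Idn (expand []))" using r by simp
    show "V a (V a ?w ?B0) (V a (?A 0) ?\<tau>) = ip a [Fd i 2, Ed i 2]"
      using r E_idem_2[OF i v(3)] ip_words(7)[OF i i a] by (simp add: LW_V eTe')
    show "tyd a (expand [Fd i 2, Ed i 2]) (expand []) 0 (V a (?A 0) ?\<tau>)"
      using tyd_V[OF d\<tau> dA] by (simp add: expand_2)
    show "tyd a (expand []) (expand [Fd i 2, Ed i 2]) (- 0) (V a ?w ?B0)"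
      using tyd_V[OF dB dw] by (simp add: expand_2)
  qed (use i a in simp_all)
qed

section \<open>Commuting different letters\<close>

context adjoint_words
begin

text \<open>Bending the strands \<open>Bs\<close> down with a cap is undone by a cup, by the
  triangle identity. So maps may be compared after bending.\<close>

lemma unbend_inj:
  assumes X: "src a z X" "tgt a (Bs @ y) X" and Y: "src a z Y" "tgt a (Bs @ y) Y" and y: "wfo a (Idn y)"
    and eq: "V a (cp a ca y) (LW a B X) = V a (cp a ca y) (LW a B Y)"
  shows "X = Y"
proof -
  have *: "X = V a (LW a Bs (V a (cp a ca y) (LW a B X))) (cp a cu z)" if X: "src a z X" "tgt a (Bs @ y) X" for X
  proof -
    note c = src_cls[OF X(1)]
    have "V a (LW a Bs (V a (cp a ca y) (LW a B X))) (cp a cu z) =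
      V a (LW a Bs (cp a ca y)) (V a (LW a (Bs @ B) X) (cp a cu z))"
      using c by (simp add: LW_V LW_LW V_assoc)
    also have "\<dots> = V a (V a (LW a Bs (cp a ca y)) (cp a cu (Bs @ y))) X"
      using c cu_nat[OF X] by (simp add: V_assoc)
    finally show ?thesis using zig_Bs[OF y] V_id_left[OF X(2)] by simp
  qed
  show ?thesis using *[OF X] *[OF Y] eq by simp
qed

text \<open>\<open>X\<close> is the rotation of \<open>R : B A \<rightarrow> A B\<close> to a map \<open>A B* \<rightarrow> B* A\<close>. Passing to rotations
  preserves the property of sliding through endomorphisms.\<close>

definition bent :: "weight \<Rightarrow> word \<Rightarrow> dgm \<Rightarrow> word \<Rightarrow> foam \<Rightarrow> bool" where
  "bent a W R v X \<longleftrightarrow> dom R = B @ W \<and> cod R = W @ B \<and> src a (W @ Bs @ v) X \<and> tgt a (Bs @ W @ v) X \<and>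
     V a (cp a ca (W @ v)) (LW a B X) = V a (LW a W (cp a ca v)) (cp a R (Bs @ v))"

text \<open>After bending, s meets R instead of X and the hypothesis applies. Naturality of the cap
  then takes s out on the other side.\<close>

lemma bent_slide_left:
  assumes X: "bent a W R v X" and v: "wfo a (Idn (W @ v))" and s: "dom s = W" "cod s = W"
    and slide: "V a (cp a R (Bs @ v)) (LW a B (cp a s (Bs @ v))) = V a (cp a s (B @ Bs @ v)) (cp a R (Bs @ v))"
  shows "V a X (cp a s (Bs @ v)) = V a (LW a Bs (cp a s v)) X"
proof (rule unbend_inj[OF _ _ _ _ v])
  have R: "dom R = B @ W" "cod R = W @ B" and X': "src a (W @ Bs @ v) X" "tgt a (Bs @ W @ v) X"
    and eq: "V a (cp a ca (W @ v)) (LW a B X) = V a (LW a W (cp a ca v)) (cp a R (Bs @ v))"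
    using X by (auto simp: bent_def)
  note c = src_cls[OF X'(1)]
  show "src a (W @ Bs @ v) (V a X (cp a s (Bs @ v)))" "tgt a (Bs @ W @ v) (V a X (cp a s (Bs @ v)))"
    "src a (W @ Bs @ v) (V a (LW a Bs (cp a s v)) X)" 
    using c X' s by simp_all
  show "tgt a (Bs @ W @ v) (V a (LW a Bs (cp a s v)) X)"
    using c tgt_LW[of a "W @ v" "cp a s v" _ Bs] s by simp
  have n: "V a (cp a s v) (LW a W (cp a ca v)) = V a (LW a W (cp a ca v)) (cp a s (B @ Bs @ v))"
    by (rule naturality[of a "B @ Bs @ v" _ v]) (simp_all add: s dc)
  have "V a (cp a ca (W @ v)) (LW a B (V a X (cp a s (Bs @ v)))) =
    V a (V a (cp a ca (W @ v)) (LW a B X)) (LW a B (cp a s (Bs @ v)))"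
    using c by (simp add: LW_V V_assoc)
  also have "\<dots> = V a (V a (LW a W (cp a ca v)) (cp a s (B @ Bs @ v))) (cp a R (Bs @ v))"
    unfolding eq using slide by (simp add: V_assoc)
  also have "\<dots> = V a (cp a s v) (V a (cp a ca (W @ v)) (LW a B X))"
    unfolding n[symmetric] eq by (simp add: V_assoc)
  also have "\<dots> = V a (V a (cp a ca (W @ v)) (LW a (B @ Bs) (cp a s v))) (LW a B X)"
    using c ca_nat[of a "W @ v" "cp a s v" "W @ v"] s by (simp add: V_assoc)
  finally show "V a (cp a ca (W @ v)) (LW a B (V a X (cp a s (Bs @ v)))) = V a (cp a ca (W @ v)) (LW a B (V a (LW a Bs (cp a s v)) X))"
    using c by (simp add: LW_V LW_LW V_assoc)
qed

text \<open>At the cap the mate is exchanged for t on the straight strand, slides past R, and is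
  turned back into a mate by a second use of \<open>mate_cap\<close>.\<close>

lemma bent_slide_right:
  assumes X: "bent a W R v X" and v: "wfo a (Idn v)" "wfo a (Idn (W @ v))" and t: "dom t = B" "cod t = B"
    and slide: "V a (cp a R (Bs @ v)) (cp a t (W @ Bs @ v)) = V a (LW a W (cp a t (Bs @ v))) (cp a R (Bs @ v))"
  shows "V a X (LW a W (cp a (mt t) v)) = V a (cp a (mt t) (W @ v)) X"
proof (rule unbend_inj[OF _ _ _ _ v(2)])
  have R: "dom R = B @ W" "cod R = W @ B" and X': "src a (W @ Bs @ v) X" "tgt a (Bs @ W @ v) X"
    and eq: "V a (cp a ca (W @ v)) (LW a B X) = V a (LW a W (cp a ca v)) (cp a R (Bs @ v))"
    using X by (auto simp: bent_def)
  note c = src_cls[OF X'(1)]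
  have m: "dom (mt t) = Bs" "cod (mt t) = Bs" by (simp_all add: mate_def dc)
  show "src a (W @ Bs @ v) (V a X (LW a W (cp a (mt t) v)))"
    using c src_LW[of a "Bs @ v" "cp a (mt t) v" _ W] m by simp
  show "tgt a (Bs @ W @ v) (V a X (LW a W (cp a (mt t) v)))" "src a (W @ Bs @ v) (V a (cp a (mt t) (W @ v)) X)" 
    "tgt a (Bs @ W @ v) (V a (cp a (mt t) (W @ v)) X)"
    using c X' m by simp_all
  have n: "V a (cp a R (Bs @ v)) (LW a (B @ W) (cp a (mt t) v)) = V a (LW a (W @ B) (cp a (mt t) v)) (cp a R (Bs @ v))"
    by (rule naturality) (simp_all add: m R)
  have n': "V a (cp a t (Bs @ W @ v)) (LW a B X) = V a (LW a B X) (cp a t (W @ Bs @ v))"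
    by (rule naturality[OF X' t])
  have "V a (cp a ca (W @ v)) (LW a B (V a X (LW a W (cp a (mt t) v)))) =
    V a (V a (cp a ca (W @ v)) (LW a B X)) (LW a (B @ W) (cp a (mt t) v))"
    using c by (simp add: LW_V LW_LW V_assoc)
  also have "\<dots> = V a (LW a W (V a (cp a ca v) (LW a B (cp a (mt t) v)))) (cp a R (Bs @ v))"
    unfolding eq using n by (simp add: V_assoc LW_V LW_LW)
  also have "\<dots> = V a (LW a W (cp a ca v)) (V a (cp a R (Bs @ v)) (cp a t (W @ Bs @ v)))"
    unfolding mate_cap[OF v(1) t] slide by (simp add: V_assoc LW_V)
  also have "\<dots> = V a (V a (cp a ca (W @ v)) (LW a B X)) (cp a t (W @ Bs @ v))"
    unfolding eq by (simp add: V_assoc)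
  also have "\<dots> = V a (V a (cp a ca (W @ v)) (cp a t (Bs @ W @ v))) (LW a B X)"
    using c n' by (simp add: V_assoc)
  also have "\<dots> = V a (V a (cp a ca (W @ v)) (LW a B (cp a (mt t) (W @ v)))) (LW a B X)"
    unfolding mate_cap[OF v(2) t] ..
  finally show "V a (cp a ca (W @ v)) (LW a B (V a X (LW a W (cp a (mt t) v)))) =
      V a (cp a ca (W @ v)) (LW a B (V a (cp a (mt t) (W @ v)) X))"
    using c by (simp add: LW_V V_assoc)
qed

end

lemma cp_caps_2: "cp a (caps i 2) v = V a (cp a (Cap i) v) (LW a [Ee i] (cp a (Cap i) (Ff i # v)))"
  by (simp add: numeral_2_eq_2 cp_simps LW_simps V_id_left V_id_right)

section \<open>Exchanging E and F of different indices\<close>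

context
  fixes a :: weight and i j :: nat
  assumes ij: "i \<noteq> j" and i: "1 \<le> i" and j: "1 \<le> j" and a: "a \<in> Wts"
begin

interpretation one: adjoint_words "[Ee j]" "[Ff j]" "Cup j" "Cap j" by (rule adjoint_words_1[OF j])
interpretation two: adjoint_words "[Ee j, Ee j]" "[Ff j, Ff j]" "cups j 2" "caps j 2" by (rule adjoint_words_2[OF j])

definition "sg v = cp a (sigma i j) v"
definition "sv v = cp a (SInv i j) v"
text \<open>The two digits count the letters F and the letters E that are exchanged.\<close>

definition "sg12 v = V a (sg (Ee i # v)) (LW a [Ee i] (sg v))"
definition "sg21 v = V a (LW a [Ff j] (sg v)) (sg (Ff j # v))"
definition "sg22 v = V a (LW a [Ff j] (sg12 v)) (sg12 (Ff j # v))"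

lemma ty_sg: "okw v \<Longrightarrow> tyd a (Ee i # Ff j # v) (Ff j # Ee i # v) 0 (sg v)"
  "okw v \<Longrightarrow> tyd a (Ff j # Ee i # v) (Ee i # Ff j # v) 0 (sv v)"
proof -
  assume v: "okw v"
  let ?b = "act v a"
  \<comment> \<open>The letter F lowers \<lambda> at j by 2 and E lowers it by 1 for neighbouring
    indices. The second change compensates the degree of the crossing, the first one the two
    constants 1 in the degrees of cup and cap.\<close>
  have "lam (act [Ee i, Ff j] ?b) j = lam ?b j - 2 - (if adj j i then 1 else 0)"
    using ij by (auto simp: lam_def act_Cons eps_def adj_def)
  then have "has_deg ?b (sigma i j) 0"
    using ij by (auto simp: sigma_def)
  then show "tyd a (Ee i # Ff j # v) (Ff j # Ee i # v) 0 (sg v)"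
    using tyd_cp[of v a "sigma i j" 0] v i j a by (simp add: wfo_sigma sg_def)
  show "tyd a (Ff j # Ee i # v) (Ee i # Ff j # v) 0 (sv v)"
    using tyd_cp[of v a "SInv i j" 0] v i j a by (simp add: wfo_gen sv_def)
qed

lemma st_sg [simp]: "w = Ee i # Ff j # v \<Longrightarrow> src a w (sg v)" "w = Ff j # Ee i # v \<Longrightarrow> tgt a w (sg v)" "cls a (sg v)"
  "w = Ff j # Ee i # v \<Longrightarrow> src a w (sv v)" "w = Ee i # Ff j # v \<Longrightarrow> tgt a w (sv v)" "cls a (sv v)"
  by (simp_all add: sg_def sv_def)

lemma sg_sv: "okw v \<Longrightarrow> V a (sg v) (sv v) = fo a (Idn (Ff j # Ee i # v))"
  "okw v \<Longrightarrow> V a (sv v) (sg v) = fo a (Idn (Ee i # Ff j # v))"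
  unfolding sg_def sv_def cp_ver[symmetric]
  using cp_cong[OF fo_rel[OF rel.iso_mixed_right[OF ij, of "act v a"]]] cp_cong[OF fo_rel[OF rel.iso_mixed_left[OF ij, of "act v a"]]] a i j
  by (simp_all add: cp_Idn wfo_sigma wfo_gen)

text \<open>\<sigma> is the crossing with one strand bent up by a cup; bending it down again leaves
  a zigzag to be straightened.\<close>

lemma bent_sg: "okw v \<Longrightarrow> one.bent a [Ee i] (Crs j i) v (sg v)"
proof -
  assume v: "okw v"
  let ?Y = "V a (LW a [Ee i] (cp a (Cap j) v)) (cp a (Crs j i) (Ff j # v))"
  have s: "src a (Ee j # Ee i # Ff j # v) ?Y" by simp
  have t: "tgt a (Ee i # v) ?Y" by (rule tgt_V[OF tgt_LW[of a v]]) simp_all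
  have v': "wfo a (Idn (Ee i # Ff j # v))" using v i j a by simp
  have "sg v = V a (LW a [Ff j] ?Y) (cp a (Cup j) (Ee i # Ff j # v))"
    by (simp add: sg_def cp_sigma LW_V LW_LW V_assoc)
  then have "V a (cp a (Cap j) (Ee i # v)) (LW a [Ee j] (sg v)) =
    V a (V a (cp a (Cap j) (Ee i # v)) (LW a [Ee j, Ff j] ?Y)) (LW a [Ee j] (cp a (Cup j) (Ee i # Ff j # v)))"
    by (simp add: LW_V LW_LW V_assoc)
  also have "\<dots> = ?Y"
    using one.ca_nat[OF s t] one.zig_B[OF v'] V_id_right[OF s] by (simp add: V_assoc)
  finally show ?thesis using v i j a by (simp add: one.bent_def)
qed

lemma unbend_sg: "okw v \<Longrightarrow> V a (cp a (Cap j) (Ee i # v)) (LW a [Ee j] (sg v)) = 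
    V a (LW a [Ee i] (cp a (Cap j) v)) (cp a (Crs j i) (Ff j # v))"
  using bent_sg by (simp add: one.bent_def)

lemma st_sg12: "src a (Ee i # Ee i # Ff j # v) (sg12 v)" "tgt a (Ff j # Ee i # Ee i # v) (sg12 v)" "cls a (sg12 v)"
  unfolding sg12_def by (rule src_V[OF _ src_LW[of a "Ee i # Ff j # v"]], simp_all)

text \<open>Rotations compose: the cap is pushed through the elementary exchanges one at a time, and
  each leaves a crossing behind.\<close>

lemma bent_sg12:
  assumes v: "okw v"
  shows "one.bent a [Ee i, Ee i] ((Idn [Ee i] \<otimes> Crs j i) \<odot> (Crs j i \<otimes> Idn [Ee i])) v (sg12 v)"
proof -
  have o: "okw (Ee i # v)" using v i by simp
  have n: "V a (cp a (Crs j i) (Ff j # Ee i # v)) (LW a [Ee j, Ee i] (sg v)) =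
    V a (LW a [Ee i, Ee j] (sg v)) (cp a (Crs j i) (Ee i # Ff j # v))"
    by (rule naturality) simp_all
  have "V a (cp a (Cap j) (Ee i # Ee i # v)) (LW a [Ee j] (sg12 v)) =
    V a (V a (cp a (Cap j) (Ee i # Ee i # v)) (LW a [Ee j] (sg (Ee i # v)))) (LW a [Ee j, Ee i] (sg v))"
    by (simp add: sg12_def LW_V LW_LW V_assoc)
  also have "\<dots> = V a (LW a [Ee i] (V a (cp a (Cap j) (Ee i # v)) (LW a [Ee j] (sg v)))) (cp a (Crs j i) (Ee i # Ff j # v))"
    unfolding unbend_sg[OF o] by (simp add: LW_V LW_LW V_assoc n)
  also have "\<dots> = V a (LW a [Ee i, Ee i] (cp a (Cap j) v))
     (V a (LW a [Ee i] (cp a (Crs j i) (Ff j # v))) (cp a (Crs j i) (Ee i # Ff j # v)))"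
    unfolding unbend_sg[OF v] by (simp add: LW_V LW_LW V_assoc)
  finally show ?thesis using st_sg12 by (simp add: one.bent_def cp_simps)
qed

lemma st_sg21: "src a (Ee i # Ff j # Ff j # v) (sg21 v)" "tgt a (Ff j # Ff j # Ee i # v) (sg21 v)" "cls a (sg21 v)"
  unfolding sg21_def using tgt_V[OF tgt_LW[of a "Ff j # Ee i # v" "sg v" _ "[Ff j]"]] by simp_all

lemma bent_sg21:
  assumes v: "okw v"
  shows "two.bent a [Ee i] ((Crs j i \<otimes> Idn [Ee j]) \<odot> (Idn [Ee j] \<otimes> Crs j i)) v (sg21 v)"
proof -
  have o: "okw (Ff j # v)" using v j by simp
  have n: "V a (cp a (Cap j) (Ff j # Ee i # v)) (LW a [Ee j, Ff j] (sg v)) = V a (sg v) (cp a (Cap j) (Ee i # Ff j # v))"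
    using one.ca_nat[of a "Ee i # Ff j # v" "sg v" "Ff j # Ee i # v"] by simp
  have n': "V a (cp a (Crs j i) (Ff j # v)) (LW a [Ee j, Ee i] (cp a (Cap j) (Ff j # v))) =
    V a (LW a [Ee i, Ee j] (cp a (Cap j) (Ff j # v))) (cp a (Crs j i) (Ee j # Ff j # Ff j # v))"
    by (rule naturality) simp_all
  have "V a (cp a (caps j 2) (Ee i # v)) (LW a [Ee j, Ee j] (sg21 v)) =
    V a (cp a (Cap j) (Ee i # v)) (LW a [Ee j] (V a (V a (cp a (Cap j) (Ff j # Ee i # v)) (LW a [Ee j, Ff j] (sg v))) (LW a [Ee j] (sg (Ff j # v)))))"
    by (simp add: sg21_def cp_caps_2 LW_V LW_LW V_assoc)
  also have "\<dots> = V a (V a (cp a (Cap j) (Ee i # v)) (LW a [Ee j] (sg v)))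
     (LW a [Ee j] (V a (cp a (Cap j) (Ee i # Ff j # v)) (LW a [Ee j] (sg (Ff j # v)))))"
    unfolding n by (simp add: LW_V V_assoc)
  also have "\<dots> = V a (LW a [Ee i] (cp a (Cap j) v)) (V a (V a (cp a (Crs j i) (Ff j # v)) 
      (LW a [Ee j, Ee i] (cp a (Cap j) (Ff j # v)))) (LW a [Ee j] (cp a (Crs j i) (Ff j # Ff j # v))))"
    unfolding unbend_sg[OF v] unbend_sg[OF o] by (simp add: LW_V LW_LW V_assoc)
  also have "\<dots> = V a (LW a [Ee i] (cp a (caps j 2) v)) (cp a ((Crs j i \<otimes> Idn [Ee j]) \<odot> (Idn [Ee j] \<otimes> Crs j i)) (Ff j # Ff j # v))"
    unfolding n' by (simp add: cp_simps cp_caps_2 LW_V LW_LW V_assoc)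
  finally show ?thesis using st_sg21 by (simp add: two.bent_def)
qed

lemma A_minus_eq:
  assumes "A a X (Sc a (-1) Y) = fo a (Nul v w)" "ty a v w X" "ty a v w Y"
  shows "X = Y"
  using A_move[OF assms(1)] A_Nul_left[OF assms(3)] ty_src ty_tgt ty_ne assms(2,3) by metis

lemma ty_crs: "\<lbrakk>okw w; 1 \<le> k; 1 \<le> l\<rbrakk> \<Longrightarrow> ty a (Ee k # Ee l # w) (Ee l # Ee k # w) (cp a (Crs k l) w)"
  using ty_cp[of w a "Crs k l"] a by (simp add: wfo_gen)

lemma ty_dot: "okw w \<Longrightarrow> 1 \<le> k \<Longrightarrow> ty a (Ee k # w) (Ee k # w) (cp a (Dot k) w)"
  using ty_cp[of w a "Dot k"] a by (simp add: wfo_gen)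

text \<open>For different indices the dot slide relations have no correction term.\<close>

lemma crs_dot:
  assumes w: "okw w"
  shows "V a (cp a (Crs j i) w) (cp a (Dot j) (Ee i # w)) = V a (LW a [Ee i] (cp a (Dot j) w)) (cp a (Crs j i) w)"
    "V a (cp a (Dot i) (Ee j # w)) (cp a (Crs j i) w) = V a (cp a (Crs j i) w) (LW a [Ee j] (cp a (Dot i) w))"
proof -
  have b: "act w a \<in> Wts" "wfo a (Idn w)" using w a by auto
  have s: "act [Ee j, Ee i] (act w a) = act [Ee i, Ee j] (act w a)" by (auto simp: act_Cons)
  have o: "okw (Ee i # w)" "okw (Ee j # w)" using i j w by auto
  have "fo (act w a) (Crs j i \<odot> (Dot j \<otimes> E\<^sub>1 i) \<ominus> (E\<^sub>1 i \<otimes> Dot j) \<odot> Crs j i) = fo (act w a) (Nul [Ee j, Ee i] [Ee i, Ee j])"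
    using fo_rel[OF rel.dot_slide_left[of "act w a" j i]] ij i j b s by (simp add: wfo_gen wfo_hor)
  from cp_cong[OF this]
  have "A a (V a (cp a (Crs j i) w) (cp a (Dot j) (Ee i # w))) (Sc a (-1) (V a (LW a [Ee i] (cp a (Dot j) w)) (cp a (Crs j i) w))) =
    fo a (Nul (Ee j # Ee i # w) (Ee i # Ee j # w))"
    using b s i j by (simp add: cp_simps cp_Nul)
  then show "V a (cp a (Crs j i) w) (cp a (Dot j) (Ee i # w)) = V a (LW a [Ee i] (cp a (Dot j) w)) (cp a (Crs j i) w)"
    by (rule A_minus_eq)
      (use ty_V[OF ty_dot[OF o(1) j] ty_crs[OF w j i]] ty_V[OF ty_crs[OF w j i] ty_LW[OF ty_dot[OF w j], of "[Ee i]", simplified]] i in simp_all)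
  have "fo (act w a) ((Dot i \<otimes> E\<^sub>1 j) \<odot> Crs j i \<ominus> Crs j i \<odot> (E\<^sub>1 j \<otimes> Dot i)) = fo (act w a) (Nul [Ee j, Ee i] [Ee i, Ee j])"
    using fo_rel[OF rel.dot_slide_right[of "act w a" i j]] ij i j b s by (simp add: wfo_gen wfo_hor)
  from cp_cong[OF this]
  have "A a (V a (cp a (Dot i) (Ee j # w)) (cp a (Crs j i) w)) (Sc a (-1) (V a (cp a (Crs j i) w) (LW a [Ee j] (cp a (Dot i) w)))) =
    fo a (Nul (Ee j # Ee i # w) (Ee i # Ee j # w))"
    using b s i j by (simp add: cp_simps cp_Nul)
  then show "V a (cp a (Dot i) (Ee j # w)) (cp a (Crs j i) w) = V a (cp a (Crs j i) w) (LW a [Ee j] (cp a (Dot i) w))"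
    by (rule A_minus_eq)
      (use ty_V[OF ty_crs[OF w j i] ty_dot[OF o(2) i]] ty_V[OF ty_LW[OF ty_dot[OF w i], of "[Ee j]", simplified] ty_crs[OF w j i]] j in simp_all)
qed

text \<open>The correction term of the cubic relation occurs only if the outer strands have equal
  index, which is excluded here.\<close>

lemma crs_cubic:
  assumes w: "okw w" and k: "k \<noteq> m" "1 \<le> k" "1 \<le> l" "1 \<le> m"
  shows "V a (cp a (Crs l m) (Ee k # w)) (V a (LW a [Ee l] (cp a (Crs k m) w)) (cp a (Crs k l) (Ee m # w))) =
    V a (LW a [Ee m] (cp a (Crs k l) w)) (V a (cp a (Crs k m) (Ee l # w)) (LW a [Ee k] (cp a (Crs l m) w)))"
proof -
  have b: "act w a \<in> Wts" "wfo a (Idn w)" using w a by auto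
  have s: "act [Ee k, Ee l, Ee m] (act w a) = act [Ee m, Ee l, Ee k] (act w a)" by (auto simp: act_Cons)
  have o: "okw (Ee k # w)" "okw (Ee l # w)" "okw (Ee m # w)" using k w by auto
  have "fo (act w a) ((Crs l m \<otimes> E\<^sub>1 k) \<odot> (E\<^sub>1 l \<otimes> Crs k m) \<odot> (Crs k l \<otimes> E\<^sub>1 m) \<ominus>
            (E\<^sub>1 m \<otimes> Crs k l) \<odot> (Crs k m \<otimes> E\<^sub>1 l) \<odot> (E\<^sub>1 k \<otimes> Crs l m)) = fo (act w a) (Nul [Ee k, Ee l, Ee m] [Ee m, Ee l, Ee k])"
    using fo_rel[OF rel.cubic[of "act w a" l m k]] k b s by (simp add: wfo_gen wfo_hor)
  from cp_cong[OF this] have "A a (V a (cp a (Crs l m) (Ee k # w)) (V a (LW a [Ee l] (cp a (Crs k m) w)) (cp a (Crs k l) (Ee m # w))))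
    (Sc a (-1) (V a (LW a [Ee m] (cp a (Crs k l) w)) (V a (cp a (Crs k m) (Ee l # w)) (LW a [Ee k] (cp a (Crs l m) w))))) =
    fo a (Nul (Ee k # Ee l # Ee m # w) (Ee m # Ee l # Ee k # w))"
    using b s k by (simp add: cp_simps cp_Nul)
  then show ?thesis
    by (rule A_minus_eq[of _ _ "Ee k # Ee l # Ee m # w" "Ee m # Ee l # Ee k # w"])
      (simp_all add: k[simplified] ty_V[OF ty_V[OF ty_crs[OF o(3) k(2,3)] ty_LW[OF ty_crs[OF w k(2,4)], of "[Ee l]", simplified]] ty_crs[OF o(1) k(3,4)]]
        ty_V[OF ty_V[OF ty_LW[OF ty_crs[OF w k(3,4)], of "[Ee k]", simplified] ty_crs[OF o(2) k(2,4)]] ty_LW[OF ty_crs[OF w k(2,3)], of "[Ee m]", simplified]])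
qed

lemma dE: "dom (E_idem k 2) = [Ee k, Ee k]" "cod (E_idem k 2) = [Ee k, Ee k]"
  using dom_idem_letter[of "Ed k 2"] by (simp_all add: expand_2)

text \<open>The idempotent is a dot after a crossing of two strands of index i. The crossing passes
  the strand of index j by the cubic relation, the dot by the dot slide.\<close>

lemma slide_E_idem:
  assumes w: "okw w"
  shows "V a (cp a ((Idn [Ee i] \<otimes> Crs j i) \<odot> (Crs j i \<otimes> Idn [Ee i])) w) (LW a [Ee j] (cp a (E_idem i 2) w)) =
    V a (cp a (E_idem i 2) (Ee j # w)) (cp a ((Idn [Ee i] \<otimes> Crs j i) \<odot> (Crs j i \<otimes> Idn [Ee i])) w)"
proof -
  have w': "wfo a (Idn w)" "wfo a (Idn (Ee j # w))" using w a j by auto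
  let ?p = "LW a [Ee i] (cp a (Crs j i) w)" and ?q = "cp a (Crs j i) (Ee i # w)"
  have n: "V a (cp a (Dot i) (Ee i # Ee j # w)) ?p = V a ?p (cp a (Dot i) (Ee j # Ee i # w))"
    by (rule naturality) simp_all
  have d: "V a (cp a (Dot i) (Ee j # Ee i # w)) ?q = V a ?q (LW a [Ee j] (cp a (Dot i) (Ee i # w)))"
    using crs_dot(2)[of "Ee i # w"] w i by simp
  have c: "V a (cp a (Crs i i) (Ee j # w)) (V a ?p ?q) = V a ?p (V a ?q (LW a [Ee j] (cp a (Crs i i) w)))"
    using crs_cubic[OF w ij[symmetric] j i i] .
  have "V a (V a (cp a (Dot i) (Ee i # Ee j # w)) (cp a (Crs i i) (Ee j # w))) (V a ?p ?q) =
    V a (V a (V a (cp a (Dot i) (Ee i # Ee j # w)) ?p) ?q) (LW a [Ee j] (cp a (Crs i i) w))"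
    by (simp add: V_assoc c)
  also have "\<dots> = V a (V a ?p (V a (cp a (Dot i) (Ee j # Ee i # w)) ?q)) (LW a [Ee j] (cp a (Crs i i) w))"
    unfolding n by (simp add: V_assoc)
  also have "\<dots> = V a (V a ?p ?q) (LW a [Ee j] (V a (cp a (Dot i) (Ee i # w)) (cp a (Crs i i) w)))"
    unfolding d by (simp add: V_assoc LW_V)
  finally show ?thesis unfolding E_idem_2[OF i w'(1)] E_idem_2[OF i w'(2)] by (simp add: cp_simps)
qed

lemma slide_F_idem:
  assumes w: "okw w"
  shows "V a (cp a ((Crs j i \<otimes> Idn [Ee j]) \<odot> (Idn [Ee j] \<otimes> Crs j i)) w) (cp a (E_idem j 2) (Ee i # w)) =
    V a (LW a [Ee i] (cp a (E_idem j 2) w)) (cp a ((Crs j i \<otimes> Idn [Ee j]) \<odot> (Idn [Ee j] \<otimes> Crs j i)) w)"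
proof -
  have w': "wfo a (Idn w)" "wfo a (Idn (Ee i # w))" using w a i by auto
  let ?p = "cp a (Crs j i) (Ee j # w)" and ?q = "LW a [Ee j] (cp a (Crs j i) w)"
  have n: "V a (cp a (Dot j) (Ee i # Ee j # w)) ?q = V a ?q (cp a (Dot j) (Ee j # Ee i # w))"
    by (rule naturality) simp_all
  have d: "V a ?p (cp a (Dot j) (Ee i # Ee j # w)) = V a (LW a [Ee i] (cp a (Dot j) (Ee j # w))) ?p"
    using crs_dot(1)[of "Ee j # w"] w j by simp
  have c: "V a ?p (V a ?q (cp a (Crs j j) (Ee i # w))) = V a (LW a [Ee i] (cp a (Crs j j) w)) (V a ?p ?q)"
    using crs_cubic[OF w ij[symmetric] j j i] .
  have "V a (V a ?p ?q) (V a (cp a (Dot j) (Ee j # Ee i # w)) (cp a (Crs j j) (Ee i # w))) =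
    V a ?p (V a (V a ?q (cp a (Dot j) (Ee j # Ee i # w))) (cp a (Crs j j) (Ee i # w)))"
    by (simp add: V_assoc)
  also have "\<dots> = V a (V a ?p (cp a (Dot j) (Ee i # Ee j # w))) (V a ?q (cp a (Crs j j) (Ee i # w)))"
    unfolding n[symmetric] by (simp add: V_assoc)
  also have "\<dots> = V a (LW a [Ee i] (V a (cp a (Dot j) (Ee j # w)) (cp a (Crs j j) w))) (V a ?p ?q)"
    unfolding d by (simp add: V_assoc c LW_V)
  finally show ?thesis unfolding E_idem_2[OF j w'(1)] E_idem_2[OF j w'(2)] by (simp add: cp_simps)
qed

lemma F2_mate: "F_idem j 2 = two.mt (E_idem j 2)"
  by (simp add: F_idem_mate expand_2)

lemma sg12_idem:
  assumes v: "okw v"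
  shows "V a (sg12 v) (cp a (E_idem i 2) (Ff j # v)) = V a (LW a [Ff j] (cp a (E_idem i 2) v)) (sg12 v)"
  using one.bent_slide_left[OF bent_sg12[OF v] _ dE[of i]] slide_E_idem[of "Ff j # v"] v a i j by simp

lemma sg21_idem:
  assumes v: "okw v"
  shows "V a (sg21 v) (LW a [Ee i] (cp a (F_idem j 2) v)) = V a (cp a (F_idem j 2) (Ee i # v)) (sg21 v)"
  unfolding F2_mate using two.bent_slide_right[OF bent_sg21[OF v] _ _ dE[of j]] slide_F_idem[of "Ff j # Ff j # v"] v a i j by simp

text \<open>The order of the elementary exchanges does not matter. One form displays compatibility
  with the idempotent of E, the other one with that of F.\<close>

lemma sg22_alt: "sg22 v = V a (sg21 (Ee i # v)) (LW a [Ee i] (sg21 v))"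
proof -
  have n: "V a (cp a (sigma i j) (Ff j # Ee i # v)) (LW a [Ee i, Ff j] (sg v)) =
    V a (LW a [Ff j, Ee i] (sg v)) (cp a (sigma i j) (Ee i # Ff j # v))"
    by (rule naturality) simp_all
  note n' = n[folded sg_def]
  show ?thesis
    unfolding sg22_def sg12_def sg21_def
    by (simp add: LW_V LW_LW V_assoc) (simp add: V_assoc[symmetric] n')
qed

lemma sg22_idem:
  assumes v: "okw v"
  shows "V a (sg22 v) (cp a (E_idem i 2) (Ff j # Ff j # v)) = V a (LW a [Ff j, Ff j] (cp a (E_idem i 2) v)) (sg22 v)"
    "V a (sg22 v) (LW a [Ee i, Ee i] (cp a (F_idem j 2) v)) = V a (cp a (F_idem j 2) (Ee i # Ee i # v)) (sg22 v)"
proof -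
  have o: "okw (Ff j # v)" "okw (Ee i # v)" using v i j by auto
  have "V a (sg22 v) (cp a (E_idem i 2) (Ff j # Ff j # v)) = V a (LW a [Ff j] (V a (sg12 v) (cp a (E_idem i 2) (Ff j # v)))) (sg12 (Ff j # v))"
    unfolding sg22_def using sg12_idem[OF o(1)] st_sg12 by (simp add: V_assoc LW_V)
  then show "V a (sg22 v) (cp a (E_idem i 2) (Ff j # Ff j # v)) = V a (LW a [Ff j, Ff j] (cp a (E_idem i 2) v)) (sg22 v)"
    unfolding sg22_def sg12_idem[OF v] using st_sg12 by (simp add: V_assoc LW_V LW_LW)
  have "V a (sg22 v) (LW a [Ee i, Ee i] (cp a (F_idem j 2) v)) = V a (sg21 (Ee i # v)) (LW a [Ee i] (V a (sg21 v) (LW a [Ee i] (cp a (F_idem j 2) v))))"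
    unfolding sg22_alt using st_sg21 by (simp add: V_assoc LW_V LW_LW)
  then show "V a (sg22 v) (LW a [Ee i, Ee i] (cp a (F_idem j 2) v)) = V a (cp a (F_idem j 2) (Ee i # Ee i # v)) (sg22 v)"
    unfolding sg22_alt sg21_idem[OF v] using st_sg21 sg21_idem[OF o(2)] by (simp add: V_assoc[symmetric] LW_V)
qed

section \<open>From intertwining isomorphisms to decompositions\<close>

definition inverses :: "word \<Rightarrow> word \<Rightarrow> foam \<Rightarrow> foam \<Rightarrow> bool" where
  "inverses u w X Y \<longleftrightarrow> tyd a u w 0 X \<and> tyd a w u 0 Y \<and> V a Y X = fo a (Idn u) \<and> V a X Y = fo a (Idn w)"

lemma inverses_sg: "okw v \<Longrightarrow> inverses (Ee i # Ff j # v) (Ff j # Ee i # v) (sg v) (sv v)"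
  by (simp add: inverses_def ty_sg sg_sv)

lemma inverses_V:
  assumes X: "inverses u w X Y" and X': "inverses w x X' Y'"
  shows "inverses u x (V a X' X) (V a Y Y')"
proof -
  have t: "tyd a u w 0 X" "tyd a w u 0 Y" "tyd a w x 0 X'" "tyd a x w 0 Y'" using X X' by (auto simp: inverses_def)
  note c = ty_cls[OF tyd_ty[OF t(1)]] ty_cls[OF tyd_ty[OF t(2)]] ty_cls[OF tyd_ty[OF t(3)]] ty_cls[OF tyd_ty[OF t(4)]]
  have "V a (V a Y Y') (V a X' X) = V a Y (V a (V a Y' X') X)" "V a (V a X' X) (V a Y Y') = V a X' (V a (V a X Y) Y')"
    using c by (simp_all add: V_assoc)
  then show ?thesis
    using X X' tyd_V[OF t(1,3)] tyd_V[OF t(4,2)] V_id_left[OF ty_tgt[OF tyd_ty[OF t(1)]]] V_id_left[OF ty_tgt[OF tyd_ty[OF t(4)]]]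
    by (simp add: inverses_def)
qed

lemma inverses_LW: "inverses v w X Y \<Longrightarrow> okw u \<Longrightarrow> inverses (u @ v) (u @ w) (LW a u X) (LW a u Y)"
  unfolding inverses_def
  by (elim conjE, intro conjI tyd_LW, assumption+) (simp_all only: LW_V[symmetric] LW_Idn ty_cls[OF tyd_ty])

text \<open>An invertible map that intertwines two idempotents restricts to an isomorphism of their
  images, since its inverse intertwines them as well.\<close>

lemma dec_intertwine:
  assumes P: "okd P" "okd Q" and X: "inverses (expand Q) (expand P) X Y" and XP: "V a X (ip a Q) = V a (ip a P) X"
  shows "dec a P [(0, Q)]"
proof (rule dec_iso[OF P])
  let ?p = "ip a P" and ?q = "ip a Q"
  have t: "tyd a (expand Q) (expand P) 0 X" "tyd a (expand P) (expand Q) 0 Y" using X by (auto simp: inverses_def)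
  note tp = tyd_ip[OF P(1) a] and tq = tyd_ip[OF P(2) a]
  note c = ty_cls[OF tyd_ty[OF t(1)]] ty_cls[OF tyd_ty[OF t(2)]] ty_cls[OF tyd_ty[OF tp]] ty_cls[OF tyd_ty[OF tq]]
  have YX: "V a Y X = fo a (Idn (expand Q))" "V a X Y = fo a (Idn (expand P))" using X by (auto simp: inverses_def)
  note ii = ip_ip[OF P(1) a] ip_ip[OF P(2) a]
  have YP: "V a ?q Y = V a Y ?p"
  proof -
    have "V a ?q Y = V a (V a Y X) (V a ?q Y)"
      unfolding YX by (rule V_id_left[symmetric]) (use tyd_V[OF t(2) tq] tyd_ty ty_tgt in blast)
    also have "\<dots> = V a Y (V a (V a X ?q) Y)" using c by (simp add: V_assoc)
    also have "\<dots> = V a Y (V a ?p (V a X Y))" unfolding XP using c by (simp add: V_assoc)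
    also have "\<dots> = V a Y ?p" unfolding YX by (simp add: V_id_right[OF ty_src[OF tyd_ty[OF tp]]])
    finally show ?thesis .
  qed
  have t2: "tyd a (expand P) (expand Q) 0 (V a Y ?p)" "tyd a (expand Q) (expand P) 0 (V a X ?q)"
    using tyd_V[OF tp t(2)] tyd_V[OF tq t(1)] by simp_all
  show "hkd a P Q 0 (V a Y ?p)"
    using t2 c ii YP[symmetric] unfolding hkd_def by (simp add: V_assoc) (simp add: V_assoc[symmetric] ii)
  show "hkd a Q P (- 0) (V a X ?q)"
    using t2 c ii XP unfolding hkd_def by (simp add: V_assoc) (simp add: V_assoc[symmetric] ii)
  have "V a (V a Y ?p) (V a X ?q) = V a Y (V a (V a ?p X) ?q)" using c by (simp add: V_assoc)
  also have "\<dots> = V a (V a Y X) ?q" unfolding XP[symmetric] using c ii by (simp add: V_assoc)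
  also have "\<dots> = ?q" unfolding YX by (rule V_id_left[OF ty_tgt[OF tyd_ty[OF tq]]])
  finally show "V a (V a Y ?p) (V a X ?q) = ?q" .
  have "V a (V a X ?q) (V a Y ?p) = V a ?p (V a (V a X Y) ?p)" unfolding XP using c by (simp add: V_assoc)
  also have "\<dots> = ?p" unfolding YX using ii by (simp add: V_id_left[OF ty_tgt[OF tyd_ty[OF tp]]])
  finally show "V a (V a X ?q) (V a Y ?p) = ?p" .
qed

lemma dec_commute:
  assumes k: "k \<in> {1, 2}" "l \<in> {1, 2}"
  shows "dec a [Fd j k, Ed i l] [(0, [Ed i l, Fd j k])]"
proof -
  note ips = ip_words[OF i j a]
  have i1: "\<exists>Y. inverses (Ee i # Ee i # Ff j # v) (Ff j # Ee i # Ee i # v) (sg12 v) Y" if "okw v" for v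
  proof -
    have "inverses (Ee i # Ee i # Ff j # v) (Ee i # Ff j # Ee i # v) (LW a [Ee i] (sg v)) (LW a [Ee i] (sv v))"
      using inverses_LW[OF inverses_sg[OF that], of "[Ee i]"] i by simp
    from inverses_V[OF this inverses_sg[of "Ee i # v"]] show ?thesis using that i unfolding sg12_def by auto
  qed
  have i2: "\<exists>Y. inverses (Ee i # Ff j # Ff j # v) (Ff j # Ff j # Ee i # v) (sg21 v) Y" if "okw v" for v
  proof -
    have "inverses (Ff j # Ee i # Ff j # v) (Ff j # Ff j # Ee i # v) (LW a [Ff j] (sg v)) (LW a [Ff j] (sv v))"
      using inverses_LW[OF inverses_sg[OF that], of "[Ff j]"] j by simp
    from inverses_V[OF inverses_sg[of "Ff j # v"] this] show ?thesis using that j unfolding sg21_def by auto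
  qed
  obtain Y1 Y2 where Y: "inverses [Ee i, Ee i, Ff j] [Ff j, Ee i, Ee i] (sg12 []) Y1"
    "inverses [Ee i, Ee i, Ff j, Ff j] [Ff j, Ee i, Ee i, Ff j] (sg12 [Ff j]) Y2"
    using i1[of "[]"] i1[of "[Ff j]"] j by auto
  have o: "okw [Ff j]" using j by simp
  from inverses_V[OF Y(2) inverses_LW[OF Y(1) o, simplified]]
  have i3: "\<exists>Y. inverses [Ee i, Ee i, Ff j, Ff j] [Ff j, Ff j, Ee i, Ee i] (sg22 []) Y"
    unfolding sg22_def by blast
  obtain Y3 where Y3: "inverses [Ee i, Ff j, Ff j] [Ff j, Ff j, Ee i] (sg21 []) Y3"
    using i2[of "[]"] by auto
  obtain Y4 where Y4: "inverses [Ee i, Ee i, Ff j, Ff j] [Ff j, Ff j, Ee i, Ee i] (sg22 []) Y4"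
    using i3 by blast
  have n: "V a (sg22 []) (V a (cp a (E_idem i 2) [Ff j, Ff j]) (LW a [Ee i, Ee i] (cp a (F_idem j 2) []))) =
    V a (V a (cp a (F_idem j 2) [Ee i, Ee i]) (LW a [Ff j, Ff j] (cp a (E_idem i 2) []))) (sg22 [])"
  proof -
    have d: "dom (F_idem j 2) = [Ff j, Ff j]" "cod (F_idem j 2) = [Ff j, Ff j]"
      using dom_idem_letter[of "Fd j 2"] by (simp_all add: expand_2)
    have m: "V a (cp a (F_idem j 2) [Ee i, Ee i]) (LW a [Ff j, Ff j] (cp a (E_idem i 2) [])) =
      V a (LW a [Ff j, Ff j] (cp a (E_idem i 2) [])) (cp a (F_idem j 2) [Ee i, Ee i])"
      by (rule naturality) (simp_all add: d dE)
    have c: "cls a (sg22 [])" by (simp add: sg22_def st_sg12)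
    show ?thesis unfolding m using c sg22_idem[of "[]"] by (simp add: V_assoc[symmetric]) (simp add: V_assoc)
  qed
  consider "k = 1" "l = 1" | "k = 1" "l = 2" | "k = 2" "l = 1" | "k = 2" "l = 2" using k by auto
  then show ?thesis
  proof cases
    case 1
    then show ?thesis
      using i j inverses_sg[of "[]"] ips(3,4) V_id_left[of a "[Ff j, Ee i]" "sg []"] V_id_right[of a "[Ee i, Ff j]" "sg []"]
      by (intro dec_intertwine[of _ _ "sg []" "sv []"]) simp_all
  next
    case 2
    then show ?thesis
      using i j Y(1) ips(5,8) sg12_idem[of "[]"]
      by (intro dec_intertwine[of _ _ "sg12 []" Y1]) (simp_all add: expand_2)
  next
    case 3
    then show ?thesis
      using i j Y3 ips(6,9) sg21_idem[of "[]"]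
      by (intro dec_intertwine[of _ _ "sg21 []" Y3]) (simp_all add: expand_2)
  next
    case 4
    then show ?thesis
      using i j Y4 ips(7,10) n
      by (intro dec_intertwine[of _ _ "sg22 []" Y4]) (simp_all add: expand_2)
  qed
qed

end

section \<open>Essential surjectivity\<close>

interpretation tf: gl2 TwoFoam zero_fm
  by (rule gl2_TwoFoam)

section \<open>From words to webs\<close>

abbreviation web1 :: "weight \<Rightarrow> dword \<Rightarrow> weight \<Rightarrow> web" where "web1 a P b \<equiv> (a, [P], b)"

definition m1 :: "foam \<Rightarrow> foam_matrix" where
  "m1 S = (\<lambda>(i, j) \<in> {..<1} \<times> {..<1}. S)"

lemma m1_00 [simp]: "m1 S (0, 0) = S" by (simp add: m1_def)

lemma fm_m1: "fm a [P] [Q] M \<Longrightarrow> M = m1 (M (0, 0))"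
  unfolding fm_def m1_def by (intro extensionalityI[of M "{..<1} \<times> {..<1}"]) auto

lemma fmd_m1I: "hkd a P Q d S \<Longrightarrow> fmd a [P] [Q] d (m1 S)"
  by (simp add: fmd_def m1_def)
lemma fm_m1I: "hk a P Q S \<Longrightarrow> fm a [P] [Q] (m1 S)"
  by (simp add: fm_def m1_def)

lemma ws_1: "ws a b [P] \<longleftrightarrow> a \<in> Wts \<and> okd P \<and> act (expand P) a = b"
  by (auto simp: ws_def web_words_eq)

lemma m1_ops:
  assumes P: "ws a b [P]"
  shows "mid (foam_cat a b) [P] = m1 (ip a P)"
    "zero_fm (a, [P], b') (a', [Q], b'') = m1 (fo a (Nul (expand P) (expand Q)))"
    "fm_add (a, [P], b) (a, [Q], b) (m1 S) (m1 T) = m1 (A a S T)"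
  by (rule ext, auto simp: mid_def zero_fm_def m1_def fm_add.simps restrict_def)+

lemma hm_m1: "hm a b c [R] [R'] [P] [Q] (m1 S) (m1 T) = m1 (Hc a S T)"
  by (rule ext) (auto simp: m1_def fm_hcomp.simps restrict_def)

lemma mcmp_m1:
  assumes w: "ws a b [P]" "ws a b [Q]" "ws a b [R]" and S: "hk a P Q S" and T: "hk a Q R T"
  shows "mcmp (foam_cat a b) [P] [Q] [R] (m1 T) (m1 S) = m1 (V a T S)"
proof -
  have "hk a P R (V a T S)" by (rule hk_V[OF S T]) (use w in \<open>auto simp: ws_1\<close>)
  then have "A a (V a T S) (fo a (Nul (expand P) (expand R))) = V a T S"
    by (rule A_Nul_right[OF hk_ty])
  then have "mcmp (foam_cat a b) [P] [Q] [R] (m1 T) (m1 S) (0, 0) = V a T S"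
    by (simp add: mcmp_def hsum_def)
  then show ?thesis using fm_m1[OF fm_mcmp[OF w fm_m1I[OF S] fm_m1I[OF T]]] by simp
qed

lemma fm_add_foldr:
  assumes w: "ws a b Ps" "ws a b Qs"
  shows "\<forall>M\<in>set Ms. fm a Ps Qs M \<Longrightarrow> fm a Ps Qs M0 \<Longrightarrow>
    fm a Ps Qs (foldr (fm_add (a, Ps, b) (a, Qs, b)) Ms M0) \<and>
    (i < length Qs \<longrightarrow> j < length Ps \<longrightarrow> foldr (fm_add (a, Ps, b) (a, Qs, b)) Ms M0 (i, j) = foldr (A a) (map (\<lambda>M. M (i, j)) Ms) (M0 (i, j)))"
proof (induction Ms)
  case (Cons M Ms)
  then show ?case using add_fm[OF w] by (simp add: fm_add_entry)
qed simp

lemma dec_decomposes: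
  assumes d: "dec a P L" and b: "act (expand P) a = b"
  shows "tf.decomposes a b (web1 a P b) (map (\<lambda>(k, Q). (k, web1 a Q b)) L)"
proof -
  from d obtain \<alpha> \<beta> where a: "a \<in> Wts" "okd P" "\<forall>(k, Q) \<in> set L. okd Q"
    and \<alpha>: "\<And>r. r < length L \<Longrightarrow> hkd a P (snd (L ! r)) (fst (L ! r)) (\<alpha> r)"
    and \<beta>: "\<And>r. r < length L \<Longrightarrow> hkd a (snd (L ! r)) P (- fst (L ! r)) (\<beta> r)"
    and \<alpha>\<beta>: "\<And>r s. r < length L \<Longrightarrow> s < length L \<Longrightarrow> V a (\<alpha> r) (\<beta> s) = (if r = s then ip a (snd (L ! r))
        else fo a (Nul (expand (snd (L ! s))) (expand (snd (L ! r)))))"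
    and s: "foldr (A a) (map (\<lambda>r. V a (\<beta> r) (\<alpha> r)) [0..<length L]) (fo a (Nul (expand P) (expand P))) = ip a P"
    unfolding dec_def by blast
  let ?Q = "\<lambda>r. snd (L ! r)"
  have wP: "ws a b [P]" using a b by (simp add: ws_1)
  have wQ: "ws a b [?Q r]" if "r < length L" for r
    using ty_okw[OF hk_ty[OF hkd_hk[OF \<alpha>[OF that]]]] a b nth_mem[OF that] by (auto simp: ws_1 case_prod_beta)
  show ?thesis
  proof (rule tf.decomposesI[where k = "\<lambda>r. fst (L ! r)" and q = "\<lambda>r. web1 a (?Q r) b" and \<alpha> = "\<lambda>r. m1 (\<alpha> r)" and \<beta> = "\<lambda>r. m1 (\<beta> r)"])
    show "tf.ar a b (web1 a P b)" using wP by (simp add: ar_web)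
    have f: "foldr (fm_add (web1 a P b) (web1 a P b)) (map (\<lambda>r. m1 (X r)) rs) (m1 N) = m1 (foldr (A a) (map X rs) N)" for X rs N
      by (induction rs) (simp_all add: m1_ops[OF wP])
    have m: "map (\<lambda>r. mcmp (foam_cat a b) [P] [?Q r] [P] (m1 (\<beta> r)) (m1 (\<alpha> r))) [0..<length L] = map (\<lambda>r. m1 (V a (\<beta> r) (\<alpha> r))) [0..<length L]"
      by (rule map_cong[OF HOL.refl], rule mcmp_m1[OF wP wQ wP hkd_hk[OF \<alpha>] hkd_hk[OF \<beta>]]) simp_all
    show "foldr (add2 TwoFoam (web1 a P b) (web1 a P b)) (map (\<lambda>i. vcomp TwoFoam (web1 a P b) (web1 a (?Q i) b) (web1 a P b) (m1 (\<beta> i)) (m1 (\<alpha> i)))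
       [0..<length (map (\<lambda>(k, Q). (k, web1 a Q b)) L)]) (zero_fm (web1 a P b) (web1 a P b)) = id2 TwoFoam (web1 a P b)"
      by (simp add: m f m1_ops[OF wP] s)
    fix r assume "r < length (map (\<lambda>(k, Q). (k, web1 a Q b)) L)"
    then have r: "r < length L" by simp
    show "map (\<lambda>(k, Q). (k, web1 a Q b)) L ! r = (fst (L ! r), web1 a (?Q r) b)" using r by (simp add: case_prod_beta)
    show "tf.HD a b (web1 a P b) (web1 a (?Q r) b) (fst (L ! r)) (m1 (\<alpha> r))"
      "tf.HD a b (web1 a (?Q r) b) (web1 a P b) (- fst (L ! r)) (m1 (\<beta> r))"
      using wP wQ[OF r] fmd_m1I[OF \<alpha>[OF r]] fmd_m1I[OF \<beta>[OF r]] by (simp_all add: HD_web)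
    fix t assume "t < length (map (\<lambda>(k, Q). (k, web1 a Q b)) L)"
    then have t: "t < length L" by simp
    show "vcomp TwoFoam (web1 a (?Q t) b) (web1 a P b) (web1 a (?Q r) b) (m1 (\<alpha> r)) (m1 (\<beta> t)) =
      (if r = t then id2 TwoFoam (web1 a (?Q r) b) else zero_fm (web1 a (?Q t) b) (web1 a (?Q r) b))"
      using mcmp_m1[OF wQ[OF t] wP wQ[OF r] hkd_hk[OF \<beta>[OF t]] hkd_hk[OF \<alpha>[OF r]]] \<alpha>\<beta>[OF r t]
      by (simp add: m1_ops[OF wQ[OF r]] m1_ops[OF wQ[OF t]])
  qed
qed

text \<open>Projections and inclusions are the rows and the columns of the identity matrix. Every
  equation to be verified is an entry of the statement that this matrix is idempotent.\<close>

lemma web_decomposes: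
  assumes w: "ws a b Ps"
  shows "tf.decomposes a b (a, Ps, b) (map (\<lambda>P. (0, web1 a P b)) Ps)"
proof -
  let ?I = "mid (foam_cat a b) Ps" and ?n = "length Ps"
  define \<alpha> where "\<alpha> r = (\<lambda>(i, j) \<in> {..<1::nat} \<times> {..<?n}. ?I (r, j))" for r
  define \<beta> where "\<beta> r = (\<lambda>(i, j) \<in> {..<?n} \<times> {..<1::nat}. ?I (i, r))" for r
  have I: "fmd a Ps Ps 0 ?I" by (rule mid_fmd[OF w])
  have II: "mcmp (foam_cat a b) Ps Ps Ps ?I ?I = ?I"
    by (rule fc.mid_left) (use w mid_fm[OF w] in \<open>simp_all add: ws_lists mhom_fm\<close>)
  have wr: "ws a b [Ps ! r]" if "r < ?n" for r using w that ws_nth'[OF w that] by (simp add: ws_1) (simp add: ws_def)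
  have \<alpha>: "fmd a Ps [Ps ! r] 0 (\<alpha> r)" and \<beta>: "fmd a [Ps ! r] Ps 0 (\<beta> r)" if "r < ?n" for r
    using I that unfolding fmd_def \<alpha>_def \<beta>_def by auto
  have \<beta>\<alpha>: "fm a Ps Ps (mcmp (foam_cat a b) Ps [Ps ! r] Ps (\<beta> r) (\<alpha> r))" if "r < ?n" for r
    by (rule fm_mcmp[OF w wr[OF that] w fmd_fm[OF \<alpha>[OF that]] fmd_fm[OF \<beta>[OF that]]])
  have z: "fm a Ps Ps (zero_fm (a, Ps, b) (a, Ps, b))" by (rule fmd_fm[OF zero_fmd[OF w w]])
  show ?thesis
  proof (rule tf.decomposesI[where k = "\<lambda>_. 0" and q = "\<lambda>r. web1 a (Ps ! r) b" and \<alpha> = \<alpha> and \<beta> = \<beta>])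
    show "tf.ar a b (a, Ps, b)" using w by (simp add: ar_web)
    let ?Ms = "map (\<lambda>r. mcmp (foam_cat a b) Ps [Ps ! r] Ps (\<beta> r) (\<alpha> r)) [0..<?n]"
    have Ms: "\<forall>M\<in>set ?Ms. fm a Ps Ps M" using \<beta>\<alpha> by auto
    have "foldr (fm_add (a, Ps, b) (a, Ps, b)) ?Ms (zero_fm (a, Ps, b) (a, Ps, b)) = ?I"
    proof (rule fm_eqI[OF _ mid_fm[OF w]])
      show "fm a Ps Ps (foldr (fm_add (a, Ps, b) (a, Ps, b)) ?Ms (zero_fm (a, Ps, b) (a, Ps, b)))"
        using fm_add_foldr[OF w w Ms z] by blast
      fix i j assume ij: "i < ?n" "j < ?n"
      have e: "mcmp (foam_cat a b) Ps [Ps ! r] Ps (\<beta> r) (\<alpha> r) (i, j) = V a (?I (i, r)) (?I (r, j))" if r: "r < ?n" for r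
      proof -
        have "hk a (Ps ! j) (Ps ! i) (V a (?I (i, r)) (?I (r, j)))"
          by (rule hk_V[of a _ "Ps ! r"]) (use fmd_fm[OF I] r ij ws_nth'[OF w] in \<open>auto intro: fm_entry\<close>)
        from A_Nul_right[OF hk_ty[OF this]] show ?thesis
          using ij by (simp add: mcmp_def hsum_def \<alpha>_def \<beta>_def)
      qed
      have "foldr (fm_add (a, Ps, b) (a, Ps, b)) ?Ms (zero_fm (a, Ps, b) (a, Ps, b)) (i, j) =
        foldr (A a) (map (\<lambda>M. M (i, j)) ?Ms) (zero_fm (a, Ps, b) (a, Ps, b) (i, j))"
        using fm_add_foldr[OF w w Ms z] ij by blast
      also have "map (\<lambda>M. M (i, j)) ?Ms = map (\<lambda>r. V a (?I (i, r)) (?I (r, j))) [0..<?n]"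
        by (simp add: e comp_def)
      also have "zero_fm (a, Ps, b) (a, Ps, b) (i, j) = fo a (Nul (expand (Ps ! j)) (expand (Ps ! i)))"
        using ij by (simp add: zero_fm_def)
      also have "foldr (A a) (map (\<lambda>r. V a (?I (i, r)) (?I (r, j))) [0..<?n]) (fo a (Nul (expand (Ps ! j)) (expand (Ps ! i)))) =
        mcmp (foam_cat a b) Ps Ps Ps ?I ?I (i, j)"
      proof -
        have "hadd (foam_cat a b) (Ps ! j) (Ps ! i) = A a" by (intro ext) simp
        then show ?thesis using ij by (simp add: mcmp_def hsum_def)
      qed
      finally show "foldr (fm_add (a, Ps, b) (a, Ps, b)) ?Ms (zero_fm (a, Ps, b) (a, Ps, b)) (i, j) = ?I (i, j)"
        unfolding II .
    qed
    then show "foldr (add2 TwoFoam (a, Ps, b) (a, Ps, b)) (map (\<lambda>i. vcomp TwoFoam (a, Ps, b) (web1 a (Ps ! i) b) (a, Ps, b) (\<beta> i) (\<alpha> i))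
       [0..<length (map (\<lambda>P. (0, web1 a P b)) Ps)]) (zero_fm (a, Ps, b) (a, Ps, b)) = id2 TwoFoam (a, Ps, b)"
      by simp
    fix r assume "r < length (map (\<lambda>P. (0, web1 a P b)) Ps)"
    then have r: "r < ?n" by simp
    show "map (\<lambda>P. (0, web1 a P b)) Ps ! r = (0, web1 a (Ps ! r) b)" using r by simp
    show "tf.HD a b (a, Ps, b) (web1 a (Ps ! r) b) 0 (\<alpha> r)" "tf.HD a b (web1 a (Ps ! r) b) (a, Ps, b) (- 0) (\<beta> r)"
      using w wr[OF r] \<alpha>[OF r] \<beta>[OF r] by (simp_all add: HD_web)
    fix s assume "s < length (map (\<lambda>P. (0, web1 a P b)) Ps)"
    then have s: "s < ?n" by simp
    note f = fm_mcmp[OF wr[OF s] w wr[OF r] fmd_fm[OF \<beta>[OF s]] fmd_fm[OF \<alpha>[OF r]]]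
    have "mcmp (foam_cat a b) [Ps ! s] Ps [Ps ! r] (\<alpha> r) (\<beta> s) (0, 0) = mcmp (foam_cat a b) Ps Ps Ps ?I ?I (r, s)"
    proof -
      have "\<alpha> r (0, x) = ?I (r, x)" "\<beta> s (x, 0) = ?I (x, s)" if "x < ?n" for x
        using that by (simp_all add: \<alpha>_def \<beta>_def)
      then show ?thesis using r s by (simp add: mcmp_def cong: list.map_cong_simp)
    qed
    then have "mcmp (foam_cat a b) [Ps ! s] Ps [Ps ! r] (\<alpha> r) (\<beta> s) = m1 (?I (r, s))"
      unfolding II using fm_m1[OF f] by simp
    then show "vcomp TwoFoam (web1 a (Ps ! s) b) (a, Ps, b) (web1 a (Ps ! r) b) (\<alpha> r) (\<beta> s) =
      (if r = s then id2 TwoFoam (web1 a (Ps ! r) b) else zero_fm (web1 a (Ps ! s) b) (web1 a (Ps ! r) b))"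
      using fc.mid_entry[OF r s] by (simp add: m1_ops[OF wr[OF r]] m1_ops[OF wr[OF s]])
  qed
qed

subsection \<open>Rotating a divided power of F\<close>

lemma adjoint_words_k:
  assumes k: "k \<in> {1, 2}" and i: "1 \<le> i"
  shows "adjoint_words (replicate k (Ee i)) (replicate k (Ff i)) (cups i k) (caps i k)"
proof (cases "k = 1")
  case True
  interpret adjoint_words "[Ee i]" "[Ff i]" "Cup i" "Cap i" by (rule adjoint_words_1[OF i])
  have c: "cp a (cups i (Suc 0)) v = cp a (Cup i) v" "cp a (caps i (Suc 0)) v = cp a (Cap i) v" for a v
    by (simp_all add: cp_simps LW_simps cp_hor_Idn V_id_right V_id_left)
  have "adjoint_words [Ee i] [Ff i] (cups i (Suc 0)) (caps i (Suc 0))"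
  proof
    fix a v assume v: "wfo a (Idn v)"
    show "V a (cp a (caps i (Suc 0)) ([Ee i] @ v)) (LW a [Ee i] (cp a (cups i (Suc 0)) v)) = fo a (Idn ([Ee i] @ v))"
      "V a (LW a [Ff i] (cp a (caps i (Suc 0)) v)) (cp a (cups i (Suc 0)) ([Ff i] @ v)) = fo a (Idn ([Ff i] @ v))"
      unfolding c by (rule zig_B[OF v], rule zig_Bs[OF v])
  qed (use i in \<open>simp_all add: wfo_cups[of i _ "Suc 0", simplified] wfo_caps[of i _ "Suc 0", simplified] wfo_gen wfo_hor\<close>)
  then show ?thesis using True by simp
next
  case False
  then have "k = 2" using k by auto
  then show ?thesis using adjoint_words_2[OF i] by (simp add: expand_2)
qed

text \<open>The divided power of E is left adjoint to that of F. Unit and counit are nested cups and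
  caps with the idempotent inserted on the E strands; since it slides to the F strands as its mate,
  both maps absorb the idempotents of both letters.\<close>

lemma rotate_F:
  assumes k: "k \<in> {1, 2}" and i: "1 \<le> i" and c: "c \<in> Wts" and P: "okd P" and d: "d = act (replicate k (Ff i)) c"
    and cl: "act (expand P) d = c"
  shows "isomorphic (hTr TwoFoam) [(l, c, web1 c (P @ [Fd i k]) c)] [(l, d, web1 d (Fd i k # P) d)]"
proof -
  let ?B = "replicate k (Ee i)" and ?Bs = "replicate k (Ff i)" and ?e = "E_idem i k" and ?f = "F_idem i k"
  let ?E = "[Ed i k]" and ?F = "[Fd i k]"
  interpret ad: adjoint_words ?B ?Bs "cups i k" "caps i k" by (rule adjoint_words_k[OF k i])
  have dW: "d \<in> Wts" using d c i by simp
  have dc: "act ?B d = c" by (simp add: d act_E act_F)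
  have okl: "okl (Ed i k)" "okl (Fd i k)" using k i by auto
  have de: "dom ?e = ?B" "cod ?e = ?B" "dom ?f = ?Bs" "cod ?f = ?Bs"
    using dom_idem_letter[of "Ed i k"] dom_idem_letter[of "Fd i k"] by simp_all
  have f: "?f = ad.mt ?e" by (rule F_idem_mate)
  have we: "wfo a ?e" "wfo a ?f" if "a \<in> Wts" for a
    using wfo_idem_letter[OF okl(1) that] wfo_idem_letter[OF okl(2) that] by simp_all
  have ide: "V a (cp a ?e v) (cp a ?e v) = cp a ?e v" "V a (cp a ?f v) (cp a ?f v) = cp a ?f v" if "a \<in> Wts" "okw v" for a v
    using cp_cong[of v a "?e \<odot> ?e" ?e] cp_cong[of v a "?f \<odot> ?f" ?f] idem_letter_idem[OF okl(1), of "act v a"] idem_letter_idem[OF okl(2), of "act v a"] that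
    by (simp_all add: fo_ver cp_ver)
  have o: "okw ?B" "okw ?Bs" using i by simp_all
  have W: "act w a \<in> Wts" if "a \<in> Wts" "okw w" for a w using that by simp
  have ty_e: "ty a ?B ?B (cp a ?e [])" "ty a ?Bs ?Bs (cp a ?f [])" if "a \<in> Wts" for a
    using ty_cp[of "[]" a ?e] ty_cp[of "[]" a ?f] we that de by simp_all
  have ipE: "ip a ?E = cp a ?e []" and ipF: "ip a ?F = cp a ?f []" if "a \<in> Wts" for a
    using that Hc_unit_right[OF ty_e(1)[OF that]] Hc_unit_right[OF ty_e(2)[OF that]] by (simp_all add: ip_Cons cp_Nil)
  have ipEF: "ip c [Ed i k, Fd i k] = V c (cp c ?e ?Bs) (LW c ?B (cp c ?f []))"
    using Hc_cp_LW[OF ty_e(2)[OF c] we(1) de(1,2) HOL.refl] ipF[OF c] W[OF c o(2)] by (simp add: ip_Cons[of c "Ed i k"])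
  have ipFE: "ip d [Fd i k, Ed i k] = V d (cp d ?f ?B) (LW d ?Bs (cp d ?e []))"
    using Hc_cp_LW[OF ty_e(1)[OF dW] we(2) de(3,4) HOL.refl] ipE[OF dW] W[OF dW o(1)] by (simp add: ip_Cons[of d "Fd i k"])
  define \<epsilon> where "\<epsilon> = V c (cp c (caps i k) []) (cp c ?e ?Bs)"
  define h where "h = (Idn ?Bs \<otimes> ?e) \<odot> cups i k"
  define \<eta> where "\<eta> = fo d h"
  have \<eta>: "\<eta> = V d (LW d ?Bs (cp d ?e [])) (cp d (cups i k) [])"
    unfolding \<eta>_def h_def by (simp add: cp_Nil[symmetric] cp_simps)
  have wh: "wfo d h" using we(1)[OF dW] dW i by (simp add: h_def wfo_hor wfo_cups de)
  have v0: "wfo c (Idn [])" "wfo d (Idn [])" "wfo c (Idn ?Bs)" using c dW o by auto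
  \<comment> \<open>For \<lambda> = \<open>lam c i\<close> the nested caps have degrees 1 -
    \<lambda>, 3 - \<lambda>, and so on; the sum of the first k of them is k (k -
    \<lambda>).\<close>
  have hd\<epsilon>: "hkd c [Ed i k, Fd i k] [] (int k * (int k - lam c i)) \<epsilon>"
  proof -
    have "has_deg (act ?Bs c) ?e 0" using k by (auto simp: E_idem_def numeral_2_eq_2)
    moreover have "has_deg c (caps i k) (int k * (int k - lam c i))"
      using k by (auto simp: numeral_2_eq_2 algebra_simps) presburger+
    ultimately have "tyd c (?B @ ?Bs) (?B @ ?Bs) 0 (cp c ?e ?Bs)" "tyd c (?B @ ?Bs) [] (int k * (int k - lam c i)) (cp c (caps i k) [])"
      using tyd_cp[of ?Bs c ?e 0] tyd_cp[of "[]" c "caps i k" "int k * (int k - lam c i)"] we W[OF c o(2)] o c i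
      by (simp_all add: de wfo_caps)
    from tyd_V[OF this] have t: "tyd c (?B @ ?Bs) [] (int k * (int k - lam c i)) \<epsilon>" unfolding \<epsilon>_def by simp
    have n: "V c (cp c ?e ?Bs) (LW c ?B (cp c ?f [])) = V c (LW c ?B (cp c ?f [])) (cp c ?e ?Bs)"
      by (rule naturality) (simp_all add: de)
    have m: "V c (cp c (caps i k) []) (LW c ?B (cp c ?f [])) = V c (cp c (caps i k) []) (cp c ?e ?Bs)"
      unfolding f using ad.mate_cap[OF v0(1) de(1,2)] by simp
    have "V c \<epsilon> (ip c [Ed i k, Fd i k]) = V c (cp c (caps i k) []) (V c (V c (cp c ?e ?Bs) (cp c ?e ?Bs)) (LW c ?B (cp c ?f [])))"
      unfolding \<epsilon>_def ipEF by (simp add: V_assoc)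
    also have "\<dots> = V c (V c (cp c (caps i k) []) (LW c ?B (cp c ?f []))) (cp c ?e ?Bs)"
      unfolding ide(1)[OF c o(2)] n by (simp add: V_assoc)
    also have "\<dots> = \<epsilon>" unfolding m using ide(1)[OF c o(2)] by (simp add: V_assoc \<epsilon>_def)
    finally show ?thesis using t V_id_left[OF ty_tgt[OF tyd_ty[OF t]]] by (simp add: hkd_def)
  qed
  have hd\<eta>: "hkd d [] [Fd i k, Ed i k] (- (int k * (int k - lam c i))) \<eta>"
  proof -
    have l: "lam d i = lam c i - 2 * int k" using i by (simp add: d act_F lam_def eps_def algebra_simps)
    have "has_deg d h (- (int k * (int k - lam c i)))"
      using k by (auto simp: h_def E_idem_def numeral_2_eq_2 algebra_simps l) presburger+
    then have t: "tyd d [] (?Bs @ ?B) (- (int k * (int k - lam c i))) \<eta>"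
      unfolding \<eta>_def by (rule tyd_fo[rotated 3]) (use wh de in \<open>simp_all add: h_def\<close>)
    have m: "V d (cp d ?f ?B) (cp d (cups i k) []) = V d (LW d ?Bs (cp d ?e [])) (cp d (cups i k) [])"
      unfolding f using ad.mate_cup[OF v0(2) de(1,2)] by simp
    have "V d (ip d [Fd i k, Ed i k]) \<eta> = V d (cp d ?f ?B) (V d (LW d ?Bs (V d (cp d ?e []) (cp d ?e []))) (cp d (cups i k) []))"
      unfolding \<eta> ipFE by (simp add: V_assoc LW_V)
    also have "\<dots> = V d (cp d ?f ?B) (V d (cp d ?f ?B) (cp d (cups i k) []))"
      unfolding ide(1)[OF dW okw_Nil] m ..
    also have "\<dots> = \<eta>" unfolding \<eta> m[symmetric] using ide(2)[OF dW o(1)] by (simp add: V_assoc[symmetric])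
    finally show ?thesis using t V_id_right[OF ty_src[OF tyd_ty[OF t]]] by (simp add: hkd_def)
  qed
  have w: "ws c d [?F]" "ws d c [?E]" "ws d c [P]" "ws c c [?E @ ?F]" "ws d d [?F @ ?E]" "ws c c [[]]" "ws d d [[]]" 
    "ws c d [?F @ ?E @ ?F]"
    using c dW d dc cl P okl o by (simp_all add: ws_1 act_append)
  note t\<epsilon> = hk_ty[OF hkd_hk[OF hd\<epsilon>]] and t\<eta> = hk_ty[OF hkd_hk[OF hd\<eta>]]
  \<comment> \<open>The idempotents in the triangle merge by idempotency, and what remains in the
    middle is the mate of the E idempotent, that is, the F idempotent.\<close>
  have zz: "V c (Hc c (ip c ?F) \<epsilon>) (Hc c \<eta> (ip c ?F)) = ip c ?F"
  proof -
    have 1: "Hc c (ip c ?F) \<epsilon> = V c (cp c ?f []) (LW c ?Bs \<epsilon>)"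
      using Hc_cp_LW[OF t\<epsilon> we(2)[OF c] de(3,4)] dc ipF[OF c] by (simp add: act_append d cp_Nil)
    have 2: "Hc c \<eta> (ip c ?F) = V c (V c (LW c ?Bs (cp c ?e ?Bs)) (cp c (cups i k) ?Bs)) (cp c ?f [])"
      using Hc_cp_LW[OF ty_e(2)[OF c], of d h "[]" "?Bs @ ?B"] wh d ipF[OF c]
      by (simp add: \<eta>_def h_def de cp_simps LW_Nil)
    have 3: "V c (LW c ?Bs \<epsilon>) (V c (LW c ?Bs (cp c ?e ?Bs)) (cp c (cups i k) ?Bs)) = cp c ?f []"
    proof -
      have "V c (LW c ?Bs \<epsilon>) (V c (LW c ?Bs (cp c ?e ?Bs)) (cp c (cups i k) ?Bs)) =
        V c (LW c ?Bs (cp c (caps i k) [])) (V c (LW c ?Bs (V c (cp c ?e ?Bs) (cp c ?e ?Bs))) (cp c (cups i k) ?Bs))"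
        by (simp add: \<epsilon>_def LW_V V_assoc)
      then show ?thesis unfolding ide(1)[OF c o(2)] f by (simp add: ad.cp_mate)
    qed
    have "V c (Hc c (ip c ?F) \<epsilon>) (Hc c \<eta> (ip c ?F)) =
      V c (cp c ?f []) (V c (V c (LW c ?Bs \<epsilon>) (V c (LW c ?Bs (cp c ?e ?Bs)) (cp c (cups i k) ?Bs))) (cp c ?f []))"
      unfolding 1 2 using ty_cls[OF t\<epsilon>] by (simp add: V_assoc)
    then show ?thesis unfolding 3 using ide(2)[OF c okw_Nil] ipF[OF c] by simp
  qed
  have "isomorphic (hTr TwoFoam) [(l, c, comp1 TwoFoam (web1 d P c) (web1 c ?F d))] [(l, d, comp1 TwoFoam (web1 c ?F d) (web1 d P c))]"
  proof (rule tf.rotate)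
    show "tf.ar c d (web1 c ?F d)" "tf.ar d c (web1 d ?E c)" "tf.ar d c (web1 d P c)" using w by (auto simp: ar_web)
    show "tf.HD c c (comp1 TwoFoam (web1 d ?E c) (web1 c ?F d)) (unit1 TwoFoam c) (int k * (int k - lam c i)) (m1 \<epsilon>)"
      "tf.HD d d (unit1 TwoFoam d) (comp1 TwoFoam (web1 c ?F d) (web1 d ?E c)) (- (int k * (int k - lam c i))) (m1 \<eta>)"
      using fmd_m1I[OF hd\<epsilon>] fmd_m1I[OF hd\<eta>] w by (simp_all add: HD_web)
    show "vcomp TwoFoam (web1 c ?F d) (comp1 TwoFoam (web1 c ?F d) (comp1 TwoFoam (web1 d ?E c) (web1 c ?F d))) (web1 c ?F d)
       (lwhisker TwoFoam (web1 c ?F d) (comp1 TwoFoam (web1 d ?E c) (web1 c ?F d)) (unit1 TwoFoam c) (m1 \<epsilon>))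
       (rwhisker TwoFoam (unit1 TwoFoam d) (comp1 TwoFoam (web1 c ?F d) (web1 d ?E c)) (web1 c ?F d) (m1 \<eta>)) = id2 TwoFoam (web1 c ?F d)"
    proof -
      have h1: "hk c (?F @ [Ed i k, Fd i k]) (?F @ []) (Hc c (ip c ?F) \<epsilon>)"
        by (rule hk_Hc[OF hk_ip hkd_hk[OF hd\<epsilon>]]) (use okl c dc d in \<open>simp_all add: act_append\<close>)
      have h2: "hk c ([] @ ?F) ([Fd i k, Ed i k] @ ?F) (Hc c \<eta> (ip c ?F))"
        by (rule hk_Hc[OF hkd_hk[OF hd\<eta>] hk_ip]) (use okl c d in simp_all)
      show ?thesis
        using mcmp_m1[OF w(1,8,1), of "Hc c \<eta> (ip c ?F)" "Hc c (ip c ?F) \<epsilon>"] h1 h2 zz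
        by (simp add: lwhisker_def rwhisker_def m1_ops[OF w(1)] hm_m1)
    qed
  qed
  then show ?thesis by simp
qed

subsection \<open>Reduction to identity 1-morphisms\<close>

text \<open>Membership in the essential image of the inclusion.\<close>

definition sum_of_units :: "int \<times> weight \<times> web \<Rightarrow> bool" where
  "sum_of_units x \<longleftrightarrow> (\<exists>L. set L \<subseteq> UNIV \<times> Wts \<and> isomorphic (hTr TwoFoam) [x] (map (\<lambda>(k, c). (k, c, unit1 TwoFoam c)) L))"

lemma hTr_obj: "(k, c, f) \<in> obj (h_pairs TwoFoam) \<longleftrightarrow> tf.ar c c f"
  by (simp add: tf.h_pairs_simps)

lemma sum_of_units_split:
  assumes x: "x \<in> obj (h_pairs TwoFoam)" and i: "isomorphic (hTr TwoFoam) [x] Y"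
    and Y: "\<And>y. y \<in> set Y \<Longrightarrow> y \<in> obj (h_pairs TwoFoam) \<and> sum_of_units y"
  shows "sum_of_units x"
proof -
  let ?u = "map (\<lambda>(k, c). (k, c, unit1 TwoFoam c))"
  obtain L where L: "set (L y) \<subseteq> UNIV \<times> Wts \<and> isomorphic (hTr TwoFoam) [y] (?u (L y))" if "y \<in> set Y" for y
    using bchoice[of "set Y" "\<lambda>y L. set L \<subseteq> UNIV \<times> Wts \<and> isomorphic (hTr TwoFoam) [y] (?u L)"] Y
    unfolding sum_of_units_def by blast
  have u: "?u K \<in> lists (obj (h_pairs TwoFoam))" if "set K \<subseteq> UNIV \<times> Wts" for K
    using that by (auto simp: hTr_obj ar_web ws_1 subset_iff)
  have "isomorphic (hTr TwoFoam) Y (concat (map (\<lambda>y. ?u (L y)) Y))"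
    unfolding hTr_def
    by (rule tf.trace.B.isomorphic_concat) (use L Y u in \<open>unfold hTr_def, blast\<close>)
  also have "concat (map (\<lambda>y. ?u (L y)) Y) = ?u (concat (map L Y))" by (simp add: map_concat comp_def)
  finally have YL: "isomorphic (hTr TwoFoam) Y (?u (concat (map L Y)))" .
  have LY: "set (concat (map L Y)) \<subseteq> UNIV \<times> Wts" using L by fastforce
  have "Y \<in> lists (obj (h_pairs TwoFoam))" using Y by auto
  then have "isomorphic (hTr TwoFoam) [x] (?u (concat (map L Y)))"
    using isomorphic_trans[OF tf.trace.B.is_category_mat_cat _ _ _ i[unfolded hTr_def] YL[unfolded hTr_def]] x u[OF LY]
    by (simp add: hTr_def mat_cat_def)
  then show ?thesis unfolding sum_of_units_def using LY by blast
qed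

text \<open>The bound m is kept as a parameter because the termination measure sums over the entries
  1 to m. Rotation and all decompositions stay within the same m.\<close>

definition closed_word :: "nat \<Rightarrow> weight \<Rightarrow> dword \<Rightarrow> bool" where
  "closed_word m c P \<longleftrightarrow> c \<in> weights m \<and> list_all (dletter_ok m) P \<and> act (expand P) c = c"

lemma dletter_ok_okl: "dletter_ok m l \<Longrightarrow> okl l" by (cases l) auto

lemma ok_okd: "list_all (dletter_ok m) P \<Longrightarrow> okd P"
  by (auto simp: okd_def list_all_iff dletter_ok_okl)

lemma weights_Wts: "c \<in> weights m \<Longrightarrow> c \<in> Wts" by (auto simp: Wts_def)

lemma closed_word_ws: "closed_word m c P \<Longrightarrow> ws c c [P]"
  by (auto simp: closed_word_def ws_1 ok_okd weights_Wts)

text \<open>A decomposition of an inner piece is whiskered by the letters on both sides and then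
  carried to the horizontal trace.\<close>

lemma sum_of_units_dec:
  assumes cl: "closed_word m c (U @ P @ W)" and d: "dec (act (expand W) c) P L"
    and g: "\<And>l k Q. (k, Q) \<in> set L \<Longrightarrow> sum_of_units (l, c, web1 c (U @ Q @ W) c)"
  shows "sum_of_units (l, c, web1 c (U @ P @ W) c)"
proof -
  let ?a = "act (expand W) c" and ?b = "act (expand P) (act (expand W) c)"
  have o: "okd U" "okd P" "okd W" "c \<in> Wts" "act (expand U) ?b = c"
    using cl ok_okd[of m] by (auto simp: closed_word_def weights_Wts act_append)
  then have ab: "?a \<in> Wts" "?b \<in> Wts" by simp_all
  have ar: "tf.ar c ?a (web1 c W ?a)" "tf.ar ?b c (web1 ?b U c)"
    using o ab by (auto simp: ar_web ws_1)
  have Q: "ws ?a ?b [Q]" if "(k, Q) \<in> set L" for k Q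
  proof -
    obtain r where r: "r < length L" "L ! r = (k, Q)" using \<open>(k, Q) \<in> set L\<close> by (auto simp: in_set_conv_nth)
    then obtain \<alpha> where "hkd ?a P Q k \<alpha>" using d unfolding dec_def by force
    then show ?thesis using d ty_okw[OF hk_ty[OF hkd_hk]] that unfolding dec_def ws_1 by fastforce
  qed
  from tf.decomposes_hTr[OF tf.decomposes_lw[OF tf.decomposes_rw[OF dec_decomposes[OF d HOL.refl] ar(1)] ar(2)], of l]
  have "isomorphic (hTr TwoFoam) [(l, c, web1 c (U @ P @ W) c)] (map (\<lambda>(k, Q). (l + k, c, web1 c (U @ Q @ W) c)) L)"
    by (simp add: comp_def split_def)
  moreover have "ws c c [U @ Q @ W]" if "(k, Q) \<in> set L" for k Q
    using Q[OF that] o by (simp add: ws_1 act_append)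
  ultimately show ?thesis
    using g closed_word_ws[OF cl] by (intro sum_of_units_split) (auto simp: hTr_obj ar_web)
qed

text \<open>The rotation of an \<open>F\<close> strictly increases this potential, which is bounded on weights with
  entries in \<open>{0, 1, 2}\<close>.\<close>

definition potential :: "nat \<Rightarrow> weight \<Rightarrow> int" where
  "potential m c = (\<Sum>n\<in>{1..m}. int n * c n)"

lemma potential_le: "c \<notin> killed \<Longrightarrow> potential m c \<le> (\<Sum>n\<in>{1..m}. 2 * int n)"
  unfolding potential_def
proof (rule sum_mono)
  fix n assume "c \<notin> killed"
  then have "c n \<in> {0, 1, 2}" unfolding killed_def by blast
  then show "int n * c n \<le> 2 * int n" by auto
qed

text \<open>The vector \<open>eps i\<close> contributes i - (i + 1) = -1. So a letter E lowers the
  potential by one, and a letter F raises it by one.\<close>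

lemma potential_eps: "1 \<le> i \<Longrightarrow> i < m \<Longrightarrow> potential m (\<lambda>n. c n + k * eps i n) = potential m c - k"
proof -
  assume i: "1 \<le> i" "i < m"
  have "(\<Sum>n\<in>{1..m}. int n * eps i n) = (\<Sum>n\<in>{i, Suc i}. int n * eps i n)"
    by (rule sum.mono_neutral_right) (use i in \<open>auto simp: eps_def\<close>)
  also have "\<dots> = -1" by (simp add: eps_def)
  finally have "(\<Sum>n\<in>{1..m}. k * (int n * eps i n)) = - k" by (simp add: sum_distrib_left[symmetric])
  then show ?thesis by (simp add: potential_def distrib_left sum.distrib mult.left_commute)
qed

fun isF :: "dletter \<Rightarrow> bool" where "isF (Fd i k) = True" | "isF (Ed i k) = False"

lemma potential_E: "list_all (dletter_ok m) P \<Longrightarrow> \<forall>l\<in>set P. \<not> isF l \<Longrightarrow> 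
    potential m (act (expand P) c) = potential m c - int (length (expand P))"
proof (induction P)
  case (Cons l P)
  then obtain i k where l: "l = Ed i k" "1 \<le> i" "i < m" by (cases l) auto
  then show ?case using Cons by (simp add: act_append act_E potential_eps)
qed simp

text \<open>Letters E lower the potential strictly, so a word consisting of them cannot return to
  its weight unless it is empty.\<close>

lemma closed_word_no_F:
  assumes "closed_word m c P" "\<forall>l\<in>set P. \<not> isF l"
  shows "P = []"
proof -
  have "expand P = []" using potential_E[of m P c] assms by (simp add: closed_word_def)
  then show ?thesis using assms(1) 
    by (cases P; cases "hd P") (auto simp: closed_word_def)
qed

lemma nonkilled: "c \<notin> killed \<Longrightarrow> 0 \<le> c n \<and> c n \<le> 2"
proof -
  assume "c \<notin> killed"
  then have "c n \<in> {0, 1, 2}" unfolding killed_def by blast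
  then show ?thesis by auto
qed

text \<open>In a word with an F, the number of divided letters that the last F still has to pass
  before it can be rotated.\<close>

definition trailing :: "dword \<Rightarrow> nat" where
  "trailing P = length (takeWhile (\<lambda>l. \<not> isF l) (rev P))"

lemma trailing_append: "\<forall>l\<in>set W. \<not> isF l \<Longrightarrow> trailing (P @ W) = trailing P + length W"
  unfolding trailing_def rev_append by (subst takeWhile_append2) auto

lemma trailing_F: "trailing (U @ [Fd j k]) = 0"
  by (simp add: trailing_def)

text \<open>Cancelling letters decreases the first component. A rotation keeps it and decreases the
  second one by raising the potential. Moving F past E keeps both and decreases the third.\<close>

definition word_order :: "nat \<Rightarrow> ((weight \<times> dword) \<times> (weight \<times> dword)) set" where
  "word_order m = inv_image (less_than <*lex*> less_than <*lex*> less_than)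
     (\<lambda>(c, P). (length (expand P), nat ((\<Sum>n\<in>{1..m}. 2 * int n) - potential m c), trailing P))"

lemma wf_word_order: "wf (word_order m)" unfolding word_order_def by auto

lemma sum_of_units_closed_word: "closed_word m c P \<Longrightarrow> sum_of_units (l, c, web1 c P c)"
proof (induction "(c, P)" arbitrary: c P l rule: wf_induct_rule[OF wf_word_order[of m]])
  case (1 c P)
  note cl = 1(2)
  have IH: "sum_of_units (l, c', web1 c' P' c')" if "((c', P'), (c, P)) \<in> word_order m" "closed_word m c' P'" for c' P' l
    using 1(1)[OF that(1)] that(2) by blast
  have c: "c \<in> Wts" "okd P" "list_all (dletter_ok m) P" "act (expand P) c = c"
    using cl weights_Wts ok_okd by (auto simp: closed_word_def)
  \<comment> \<open>The induction step for all cases but rotation: it suffices to decompose an inner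
    piece R so that replacing it by any summand makes the word smaller.\<close>
  have step: "sum_of_units (l, c, web1 c P c)"
    if P: "P = U @ R @ W" and d: "dec (act (expand W) c) R L"
      and L: "\<And>k Q. (k, Q) \<in> set L \<Longrightarrow> list_all (dletter_ok m) Q \<and> act (expand Q) (act (expand W) c) = act (expand R) (act (expand W) c) \<and>
        (length (expand Q) < length (expand R) \<or> length (expand Q) = length (expand R) \<and> trailing (U @ Q @ W) < trailing P)"
    for U R W L
    unfolding P
  proof (rule sum_of_units_dec[OF cl[unfolded P] d])
    fix l k Q assume "(k, Q) \<in> set L"
    note L = L[OF this]
    show "sum_of_units (l, c, web1 c (U @ Q @ W) c)"
    proof (rule IH)
      show "closed_word m c (U @ Q @ W)" using cl L unfolding P closed_word_def by (simp add: act_append)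
      show "((c, U @ Q @ W), c, P) \<in> word_order m" using L unfolding word_order_def P by auto
    qed
  qed
  \<comment> \<open>A word through a killed weight or with a divided cube decomposes into the empty
    sum. In the remaining case all intermediate weights have entries in {0, 1, 2} and all exponents
    are at most 2.\<close>
  consider (kill) U W where "P = U @ W" "act (expand W) c \<in> killed"
    | (big) U l W where "P = U @ [l] @ W" "3 \<le> length (expand_letter l)"
    | (nice) "\<And>U W. P = U @ W \<Longrightarrow> act (expand W) c \<notin> killed" "\<And>U l W. P = U @ [l] @ W \<Longrightarrow> length (expand_letter l) < 3"
    by (meson not_less)
  then show ?case
  proof cases
    case kill
    have "fo c (Idn (expand P)) = fo c (Nul (expand P) (expand P))"
      unfolding kill(1) expand_simps by (rule kill_word[OF kill(2) c(1)]) (use c kill in auto)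
    then have "dec (act (expand []) c) P []" using dec_zero[OF c(1,2)] by simp
    then show ?thesis by (intro step[of "[]" P "[]"]) auto
  next
    case big
    let ?b = "act (expand W) c"
    have o: "okl l" "?b \<in> Wts" using c big by auto
    obtain k s where s: "expand_letter l = replicate k s" "1 \<le> lindex s"
      using o(1) by (cases l) auto
    have "fo ?b (Idn (expand [l])) = fo ?b (Nul (expand [l]) (expand [l]))"
      using cube_zero[OF o(2) s(2), of k] big(2) by (simp add: s(1))
    then have "dec ?b [l] []" using dec_zero[OF o(2)] o(1) by simp
    then show ?thesis using big(1) by (intro step[of U "[l]" W]) auto
  next
    case nice
    show ?thesis
    proof (cases "\<exists>l\<in>set P. isF l")
      case False
      then have P: "P = []" using closed_word_no_F[OF cl] by blast
      have "isomorphic (hTr TwoFoam) [(l, c, web1 c P c)] (map (\<lambda>(k, c). (k, c, unit1 TwoFoam c)) [(l, c)])"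
        unfolding hTr_def using closed_word_ws[OF cl] P
        by (simp, intro isomorphic_refl[OF tf.trace.B.is_category_mat_cat]) (auto simp: mat_cat_def hTr_obj ar_web)
      then show ?thesis unfolding sum_of_units_def using c(1) by (intro exI[of _ "[(l, c)]"]) auto
    next
      case True
      then obtain U f W where P: "P = U @ f # W" "isF f" "\<forall>l\<in>set W. \<not> isF l"
        using split_list_last_prop by metis
      then obtain j k where f: "f = Fd j k" by (cases f) auto
      have k: "k \<in> {1, 2}" "1 \<le> j" "j < m"
        using nice(2)[of U f W] c(3) P f by auto
      show ?thesis
      proof (cases W)
        case Nil
        define d where "d = act (replicate k (Ff j)) c"
        have dd: "d = act (expand [Fd j k]) c" by (simp add: d_def)
        have cd: "act (expand U) d = c" using c(4) P Nil f by (simp add: act_append d_def)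
        have nk: "c \<notin> killed" "d \<notin> killed" using nice(1)[of P "[]"] nice(1)[of U "[f]"] P Nil f by (simp_all add: d_def)
        have U: "okd U" "list_all (dletter_ok m) U" using c P by auto
        have p: "potential m d = potential m c + int k"
          using potential_eps[of j m c "- int k"] k by (simp add: d_def act_F)
        have "d \<in> weights m" using cl k by (auto simp: d_def act_F closed_word_def weights_def eps_def)
        then have cld: "closed_word m d (Fd j k # U)"
          using U k cd by (auto simp: closed_word_def act_append d_def)
        \<comment> \<open>The potential has increased by k. That d is not killed keeps the new value
          below the bound, so the difference truncated by \<open>nat\<close> really
          decreases.\<close>
        have "((d, Fd j k # U), c, P) \<in> word_order m"
          using p k potential_le[OF nk(2), of m] unfolding word_order_def P Nil f by auto
        from IH[OF this cld] have g: "sum_of_units (l, d, web1 d (Fd j k # U) d)" for l .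
        show ?thesis
          using rotate_F[OF k(1,2) c(1) U(1) d_def cd, of l] g closed_word_ws[OF cl] closed_word_ws[OF cld] unfolding P Nil f
          by (intro sum_of_units_split[where Y = "[(l, d, web1 d (Fd j k # U) d)]"]) (auto simp: hTr_obj ar_web)
      next
        case (Cons e W')
        then obtain i n where e: "e = Ed i n" using P(3) by (cases e) auto
        have n: "n \<in> {1, 2}" "1 \<le> i" "i < m"
          using nice(2)[of "U @ [f]" e W'] c(3) P Cons e by auto
        let ?b = "act (expand W') c"
        have b: "?b \<in> Wts" using c P Cons by simp
        have P': "P = U @ [Fd j k, Ed i n] @ W'" using P Cons f e by simp
        have W': "\<forall>l\<in>set W'. \<not> isF l" using P(3) Cons by simp
        have t: "trailing P = Suc (length W')"
          using trailing_append[of "e # W'" "U @ [Fd j k]"] trailing_F[of U j k] P Cons f by simp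
        have t': "trailing (U @ [Ed i' n', Fd j' k'] @ W') = length W'" for i' n' j' k'
          using trailing_append[OF W', of "(U @ [Ed i' n']) @ [Fd j' k']"] trailing_F[of "U @ [Ed i' n']" j' k'] by simp
        have nk: "?b \<notin> killed" "act (expand [Ed i n]) ?b \<notin> killed" "act (expand [Fd j k, Ed i n]) ?b \<notin> killed"
          using nice(1)[of "U @ [f, e]" W'] nice(1)[of "U @ [f]" "e # W'"] nice(1)[of U "[f, e] @ W'"] P Cons f e
          by (simp_all add: act_append)
        have ew: "act (expand [Ed i n]) ?b = (\<lambda>t. ?b t + int n * eps i t)"
          "act (expand [Fd j k, Ed i n]) ?b = (\<lambda>t. ?b t + int n * eps i t - int k * eps j t)"
          by (simp_all add: act_append act_E act_F)
        note nonk = nonkilled[OF nk(1), of i] nonkilled[OF nk(1), of "Suc i"] nonkilled[OF nk(2), of i] nonkilled[OF nk(2), of "Suc i"]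
           nonkilled[OF nk(3), of i] nonkilled[OF nk(3), of "Suc i"]
        note nonk = nonk[unfolded ew]
        have lt: "trailing (U @ [Ed i' n', Fd j' k'] @ W') < trailing P" for i' n' j' k' unfolding t t' by simp
        have sw: "act (expand [Ed i n, Fd j k]) ?b = act (expand [Fd j k, Ed i n]) ?b"
          by (auto simp: act_append act_E act_F)
        show ?thesis
        proof (cases "i = j")
          case False
          show ?thesis
            by (rule step[OF P' dec_commute[OF False n(2) k(2) b k(1) n(1)]]) (use k n lt sw in auto)
        next
          case ij: True
          consider "k = 1" "n = 1" | "k = 1" "n = 2" | "k = 2" "n = 1" | "k = 2" "n = 2" using k(1) n(1) by auto
          then show ?thesis
          proof cases
            case 1
            \<comment> \<open>That E does not leave {0, 1, 2} forces an entry at most 1 at i and at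
              least 1 at i + 1.\<close>
            have "lam ?b i \<le> 0" using nonk 1 ij by (simp add: eps_def lam_def)
            then obtain \<kappa> where d: "dec ?b [Fd i 1, Ed i 1] ((0, [Ed i 1, Fd i 1]) # map (\<lambda>r. (\<kappa> r, [])) [0..<nat (- lam ?b i)])"
              using dec_FE[OF n(2) b] by blast
            show ?thesis
            proof (rule step[OF _ d])
              show "P = U @ [Fd i 1, Ed i 1] @ W'" using P' 1 ij by simp
              fix k' Q assume "(k', Q) \<in> set ((0, [Ed i 1, Fd i 1]) # map (\<lambda>r. (\<kappa> r, [])) [0..<nat (- lam ?b i)])"
              then have Q: "Q = [Ed i 1, Fd i 1] \<or> Q = []" by auto
              have sw': "act (expand [Ed i 1, Fd i 1]) ?b = ?b" "act (expand [Fd i 1, Ed i 1]) ?b = ?b"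
                using act_E[of 1 i] act_F[of 1 i] by (simp_all add: act_append act_Cons)
              from Q show "list_all (dletter_ok m) Q \<and> act (expand Q) ?b = act (expand [Fd i 1, Ed i 1]) ?b \<and>
                  (length (expand Q) < length (expand [Fd i 1, Ed i 1]) \<or>
                   length (expand Q) = length (expand [Fd i 1, Ed i 1]) \<and> trailing (U @ Q @ W') < trailing P)"
              proof
                assume "Q = [Ed i 1, Fd i 1]"
                then show ?thesis unfolding sw' using n lt[of i 1 i 1] sw' by simp
              next
                assume "Q = []"
                then show ?thesis unfolding sw' by simp
              qed
            qed
          next
            case 2
            \<comment> \<open>The letter E twice moves two units from position i + 1 to position i,
              which fits only from 0, 2 to 2, 0.\<close>
            then have "?b i = 0" "?b (Suc i) = 2" using nonk ij by (simp_all add: eps_def)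
            from dec_FE2[OF n(2) b this] show ?thesis
              by (intro step[of U "[Fd i 1, Ed i 2]" W'])
                (use P' 2 ij n in \<open>auto simp: act_Cons expand_2\<close>)
          next
            case 3
            \<comment> \<open>After E the entry at i has to be 2 to survive two letters F, and the
              entry at i + 1 has to be 0 to have room for them.\<close>
            then have "?b i = 1" "?b (Suc i) = 1" using nonk ij by (simp_all add: eps_def)
            from dec_F2E[OF n(2) b this] show ?thesis
              by (intro step[of U "[Fd i 2, Ed i 1]" W'])
                (use P' 3 ij n in \<open>auto simp: act_Cons expand_2\<close>)
          next
            case 4
            then have "?b i = 0" "?b (Suc i) = 2" using nonk ij by (simp_all add: eps_def)
            from dec_F2E2[OF n(2) b this] show ?thesis
              by (intro step[of U "[Fd i 2, Ed i 2]" W'])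
                (use P' 4 ij n in \<open>auto simp: act_Cons expand_2\<close>)
          qed
        qed
      qed
    qed
  qed
qed

theorem proposition4p2:
  "is_equivalence (vTr TwoFoam) (hTr TwoFoam) (trace_inclusion TwoFoam)"
proof (rule tf.trace_equivalence)
  fix k c f assume f: "tf.ar c c f"
  then obtain Ps where Ps: "f = (c, Ps, c)" and w: "ws c c Ps" by (auto simp: ar_web)
  \<comment> \<open>An endomorphism is split into its words by \<open>web_decomposes\<close>; each
    of them is a closed word for a suitable m.\<close>
  have "sum_of_units (k, c, f)"
  proof (rule sum_of_units_split)
    show "isomorphic (hTr TwoFoam) [(k, c, f)] (map (\<lambda>P. (k, c, web1 c P c)) Ps)"
      using tf.decomposes_hTr[OF web_decomposes[OF w], of k] by (simp add: Ps comp_def)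
    fix y assume "y \<in> set (map (\<lambda>P. (k, c, web1 c P c)) Ps)"
    then obtain P where P: "P \<in> set Ps" "y = (k, c, web1 c P c)" by auto
    then have "P \<in> web_words c c" using w by (auto simp: ws_def)
    then obtain m where "closed_word m c P" by (auto simp: web_words_def closed_word_def)
    then show "y \<in> obj (h_pairs TwoFoam) \<and> sum_of_units y"
      using sum_of_units_closed_word[of m c P k] closed_word_ws[of m c P] P(2) by (auto simp: hTr_obj ar_web)
  qed (simp add: hTr_obj f)
  then show "\<exists>L. set L \<subseteq> UNIV \<times> obj2 TwoFoam \<and> isomorphic (hTr TwoFoam) [(k, c, f)] (map (\<lambda>(k, c). (k, c, unit1 TwoFoam c)) L)"
    unfolding sum_of_units_def by simp
qed

end
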